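(* Let $C$ be a small category, regarded as a strict $\omega$-category in which all cells of dimension strictly greater than $1$ are units. For every $k \in \mathbb{N}$, there is an isomorphism of abelian groups \[ H_k(C) \simeq H_k^{\mathrm{pol}}(C), \] where $H_k(C)$ is the $k$-th homology group of the nerve of $C$ and $H_k^{\mathrm{pol}}(C)$ is the $k$-th polygraphic homology group of $C$.
   Context: **$\omega$-categories.** "$\omega$-category" means small strict $\omega$-category and $\omega\mathbf{Cat}$ is the category of these and strict $\omega$-functors. $C_n$ is the set of $n$-cells of $C$; an $n$-cell $x$ ($n>0$) has source $s(x)$ and target $t(x)$ in $C_{n-1}$; $s_k(x),t_k(x)$ for $k<n$ are the iterated $k$-dimensional source and target. Two $n$-cells $x,y$ are $k$-composable ($k<n$) if $s_k(x)=t_k(y)$, with composite $x\ast_k y$; $1_x$ is the unit on $x$. Two $n$-cells are parallel if $n=0$, or $n>0$ and they have the same source and the same target. An $n$-category is an $\omega$-category all of whose cells of dimension $>n$ are (iterated) units; small categories are identified with $1$-categories. $C_{\leq n}$ is the $n$-category obtained from $C$ by removing all non-unit cells of dimension $>n$; $C_{\leq -1}=\emptyset$. **Free $\omega$-categories.** $\mathbb{D}_n$ is the $\omega$-category representing $C\mapsto C_n$; $\mathbb{S}_n$ is the $\omega$-category representing $C\mapsto\{\text{pairs of parallel } n\text{-cells of } C\}$; $\mathbb{S}_{-1}=\emptyset$. The map $i_n:\mathbb{S}_{n-1}\to\mathbb{D}_n$ represents $x\mapsto (s(x),t(x))$ (and $i_0$ is the unique map $\emptyset\to\mathbb{D}_0$).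 An $\omega$-category $C$ is free if there are subsets $\Sigma_n\subseteq C_n$ such that for each $n\ge 0$ the square formed by $\coprod_{x\in\Sigma_n} i_n:\coprod_{x\in\Sigma_n}\mathbb{S}_{n-1}\to\coprod_{x\in\Sigma_n}\mathbb{D}_n$, the inclusion $C_{\leq n-1}\to C_{\leq n}$, and the maps $\langle s(x),t(x)\rangle:\mathbb S_{n-1}\to C_{\leq n-1}$ and $\langle x\rangle:\mathbb D_n\to C_{\leq n}$ classifying the pair $(s(x),t(x))$ and the cell $x$, is a pushout. **Abelianization.** For an $\omega$-category $C$, $\lambda(C)$ is the non-negatively graded chain complex where $\lambda(C)_n$ is the quotient of the free abelian group $\mathbb{Z}C_n$ by the relations $x\ast_k y\sim x+y$ for all $k$-composable $n$-cells $x,y$ ($k<n$), with differential induced by $x\mapsto t(x)-s(x)$. **Polygraphic homology.** A polygraphic resolution of $C$ is an $\omega$-functor $u:P\to C$ with $P$ free and $u$ having the right lifting property with respect to all $i_n$, $n\geq0$ (i.e. $u$ is surjective on $0$-cells, and for all parallel $n$-cells $x,y$ of $P$ and every $(n+1)$-cell $\beta:u(x)\to u(y)$ of $C$ there is an $(n+1)$-cell $\alpha:x\to y$ of $P$ with $u(\alpha)=\beta$). Every $\omega$-category has a polygraphic resolution, and $H_k^{\mathrm{pol}}(C)$ is the $k$-th homology group of $\lambda(P)$ for any polygraphic resolution $P\to C$; it is independent, up to isomorphism, of the choice. **Homology of the nerve.** $H_k(C)$ is the $k$-th homology group of Street's nerve of $C$. When $C$ is a small category this nerve is canonically isomorphic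 to the usual nerve $[n]\mapsto \mathrm{Hom}_{\mathbf{Cat}}([n],C)$, so $H_k(C)$ is the $k$-th integral homology group of the usual nerve of $C$. *)

theory Defs
  imports "HOL-Algebra.Free_Abelian_Groups"
begin

section \<open>Strict \<open>\<omega>\<close>-categories\<close>

text \<open>
  Cells are graded: \<open>cells C n\<close> is the set of \<open>n\<close>-cells, and these sets need not be disjoint for
  different \<open>n\<close>, so every operation carries the dimension it acts in.
  \<open>src C n\<close> and \<open>tgt C n\<close> map \<open>(n+1)\<close>-cells to \<open>n\<close>-cells, \<open>idn C n\<close> maps an \<open>n\<close>-cell to its unit
  \<open>(n+1)\<close>-cell, and \<open>cmp C n k x y\<close> is the composite \<open>x *\<^sub>k y\<close> of two \<open>n\<close>-cells.
\<close>

record 'a ocat =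
  cells :: "nat \<Rightarrow> 'a set"
  src :: "nat \<Rightarrow> 'a \<Rightarrow> 'a"
  tgt :: "nat \<Rightarrow> 'a \<Rightarrow> 'a"
  idn :: "nat \<Rightarrow> 'a \<Rightarrow> 'a"
  cmp :: "nat \<Rightarrow> nat \<Rightarrow> 'a \<Rightarrow> 'a \<Rightarrow> 'a"

text \<open>
  For an \<open>n\<close>-cell \<open>x\<close> and \<open>k \<le> n\<close>, \<open>src_at C k n x\<close> and \<open>tgt_at C k n x\<close> are the iterated
  \<open>k\<close>-dimensional source and target (\<open>x\<close> itself if \<open>k = n\<close>).  For a \<open>k\<close>-cell \<open>x\<close> and \<open>k \<le> n\<close>,
  \<open>idn_at C k n x\<close> is the iterated unit of dimension \<open>n\<close> on \<open>x\<close>.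
\<close>

primrec src_at :: "'a ocat \<Rightarrow> nat \<Rightarrow> nat \<Rightarrow> 'a \<Rightarrow> 'a" where
  "src_at C k 0 x = x"
| "src_at C k (Suc n) x = (if k \<le> n then src_at C k n (src C n x) else x)"

primrec tgt_at :: "'a ocat \<Rightarrow> nat \<Rightarrow> nat \<Rightarrow> 'a \<Rightarrow> 'a" where
  "tgt_at C k 0 x = x"
| "tgt_at C k (Suc n) x = (if k \<le> n then tgt_at C k n (tgt C n x) else x)"

primrec idn_at :: "'a ocat \<Rightarrow> nat \<Rightarrow> nat \<Rightarrow> 'a \<Rightarrow> 'a" where
  "idn_at C k 0 x = x"
| "idn_at C k (Suc n) x = (if k \<le> n then idn C n (idn_at C k n x) else x)"

definition composable :: "'a ocat \<Rightarrow> nat \<Rightarrow> nat \<Rightarrow> 'a \<Rightarrow> 'a \<Rightarrow> bool" where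
  "composable C n k x y \<longleftrightarrow>
     k < n \<and> x \<in> cells C n \<and> y \<in> cells C n \<and> src_at C k n x = tgt_at C k n y"

definition parallel :: "'a ocat \<Rightarrow> nat \<Rightarrow> 'a \<Rightarrow> 'a \<Rightarrow> bool" where
  "parallel C n x y \<longleftrightarrow> x \<in> cells C n \<and> y \<in> cells C n \<and>
     (n = 0 \<or> (src C (n - 1) x = src C (n - 1) y \<and> tgt C (n - 1) x = tgt C (n - 1) y))"

locale omega_category =
  fixes C :: "'a ocat"
  assumes src_closed: "x \<in> cells C (Suc n) \<Longrightarrow> src C n x \<in> cells C n"
    and tgt_closed: "x \<in> cells C (Suc n) \<Longrightarrow> tgt C n x \<in> cells C n"
    and src_src: "x \<in> cells C (Suc (Suc n)) \<Longrightarrow> src C n (src C (Suc n) x) = src C n (tgt C (Suc n) x)"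
    and tgt_tgt: "x \<in> cells C (Suc (Suc n)) \<Longrightarrow> tgt C n (tgt C (Suc n) x) = tgt C n (src C (Suc n) x)"
    and idn_closed: "x \<in> cells C n \<Longrightarrow> idn C n x \<in> cells C (Suc n)"
    and src_idn: "x \<in> cells C n \<Longrightarrow> src C n (idn C n x) = x"
    and tgt_idn: "x \<in> cells C n \<Longrightarrow> tgt C n (idn C n x) = x"
    and cmp_closed: "composable C n k x y \<Longrightarrow> cmp C n k x y \<in> cells C n"
    and src_cmp_top: "composable C (Suc n) n x y \<Longrightarrow> src C n (cmp C (Suc n) n x y) = src C n y"
    and tgt_cmp_top: "composable C (Suc n) n x y \<Longrightarrow> tgt C n (cmp C (Suc n) n x y) = tgt C n x"
    and src_cmp: "composable C (Suc n) k x y \<Longrightarrow> k < n \<Longrightarrow>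
        src C n (cmp C (Suc n) k x y) = cmp C n k (src C n x) (src C n y)"
    and tgt_cmp: "composable C (Suc n) k x y \<Longrightarrow> k < n \<Longrightarrow>
        tgt C n (cmp C (Suc n) k x y) = cmp C n k (tgt C n x) (tgt C n y)"
    and cmp_assoc: "composable C n k x y \<Longrightarrow> composable C n k y z \<Longrightarrow>
        cmp C n k (cmp C n k x y) z = cmp C n k x (cmp C n k y z)"
    and cmp_idn_right: "x \<in> cells C n \<Longrightarrow> k < n \<Longrightarrow>
        cmp C n k x (idn_at C k n (src_at C k n x)) = x"
    and cmp_idn_left: "x \<in> cells C n \<Longrightarrow> k < n \<Longrightarrow>
        cmp C n k (idn_at C k n (tgt_at C k n x)) x = x"
    and interchange: "k < l \<Longrightarrow> composable C n l x x' \<Longrightarrow> composable C n l y y' \<Longrightarrow>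
        composable C n k x y \<Longrightarrow> composable C n k x' y' \<Longrightarrow>
        cmp C n k (cmp C n l x x') (cmp C n l y y') = cmp C n l (cmp C n k x y) (cmp C n k x' y')"
    and idn_cmp: "composable C n k x y \<Longrightarrow>
        idn C n (cmp C n k x y) = cmp C (Suc n) k (idn C n x) (idn C n y)"

locale omega_functor = dom: omega_category C + cod: omega_category D
  for C :: "'a ocat" and D :: "'b ocat" +
  fixes f :: "nat \<Rightarrow> 'a \<Rightarrow> 'b"
  assumes fun_closed: "x \<in> cells C n \<Longrightarrow> f n x \<in> cells D n"
    and fun_src: "x \<in> cells C (Suc n) \<Longrightarrow> f n (src C n x) = src D n (f (Suc n) x)"
    and fun_tgt: "x \<in> cells C (Suc n) \<Longrightarrow> f n (tgt C n x) = tgt D n (f (Suc n) x)"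
    and fun_idn: "x \<in> cells C n \<Longrightarrow> f (Suc n) (idn C n x) = idn D n (f n x)"
    and fun_cmp: "composable C n k x y \<Longrightarrow> f n (cmp C n k x y) = cmp D n k (f n x) (f n y)"

definition fun_agree :: "'a ocat \<Rightarrow> (nat \<Rightarrow> 'a \<Rightarrow> 'b) \<Rightarrow> (nat \<Rightarrow> 'a \<Rightarrow> 'b) \<Rightarrow> bool" where
  "fun_agree C f g \<longleftrightarrow> (\<forall>n. \<forall>x\<in>cells C n. f n x = g n x)"

definition n_category :: "nat \<Rightarrow> 'a ocat \<Rightarrow> bool" where
  "n_category n C \<longleftrightarrow> omega_category C \<and>
     (\<forall>m>n. \<forall>x\<in>cells C m. \<exists>y\<in>cells C n. x = idn_at C n m y)"

text \<open>
  \<open>below C n\<close> is \<open>C\<^bsub>\<le> n - 1\<^esub>\<close>: all cells of dimension \<open>< n\<close> and their iterated units.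
  In particular \<open>below C 0\<close> is empty, as required for \<open>C\<^bsub>\<le> -1\<^esub>\<close>.
\<close>

definition below :: "'a ocat \<Rightarrow> nat \<Rightarrow> 'a ocat" where
  "below C n = C\<lparr>cells := \<lambda>m. {x. \<exists>k\<le>m. k < n \<and> (\<exists>y\<in>cells C k. x = idn_at C k m y)}\<rparr>"


section \<open>Free \<open>\<omega>\<close>-categories\<close>

text \<open>
  \<open>globe n\<close> is \<open>D\<^sub>n\<close> and \<open>sphere n\<close> is \<open>S\<^bsub>n - 1\<^esub>\<close>.  A pair \<open>(j, b)\<close> stands for the non-unit
  \<open>j\<close>-cell which is a source (\<open>b = False\<close>) or a target (\<open>b = True\<close>), and, seen as a cell of
  dimension \<open>m > j\<close>, for its iterated unit; the unique non-unit \<open>n\<close>-cell of \<open>globe n\<close> is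
  \<open>(n, True)\<close>.  If two \<open>m\<close>-cells are \<open>k\<close>-composable, then at least one of them is a unit on a cell
  of dimension \<open>\<le> k\<close>, and the composite is the other one.
\<close>

definition globular :: "(nat \<Rightarrow> (nat \<times> bool) set) \<Rightarrow> (nat \<times> bool) ocat" where
  "globular X = \<lparr>cells = X,
     src = (\<lambda>m x. if fst x = Suc m then (m, False) else x),
     tgt = (\<lambda>m x. if fst x = Suc m then (m, True) else x),
     idn = (\<lambda>m x. x),
     cmp = (\<lambda>m k x y. if fst x \<le> k then y else x)\<rparr>"

definition globe :: "nat \<Rightarrow> (nat \<times> bool) ocat" where
  "globe n = globular (\<lambda>m. {(j, b). j \<le> m \<and> (j < n \<or> j = n \<and> b)})"

definition sphere :: "nat \<Rightarrow> (nat \<times> bool) ocat" where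
  "sphere n = globular (\<lambda>m. {(j, b). j \<le> m \<and> j < n})"

text \<open>
  The \<open>\<omega>\<close>-functor \<open>D\<^sub>n \<rightarrow> C\<close> classifying an \<open>n\<close>-cell \<open>x\<close>, and the \<open>\<omega>\<close>-functor \<open>S\<^bsub>n - 1\<^esub> \<rightarrow> C\<close>
  classifying a pair of parallel \<open>(n-1)\<close>-cells \<open>y\<close>, \<open>z\<close> (for \<open>n = 0\<close> its domain is empty).
\<close>

definition cell_map :: "'a ocat \<Rightarrow> nat \<Rightarrow> 'a \<Rightarrow> nat \<Rightarrow> nat \<times> bool \<Rightarrow> 'a" where
  "cell_map C n x m = (\<lambda>(j, b). idn_at C j m (if b then tgt_at C j n x else src_at C j n x))"

definition pair_map :: "'a ocat \<Rightarrow> nat \<Rightarrow> 'a \<Rightarrow> 'a \<Rightarrow> nat \<Rightarrow> nat \<times> bool \<Rightarrow> 'a" where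
  "pair_map C n y z m =
     (\<lambda>(j, b). idn_at C j m (if b then tgt_at C j (n - 1) z else src_at C j (n - 1) y))"

definition coproduct :: "'i set \<Rightarrow> ('i \<Rightarrow> 'a ocat) \<Rightarrow> ('i \<times> 'a) ocat" where
  "coproduct I X = \<lparr>cells = (\<lambda>n. SIGMA i:I. cells (X i) n),
     src = (\<lambda>n (i, x). (i, src (X i) n x)),
     tgt = (\<lambda>n (i, x). (i, tgt (X i) n x)),
     idn = (\<lambda>n (i, x). (i, idn (X i) n x)),
     cmp = (\<lambda>n k (i, x) (j, y). (i, cmp (X i) n k x y))\<rparr>"

text \<open>
  The square with top \<open>f : A \<rightarrow> B\<close>, left side \<open>g : A \<rightarrow> C\<close>, right side \<open>h : B \<rightarrow> D\<close> and bottom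
  \<open>i : C \<rightarrow> D\<close> is a pushout with respect to \<open>\<omega>\<close>-categories whose cells are taken from the type
  \<open>'e\<close>.
\<close>

definition pushout_square ::
  "'e itself \<Rightarrow> 'a ocat \<Rightarrow> 'b ocat \<Rightarrow> 'c ocat \<Rightarrow> 'd ocat \<Rightarrow>
   (nat \<Rightarrow> 'a \<Rightarrow> 'b) \<Rightarrow> (nat \<Rightarrow> 'a \<Rightarrow> 'c) \<Rightarrow> (nat \<Rightarrow> 'b \<Rightarrow> 'd) \<Rightarrow> (nat \<Rightarrow> 'c \<Rightarrow> 'd) \<Rightarrow> bool" where
  "pushout_square (_ :: 'e itself) A B C D f g h i \<longleftrightarrow>
     omega_functor A B f \<and> omega_functor A C g \<and> omega_functor B D h \<and> omega_functor C D i \<and>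
     fun_agree A (\<lambda>n. h n \<circ> f n) (\<lambda>n. i n \<circ> g n) \<and>
     (\<forall>(E :: 'e ocat) p q. omega_functor B E p \<and> omega_functor C E q \<and>
        fun_agree A (\<lambda>n. p n \<circ> f n) (\<lambda>n. q n \<circ> g n) \<longrightarrow>
        (\<exists>r. omega_functor D E r \<and>
             fun_agree B (\<lambda>n. r n \<circ> h n) p \<and> fun_agree C (\<lambda>n. r n \<circ> i n) q \<and>
             (\<forall>r'. omega_functor D E r' \<and>
                fun_agree B (\<lambda>n. r' n \<circ> h n) p \<and> fun_agree C (\<lambda>n. r' n \<circ> i n) q \<longrightarrow>
                fun_agree D r' r)))"

text \<open>
  A definition cannot quantify over all types, so the pushouts below are tested against
  \<open>\<omega>\<close>-categories with cells in one type \<open>'a test\<close> built from the type \<open>'a\<close> of cells of \<open>C\<close>.  This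
  loses nothing: a cocone on the square lands in the sub-\<open>\<omega>\<close>-category generated by its image, which
  (like the pushout itself) has in each dimension at most \<open>max \<bar>'a\<bar> \<aleph>\<^sub>0\<close> cells, whereas
  \<open>'a test\<close> is infinite and at least as large as \<open>'a\<close>.
\<close>

type_synonym 'a test = "('a + nat) list set"

definition free_omega_category :: "'a ocat \<Rightarrow> bool" where
  "free_omega_category C \<longleftrightarrow> omega_category C \<and>
     (\<exists>\<Sigma>. (\<forall>n. \<Sigma> n \<subseteq> cells C n) \<and>
       (\<forall>n. pushout_square TYPE('a test)
          (coproduct (\<Sigma> n) (\<lambda>_. sphere n)) (coproduct (\<Sigma> n) (\<lambda>_. globe n))
          (below C n) (below C (Suc n))
          (\<lambda>m z. z)
          (\<lambda>m (x, z). pair_map C n (src C (n - 1) x) (tgt C (n - 1) x) m z)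
          (\<lambda>m (x, z). cell_map C n x m z)
          (\<lambda>m z. z)))"

definition polygraphic_resolution :: "'a ocat \<Rightarrow> 'b ocat \<Rightarrow> (nat \<Rightarrow> 'a \<Rightarrow> 'b) \<Rightarrow> bool" where
  "polygraphic_resolution P C u \<longleftrightarrow> free_omega_category P \<and> omega_functor P C u \<and>
     u 0 ` cells P 0 = cells C 0 \<and>
     (\<forall>n x y. \<forall>\<beta>\<in>cells C (Suc n).
        parallel P n x y \<and> src C n \<beta> = u n x \<and> tgt C n \<beta> = u n y \<longrightarrow>
        (\<exists>\<alpha>\<in>cells P (Suc n). src P n \<alpha> = x \<and> tgt P n \<alpha> = y \<and> u (Suc n) \<alpha> = \<beta>))"


section \<open>Homology\<close>

text \<open>Homology of a non-negatively graded complex of abelian groups, with \<open>d n : G (n+1) \<rightarrow> G n\<close>.\<close>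

definition cycles :: "(nat \<Rightarrow> 'a monoid) \<Rightarrow> (nat \<Rightarrow> 'a \<Rightarrow> 'a) \<Rightarrow> nat \<Rightarrow> 'a set" where
  "cycles G d k = (case k of 0 \<Rightarrow> carrier (G 0) | Suc m \<Rightarrow> kernel (G (Suc m)) (G m) (d m))"

definition chain_homology :: "(nat \<Rightarrow> 'a monoid) \<Rightarrow> (nat \<Rightarrow> 'a \<Rightarrow> 'a) \<Rightarrow> nat \<Rightarrow> 'a set monoid" where
  "chain_homology G d k =
     subgroup_generated (G k) (cycles G d k) Mod (d k ` carrier (G (Suc k)))"

text \<open>
  The complex \<open>\<lambda>(C)\<close>: \<open>abel C n\<close> is the group in degree \<open>n\<close>, and \<open>abel_diff C n\<close> sends the class
  of an \<open>(n+1)\<close>-cell \<open>x\<close> to the class of \<open>t(x) - s(x)\<close>.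
\<close>

definition abel_rel :: "'a ocat \<Rightarrow> nat \<Rightarrow> ('a \<Rightarrow>\<^sub>0 int) set" where
  "abel_rel C n = generate (free_Abelian_group (cells C n))
     {frag_of (cmp C n k x y) - (frag_of x + frag_of y) | k x y. composable C n k x y}"

definition abel :: "'a ocat \<Rightarrow> nat \<Rightarrow> ('a \<Rightarrow>\<^sub>0 int) set monoid" where
  "abel C n = free_Abelian_group (cells C n) Mod abel_rel C n"

definition abel_diff :: "'a ocat \<Rightarrow> nat \<Rightarrow> ('a \<Rightarrow>\<^sub>0 int) set \<Rightarrow> ('a \<Rightarrow>\<^sub>0 int) set" where
  "abel_diff C n X = the_elem
     ((\<lambda>c. abel_rel C n #>\<^bsub>free_Abelian_group (cells C n)\<^esub>
           frag_extend (\<lambda>x. frag_of (tgt C n x) - frag_of (src C n x)) c) ` X)"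

definition abel_homology :: "'a ocat \<Rightarrow> nat \<Rightarrow> ('a \<Rightarrow>\<^sub>0 int) set set monoid" where
  "abel_homology C = chain_homology (abel C) (abel_diff C)"

text \<open>
  The poset \<open>[n]\<close> as a \<open>1\<close>-category: \<open>(i, j)\<close> is the unique arrow \<open>i \<rightarrow> j\<close>, \<open>(i, i)\<close> is also the
  object \<open>i\<close>, and every arrow represents its iterated units.
\<close>

definition simplex :: "nat \<Rightarrow> (nat \<times> nat) ocat" where
  "simplex n = \<lparr>cells = (\<lambda>m. {(i, j). i \<le> j \<and> j \<le> n \<and> (m = 0 \<longrightarrow> i = j)}),
     src = (\<lambda>m (i, j). if m = 0 then (i, i) else (i, j)),
     tgt = (\<lambda>m (i, j). if m = 0 then (j, j) else (i, j)),
     idn = (\<lambda>m x. x),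
     cmp = (\<lambda>m k x y. if k = 0 then (fst y, snd x) else x)\<rparr>"

text \<open>
  For a \<open>1\<close>-category \<open>C\<close>, \<open>nerve C n\<close> is the set of functors \<open>[n] \<rightarrow> C\<close>, made extensional so that
  functors which agree on all cells are equal; \<open>nerve_map m \<phi>\<close> is precomposition with the monotone
  map \<open>\<phi> : [m] \<rightarrow> [n]\<close>, and \<open>coface i\<close> is the injection missing \<open>i\<close>.
\<close>

definition nerve :: "'a ocat \<Rightarrow> nat \<Rightarrow> (nat \<Rightarrow> nat \<times> nat \<Rightarrow> 'a) set" where
  "nerve C n = {f. omega_functor (simplex n) C f \<and> (\<forall>q. f q \<in> extensional (cells (simplex n) q))}"

definition nerve_map ::
  "nat \<Rightarrow> (nat \<Rightarrow> nat) \<Rightarrow> (nat \<Rightarrow> nat \<times> nat \<Rightarrow> 'a) \<Rightarrow> nat \<Rightarrow> nat \<times> nat \<Rightarrow> 'a" where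
  "nerve_map m \<phi> f = (\<lambda>q. restrict (\<lambda>(i, j). f q (\<phi> i, \<phi> j)) (cells (simplex m) q))"

definition coface :: "nat \<Rightarrow> nat \<Rightarrow> nat" where
  "coface i j = (if j < i then j else Suc j)"

definition nerve_diff ::
  "nat \<Rightarrow> ((nat \<Rightarrow> nat \<times> nat \<Rightarrow> 'a) \<Rightarrow>\<^sub>0 int) \<Rightarrow> ((nat \<Rightarrow> nat \<times> nat \<Rightarrow> 'a) \<Rightarrow>\<^sub>0 int)" where
  "nerve_diff n =
     frag_extend (\<lambda>f. \<Sum>i\<le>Suc n. frag_cmul ((-1) ^ i) (frag_of (nerve_map n (coface i) f)))"

definition nerve_homology ::
  "'a ocat \<Rightarrow> nat \<Rightarrow> ((nat \<Rightarrow> nat \<times> nat \<Rightarrow> 'a) \<Rightarrow>\<^sub>0 int) set monoid" where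
  "nerve_homology C = chain_homology (\<lambda>n. free_Abelian_group (nerve C n)) nerve_diff"

end

theory Submission
  imports Defs
begin

text \<open>
  Let \<open>u : P \<rightarrow> C\<close> be the resolution and \<open>\<Sigma>\<close> the generators of \<open>P\<close>.  The group \<open>\<lambda>(P)\<^sub>n\<close> is free on \<open>\<Sigma>\<^sub>n\<close>, and it
  is the colimit of a free left \<open>C\<close>-module \<open>c \<mapsto> \<lambda>(P/c)\<^sub>n\<close>, in which a generator \<open>\<sigma>\<close> sits at the target object of
  \<open>u(\<sigma>)\<close>.  Likewise the chains of the nerve are the colimit of the bar complex.  If both families of complexes are
  free resolutions of the constant functor \<open>\<int>\<close>, comparing them gives a homotopy equivalence of the colimits.

  The bar complex is contracted by appending an arrow.  For \<open>\<lambda>(P/c)\<close>, choose a \<open>0\<close>-cell \<open>o\<close> of \<open>P\<close> over \<open>c\<close>.  By the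
  lifting property of \<open>u\<close> and freeness of \<open>P\<close> one constructs, generator by generator, a functorial choice of a
  cylinder in \<open>P\<close> from every cell \<open>x\<close> over \<open>c\<close> to the unit on \<open>o\<close>.  The top cells of these cylinders, linearized over
  \<open>C\<close>, form a contracting homotopy; functoriality of the choice makes it additive under composition.
\<close>

section \<open>One-sorted strict \<omega>-categories\<close>

text \<open>The universal property of freeness is available for \<open>P\<close> itself. A choice of
  cylinders over all cells of a slice is therefore made by one functor out of \<open>P\<close>,
  whose value at a cell \<open>x\<close> is a family of cylinders, one for each arrow
  \<open>f\<close> from the target object of \<open>u(x)\<close> to \<open>c\<close>. A functor
  prescribed on generators needs a strict omega-category to land in. Cylinders of \<open>P\<close>
  must thus compose with associativity and interchange holding as equations; this is the long
  computation at the beginning. In one-sorted form units are implicit and a cylinder is one sequence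
  of cells, so that its laws can be proved by induction on the level. The lifting property fills a
  pair of parallel cells only if their images in \<open>C\<close> are joined by a cell. Above
  dimension 1 the images are equal, because \<open>C\<close> has only units there. In dimension 1
  they are made equal by taking the cylinder over the source at the composite of \<open>f\<close>
  with \<open>u(x)\<close>. Since all cylinders end in the same 0-cell, the cells used for
  whiskering either vanish under linearization, being of lower dimension, or act as an identity.
  Hence the top cells of composites add up without a twist.\<close>

text \<open>
  All cells live in one set, units are implicit, and \<open>bd k False\<close>, \<open>bd k True\<close> are the iterated
  \<open>k\<close>-dimensional source and target.  Cells of infinite dimension are allowed.
\<close>

locale oset =
  fixes S :: "'a set" and bd :: "nat \<Rightarrow> bool \<Rightarrow> 'a \<Rightarrow> 'a" and cp :: "nat \<Rightarrow> 'a \<Rightarrow> 'a \<Rightarrow> 'a"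
  assumes bd_in [simp, intro]: "x \<in> S \<Longrightarrow> bd k e x \<in> S"
    and bd_lt: "x \<in> S \<Longrightarrow> k < l \<Longrightarrow> bd k e (bd l e' x) = bd k e x"
    and bd_ge: "x \<in> S \<Longrightarrow> l \<le> k \<Longrightarrow> bd k e (bd l e' x) = bd l e' x"
    and cp_in: "x \<in> S \<Longrightarrow> y \<in> S \<Longrightarrow> bd k False x = bd k True y \<Longrightarrow> cp k x y \<in> S"
    and bd_cp_False: "x \<in> S \<Longrightarrow> y \<in> S \<Longrightarrow> bd k False x = bd k True y \<Longrightarrow>
      bd k False (cp k x y) = bd k False y"
    and bd_cp_True: "x \<in> S \<Longrightarrow> y \<in> S \<Longrightarrow> bd k False x = bd k True y \<Longrightarrow>
      bd k True (cp k x y) = bd k True x"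
    and bd_cp: "x \<in> S \<Longrightarrow> y \<in> S \<Longrightarrow> bd k False x = bd k True y \<Longrightarrow> k < l \<Longrightarrow>
      bd l e (cp k x y) = cp k (bd l e x) (bd l e y)"
    and cp_assoc: "x \<in> S \<Longrightarrow> y \<in> S \<Longrightarrow> z \<in> S \<Longrightarrow> bd k False x = bd k True y \<Longrightarrow>
      bd k False y = bd k True z \<Longrightarrow> cp k (cp k x y) z = cp k x (cp k y z)"
    and cp_unit_right: "x \<in> S \<Longrightarrow> cp k x (bd k False x) = x"
    and cp_unit_left: "x \<in> S \<Longrightarrow> cp k (bd k True x) x = x"
    and interchange: "k < l \<Longrightarrow> x \<in> S \<Longrightarrow> x' \<in> S \<Longrightarrow> y \<in> S \<Longrightarrow> y' \<in> S \<Longrightarrow>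
      bd l False x = bd l True x' \<Longrightarrow> bd l False y = bd l True y' \<Longrightarrow>
      bd k False x = bd k True y \<Longrightarrow> bd k False x' = bd k True y' \<Longrightarrow>
      cp k (cp l x x') (cp l y y') = cp l (cp k x y) (cp k x' y')"
begin

section \<open>Boundaries and degenerate composites\<close>

lemma bd_cp_below_left:
  assumes "x \<in> S" "y \<in> S" "bd k False x = bd k True y" "l < k"
  shows "bd l e (cp k x y) = bd l e x"
  using assms by (metis bd_cp_True bd_lt cp_in)

lemma bd_below_eq:
  assumes "x \<in> S" "y \<in> S" "bd k d x = bd k d' y" "l < k"
  shows "bd l e x = bd l e y"
  using assms by (metis bd_lt)

lemma bd_cell: "x \<in> S \<Longrightarrow> bd k e' x = x \<Longrightarrow> k \<le> l \<Longrightarrow> bd l e x = x"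
  by (metis bd_ge)

lemma cp_self: "x \<in> S \<Longrightarrow> bd k e x = x \<Longrightarrow> cp k x x = x"
  by (metis bd_cell cp_unit_right order_refl)

lemma cp_cell_self: "x \<in> S \<Longrightarrow> bd k e x = x \<Longrightarrow> k \<le> l \<Longrightarrow> cp l x x = x"
  by (metis bd_cell cp_self)

text \<open>
  A cylinder of level \<open>m\<close> from \<open>x\<close> to \<open>y\<close> consists of \<open>(m+1)\<close>-cells \<open>A m e\<close> from \<open>bd m e x\<close> to
  \<open>bd m e y\<close>, and of a cylinder of level \<open>m + 1\<close> from \<open>A m True *\<^sub>m x\<close> to \<open>y *\<^sub>m A m False\<close>.
  Only the values \<open>A j\<close> with \<open>j \<ge> m\<close> matter.
\<close>

coinductive cyl :: "nat \<Rightarrow> 'a \<Rightarrow> 'a \<Rightarrow> (nat \<Rightarrow> bool \<Rightarrow> 'a) \<Rightarrow> bool" where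
  cylI: "x \<in> S \<Longrightarrow> y \<in> S \<Longrightarrow> (\<And>e. A m e \<in> S) \<Longrightarrow> (\<And>e. bd (Suc m) False (A m e) = A m e) \<Longrightarrow>
    (\<And>e. bd m False (A m e) = bd m e x) \<Longrightarrow> (\<And>e. bd m True (A m e) = bd m e y) \<Longrightarrow>
    cyl (Suc m) (cp m (A m True) x) (cp m y (A m False)) A \<Longrightarrow> cyl m x y A"

text \<open>Equality of cylinders of level \<open>m\<close>: entries below \<open>m\<close> carry no
  information, so the laws hold up to \<open>eqv m\<close> and become equations at
  \<open>m = 0\<close>.\<close>

definition eqv :: "nat \<Rightarrow> (nat \<Rightarrow> bool \<Rightarrow> 'a) \<Rightarrow> (nat \<Rightarrow> bool \<Rightarrow> 'a) \<Rightarrow> bool" where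
  "eqv m A B \<longleftrightarrow> (\<forall>j\<ge>m. \<forall>e. A j e = B j e)"

text \<open>The constant cylinder on \<open>w\<close>. As an argument of \<open>od\<close> it
  expresses whiskering by \<open>w\<close>.\<close>

definition tau :: "'a \<Rightarrow> nat \<Rightarrow> bool \<Rightarrow> 'a" where
  "tau w = (\<lambda>j e. bd j e w)"

text \<open>This is an operation on cylinders only at levels above \<open>l\<close>, where all
  entries have matching \<open>l\<close>-boundaries.\<close>

definition od :: "nat \<Rightarrow> (nat \<Rightarrow> bool \<Rightarrow> 'a) \<Rightarrow> (nat \<Rightarrow> bool \<Rightarrow> 'a) \<Rightarrow> nat \<Rightarrow> bool \<Rightarrow> 'a" where
  "od l A B = (\<lambda>j e. cp l (A j e) (B j e))"

text \<open>The \<open>k\<close>-boundary of a cylinder. The cell \<open>A k e\<close> is its own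
  unit in higher dimensions, so repeating it from \<open>k\<close> on gives a degenerate
  cylinder.\<close>

definition trunc :: "nat \<Rightarrow> bool \<Rightarrow> (nat \<Rightarrow> bool \<Rightarrow> 'a) \<Rightarrow> nat \<Rightarrow> bool \<Rightarrow> 'a" where
  "trunc k e A = (\<lambda>j e'. if j < k then A j e' else A k e)"

text \<open>Entry of a concatenation \<open>d\<close> levels above \<open>m\<close>. Two tails can
  be concatenated only if they meet; to this end the tail of \<open>A\<close> is whiskered by
  \<open>B m True\<close> and the tail of \<open>B\<close> by \<open>A m False\<close>.\<close>

primrec cc :: "nat \<Rightarrow> nat \<Rightarrow> (nat \<Rightarrow> bool \<Rightarrow> 'a) \<Rightarrow> (nat \<Rightarrow> bool \<Rightarrow> 'a) \<Rightarrow> bool \<Rightarrow> 'a" where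
  "cc 0 m A B e = cp m (B m e) (A m e)"
| "cc (Suc d) m A B e = cc d (Suc m) (od m (tau (B m True)) A) (od m B (tau (A m False))) e"

text \<open>The concatenation of a cylinder \<open>A\<close> from \<open>x\<close> to \<open>y\<close> with a cylinder \<open>B\<close> from \<open>y\<close> to \<open>z\<close>.\<close>

definition con :: "nat \<Rightarrow> (nat \<Rightarrow> bool \<Rightarrow> 'a) \<Rightarrow> (nat \<Rightarrow> bool \<Rightarrow> 'a) \<Rightarrow> nat \<Rightarrow> bool \<Rightarrow> 'a" where
  "con m A B = (\<lambda>j e. cc (j - m) m A B e)"

text \<open>
  Every cylinder of level \<open>m\<close> from \<open>x\<close> to \<open>y\<close> is one of level \<open>m + d\<close> from \<open>lx d m x A\<close> to \<open>ry d m y A\<close>.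
\<close>

primrec lx :: "nat \<Rightarrow> nat \<Rightarrow> 'a \<Rightarrow> (nat \<Rightarrow> bool \<Rightarrow> 'a) \<Rightarrow> 'a" where
  "lx 0 m x A = x"
| "lx (Suc d) m x A = lx d (Suc m) (cp m (A m True) x) A"

primrec ry :: "nat \<Rightarrow> nat \<Rightarrow> 'a \<Rightarrow> (nat \<Rightarrow> bool \<Rightarrow> 'a) \<Rightarrow> 'a" where
  "ry 0 m y A = y"
| "ry (Suc d) m y A = ry d (Suc m) (cp m y (A m False)) A"

text \<open>
  The composite along \<open>k\<close> of cylinders \<open>A\<close> and \<open>B\<close>, where \<open>x\<close> is the source of \<open>B\<close> and \<open>y\<close> the target of
  \<open>A\<close>.  Above dimension \<open>k\<close> it is the concatenation of \<open>A\<close> whiskered by \<open>x\<close> with \<open>B\<close> whiskered by \<open>y\<close>.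
\<close>

definition gc :: "nat \<Rightarrow> 'a \<Rightarrow> 'a \<Rightarrow> (nat \<Rightarrow> bool \<Rightarrow> 'a) \<Rightarrow> (nat \<Rightarrow> bool \<Rightarrow> 'a) \<Rightarrow> nat \<Rightarrow> bool \<Rightarrow> 'a" where
  "gc k x y A B = (\<lambda>j e. if j < k then A j e else if j = k then (if e then A k True else B k False)
     else con (Suc k) (od k A (tau x)) (od k (tau y) B) j e)"

section \<open>Sequences of cells up to a level\<close>

lemma eqv_refl [simp]: "eqv m A A"
  by (simp add: eqv_def)

lemma eqv_Suc: "eqv m A B \<Longrightarrow> eqv (Suc m) A B"
  by (simp add: eqv_def)

lemma eqv_sym: "eqv m A B \<Longrightarrow> eqv m B A"
  by (simp add: eqv_def)

lemma eqv_trans: "eqv m A B \<Longrightarrow> eqv m B D \<Longrightarrow> eqv m A D"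
  by (simp add: eqv_def)

lemma eqvD: "eqv m A B \<Longrightarrow> m \<le> j \<Longrightarrow> A j e = B j e"
  by (simp add: eqv_def)

lemma eqv_od: "eqv m A A' \<Longrightarrow> eqv m B B' \<Longrightarrow> eqv m (od l A B) (od l A' B')"
  by (simp add: eqv_def od_def)

lemma cc_cong: "eqv m A A' \<Longrightarrow> eqv m B B' \<Longrightarrow> cc d m A B e = cc d m A' B' e"
proof (induction d arbitrary: m A A' B B')
  case 0
  then show ?case by (simp add: eqvD)
next
  case (Suc d)
  have "eqv (Suc m) (od m (tau (B m True)) A) (od m (tau (B' m True)) A')"
    "eqv (Suc m) (od m B (tau (A m False))) (od m B' (tau (A' m False)))"
    using Suc.prems by (auto simp: eqv_def od_def)
  from Suc.IH[OF this] show ?case by simp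
qed

lemma con_cong: "eqv m A A' \<Longrightarrow> eqv m B B' \<Longrightarrow> con m A B = con m A' B'"
  by (auto simp: con_def fun_eq_iff intro: cc_cong)

lemma con_head [simp]: "con m A B m e = cp m (B m e) (A m e)"
  by (simp add: con_def)

lemma con_tail:
  "m < j \<Longrightarrow> con m A B j e = con (Suc m) (od m (tau (B m True)) A) (od m B (tau (A m False))) j e"
  by (cases "j - m") (auto simp: con_def Suc_diff_Suc[symmetric] simp del: Suc_diff_Suc)

lemma con_tail_eqv:
  "eqv (Suc m) (con m A B) (con (Suc m) (od m (tau (B m True)) A) (od m B (tau (A m False))))"
  by (auto simp: eqv_def con_tail)

text \<open>Head and whiskered tail determine a concatenation; inductive proofs use this to pass
  from level \<open>m\<close> to \<open>Suc m\<close>.\<close>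

lemma con_eqvI:
  assumes "\<And>e. W m e = cp m (B m e) (A m e)"
    and "eqv (Suc m) W (con (Suc m) (od m (tau (B m True)) A) (od m B (tau (A m False))))"
  shows "eqv m W (con m A B)"
  unfolding eqv_def
proof (intro allI impI)
  fix j e assume "m \<le> j"
  show "W j e = con m A B j e"
  proof (cases "j = m")
    case False
    with \<open>m \<le> j\<close> show ?thesis using assms(2) by (simp add: con_tail eqv_def)
  qed (simp add: assms(1))
qed

section \<open>Cylinders, whiskering and concatenation\<close>

lemma cylD:
  assumes "cyl m x y A"
  shows "x \<in> S" "y \<in> S" "A m e \<in> S" "bd (Suc m) e' (A m e) = A m e"
    "bd m False (A m e) = bd m e x" "bd m True (A m e) = bd m e y"
    "cyl (Suc m) (cp m (A m True) x) (cp m y (A m False)) A"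
  using assms by - (erule cyl.cases; auto intro: bd_cell)+

lemma cyl_cell: "cyl m x y A \<Longrightarrow> m < l \<Longrightarrow> bd l e' (A m e) = A m e"
  by (metis Suc_leI bd_cell cylD(3,4))

lemma cyl_cong:
  assumes "cyl m x y A" "eqv m A B"
  shows "cyl m x y B"
  using assms
proof (coinduction arbitrary: m x y A)
  case cyl
  have [simp]: "A m e = B m e" for e using cyl(2) by (simp add: eqv_def)
  have eqs: "eqv (Suc m) A B" using cyl(2) by (rule eqv_Suc)
  show ?case
    using cylD[OF cyl(1)] eqs by auto
qed

text \<open>Both sides are the \<open>l\<close>-boundary of the single cell \<open>A m True\<close>,
  computed through its \<open>m\<close>-source and through its \<open>m\<close>-target.\<close>

lemma cyl_par:
  assumes "cyl m x y A" "l < m"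
  shows "bd l e x = bd l e y"
proof -
  note a = cylD[OF assms(1)]
  have "bd l e x = bd l e (bd m True x)" using a(1) assms(2) by (simp add: bd_lt)
  also have "\<dots> = bd l e (bd m False (A m True))" using a(5) by simp
  also have "\<dots> = bd l e (bd m True (A m True))" using a(3) assms(2) by (simp add: bd_lt)
  also have "\<dots> = bd l e y" using a(2,6) assms(2) by (simp add: bd_lt)
  finally show ?thesis .
qed

text \<open>One level up, \<open>x\<close> is replaced by \<open>cp m (A m True) x\<close>, whose
  \<open>l\<close>-boundary can be read off its \<open>m\<close>-target and is again that of
  \<open>x\<close>. Hence entries of two cylinders with \<open>l\<close>-composable ends are
  \<open>l\<close>-composable at every level.\<close>

lemma cyl_bd_below:
  assumes "cyl m x y A" "l < m" "m \<le> j"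
  shows "bd l e (A j e') = bd l e x \<and> A j e' \<in> S"
proof -
  have "\<forall>m x y. cyl m x y A \<longrightarrow> l < m \<longrightarrow> bd l e (A (m + d) e') = bd l e x \<and> A (m + d) e' \<in> S" for d
  proof (induction d)
    case 0
    show ?case
    proof (intro allI impI)
      fix m x y assume c: "cyl m x y A" and l: "l < m"
      have "bd l e (A m e') = bd l e (bd m False (A m e'))" using cylD(3)[OF c] l by (simp add: bd_lt)
      also have "\<dots> = bd l e x" using cylD(1,5)[OF c] l by (simp add: bd_lt)
      finally show "bd l e (A (m + 0) e') = bd l e x \<and> A (m + 0) e' \<in> S" using cylD(3)[OF c] by simp
    qed
  next
    case (Suc d)
    show ?case
    proof (intro allI impI)
      fix m x y assume c: "cyl m x y A" and l: "l < m"
      have "bd l e (A (Suc m + d) e') = bd l e (cp m (A m True) x) \<and> A (Suc m + d) e' \<in> S"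
        using Suc.IH cylD(7)[OF c] l less_SucI by blast
      moreover have "bd l e (cp m (A m True) x) = bd l e (bd m True (cp m (A m True) x))"
        using cylD(1,3,5)[OF c] l by (simp add: bd_lt cp_in)
      moreover have "bd l e (bd m True (cp m (A m True) x)) = bd l e y"
        using cylD(1,2,3,5,6)[OF c] l by (simp add: bd_lt bd_cp_True)
      moreover have "bd l e y = bd l e x" using cyl_par[OF c l] by simp
      ultimately show "bd l e (A (m + Suc d) e') = bd l e x \<and> A (m + Suc d) e' \<in> S"
        by simp
    qed
  qed
  then show ?thesis using assms by (metis le_add_diff_inverse)
qed

lemma cyl_cells:
  assumes "cyl m x y A" "m \<le> j"
  shows "A j e \<in> S \<and> bd (Suc j) e' (A j e) = A j e"
proof -
  have "\<forall>m x y. cyl m x y A \<longrightarrow> A (m + d) e \<in> S \<and> bd (Suc (m + d)) e' (A (m + d) e) = A (m + d) e" for d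
  proof (induction d)
    case 0
    show ?case using cylD(3,4) by simp
  next
    case (Suc d)
    show ?case
    proof (intro allI impI)
      fix m x y assume c: "cyl m x y A"
      show "A (m + Suc d) e \<in> S \<and> bd (Suc (m + Suc d)) e' (A (m + Suc d) e) = A (m + Suc d) e"
        using Suc.IH cylD(7)[OF c] by (metis add_Suc_shift)
    qed
  qed
  then show ?thesis using assms by (metis le_add_diff_inverse)
qed

lemma cyl_tau:
  assumes "x \<in> S"
  shows "cyl m x x (tau x)"
  using assms
proof (coinduction arbitrary: m)
  case (cyl m)
  then show ?case by (simp add: tau_def bd_ge cp_unit_left cp_unit_right)
qed

lemma cyl_const:
  assumes "a \<in> S" "bd m e a = a"
  shows "cyl m a a (\<lambda>j e. a)"
  by (rule cyl_cong[OF cyl_tau]) (use assms in \<open>auto simp: eqv_def tau_def intro: bd_cell\<close>)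

text \<open>The sequence can stay fixed in a coinduction, since only the two ends change from one
  level to the next.\<close>

lemma cyl_coinduct_simple:
  assumes "X m x y" and "\<And>m x y. X m x y \<Longrightarrow> x \<in> S \<and> y \<in> S \<and>
      (\<forall>e. A m e \<in> S \<and> bd (Suc m) False (A m e) = A m e \<and> bd m False (A m e) = bd m e x \<and>
        bd m True (A m e) = bd m e y) \<and> X (Suc m) (cp m (A m True) x) (cp m y (A m False))"
  shows "cyl m x y A"
  using assms(1)
proof (coinduction arbitrary: m x y)
  case (cyl m x y)
  from assms(2)[OF this] show ?case by auto
qed

text \<open>Interchange between \<open>l\<close> and \<open>m\<close> turns the whiskered ends of
  the composite into composites of whiskered ends (\<open>n1\<close>, \<open>n2\<close>), so the
  coinductive relation reproduces itself one level up.\<close>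

lemma cyl_od:
  assumes "cyl m x y A" "cyl m x' y' B" "l < m" "bd l False x = bd l True x'"
  shows "cyl m (cp l x x') (cp l y y') (od l A B)"
proof (rule cyl_coinduct_simple[where X="\<lambda>m z w. \<exists>x x' y y'. z = cp l x x' \<and> w = cp l y y' \<and>
    cyl m x y A \<and> cyl m x' y' B \<and> l < m \<and> bd l False x = bd l True x'"])
  fix m z w
  assume "\<exists>x x' y y'. z = cp l x x' \<and> w = cp l y y' \<and> cyl m x y A \<and> cyl m x' y' B \<and> l < m \<and>
    bd l False x = bd l True x'"
  then obtain x x' y y' where zw: "z = cp l x x'" "w = cp l y y'" and
    cyl: "cyl m x y A" "cyl m x' y' B" "l < m" "bd l False x = bd l True x'" by blast
  note a = cylD[OF cyl(1)] and b = cylD[OF cyl(2)]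
  have l: "l < m" by fact
  have cy: "bd l False y = bd l True y'"
    using cyl cyl_par by metis
  have ab: "bd l False (A m e) = bd l True (B m e)" for e
    using cyl_bd_below[OF cyl(1) l] cyl_bd_below[OF cyl(2) l] cyl(4) by simp
  have ab': "bd l False (A m e) = bd l True x'" "bd l False x = bd l True (B m e)"
     "bd l False (A m e) = bd l True y'" "bd l False y = bd l True (B m e)" for e
    using cyl_bd_below[OF cyl(1) l] cyl_bd_below[OF cyl(2) l] cyl(4) cyl_par[OF cyl(1) l]
      cyl_par[OF cyl(2) l] by simp_all
  have h: "bd m d (od l A B m e) = cp l (bd m d (A m e)) (bd m d (B m e))"
    "bd m d (cp l x x') = cp l (bd m d x) (bd m d x')"
    "bd m d (cp l y y') = cp l (bd m d y) (bd m d y')"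
    "bd (Suc m) d (od l A B m e) = cp l (A m e) (B m e)" for d e
    using a b ab cy l cyl(4) by (auto simp: od_def bd_cp)
  have n1: "cp m (od l A B m True) (cp l x x') = cp l (cp m (A m True) x) (cp m (B m True) x')"
    unfolding od_def by (rule interchange[symmetric]) (use a b ab l cyl(4) in auto)
  have n2: "cp m (cp l y y') (od l A B m False) = cp l (cp m y (A m False)) (cp m y' (B m False))"
    unfolding od_def by (rule interchange[symmetric]) (use a b ab l cy in auto)
  have p: "bd l False (cp m (A m True) x) = bd l True (cp m (B m True) x')"
    using a b ab l by (simp add: bd_cp_below_left)
  have "cyl (Suc m) (cp m (A m True) x) (cp m y (A m False)) A"
    "cyl (Suc m) (cp m (B m True) x') (cp m y' (B m False)) B" by (fact a(7), fact b(7))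
  moreover have "od l A B m e = cp l (A m e) (B m e)" for e by (simp add: od_def)
  moreover have "cp l (A m e) (B m e) \<in> S" "cp l x x' \<in> S" "cp l y y' \<in> S" for e
    using a b ab cy cyl(4) by (auto intro: cp_in)
  moreover have "bd (Suc m) False (od l A B m e) = od l A B m e \<and> bd m False (od l A B m e) = bd m e z \<and>
      bd m True (od l A B m e) = bd m e w" for e
    unfolding zw h using a b by (simp add: od_def)
  moreover have "\<exists>x x' y y'. cp m (od l A B m True) z = cp l x x' \<and> cp m w (od l A B m False) = cp l y y' \<and>
    cyl (Suc m) x y A \<and> cyl (Suc m) x' y' B \<and> l < Suc m \<and> bd l False x = bd l True x'"
    unfolding zw n1 n2 using a(7) b(7) p l by (metis less_SucI)
  ultimately show "z \<in> S \<and> w \<in> S \<and>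
      (\<forall>e. od l A B m e \<in> S \<and> bd (Suc m) False (od l A B m e) = od l A B m e \<and>
        bd m False (od l A B m e) = bd m e z \<and> bd m True (od l A B m e) = bd m e w) \<and>
      (\<exists>x x' y y'. cp m (od l A B m True) z = cp l x x' \<and> cp m w (od l A B m False) = cp l y y' \<and>
        cyl (Suc m) x y A \<and> cyl (Suc m) x' y' B \<and> l < Suc m \<and> bd l False x = bd l True x')"
    by (simp add: zw)
qed (use assms in blast)

text \<open>Together with the next lemma this shows that the whiskered tails meet, in the composite
  of \<open>B m True\<close>, \<open>y\<close> and \<open>A m False\<close>; it justifies the
  recursion in \<open>cc\<close>.\<close>

lemma cyl_tail_left:
  assumes "cyl m x y A" "cyl m y z B"
  shows "cyl (Suc m) (cp m (cp m (B m True) (A m True)) x) (cp m (B m True) (cp m y (A m False)))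
    (od m (tau (B m True)) A)"
proof -
  note a = cylD[OF assms(1)] and b = cylD[OF assms(2)]
  have e1: "cp m (cp m (B m True) (A m True)) x = cp m (B m True) (cp m (A m True) x)"
    using a b by (auto intro: cp_assoc)
  show ?thesis unfolding e1
    by (rule cyl_od[OF cyl_tau a(7)]) (use a b in \<open>auto simp: bd_cp_True\<close>)
qed

lemma cyl_tail_right:
  assumes "cyl m x y A" "cyl m y z B"
  shows "cyl (Suc m) (cp m (B m True) (cp m y (A m False))) (cp m z (cp m (B m False) (A m False)))
    (od m B (tau (A m False)))"
proof -
  note a = cylD[OF assms(1)] and b = cylD[OF assms(2)]
  have e1: "cp m z (cp m (B m False) (A m False)) = cp m (cp m z (B m False)) (A m False)"
    using a b by (auto intro: cp_assoc[symmetric])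
  have e2: "cp m (B m True) (cp m y (A m False)) = cp m (cp m (B m True) y) (A m False)"
    using a b by (auto intro: cp_assoc[symmetric])
  show ?thesis unfolding e1 e2
    by (rule cyl_od[OF b(7) cyl_tau]) (use a b in \<open>auto simp: bd_cp_False\<close>)
qed

text \<open>The tail of a concatenation is a concatenation only up to \<open>eqv\<close>. So one
  sequence \<open>W\<close> is kept fixed, and the relation records that from level \<open>m\<close>
  on it is some concatenation.\<close>

lemma cyl_con:
  assumes "cyl m x y A" "cyl m y z B"
  shows "cyl m x z (con m A B)"
proof -
  define W where "W = con m A B"
  have "cyl m x z W"
  proof (rule cyl_coinduct_simple[where X="\<lambda>m x z. \<exists>A B y. cyl m x y A \<and> cyl m y z B \<and> eqv m W (con m A B)"])
    show "\<exists>A B y. cyl m x y A \<and> cyl m y z B \<and> eqv m W (con m A B)"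
      using assms W_def eqv_refl by blast
  next
    fix m x z assume "\<exists>A B y. cyl m x y A \<and> cyl m y z B \<and> eqv m W (con m A B)"
    then obtain A B y where c: "cyl m x y A" "cyl m y z B" "eqv m W (con m A B)" by blast
    note a = cylD[OF c(1)] and b = cylD[OF c(2)]
    have W: "W m e = cp m (B m e) (A m e)" for e
      using eqvD[OF c(3), of m] by simp
    have ba: "bd m False (B m e) = bd m True (A m e)" for e by (simp add: a b)
    have "eqv (Suc m) W (con (Suc m) (od m (tau (B m True)) A) (od m B (tau (A m False))))"
      using eqv_trans[OF eqv_Suc[OF c(3)] con_tail_eqv] .
    then have "\<exists>A B y'. cyl (Suc m) (cp m (W m True) x) y' A \<and> cyl (Suc m) y' (cp m z (W m False)) B \<and>
        eqv (Suc m) W (con (Suc m) A B)"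
      using cyl_tail_left[OF c(1,2)] cyl_tail_right[OF c(1,2)] unfolding W by blast
    moreover have "W m e \<in> S \<and> bd (Suc m) False (W m e) = W m e \<and> bd m False (W m e) = bd m e x \<and>
        bd m True (W m e) = bd m e z" for e
      unfolding W using a b ba by (simp add: bd_cp bd_cp_True bd_cp_False cp_in)
    ultimately show "x \<in> S \<and> z \<in> S \<and> (\<forall>e. W m e \<in> S \<and> bd (Suc m) False (W m e) = W m e \<and>
        bd m False (W m e) = bd m e x \<and> bd m True (W m e) = bd m e z) \<and>
        (\<exists>A B y. cyl (Suc m) (cp m (W m True) x) y A \<and> cyl (Suc m) y (cp m z (W m False)) B \<and>
        eqv (Suc m) W (con (Suc m) A B))"
      using a(1) b(2) by simp
  qed
  then show ?thesis by (simp add: W_def)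
qed

section \<open>Laws of whiskering and concatenation\<close>

lemma tau_od:
  assumes "x \<in> S" "y \<in> S" "bd k False x = bd k True y" "k < m"
  shows "eqv m (tau (cp k x y)) (od k (tau x) (tau y))"
  using assms by (auto simp: eqv_def tau_def od_def bd_cp)

lemma cyl_comp:
  assumes "cyl m x y A" "cyl m x' y' B" "l < m" "bd l False x = bd l True x'" "m \<le> j"
  shows "bd l False (A j e) = bd l True (B j e')"
  using cyl_bd_below[OF assms(1,3,5)] cyl_bd_below[OF assms(2,3,5)] assms(4) by simp

lemma od_od_eqv:
  assumes "cyl m x y A" "cyl m x' y' A'" "cyl m z w B" "cyl m z' w' B'" "k < l" "l < m"
    and "bd l False x = bd l True x'" "bd l False z = bd l True z'"
    and "bd k False x = bd k True z"
  shows "eqv m (od k (od l A A') (od l B B')) (od l (od k A B) (od k A' B'))"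
  unfolding eqv_def od_def
proof (intro allI impI)
  fix j e assume j: "m \<le> j"
  have k: "k < m" using assms by simp
  have "bd k False x' = bd k True z'"
    using assms by (metis bd_below_eq cylD(1))
  then show "cp k (cp l (A j e) (A' j e)) (cp l (B j e) (B' j e)) =
      cp l (cp k (A j e) (B j e)) (cp k (A' j e) (B' j e))"
    using assms cyl_comp[OF assms(1,2,6,7) j] cyl_comp[OF assms(3,4,6,8) j]
      cyl_comp[OF assms(1,3) k assms(9) j] cyl_comp[OF assms(2,4) k _ j]
      cyl_cells[OF assms(1) j] cyl_cells[OF assms(2) j] cyl_cells[OF assms(3) j] cyl_cells[OF assms(4) j]
    by (intro interchange) auto
qed

lemma od_assoc_eqv:
  assumes "cyl m x y A" "cyl m x' y' B" "cyl m x'' y'' D" "l < m"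
    and "bd l False x = bd l True x'" "bd l False x' = bd l True x''"
  shows "eqv m (od l (od l A B) D) (od l A (od l B D))"
  unfolding eqv_def od_def
  using cyl_comp[OF assms(1,2,4,5)] cyl_comp[OF assms(2,3,4,6)]
      cyl_cells[OF assms(1)] cyl_cells[OF assms(2)] cyl_cells[OF assms(3)]
  by (auto intro!: cp_assoc)

text \<open>An interchange law. For the heads it is interchange of cells; for the tails the whiskers
  must be regrouped through the composition along \<open>l\<close> (\<open>o1\<close>,
  \<open>o2\<close>) before the induction hypothesis applies.\<close>

lemma con_od:
  assumes "cyl m x y A" "cyl m y z B" "cyl m x' y' A'" "cyl m y' z' B'" "l < m"
    and "bd l False x = bd l True x'"
  shows "eqv m (con m (od l A A') (od l B B')) (od l (con m A B) (con m A' B'))"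
proof -
  have "cc d m (od l A A') (od l B B') e = cp l (cc d m A B e) (cc d m A' B' e)" for d e
    using assms
  proof (induction d arbitrary: m x y z x' y' z' A B A' B')
    case 0
    note a = cylD[OF 0(1)] and b = cylD[OF 0(2)] and a' = cylD[OF 0(3)] and b' = cylD[OF 0(4)]
    have y: "bd l False y = bd l True y'" using 0 cyl_par by metis
    show ?case unfolding cc.simps od_def
      by (rule interchange[symmetric])
        (use 0 y a(3,5,6) b(3,5,6) a'(3,5,6) b'(3,5,6) cyl_comp[OF 0(1,3,5,6) order_refl]
          cyl_comp[OF 0(2,4,5) y order_refl] in auto)
  next
    case (Suc d)
    note a = cylD[OF Suc(2)] and b = cylD[OF Suc(3)] and a' = cylD[OF Suc(4)] and b' = cylD[OF Suc(5)]
    have y: "bd l False y = bd l True y'" using Suc.prems cyl_par by metis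
    note ca = cyl_comp[OF Suc(2,4,6,7) order_refl] and cb = cyl_comp[OF Suc(3,5,6) y order_refl]
    have l: "l < Suc m" and lm: "l < m" using Suc by auto
    have tb: "eqv (Suc m) (tau (cp l (B m True) (B' m True))) (od l (tau (B m True)) (tau (B' m True)))"
      by (rule tau_od) (use b(3) b'(3) cb l in auto)
    have ta: "eqv (Suc m) (tau (cp l (A m False) (A' m False))) (od l (tau (A m False)) (tau (A' m False)))"
      by (rule tau_od) (use a(3) a'(3) ca l in auto)
    have o1: "eqv (Suc m) (od l (od m (tau (B m True)) A) (od m (tau (B' m True)) A'))
        (od m (od l (tau (B m True)) (tau (B' m True))) (od l A A'))"
      by (rule od_od_eqv[OF cyl_tau a(7) cyl_tau a'(7)])
        (use a b a' b' lm cb in \<open>auto simp: bd_cp_True bd_cp_False cp_in\<close>)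
    have o2: "eqv (Suc m) (od l (od m B (tau (A m False))) (od m B' (tau (A' m False))))
        (od m (od l B B') (od l (tau (A m False)) (tau (A' m False))))"
      by (rule od_od_eqv[OF b(7) cyl_tau b'(7) cyl_tau])
        (use a b a' b' lm cb in \<open>auto simp: bd_cp_False bd_cp_below_left\<close>)
    have "cc (Suc d) m (od l A A') (od l B B') e =
        cc d (Suc m) (od m (tau (cp l (B m True) (B' m True))) (od l A A'))
          (od m (od l B B') (tau (cp l (A m False) (A' m False)))) e"
      by (simp add: od_def)
    also have "\<dots> = cc d (Suc m) (od l (od m (tau (B m True)) A) (od m (tau (B' m True)) A'))
        (od l (od m B (tau (A m False))) (od m B' (tau (A' m False)))) e"
      by (rule cc_cong) (blast intro: eqv_trans eqv_sym eqv_od tb ta o1 o2 eqv_refl)+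
    also have "\<dots> = cp l (cc d (Suc m) (od m (tau (B m True)) A) (od m B (tau (A m False))) e)
        (cc d (Suc m) (od m (tau (B' m True)) A') (od m B' (tau (A' m False))) e)"
      by (rule Suc.IH[OF cyl_tail_left[OF Suc(2,3)] cyl_tail_right[OF Suc(2,3)]
            cyl_tail_left[OF Suc(4,5)] cyl_tail_right[OF Suc(4,5)] l])
        (use a b a' b' lm cb in \<open>simp add: bd_cp_below_left bd_cp_False cp_in\<close>)
    finally show ?case by simp
  qed
  then show ?thesis by (auto simp: eqv_def con_def od_def)
qed

text \<open>One level up the constant cylinder is constant on an end of the tail, while the tail of
  \<open>A\<close> is whiskered by units. The situation is thus unchanged and induction on the depth
  applies.\<close>

lemma
  assumes "cyl m x y A"
  shows con_tau_left: "eqv m (con m (tau x) A) A"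
    and con_tau_right: "eqv m (con m A (tau y)) A"
proof -
  have "cc d m (tau x) A e = A (m + d) e \<and> cc d m A (tau y) e = A (m + d) e" for d e
    using assms
  proof (induction d arbitrary: m x y A)
    case 0
    note a = cylD[OF 0]
    show ?case using cp_unit_right[OF a(3), of m e] cp_unit_left[OF a(3), of m e] a by (simp add: tau_def)
  next
    case (Suc d)
    note a = cylD[OF Suc(2)]
    let ?x = "cp m (A m True) x" and ?y = "cp m y (A m False)"
    have ux: "cp m (A j e) (bd m False x) = A j e" and uy: "cp m (bd m True y) (A j e) = A j e"
      if "m < j" for j e
    proof -
      have j: "Suc m \<le> j" "m < Suc m" using that by auto
      have "bd m False (A j e) = bd m False ?x" "bd m True (A j e) = bd m True ?y" "A j e \<in> S"
        using cyl_bd_below[OF a(7) j(2,1), of _ e] cyl_par[OF a(7) j(2)] by auto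
      moreover have "bd m False ?x = bd m False x" "bd m True ?y = bd m True y"
        using a by (auto simp: bd_cp_False bd_cp_True)
      ultimately show "cp m (A j e) (bd m False x) = A j e" "cp m (bd m True y) (A j e) = A j e"
        using cp_unit_right[of "A j e" m] cp_unit_left[of "A j e" m] by auto
    qed
    have t1: "eqv (Suc m) (od m (tau (A m True)) (tau x)) (tau ?x)"
      by (rule eqv_sym, rule tau_od) (use a in auto)
    have t2: "eqv (Suc m) (od m (tau y) (tau (A m False))) (tau ?y)"
      by (rule eqv_sym, rule tau_od) (use a in auto)
    have t3: "eqv (Suc m) (od m A (tau (tau x m False))) A" "eqv (Suc m) (od m (tau (tau y m True)) A) A"
      using a(1,2) ux uy by (auto simp: eqv_def tau_def od_def bd_ge)
    have "cc (Suc d) m (tau x) A e = cc d (Suc m) (tau ?x) A e"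
      unfolding cc.simps by (rule cc_cong[OF t1 t3(1)])
    moreover have "cc (Suc d) m A (tau y) e = cc d (Suc m) A (tau ?y) e"
      unfolding cc.simps by (rule cc_cong[OF t3(2) t2])
    ultimately show ?case using Suc.IH[OF a(7)] by simp
  qed
  then show "eqv m (con m (tau x) A) A" "eqv m (con m A (tau y)) A"
    by (auto simp: eqv_def con_def)
qed

text \<open>At the next level both bracketings consist of \<open>A\<close> whiskered twice on the
  left, \<open>B\<close> whiskered on both sides and \<open>D\<close> whiskered twice on the right;
  \<open>e1\<close> to \<open>e5\<close> bring them to this common form.\<close>

lemma con_assoc:
  assumes "cyl m x y A" "cyl m y z B" "cyl m z w D"
  shows "eqv m (con m (con m A B) D) (con m A (con m B D))"
proof -
  have "cc d m (con m A B) D e = cc d m A (con m B D) e" for d e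
    using assms
  proof (induction d arbitrary: m x y z w A B D)
    case 0
    note a = cylD[OF 0(1)] and b = cylD[OF 0(2)] and c = cylD[OF 0(3)]
    show ?case using a(3,5,6) b(3,5,6) c(3,5,6) by (simp add: cp_assoc)
  next
    case (Suc d)
    note a = cylD[OF Suc(2)] and b = cylD[OF Suc(3)] and c = cylD[OF Suc(4)]
    note ab = cyl_tail_left[OF Suc(2,3)] cyl_tail_right[OF Suc(2,3)]
    note bc = cyl_tail_left[OF Suc(3,4)] cyl_tail_right[OF Suc(3,4)]
    let ?b = "B m True" and ?a = "A m False" and ?d = "D m True" and ?b' = "B m False"
    let ?A = "od m (tau ?d) (od m (tau ?b) A)" and ?B = "od m (tau ?d) (od m B (tau ?a))"
      and ?D = "od m (od m D (tau ?b')) (tau ?a)"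
    let ?X2 = "cp m ?b (cp m y ?a)" and ?X3 = "cp m z (cp m ?b' ?a)"
    have cA: "cyl (Suc m) (cp m ?d (cp m (cp m ?b (A m True)) x)) (cp m ?d ?X2) ?A"
      by (rule cyl_od[OF cyl_tau ab(1)]) (use a b c in \<open>auto simp: bd_cp_True bd_cp_False cp_in\<close>)
    have "cyl (Suc m) (cp m ?d ?X2) (cp m ?d ?X3) (od m (tau ?d) (od m B (tau ?a)))"
      by (rule cyl_od[OF cyl_tau ab(2)]) (use a b c in \<open>auto simp: bd_cp_True bd_cp_False cp_in\<close>)
    then have cB: "cyl (Suc m) (cp m ?d ?X2) (cp m ?d ?X3) ?B" .
    have cD: "cyl (Suc m) (cp m (cp m ?d (cp m z ?b')) ?a) (cp m (cp m w (cp m (D m False) ?b')) ?a) ?D"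
      by (rule cyl_od[OF bc(2) cyl_tau]) (use a b c in \<open>auto simp: bd_cp_True bd_cp_False cp_in\<close>)
    have e0: "eqv (Suc m) (con m A B) (con (Suc m) (od m (tau ?b) A) (od m B (tau ?a)))"
      "eqv (Suc m) (con m B D) (con (Suc m) (od m (tau ?d) B) (od m D (tau ?b')))"
      by (rule con_tail_eqv)+
    have tt: "eqv (Suc m) (con (Suc m) (tau ?d) (tau ?d)) (tau ?d)"
      "eqv (Suc m) (con (Suc m) (tau ?a) (tau ?a)) (tau ?a)"
      by (rule con_tau_left[OF cyl_tau], use a c in simp)+
    have e1: "eqv (Suc m) (od m (tau ?d) (con m A B)) (con (Suc m) ?A ?B)"
    proof -
      have "eqv (Suc m) (con (Suc m) ?A ?B)
          (od m (con (Suc m) (tau ?d) (tau ?d)) (con (Suc m) (od m (tau ?b) A) (od m B (tau ?a))))"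
        by (rule con_od[OF cyl_tau cyl_tau ab])
          (use a b c in \<open>auto simp: bd_cp_True bd_cp_False cp_in cp_assoc\<close>)
      then show ?thesis
        by (meson e0 tt eqv_od eqv_sym eqv_trans)
    qed
    have e2: "eqv (Suc m) (od m (con m B D) (tau ?a)) (con (Suc m) (od m (od m (tau ?d) B) (tau ?a)) ?D)"
    proof -
      have "eqv (Suc m) (con (Suc m) (od m (od m (tau ?d) B) (tau ?a)) ?D)
          (od m (con (Suc m) (od m (tau ?d) B) (od m D (tau ?b'))) (con (Suc m) (tau ?a) (tau ?a)))"
        by (rule con_od[OF bc cyl_tau cyl_tau])
          (use a b c in \<open>auto simp: bd_cp_True bd_cp_False cp_in cp_assoc\<close>)
      then show ?thesis
        by (meson e0 tt eqv_od eqv_sym eqv_trans)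
    qed
    have e3: "eqv (Suc m) (od m (od m (tau ?d) B) (tau ?a)) ?B"
      by (rule od_assoc_eqv[OF cyl_tau b(7) cyl_tau])
        (use a b c in \<open>auto simp: bd_cp_True bd_cp_False cp_in\<close>)
    have e4: "eqv (Suc m) (od m (tau (cp m ?d ?b)) A) ?A"
    proof -
      have "eqv (Suc m) (od m (tau (cp m ?d ?b)) A) (od m (od m (tau ?d) (tau ?b)) A)"
        by (rule eqv_od[OF tau_od]) (use b c in auto)
      moreover have "eqv (Suc m) (od m (od m (tau ?d) (tau ?b)) A) ?A"
        by (rule od_assoc_eqv[OF cyl_tau cyl_tau a(7)]) (use a b c in \<open>auto simp: bd_cp_True bd_cp_False cp_in\<close>)
      ultimately show ?thesis by (rule eqv_trans)
    qed
    have e5: "eqv (Suc m) (od m D (tau (cp m ?b' ?a))) ?D"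
    proof -
      have "eqv (Suc m) (od m D (tau (cp m ?b' ?a))) (od m D (od m (tau ?b') (tau ?a)))"
        by (rule eqv_od[OF eqv_refl tau_od]) (use a b in auto)
      moreover have "eqv (Suc m) (od m (od m D (tau ?b')) (tau ?a)) (od m D (od m (tau ?b') (tau ?a)))"
        by (rule od_assoc_eqv[OF c(7) cyl_tau cyl_tau]) (use a b c in \<open>auto simp: bd_cp_False\<close>)
      ultimately show ?thesis by (meson eqv_trans eqv_sym)
    qed
    have "cc (Suc d) m (con m A B) D e =
        cc d (Suc m) (od m (tau ?d) (con m A B)) (od m D (tau (cp m ?b' ?a))) e" by simp
    also have "\<dots> = cc d (Suc m) (con (Suc m) ?A ?B) ?D e"
      by (rule cc_cong[OF e1 e5])
    also have "\<dots> = cc d (Suc m) ?A (con (Suc m) ?B ?D) e"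
    proof (rule Suc.IH[OF cA cB])
      have "cp m (cp m ?d (cp m z ?b')) ?a = cp m ?d (cp m (cp m z ?b') ?a)"
        "cp m ?d (cp m z (cp m ?b' ?a)) = cp m ?d (cp m (cp m z ?b') ?a)"
        using a b c by (simp_all add: cp_assoc bd_cp_True bd_cp_False cp_in)
      then show "cyl (Suc m) (cp m ?d (cp m z (cp m ?b' ?a)))
          (cp m (cp m w (cp m (D m False) ?b')) ?a) ?D"
        using cD a b c by (simp add: bd_cp_False bd_cp_True)
    qed
    also have "\<dots> = cc d (Suc m) (od m (tau (cp m ?d ?b)) A) (od m (con m B D) (tau ?a)) e"
      by (rule cc_cong)
        (meson e2 e3 e4 con_cong eqv_refl eqv_sym eqv_trans, metis e2 e3 con_cong eqv_refl eqv_sym)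
    finally show ?case by simp
  qed
  then show ?thesis by (auto simp: eqv_def con_def)
qed

section \<open>Composition of cylinders along a lower dimension\<close>

lemma od_nth: "od l A B j e = cp l (A j e) (B j e)"
  by (simp add: od_def)

lemma tau_nth: "tau w j e = bd j e w"
  by (simp add: tau_def)

text \<open>\<open>gc\<close> expects ends of level \<open>k\<close>, so the given ends of level
  \<open>m\<close> are first carried up by \<open>lx\<close> and \<open>ry\<close>. Level 0 is the
  operation of interest; the other levels occur in the inductions.\<close>

definition comp :: "nat \<Rightarrow> nat \<Rightarrow> 'a \<Rightarrow> 'a \<Rightarrow> (nat \<Rightarrow> bool \<Rightarrow> 'a) \<Rightarrow> (nat \<Rightarrow> bool \<Rightarrow> 'a) \<Rightarrow> nat \<Rightarrow> bool \<Rightarrow> 'a" where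
  "comp m k x y A B = gc k (lx (k - m) m x B) (ry (k - m) m y A) A B"

text \<open>From level \<open>m\<close> on, this says that \<open>trunc k False A\<close> equals
  \<open>trunc k True B\<close>, and that both pairs of ends are composable.\<close>

definition ccomp where
  "ccomp m k x y A x' y' B \<longleftrightarrow> cyl m x y A \<and> cyl m x' y' B \<and> m \<le> k \<and> bd k False x = bd k True x' \<and>
    bd k False y = bd k True y' \<and> (\<forall>j e. m \<le> j \<and> j < k \<longrightarrow> A j e = B j e) \<and> A k False = B k True"

text \<open>Statements about \<open>comp\<close> are proved at \<open>m = k\<close>, where it is a
  concatenation of two whiskered cylinders, and transported to lower levels by this
  equation.\<close>

lemma comp_Suc: "m < k \<Longrightarrow>
    comp m k x' y A B = comp (Suc m) k (cp m (B m True) x') (cp m y (A m False)) A B"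
  by (simp add: comp_def Suc_diff_Suc[symmetric] del: Suc_diff_Suc)

lemma comp_refl: "comp k k x' y A B = gc k x' y A B"
  by (simp add: comp_def)

lemma comp_nth_lt: "j < k \<Longrightarrow> comp m k x' y A B j e = A j e"
  by (simp add: comp_def gc_def)

lemma comp_nth_eq: "comp m k x' y A B k e = (if e then A k True else B k False)"
  by (simp add: comp_def gc_def)

lemma gc_tail: "eqv (Suc k) (gc k x y A B) (con (Suc k) (od k A (tau x)) (od k (tau y) B))"
  by (simp add: eqv_def gc_def)

lemma lx_cong: "(\<forall>j e. m \<le> j \<and> j < m + d \<longrightarrow> A j e = B j e) \<Longrightarrow> lx d m x A = lx d m x B"
  by (induction d arbitrary: m x) auto

lemma ry_cong: "(\<forall>j e. m \<le> j \<and> j < m + d \<longrightarrow> A j e = B j e) \<Longrightarrow> ry d m x A = ry d m x B"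
  by (induction d arbitrary: m x) auto

lemma comp_cong:
  assumes "eqv m A A'" "eqv m B B'" "m \<le> k"
  shows "eqv m (comp m k x y A B) (comp m k x y A' B')"
proof -
  have l: "lx (k - m) m x B = lx (k - m) m x B'" "ry (k - m) m y A = ry (k - m) m y A'"
    using assms by (auto intro!: lx_cong ry_cong simp: eqv_def)
  have "eqv (Suc k) A A'" "eqv (Suc k) B B'" using assms by (auto simp: eqv_def)
  then have "con (Suc k) (od k A (tau x)) (od k (tau y) B) = con (Suc k) (od k A' (tau x)) (od k (tau y) B')"
    for x y by (intro con_cong eqv_od) auto
  then show ?thesis
    using assms by (auto simp: eqv_def comp_def gc_def l)
qed

lemma cyl_lx: "cyl m x y A \<Longrightarrow> cyl (m + d) (lx d m x A) (ry d m y A) A"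
proof (induction d arbitrary: m x y)
  case (Suc d)
  from Suc.IH[OF cylD(7)[OF Suc.prems]] show ?case by simp
qed simp

lemma lx_trunc:
  assumes "cyl m x y A" "m + d \<le> l"
  shows "lx d m (bd l e x) (trunc l e A) = bd l e (lx d m x A) \<and>
    ry d m (bd l e y) (trunc l e A) = bd l e (ry d m y A)"
  using assms
proof (induction d arbitrary: m x y)
  case (Suc d)
  note a = cylD[OF Suc(2)]
  have ml: "m < l" using Suc by simp
  then have [simp]: "trunc l e A m b = A m b" for b by (simp add: trunc_def)
  have "cp m (A m True) (bd l e x) = bd l e (cp m (A m True) x)"
    "cp m (bd l e y) (A m False) = bd l e (cp m y (A m False))"
    using a ml cyl_cell[OF Suc(2) ml] by (auto simp: bd_cp)
  then show ?case using Suc.IH[OF a(7)] Suc(3) by simp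
qed simp

lemma ccomp_Suc:
  assumes "ccomp m k x y A x' y' B" "m < k"
  shows "ccomp (Suc m) k (cp m (A m True) x) (cp m y (A m False)) A (cp m (B m True) x') (cp m y' (B m False)) B"
proof -
  have c: "cyl m x y A" "cyl m x' y' B" using assms by (auto simp: ccomp_def)
  note a = cylD[OF c(1)] and b = cylD[OF c(2)]
  have ab: "A m e = B m e" for e using assms by (simp add: ccomp_def)
  have k: "bd k False x = bd k True x'" "bd k False y = bd k True y'" using assms by (auto simp: ccomp_def)
  show ?thesis
    using assms a b ab k cyl_cell[OF c(2) assms(2)] by (auto simp: ccomp_def bd_cp)
qed

text \<open>Descent from level \<open>k\<close> to level \<open>m\<close>.\<close>

lemma ccomp_ind:
  assumes "ccomp m k x y A x' y' B"
    and "\<And>x y x' y'. ccomp k k x y A x' y' B \<Longrightarrow> Q k x y x' y'"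
    and "\<And>m x y x' y'. ccomp m k x y A x' y' B \<Longrightarrow> m < k \<Longrightarrow>
      Q (Suc m) (cp m (A m True) x) (cp m y (A m False)) (cp m (B m True) x') (cp m y' (B m False)) \<Longrightarrow>
      Q m x y x' y'"
  shows "Q m x y x' y'"
proof -
  have "m \<le> k" using assms by (simp add: ccomp_def)
  then show ?thesis using assms(1)
  proof (induction "k - m" arbitrary: m x y x' y')
    case 0
    then show ?case using assms(2) by simp
  next
    case (Suc d)
    then have "m < k" by simp
    moreover have "Q (Suc m) (cp m (A m True) x) (cp m y (A m False)) (cp m (B m True) x') (cp m y' (B m False))"
      by (rule Suc.hyps(1)) (use Suc ccomp_Suc \<open>m < k\<close> in auto)
    ultimately show ?case using assms(3) Suc by blast
  qed
qed

text \<open>The cell \<open>a\<close> has dimension at most \<open>k\<close>, hence equals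
  \<open>cp k a a\<close>, and interchange applies.\<close>

lemma cp_bd_comp:
  assumes "x \<in> S" "x' \<in> S" "bd k False x = bd k True x'" "a \<in> S" "bd (Suc m) e a = a" "m < k"
  shows "bd m False a = bd m True x \<Longrightarrow> cp m a (cp k x x') = cp k (cp m a x) (cp m a x')"
    and "bd m False x = bd m True a \<Longrightarrow> cp m (cp k x x') a = cp k (cp m x a) (cp m x' a)"
proof -
  have aa: "cp k a a = a" by (rule cp_cell_self[OF assms(4,5)]) (use assms in auto)
  have ak: "bd k e' a = a" for e' by (rule bd_cell[OF assms(4,5)]) (use assms in auto)
  have xx: "bd m e x = bd m e x'" for e by (rule bd_below_eq[OF assms(1,2,3,6)])
  show "bd m False a = bd m True x \<Longrightarrow> cp m a (cp k x x') = cp k (cp m a x) (cp m a x')"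
    using interchange[of m k a a x x'] assms(1-4,6) aa ak xx by simp
  show "bd m False x = bd m True a \<Longrightarrow> cp m (cp k x x') a = cp k (cp m x a) (cp m x' a)"
    using interchange[of m k x x' a a] assms(1-4,6) aa ak xx by simp
qed

text \<open>The two whiskered cylinders meet because \<open>A k False = B k True\<close>.\<close>

lemma ccomp_tails:
  assumes "ccomp k k x y A x' y' B"
  shows "cyl (Suc k) (cp k (A k True) (cp k x x')) (cp k (cp k y (A k False)) x') (od k A (tau x'))"
    "cyl (Suc k) (cp k (cp k y (A k False)) x') (cp k (cp k y y') (B k False)) (od k (tau y) B)"
proof -
  have c: "cyl k x y A" "cyl k x' y' B" and k: "bd k False x = bd k True x'" "bd k False y = bd k True y'"
    and ab: "A k False = B k True" using assms by (auto simp: ccomp_def)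
  note a = cylD[OF c(1)] and b = cylD[OF c(2)]
  have "cyl (Suc k) (cp k (cp k (A k True) x) x') (cp k (cp k y (A k False)) x') (od k A (tau x'))"
    by (rule cyl_od[OF a(7) cyl_tau]) (use a b k in \<open>auto simp: bd_cp_False\<close>)
  then show "cyl (Suc k) (cp k (A k True) (cp k x x')) (cp k (cp k y (A k False)) x') (od k A (tau x'))"
    using a b k by (simp add: cp_assoc)
  have "cyl (Suc k) (cp k y (cp k (B k True) x')) (cp k y (cp k y' (B k False))) (od k (tau y) B)"
    by (rule cyl_od[OF cyl_tau b(7)]) (use a b k in \<open>auto simp: bd_cp_True\<close>)
  moreover have "cp k y (cp k (B k True) x') = cp k (cp k y (A k False)) x'" unfolding ab
    using a b k ab[symmetric] by (intro cp_assoc[symmetric]) auto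
  moreover have "cp k y (cp k y' (B k False)) = cp k (cp k y y') (B k False)"
    using a b k by (simp add: cp_assoc)
  ultimately show "cyl (Suc k) (cp k (cp k y (A k False)) x') (cp k (cp k y y') (B k False)) (od k (tau y) B)"
    by simp
qed

lemma cyl_comp_closed:
  assumes "ccomp m k x y A x' y' B"
  shows "cyl m (cp k x x') (cp k y y') (comp m k x' y A B)"
  using assms
proof (rule ccomp_ind)
  fix x y x' y' assume c: "ccomp k k x y A x' y' B"
  have cc: "cyl k x y A" "cyl k x' y' B" and k: "bd k False x = bd k True x'" "bd k False y = bd k True y'"
    and ab: "A k False = B k True" using c by (auto simp: ccomp_def)
  note a = cylD[OF cc(1)] and b = cylD[OF cc(2)]
  let ?W = "comp k k x' y A B"
  have W: "?W k e = (if e then A k True else B k False)" for e by (simp add: comp_nth_eq)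
  have "cyl (Suc k) (cp k (A k True) (cp k x x')) (cp k (cp k y y') (B k False)) ?W"
    by (rule cyl_cong[OF cyl_con[OF ccomp_tails[OF c]]]) (simp add: comp_refl eqv_sym gc_tail)
  then show "cyl k (cp k x x') (cp k y y') ?W"
    by - (rule cylI; use a b k in \<open>auto simp: W bd_cp_False bd_cp_True cp_in\<close>)
next
  fix m x y x' y' assume c: "ccomp m k x y A x' y' B" and m: "m < k"
    and IH: "cyl (Suc m) (cp k (cp m (A m True) x) (cp m (B m True) x'))
      (cp k (cp m y (A m False)) (cp m y' (B m False)))
      (comp (Suc m) k (cp m (B m True) x') (cp m y (A m False)) A B)"
  have cc: "cyl m x y A" "cyl m x' y' B" and k: "bd k False x = bd k True x'" "bd k False y = bd k True y'"
    and ab: "A m e = B m e" for e using c m by (auto simp: ccomp_def)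
  note a = cylD[OF cc(1)] and b = cylD[OF cc(2)]
  let ?W = "comp m k x' y A B"
  have W: "?W m e = A m e" for e using m by (simp add: comp_nth_lt)
  have "cp k (cp m (A m True) x) (cp m (B m True) x') = cp m (A m True) (cp k x x')"
    using cp_bd_comp(1)[OF a(1) b(1) k(1) a(3) a(4) m] a ab by simp
  moreover have "cp k (cp m y (A m False)) (cp m y' (B m False)) = cp m (cp k y y') (A m False)"
    using cp_bd_comp(2)[OF a(2) b(2) k(2) a(3) a(4) m] a ab[symmetric] by simp
  ultimately have "cyl (Suc m) (cp m (?W m True) (cp k x x')) (cp m (cp k y y') (?W m False)) ?W"
    using IH comp_Suc[OF m] W by simp
  then show "cyl m (cp k x x') (cp k y y') ?W"
    by - (rule cylI; use a b k m in \<open>auto simp: W cp_in bd_cp_below_left\<close>)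
qed

lemma lx_od:
  assumes "cyl m x y A" "cyl m x' y' B" "k < m" "bd k False x = bd k True x'"
  shows "lx d m (cp k x x') (od k A B) = cp k (lx d m x A) (lx d m x' B)
    \<and> ry d m (cp k y y') (od k A B) = cp k (ry d m y A) (ry d m y' B)"
  using assms
proof (induction d arbitrary: m x y x' y')
  case (Suc d)
  note a = cylD[OF Suc(2)] and b = cylD[OF Suc(3)]
  note ab = cyl_comp[OF Suc(2,3,4,5) order_refl]
  have y: "bd k False y = bd k True y'" using Suc.prems cyl_par by metis
  have "cp m (cp k (A m True) (B m True)) (cp k x x') = cp k (cp m (A m True) x) (cp m (B m True) x')"
    by (rule interchange[symmetric]) (use a b ab Suc in auto)
  moreover have "cp m (cp k y y') (cp k (A m False) (B m False)) = cp k (cp m y (A m False)) (cp m y' (B m False))"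
    by (rule interchange[symmetric]) (use a b ab y Suc in auto)
  moreover have "bd k False (cp m (A m True) x) = bd k True (cp m (B m True) x')"
    using a b ab Suc by (simp add: bd_cp_below_left)
  ultimately show ?case using Suc.IH[OF a(7) b(7)] Suc(4) by (simp add: od_def)
qed simp

lemma lx_tau: "x \<in> S \<Longrightarrow> lx d m x (tau x) = x" "x \<in> S \<Longrightarrow> ry d m x (tau x) = x"
  by (induction d arbitrary: m) (auto simp: tau_def cp_unit_left cp_unit_right)

text \<open>Needed to move whiskers through composites: a whisker by a composite cell is a composite
  of constant cylinders.\<close>

lemma comp_tau:
  assumes "x \<in> S" "x' \<in> S" "bd k False x = bd k True x'" "m \<le> k"
  shows "eqv m (comp m k x' x (tau x) (tau x')) (tau (cp k x x'))"
proof -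
  let ?z = "cp k x x'"
  have z: "?z \<in> S" using assms by (auto intro: cp_in)
  have t: "eqv (Suc k) (od k (tau x) (tau x')) (tau ?z)"
    by (rule eqv_sym, rule tau_od) (use assms in auto)
  have "eqv (Suc k) (con (Suc k) (od k (tau x) (tau x')) (od k (tau x) (tau x'))) (tau ?z)"
    unfolding con_cong[OF t t] by (rule con_tau_left[OF cyl_tau[OF z]])
  moreover have "comp m k x' x (tau x) (tau x') = gc k x' x (tau x) (tau x')"
    using assms by (simp add: comp_def lx_tau)
  moreover have "tau x j e = tau ?z j e" if "j < k" for j e
    using assms that by (simp add: tau_def bd_cp_below_left)
  moreover have "tau x k True = tau ?z k True" "tau x' k False = tau ?z k False"
    using assms by (simp_all add: tau_def bd_cp_True bd_cp_False)
  ultimately show ?thesis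
    unfolding eqv_def gc_def by (auto simp: not_less_iff_gr_or_eq Suc_le_eq)
qed

lemma ccomp_tau:
  "x \<in> S \<Longrightarrow> x' \<in> S \<Longrightarrow> bd k False x = bd k True x' \<Longrightarrow> m \<le> k \<Longrightarrow>
    ccomp m k x x (tau x) x' x' (tau x')"
  unfolding ccomp_def by (auto simp: cyl_tau tau_nth
      intro!: bd_below_eq[of x x' k False True])

lemma bd_below_eq4:
  assumes "x \<in> S" "x' \<in> S" "w \<in> S" "w' \<in> S" "bd l d x = bd l d' x'" "bd l c w = bd l c' w'" "k < l"
  shows "bd k False x' = bd k True w' \<longleftrightarrow> bd k False x = bd k True w"
  using bd_below_eq[OF assms(1,2,5,7), of False] bd_below_eq[OF assms(3,4,6,7), of True] by simp

text \<open>Interchange of \<open>k\<close> and \<open>l\<close> when \<open>k\<close> lies below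
  the level. Above \<open>l\<close> the composites are concatenations, so after regrouping the
  whiskers (\<open>o1\<close>, \<open>o2\<close>) the claim is an instance of
  \<open>con_od\<close>.\<close>

lemma od_comp:
  assumes "ccomp m l x y A x' y' A'" "ccomp m l w z B w' z' B'" "k < m" "bd k False x = bd k True w"
  shows "eqv m (od k (comp m l x' y A A') (comp m l w' z B B'))
     (comp m l (cp k x' w') (cp k y z) (od k A B) (od k A' B'))"
proof -
  have c: "cyl m x y A" "cyl m x' y' A'" "cyl m w z B" "cyl m w' z' B'" and ml: "m \<le> l"
    and l: "bd l False x = bd l True x'" "bd l False y = bd l True y'"
      "bd l False w = bd l True w'" "bd l False z = bd l True z'"
    using assms by (auto simp: ccomp_def)
  have k': "bd k False x' = bd k True w'"
    using bd_below_eq4[OF cylD(1)[OF c(1)] cylD(1)[OF c(2)] cylD(1)[OF c(3)] cylD(1)[OF c(4)] l(1,3)]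
      assms ml by simp
  let ?d = "l - m"
  let ?xl = "lx ?d m x' A'" and ?wl = "lx ?d m w' B'" and ?yl = "ry ?d m y A" and ?zl = "ry ?d m z B"
  have e: "lx ?d m (cp k x' w') (od k A' B') = cp k ?xl ?wl"
    "ry ?d m (cp k y z) (od k A B) = cp k ?yl ?zl"
    using lx_od[OF c(2,4) assms(3) k'] lx_od[OF c(1,3) assms(3,4)] by auto
  have ml': "m + ?d = l" using ml by simp
  note cA = cyl_lx[OF c(1), of ?d, unfolded ml'] and cA' = cyl_lx[OF c(2), of ?d, unfolded ml']
   and cB = cyl_lx[OF c(3), of ?d, unfolded ml'] and cB' = cyl_lx[OF c(4), of ?d, unfolded ml']

  have kA: "ccomp l l (lx ?d m x A) ?yl A ?xl (ry ?d m y' A') A'"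
  proof -
    have "m \<le> l \<longrightarrow> ccomp l l (lx (l - m) m x A) (ry (l - m) m y A) A (lx (l - m) m x' A') (ry (l - m) m y' A') A'"
      by (rule ccomp_ind[OF assms(1)]) (auto simp: Suc_diff_Suc[symmetric] simp del: Suc_diff_Suc)
    then show ?thesis using ml by simp
  qed
  have kB: "ccomp l l (lx ?d m w B) ?zl B ?wl (ry ?d m z' B') B'"
  proof -
    have "m \<le> l \<longrightarrow> ccomp l l (lx (l - m) m w B) (ry (l - m) m z B) B (lx (l - m) m w' B') (ry (l - m) m z' B') B'"
      by (rule ccomp_ind[OF assms(2)]) (auto simp: Suc_diff_Suc[symmetric] simp del: Suc_diff_Suc)
    then show ?thesis using ml by simp
  qed
  note tA = ccomp_tails[OF kA] and tB = ccomp_tails[OF kB]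
  let ?P = "con (Suc l) (od l A (tau ?xl)) (od l (tau ?yl) A')"
  let ?Q = "con (Suc l) (od l B (tau ?wl)) (od l (tau ?zl) B')"
  have kl: "k < Suc l" "k < l" using assms(3) ml by auto
  have sA: "lx ?d m x A \<in> S" "?xl \<in> S" "?yl \<in> S" "lx ?d m w B \<in> S" "?wl \<in> S" "?zl \<in> S"
    using cA cA' cB cB' cylD(1,2) by blast+
  have A0: "A l e \<in> S" "bd l False (A l e) = bd l e (lx ?d m x A)" "bd l True (A l e) = bd l e ?yl"
    "B l e \<in> S" "bd l False (B l e) = bd l e (lx ?d m w B)" "bd l True (B l e) = bd l e ?zl" 
    "A' l e \<in> S" "bd l False (A' l e) = bd l e ?xl" 
    "B' l e \<in> S" "bd l False (B' l e) = bd l e ?wl" for e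
    using cylD(3,5,6)[OF cA] cylD(3,5,6)[OF cB] cylD(3,5,6)[OF cA'] cylD(3,5,6)[OF cB'] by auto
  have ll: "bd l False (lx ?d m x A) = bd l True ?xl" "bd l False (lx ?d m w B) = bd l True ?wl"
    "bd l False ?yl = bd l True (ry ?d m y' A')" "bd l False ?zl = bd l True (ry ?d m z' B')"
    using kA kB by (auto simp: ccomp_def)
  have kAB: "bd k False (A l True) = bd k True (B l True)"
    by (rule cyl_comp[OF c(1,3) assms(3,4) ml])
  have kxw0: "bd k False (lx ?d m x A) = bd k True (lx ?d m w B)"
    using bd_below_eq[OF A0(1) sA(1) A0(2) kl(2)] bd_below_eq[OF A0(4) sA(4) A0(5) kl(2)] kAB by metis
  have kxw: "bd k False ?xl = bd k True ?wl"
    using bd_below_eq4[OF sA(1,2,4,5) ll(1,2) kl(2)] kxw0 by simp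
  have kyz: "bd k False ?yl = bd k True ?zl"
    using bd_below_eq[OF A0(1) sA(3) A0(3) kl(2)] bd_below_eq[OF A0(4) sA(6) A0(6) kl(2)] kAB by metis
  have kS: "bd k False (cp l (A l True) (cp l (lx ?d m x A) ?xl)) = bd k True (cp l (B l True) (cp l (lx ?d m w B) ?wl))"
    using A0 sA kl ll cyl_comp[OF c(1,3) assms(3,4), of l] ml
    by (simp add: bd_cp_below_left bd_cp_True cp_in)
  have xx: "lx ?d m x A \<in> S \<and> bd (Suc l) True (A l True) = A l True" using cylD[OF cA] by simp
  have o1: "eqv (Suc l) (od k (od l A (tau ?xl)) (od l B (tau ?wl))) (od l (od k A B) (tau (cp k ?xl ?wl)))"
  proof -
    have "eqv (Suc l) (od k (od l A (tau ?xl)) (od l B (tau ?wl))) (od l (od k A B) (od k (tau ?xl) (tau ?wl)))"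
      by (rule od_od_eqv[OF cylD(7)[OF cA] cyl_tau cylD(7)[OF cB] cyl_tau])
        (use sA kl A0 ll cyl_comp[OF c(1,3) assms(3,4), of l] ml in \<open>auto simp: bd_cp_False bd_cp_below_left\<close>)
    moreover have "eqv (Suc l) (od l (od k A B) (tau (cp k ?xl ?wl))) (od l (od k A B) (od k (tau ?xl) (tau ?wl)))"
      by (rule eqv_od[OF eqv_refl tau_od]) (use sA kl kxw in auto)
    ultimately show ?thesis by (meson eqv_trans eqv_sym)
  qed
  have o2: "eqv (Suc l) (od k (od l (tau ?yl) A') (od l (tau ?zl) B')) (od l (tau (cp k ?yl ?zl)) (od k A' B'))"
  proof -
    have "eqv (Suc l) (od k (od l (tau ?yl) A') (od l (tau ?zl) B')) (od l (od k (tau ?yl) (tau ?zl)) (od k A' B'))"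
      by (rule od_od_eqv[OF cyl_tau cylD(7)[OF cA'] cyl_tau cylD(7)[OF cB']])
        (use sA kl A0 ll kyz cylD(6)[OF cA'] cylD(6)[OF cB'] in \<open>auto simp: bd_cp_True\<close>)
    moreover have "eqv (Suc l) (od l (tau (cp k ?yl ?zl)) (od k A' B')) (od l (od k (tau ?yl) (tau ?zl)) (od k A' B'))"
      by (rule eqv_od[OF tau_od eqv_refl]) (use sA kl kyz in auto)
    ultimately show ?thesis by (meson eqv_trans eqv_sym)
  qed
  have "eqv (Suc l) (od k ?P ?Q)
      (con (Suc l) (od l (od k A B) (tau (cp k ?xl ?wl))) (od l (tau (cp k ?yl ?zl)) (od k A' B')))"
    unfolding con_cong[OF eqv_sym[OF o1] eqv_sym[OF o2]]
    by (rule eqv_sym, rule con_od[OF tA(1,2) tB(1,2) kl(1) kS])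
  then show ?thesis
    by (auto simp: eqv_def comp_def gc_def e od_nth)
qed

section \<open>Concatenation commutes with composition\<close>

lemma ccompD:
  assumes "ccomp m k x y A x' y' B"
  shows "cyl m x y A" "cyl m x' y' B" "m \<le> k" "bd k False x = bd k True x'" "bd k False y = bd k True y'"
    "m \<le> j \<Longrightarrow> j < k \<Longrightarrow> A j e = B j e" "A k False = B k True"
    "x \<in> S" "y \<in> S" "x' \<in> S" "y' \<in> S"
  using assms cylD(1,2)[of m x y A] cylD(1,2)[of m x' y' B] by (auto simp: ccomp_def)

lemma ccompI:
  assumes "cyl m x y A" "cyl m x' y' B" "m \<le> k" "bd k False x = bd k True x'" "bd k False y = bd k True y'"
    "\<And>j e. m \<le> j \<Longrightarrow> j < k \<Longrightarrow> A j e = B j e" "A k False = B k True"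
  shows "ccomp m k x y A x' y' B"
  using assms by (simp add: ccomp_def)

lemma ccomp_od:
  assumes "ccomp m l x y A x' y' A'" "ccomp m l w z B w' z' B'" "k < m" "bd k False x = bd k True w"
  shows "ccomp m l (cp k x w) (cp k y z) (od k A B) (cp k x' w') (cp k y' z') (od k A' B')"
proof -
  note a = ccompD[OF assms(1)] and b = ccompD[OF assms(2)]
  have kl: "k < l" using assms(3) a(3) by simp
  have k': "bd k False x' = bd k True w'" "bd k False y = bd k True z" "bd k False y' = bd k True z'"
    using bd_below_eq4[OF a(8,10) b(8,10) a(4) b(4) kl] assms(4)
      bd_below_eq4[OF a(9,11) b(9,11) a(5) b(5) kl] cyl_par[OF a(1) assms(3)] cyl_par[OF b(1) assms(3)]
    by simp_all
  show ?thesis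
  proof (rule ccompI)
    show "cyl m (cp k x w) (cp k y z) (od k A B)" by (rule cyl_od[OF a(1) b(1) assms(3,4)])
    show "cyl m (cp k x' w') (cp k y' z') (od k A' B')" by (rule cyl_od[OF a(2) b(2) assms(3) k'(1)])
  qed (use a b k' kl assms(4) in \<open>auto simp: bd_cp od_nth\<close>)
qed

text \<open>Two independent cylinders can be passed in either order: by \<open>con_od\<close> with
  constant cylinders, both orders give \<open>od l B A\<close>.\<close>

lemma con_exchange:
  assumes "cyl m p q B" "cyl m r s A" "l < m" "bd l False p = bd l True r"
  shows "eqv m (con m (od l B (tau r)) (od l (tau q) A)) (con m (od l (tau p) A) (od l B (tau s)))"
proof -
  have S: "p \<in> S" "q \<in> S" "r \<in> S" "s \<in> S" using assms cylD by blast+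
  have "eqv m (con m (od l B (tau r)) (od l (tau q) A)) (od l (con m B (tau q)) (con m (tau r) A))"
    by (rule con_od[OF assms(1) cyl_tau cyl_tau assms(2-4)]) (use S in auto)
  moreover have "eqv m (od l (con m B (tau q)) (con m (tau r) A)) (od l B A)"
    by (rule eqv_od[OF con_tau_right con_tau_left]) (fact assms)+
  moreover have "eqv m (con m (od l (tau p) A) (od l B (tau s))) (od l (con m (tau p) B) (con m A (tau s)))"
    by (rule con_od[OF cyl_tau assms(1,2) cyl_tau assms(3,4)]) (use S in auto)
  moreover have "eqv m (od l (con m (tau p) B) (con m A (tau s))) (od l B A)"
    by (rule eqv_od[OF con_tau_left con_tau_right]) (fact assms)+
  ultimately show ?thesis by (meson eqv_trans eqv_sym)
qed

lemma con4:
  assumes "cyl m p q P1" "cyl m q r P2" "cyl m r s P3" "cyl m s t P4"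
  shows "eqv m (con m (con m P1 P2) (con m P3 P4)) (con m (con m P1 (con m P2 P3)) P4)"
proof -
  have e: "eqv m (con m (con m P1 P2) (con m P3 P4)) (con m (con m (con m P1 P2) P3) P4)"
    by (rule eqv_sym, rule con_assoc[OF cyl_con[OF assms(1,2)] assms(3,4)])
  have "con m (con m (con m P1 P2) P3) P4 = con m (con m P1 (con m P2 P3)) P4"
    by (rule con_cong[OF con_assoc[OF assms(1-3)] eqv_refl])
  then show ?thesis using e by simp
qed

text \<open>Above \<open>l\<close> each side is a concatenation of four whiskered pieces, made of
  \<open>A\<close>, \<open>B\<close>, \<open>A'\<close>, \<open>B'\<close> on one side and of
  \<open>A\<close>, \<open>A'\<close>, \<open>B\<close>, \<open>B'\<close> on the other. The two
  middle pieces are swapped by \<open>con_exchange\<close>.\<close>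

lemma con_comp_base:
  assumes "ccomp l l x y A x' y' A'" "ccomp l l y z B y' z' B'"
  shows "eqv l (con l (comp l l x' y A A') (comp l l y' z B B')) (comp l l x' z (con l A B) (con l A' B'))"
proof (rule eqv_sym, rule con_eqvI)
  note a0 = ccompD[OF assms(1)] and b0 = ccompD[OF assms(2)]
  note a = cylD[OF a0(1)] and a' = cylD[OF a0(2)] and b = cylD[OF b0(1)] and b' = cylD[OF b0(2)]
  let ?GA = "comp l l x' y A A'" and ?GB = "comp l l y' z B B'"
    and ?W = "comp l l x' z (con l A B) (con l A' B')" and ?m = "Suc l"
  show "?W l e = cp l (?GB l e) (?GA l e)" for e by (simp add: comp_nth_eq)
  \<comment> \<open>The cells that act as whiskers. By composability \<open>a0\<close> is also
    \<open>A' l True\<close> and \<open>b1'\<close> is also \<open>B l False\<close>, which is what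
    makes the pieces of the two columns fit together.\<close>
  define b1 b1' a0 a0' where d: "b1 = B l True" "b1' = B' l True" "a0 = A l False" "a0' = A' l False"
  have eq: "A' l True = a0" "B l False = b1'" using a0(7) b0(7) d by auto
  note S = a(3) a'(3) b(3) b'(3)
  have f: "bd l False a0 = bd l False x" "bd l True a0 = bd l False y"
    "bd l False a0 = bd l True x'" "bd l True a0 = bd l True y'"
    "bd l False b1' = bd l False y" "bd l True b1' = bd l False z"
    "bd l False b1' = bd l True y'" "bd l True b1' = bd l True z'"
    "bd l False b1 = bd l True y" "bd l True b1 = bd l True z"
    "bd l False a0' = bd l False x'" "bd l True a0' = bd l False y'"
    "a0 \<in> S" "a0' \<in> S" "b1 \<in> S" "b1' \<in> S"
    using d a(3,5,6) a'(3,5,6) b(3,5,6) b'(3,5,6) eq by metis+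
  note ss = a(1,2,5,6) a'(1,2,5,6) b(1,2,5,6) b'(1,2,5,6) S f a0(4,5) b0(4,5)
  note sm = bd_cp_True bd_cp_False cp_in cp_assoc
  let ?P1 = "od l (od l (tau b1) A) (tau x')" and ?P2 = "od l (od l B (tau a0)) (tau x')"
  let ?P3 = "od l (tau z) (od l (tau b1') A')" and ?P4 = "od l (tau z) (od l B' (tau a0'))"
  let ?Q1 = "od l (tau b1) (od l A (tau x'))" and ?Q2 = "od l (tau b1) (od l (tau y) A')"
  let ?Q3 = "od l (od l B (tau y')) (tau a0')" and ?Q4 = "od l (od l (tau z) B') (tau a0')"
  note tl = cyl_tail_left[OF a0(1) b0(1), folded d] cyl_tail_right[OF a0(1) b0(1), folded d]
    cyl_tail_left[OF a0(2) b0(2), folded d] cyl_tail_right[OF a0(2) b0(2), folded d]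
  note ta = ccomp_tails[OF assms(1), folded d] and tb = ccomp_tails[OF assms(2), folded d]
  have p1: "eqv ?m (od l (con l A B) (tau x')) (con ?m ?P1 ?P2)"
  proof -
    have "eqv ?m (con ?m ?P1 ?P2) (od l (con ?m (od l (tau b1) A) (od l B (tau a0))) (con ?m (tau x') (tau x')))"
      by (rule con_od[OF tl(1,2) cyl_tau cyl_tau]) (use ss in \<open>auto simp: sm\<close>)
    moreover have "eqv ?m (od l (con ?m (od l (tau b1) A) (od l B (tau a0))) (con ?m (tau x') (tau x')))
        (od l (con l A B) (tau x'))"
      by (rule eqv_od[OF eqv_sym[OF con_tail_eqv[of l A B, folded d]] con_tau_left[OF cyl_tau]]) (fact a')
    ultimately show ?thesis by (meson eqv_trans eqv_sym)
  qed
  have p2: "eqv ?m (od l (tau z) (con l A' B')) (con ?m ?P3 ?P4)"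
  proof -
    have "eqv ?m (con ?m ?P3 ?P4) (od l (con ?m (tau z) (tau z)) (con ?m (od l (tau b1') A') (od l B' (tau a0'))))"
      by (rule con_od[OF cyl_tau cyl_tau tl(3,4)]) (use ss in \<open>auto simp: sm\<close>)
    moreover have "eqv ?m (od l (con ?m (tau z) (tau z)) (con ?m (od l (tau b1') A') (od l B' (tau a0'))))
        (od l (tau z) (con l A' B'))"
      by (rule eqv_od[OF con_tau_left[OF cyl_tau] eqv_sym[OF con_tail_eqv[of l A' B', folded d]]]) (fact b)
    ultimately show ?thesis by (meson eqv_trans eqv_sym)
  qed
  have q1: "eqv ?m (od l (tau b1) ?GA) (con ?m ?Q1 ?Q2)"
  proof -
    have "eqv ?m (con ?m ?Q1 ?Q2) (od l (con ?m (tau b1) (tau b1)) (con ?m (od l A (tau x')) (od l (tau y) A')))"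
      by (rule con_od[OF cyl_tau cyl_tau ta]) (use ss d in \<open>auto simp: sm\<close>)
    moreover have "eqv ?m (od l (con ?m (tau b1) (tau b1)) (con ?m (od l A (tau x')) (od l (tau y) A')))
        (od l (tau b1) ?GA)"
      unfolding comp_refl by (rule eqv_od[OF con_tau_left[OF cyl_tau] eqv_sym[OF gc_tail]]) (fact f)
    ultimately show ?thesis by (meson eqv_trans eqv_sym)
  qed
  have q2: "eqv ?m (od l ?GB (tau a0')) (con ?m ?Q3 ?Q4)"
  proof -
    have "eqv ?m (con ?m ?Q3 ?Q4) (od l (con ?m (od l B (tau y')) (od l (tau z) B')) (con ?m (tau a0') (tau a0')))"
      by (rule con_od[OF tb cyl_tau cyl_tau]) (use ss d in \<open>auto simp: sm\<close>)
    moreover have "eqv ?m (od l (con ?m (od l B (tau y')) (od l (tau z) B')) (con ?m (tau a0') (tau a0')))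
        (od l ?GB (tau a0'))"
      unfolding comp_refl by (rule eqv_od[OF eqv_sym[OF gc_tail] con_tau_left[OF cyl_tau]]) (fact f)
    ultimately show ?thesis by (meson eqv_trans eqv_sym)
  qed
  have r1: "eqv ?m ?P1 ?Q1"
    by (rule od_assoc_eqv[OF cyl_tau a(7) cyl_tau]) (use ss d in \<open>auto simp: sm\<close>)
  have r4: "eqv ?m ?Q4 ?P4"
    by (rule od_assoc_eqv[OF cyl_tau b'(7) cyl_tau]) (use ss d in \<open>auto simp: sm\<close>)
  let ?X = "cp l a0 x'" and ?Y = "cp l z b1'" and ?V = "cp l b1 y" and ?U = "cp l y' a0'"
  have r2: "eqv ?m ?P2 (od l B (tau ?X))"
  proof -
    have "eqv ?m ?P2 (od l B (od l (tau a0) (tau x')))"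
      by (rule od_assoc_eqv[OF b(7) cyl_tau cyl_tau]) (use ss d in \<open>auto simp: sm\<close>)
    moreover have "eqv ?m (od l B (tau ?X)) (od l B (od l (tau a0) (tau x')))"
      by (rule eqv_od[OF eqv_refl tau_od]) (use ss in auto)
    ultimately show ?thesis by (meson eqv_trans eqv_sym)
  qed
  have r3: "eqv ?m ?P3 (od l (tau ?Y) A')"
  proof -
    have "eqv ?m (od l (od l (tau z) (tau b1')) A') ?P3"
      by (rule od_assoc_eqv[OF cyl_tau cyl_tau a'(7)]) (use ss d eq in \<open>auto simp: sm\<close>)
    moreover have "eqv ?m (od l (tau ?Y) A') (od l (od l (tau z) (tau b1')) A')"
      by (rule eqv_od[OF tau_od eqv_refl]) (use ss in auto)
    ultimately show ?thesis by (meson eqv_trans eqv_sym)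
  qed
  have s2: "eqv ?m ?Q2 (od l (tau ?V) A')"
  proof -
    have "eqv ?m (od l (od l (tau b1) (tau y)) A') ?Q2"
      by (rule od_assoc_eqv[OF cyl_tau cyl_tau a'(7)]) (use ss d eq in \<open>auto simp: sm\<close>)
    moreover have "eqv ?m (od l (tau ?V) A') (od l (od l (tau b1) (tau y)) A')"
      by (rule eqv_od[OF tau_od eqv_refl]) (use ss in auto)
    ultimately show ?thesis by (meson eqv_trans eqv_sym)
  qed
  have s3: "eqv ?m ?Q3 (od l B (tau ?U))"
  proof -
    have "eqv ?m ?Q3 (od l B (od l (tau y') (tau a0')))"
      by (rule od_assoc_eqv[OF b(7) cyl_tau cyl_tau]) (use ss d in \<open>auto simp: sm\<close>)
    moreover have "eqv ?m (od l B (tau ?U)) (od l B (od l (tau y') (tau a0')))"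
      by (rule eqv_od[OF eqv_refl tau_od]) (use ss in auto)
    ultimately show ?thesis by (meson eqv_trans eqv_sym)
  qed
  have cB: "cyl ?m ?V ?Y B" using b(7) d eq by simp
  have cA': "cyl ?m ?X ?U A'" using a'(7) d eq by simp
  have VX: "bd l False ?V = bd l True ?X" using ss by (simp add: sm)
  have ex: "eqv ?m (con ?m ?P2 ?P3) (con ?m ?Q2 ?Q3)"
  proof -
    have "con ?m ?P2 ?P3 = con ?m (od l B (tau ?X)) (od l (tau ?Y) A')" by (rule con_cong[OF r2 r3])
    moreover have "con ?m ?Q2 ?Q3 = con ?m (od l (tau ?V) A') (od l B (tau ?U))" by (rule con_cong[OF s2 s3])
    ultimately show ?thesis using con_exchange[OF cB cA' _ VX] by simp
  qed
  have c1: "cyl ?m (cp l (cp l (cp l b1 (A l True)) x) x') (cp l ?V ?X) ?P1"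
  proof -
    have "cyl ?m (cp l (cp l (cp l b1 (A l True)) x) x') (cp l (cp l b1 (cp l y a0)) x') ?P1"
      by (rule cyl_od[OF tl(1) cyl_tau]) (use ss d in \<open>auto simp: sm\<close>)
    moreover have "cp l (cp l b1 (cp l y a0)) x' = cp l ?V ?X" using ss by (simp add: sm)
    ultimately show ?thesis by simp
  qed
  have c1': "cyl ?m (cp l (cp l (cp l b1 (A l True)) x) x') (cp l ?V ?X) ?Q1"
    by (rule cyl_cong[OF c1 r1])
  have c2: "cyl ?m (cp l ?V ?X) (cp l ?Y ?X) ?P2"
    by (rule cyl_cong[OF cyl_od[OF cB cyl_tau _ _] eqv_sym[OF r2]]) (use ss VX in \<open>auto simp: sm\<close>)
  have YX: "bd l False ?Y = bd l True ?X" using ss by (simp add: sm)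
  have VU: "bd l False ?V = bd l True ?U" using ss by (simp add: sm)
  have YU: "bd l False ?Y = bd l True ?U" using ss by (simp add: sm)
  have c3: "cyl ?m (cp l ?Y ?X) (cp l ?Y ?U) ?P3"
    by (rule cyl_cong[OF cyl_od[OF cyl_tau cA' _ YX] eqv_sym[OF r3]]) (use ss in \<open>auto simp: sm\<close>)
  have d2: "cyl ?m (cp l ?V ?X) (cp l ?V ?U) ?Q2"
    by (rule cyl_cong[OF cyl_od[OF cyl_tau cA' _ VX] eqv_sym[OF s2]]) (use ss in \<open>auto simp: sm\<close>)
  have d3: "cyl ?m (cp l ?V ?U) (cp l ?Y ?U) ?Q3"
    by (rule cyl_cong[OF cyl_od[OF cB cyl_tau _ VU] eqv_sym[OF s3]]) (use ss in \<open>auto simp: sm\<close>)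
  have c4: "cyl ?m (cp l ?Y ?U) (cp l z (cp l z' (cp l (B' l False) a0'))) ?P4"
  proof -
    have "cyl ?m (cp l z (cp l b1' (cp l y' a0'))) (cp l z (cp l z' (cp l (B' l False) a0'))) ?P4"
      by (rule cyl_od[OF cyl_tau tl(4)]) (use ss d in \<open>auto simp: sm\<close>)
    moreover have "cp l z (cp l b1' (cp l y' a0')) = cp l ?Y ?U" using ss by (simp add: sm)
    ultimately show ?thesis by simp
  qed
  have c4': "cyl ?m (cp l ?Y ?U) (cp l z (cp l z' (cp l (B' l False) a0'))) ?Q4"
    by (rule cyl_cong[OF c4 eqv_sym[OF r4]])
  have "eqv ?m ?W (con ?m (od l (con l A B) (tau x')) (od l (tau z) (con l A' B')))"
    unfolding comp_refl by (rule gc_tail)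
  also have "con ?m (od l (con l A B) (tau x')) (od l (tau z) (con l A' B')) =
      con ?m (con ?m ?P1 ?P2) (con ?m ?P3 ?P4)"
    by (rule con_cong[OF p1 p2])
  finally have w: "eqv ?m ?W (con ?m (con ?m ?P1 (con ?m ?P2 ?P3)) ?P4)"
    using con4[OF c1 c2 c3 c4] eqv_trans by blast
  have "con ?m ?P1 (con ?m ?P2 ?P3) = con ?m ?Q1 (con ?m ?Q2 ?Q3)" by (rule con_cong[OF r1 ex])
  then have E: "con ?m (con ?m ?P1 (con ?m ?P2 ?P3)) ?P4 = con ?m (con ?m ?Q1 (con ?m ?Q2 ?Q3)) ?Q4"
    using con_cong[OF eqv_refl eqv_sym[OF r4]] by simp
  have "eqv ?m ?W (con ?m (con ?m ?Q1 ?Q2) (con ?m ?Q3 ?Q4))"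
    by (rule eqv_trans[OF w[unfolded E] eqv_sym[OF con4[OF c1' d2 d3 c4']]])
  moreover have "con ?m (od l (tau b1) ?GA) (od l ?GB (tau a0')) = con ?m (con ?m ?Q1 ?Q2) (con ?m ?Q3 ?Q4)"
    by (rule con_cong[OF q1 q2])
  ultimately show "eqv ?m ?W (con ?m (od l (tau (?GB l True)) ?GA) (od l ?GB (tau (?GA l False))))"
    by (simp add: comp_nth_eq d)
qed

text \<open>A cell \<open>b\<close> of dimension at most \<open>l\<close> equals
  \<open>cp l b b\<close>, so its constant cylinder is a composite with itself and
  \<open>od_comp\<close> lets it act on both factors.\<close>

lemma od_tau_comp:
  assumes "ccomp (Suc m) l x y A x' y' A'" "b \<in> S" "bd (Suc m) False b = b"
  shows "bd m False b = bd m True x \<Longrightarrow> eqv (Suc m) (od m (tau b) (comp (Suc m) l x' y A A'))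
     (comp (Suc m) l (cp m b x') (cp m b y) (od m (tau b) A) (od m (tau b) A'))"
    "bd m False b = bd m True x \<Longrightarrow>
      ccomp (Suc m) l (cp m b x) (cp m b y) (od m (tau b) A) (cp m b x') (cp m b y') (od m (tau b) A')"
    "bd m False x = bd m True b \<Longrightarrow> eqv (Suc m) (od m (comp (Suc m) l x' y A A') (tau b))
     (comp (Suc m) l (cp m x' b) (cp m y b) (od m A (tau b)) (od m A' (tau b)))"
    "bd m False x = bd m True b \<Longrightarrow>
      ccomp (Suc m) l (cp m x b) (cp m y b) (od m A (tau b)) (cp m x' b) (cp m y' b) (od m A' (tau b))"
proof -
  have ml: "Suc m \<le> l" by (rule ccompD(3)[OF assms(1)])
  have bl: "bd l e b = b" for e using bd_cell[OF assms(2,3) ml] .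
  have bb: "cp l b b = b" using cp_cell_self[OF assms(2,3) ml] .
  have c: "ccomp (Suc m) l b b (tau b) b b (tau b)"
    by (rule ccomp_tau) (use assms(2) bl ml in auto)
  have t: "eqv (Suc m) (comp (Suc m) l b b (tau b) (tau b)) (tau b)"
    using comp_tau[OF assms(2,2) _ ml] bl bb by simp
  show "ccomp (Suc m) l (cp m b x) (cp m b y) (od m (tau b) A) (cp m b x') (cp m b y') (od m (tau b) A')"
    if "bd m False b = bd m True x"
    by (rule ccomp_od[OF c assms(1)]) (use that in auto)
  show "ccomp (Suc m) l (cp m x b) (cp m y b) (od m A (tau b)) (cp m x' b) (cp m y' b) (od m A' (tau b))"
    if "bd m False x = bd m True b"
    by (rule ccomp_od[OF assms(1) c]) (use that in auto)
  show "eqv (Suc m) (od m (tau b) (comp (Suc m) l x' y A A'))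
     (comp (Suc m) l (cp m b x') (cp m b y) (od m (tau b) A) (od m (tau b) A'))"
    if "bd m False b = bd m True x"
    using eqv_trans[OF eqv_od[OF eqv_sym[OF t] eqv_refl] od_comp[OF c assms(1) _ that]] by simp
  show "eqv (Suc m) (od m (comp (Suc m) l x' y A A') (tau b))
     (comp (Suc m) l (cp m x' b) (cp m y b) (od m A (tau b)) (od m A' (tau b)))"
    if "bd m False x = bd m True b"
    using eqv_trans[OF eqv_od[OF eqv_refl eqv_sym[OF t]] od_comp[OF assms(1) c _ that]] by simp
qed

text \<open>Below \<open>l\<close> the factors of a composite have the same heads. The whiskers of
  the tails are therefore the same for both factors and move inside the composites, after which the
  claim is the one for level \<open>Suc m\<close>.\<close>

lemma con_comp:
  assumes "ccomp m l x y A x' y' A'" "ccomp m l y z B y' z' B'"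
  shows "eqv m (con m (comp m l x' y A A') (comp m l y' z B B')) (comp m l x' z (con m A B) (con m A' B'))"
  using assms
proof (induction "l - m" arbitrary: m x y A x' y' A' z B z' B')
  case 0
  then have "m = l" using ccompD(3)[OF 0(2)] by simp
  with con_comp_base 0(2,3) show ?case by blast
next
  case (Suc d)
  note a0 = ccompD[OF Suc(3)] and b0 = ccompD[OF Suc(4)]
  note a = cylD[OF a0(1)] and a' = cylD[OF a0(2)] and b = cylD[OF b0(1)] and b' = cylD[OF b0(2)]
  have ml: "m < l" and dl: "d = l - Suc m" using Suc(2) by auto
  have ab: "A' m e = A m e" "B' m e = B m e" for e using a0(6) b0(6) ml by auto
  define b1 a1 where d: "b1 = B m True" "a1 = A m False"
  let ?GA = "comp m l x' y A A'" and ?GB = "comp m l y' z B B'"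
    and ?W = "comp m l x' z (con m A B) (con m A' B')"
  have cA: "ccomp (Suc m) l (cp m (A m True) x) (cp m y a1) A (cp m (A m True) x') (cp m y' a1) A'"
    using ccomp_Suc[OF Suc(3) ml] by (simp add: ab d)
  have cB: "ccomp (Suc m) l (cp m b1 y) (cp m z (B m False)) B (cp m b1 y') (cp m z' (B m False)) B'"
    using ccomp_Suc[OF Suc(4) ml] by (simp add: ab d)
  have GA: "?GA = comp (Suc m) l (cp m (A m True) x') (cp m y a1) A A'"
    and GB: "?GB = comp (Suc m) l (cp m b1 y') (cp m z (B m False)) B B'"
    using comp_Suc[OF ml] by (simp_all add: ab d)
  have W: "?W = comp (Suc m) l (cp m (cp m b1 (A m True)) x') (cp m z (cp m (B m False) a1)) (con m A B) (con m A' B')"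
    using comp_Suc[OF ml] by (simp add: ab d)
  have s: "b1 \<in> S" "a1 \<in> S" "bd (Suc m) False b1 = b1" "bd (Suc m) False a1 = a1"
    using a b d by auto
  have m1: "bd m False b1 = bd m True (cp m (A m True) x)" using a b d by (simp add: bd_cp_True)
  have m2: "bd m False (cp m b1 y) = bd m True a1" using a b d by (simp add: bd_cp_False)
  note o1 = od_tau_comp(1,2)[OF cA s(1,3) m1] and o2 = od_tau_comp(3,4)[OF cB s(2,4) m2]
  have e1: "cp m b1 (cp m y a1) = cp m (cp m b1 y) a1"
    using a b d by (simp add: cp_assoc)
  have f: "bd m True a1 = bd m False y'" "bd m False b1 = bd m True y'"
      "bd m False (A m True) = bd m True x'"
    using a'(6)[of False] b'(5)[of True] a'(5)[of True] ab d by simp_all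
  have f': "bd m False b1 = bd m True (A m True)" using a(6)[of True] b(5)[of True] d by simp
  have e2: "cp m b1 (cp m y' a1) = cp m (cp m b1 y') a1"
    by (rule cp_assoc[symmetric, OF s(1) b'(1) s(2) f(2) f(1)[symmetric]])
  have e3: "cp m b1 (cp m (A m True) x') = cp m (cp m b1 (A m True)) x'"
    by (rule cp_assoc[symmetric, OF s(1) a(3) a'(1) f' f(3)])
  have e4: "cp m (cp m z (B m False)) a1 = cp m z (cp m (B m False) a1)"
    using a b d by (simp add: cp_assoc)
  have o1': "ccomp (Suc m) l (cp m b1 (cp m (A m True) x)) (cp m (cp m b1 y) a1) (od m (tau b1) A)
      (cp m b1 (cp m (A m True) x')) (cp m (cp m b1 y') a1) (od m (tau b1) A')"
    using o1(2) unfolding e1 e2 .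
  have "eqv m ?W (con m ?GA ?GB)"
  proof (rule con_eqvI)
    show "?W m e = cp m (?GB m e) (?GA m e)" for e by (simp add: comp_nth_lt ml)
    have h: "?GB m True = b1" "?GA m False = a1" by (simp_all add: comp_nth_lt ml d)
    have "con (Suc m) (od m (tau b1) ?GA) (od m ?GB (tau a1)) =
      con (Suc m) (comp (Suc m) l (cp m b1 (cp m (A m True) x')) (cp m (cp m b1 y) a1) (od m (tau b1) A) (od m (tau b1) A'))
       (comp (Suc m) l (cp m (cp m b1 y') a1) (cp m (cp m z (B m False)) a1) (od m B (tau a1)) (od m B' (tau a1)))"
      using con_cong[OF o1(1)[folded GA] o2(1)[folded GB]] unfolding e1 .
    moreover have "eqv (Suc m) \<dots> (comp (Suc m) l (cp m b1 (cp m (A m True) x')) (cp m (cp m z (B m False)) a1)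
       (con (Suc m) (od m (tau b1) A) (od m B (tau a1))) (con (Suc m) (od m (tau b1) A') (od m B' (tau a1))))"
      by (rule Suc(1)[OF dl o1' o2(2)])
    moreover have "eqv (Suc m) (comp (Suc m) l (cp m b1 (cp m (A m True) x')) (cp m (cp m z (B m False)) a1)
       (con (Suc m) (od m (tau b1) A) (od m B (tau a1))) (con (Suc m) (od m (tau b1) A') (od m B' (tau a1)))) ?W"
      unfolding W e3 e4
      by (rule comp_cong) (use con_tail_eqv[of m A B] con_tail_eqv[of m A' B'] ml in \<open>auto simp: d ab eqv_sym\<close>)
    ultimately show "eqv (Suc m) ?W (con (Suc m) (od m (tau (?GB m True)) ?GA) (od m ?GB (tau (?GA m False))))"
      unfolding h by (simp only:) (blast intro: eqv_sym eqv_trans)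
  qed
  then show ?case by (rule eqv_sym)
qed

section \<open>Boundaries, units, associativity and interchange for cylinders\<close>

lemma trunc_lt: "j < k \<Longrightarrow> trunc k e A j e' = A j e'"
  and trunc_ge: "k \<le> j \<Longrightarrow> trunc k e A j e' = A k e"
  by (auto simp: trunc_def)

lemma eqv_trunc: "eqv m A B \<Longrightarrow> m \<le> l \<Longrightarrow> eqv m (trunc l e A) (trunc l e B)"
  by (auto simp: eqv_def trunc_def)

lemma tau_cell: "a \<in> S \<Longrightarrow> bd m e a = a \<Longrightarrow> eqv m (tau a) (\<lambda>j e. a)"
  by (auto simp: eqv_def tau_nth intro: bd_cell)

lemma od_tau_trunc:
  assumes "x \<in> S" "k \<le> l"
  shows "eqv k (od i (trunc l e A) (tau (bd l e x))) (trunc l e (od i A (tau x)))"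
    "eqv k (od i (tau (bd l e x)) (trunc l e A)) (trunc l e (od i (tau x) A))"
  using assms by (auto simp: eqv_def od_nth tau_nth trunc_def bd_ge bd_lt)

text \<open>At \<open>m = l\<close> both truncations are constant on a single cell, and so is their
  concatenation. At lower levels the whiskers have dimension at most \<open>l\<close> and commute
  with truncation.\<close>

lemma con_trunc:
  assumes "cyl m x y A" "cyl m y z B" "m \<le> l"
  shows "eqv m (con m (trunc l e A) (trunc l e B)) (trunc l e (con m A B))"
  using assms
proof (induction "l - m" arbitrary: m x y A z B)
  case 0
  then have [simp]: "m = l" by simp
  note a = cylD[OF 0(2)] and b = cylD[OF 0(3)]
  define p q where "p = A l e" "q = B l e"
  have pq: "p \<in> S" "q \<in> S" "bd (Suc l) False p = p" "bd (Suc l) False q = q" "bd l False q = bd l True p"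
    using a b by (auto simp: p_q_def)
  let ?r = "cp l q p"
  have r: "?r \<in> S" "bd (Suc l) False ?r = ?r" using pq by (auto simp: bd_cp cp_in)
  have t: "eqv l (trunc l e A) (\<lambda>j e. p)" "eqv l (trunc l e B) (\<lambda>j e. q)"
    by (auto simp: eqv_def trunc_def p_q_def)
  have "eqv l (\<lambda>j e. ?r) (con l (\<lambda>j e. p) (\<lambda>j e. q))"
  proof (rule con_eqvI)
    have u: "eqv (Suc l) (od l (tau q) (\<lambda>j e. p)) (tau ?r)" "eqv (Suc l) (od l (\<lambda>j e. q) (tau p)) (tau ?r)"
      using tau_cell[OF pq(2,4)] tau_cell[OF pq(1,3)] tau_cell[OF r] by (auto simp: eqv_def od_nth)
    have "con (Suc l) (od l (tau q) (\<lambda>j e. p)) (od l (\<lambda>j e. q) (tau p)) = con (Suc l) (tau ?r) (tau ?r)"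
      by (rule con_cong[OF u])
    moreover have "eqv (Suc l) (con (Suc l) (tau ?r) (tau ?r)) (\<lambda>j e. ?r)"
      by (rule eqv_trans[OF con_tau_left[OF cyl_tau[OF r(1)]] tau_cell[OF r]])
    ultimately show "eqv (Suc l) (\<lambda>j e. ?r) (con (Suc l) (od l (tau q) (\<lambda>j e. p)) (od l (\<lambda>j e. q) (tau p)))"
      by (simp add: eqv_sym)
  qed simp
  moreover have "con l (trunc l e A) (trunc l e B) = con l (\<lambda>j e. p) (\<lambda>j e. q)" by (rule con_cong[OF t])
  ultimately show ?case by (auto simp: eqv_def trunc_ge p_q_def)
next
  case (Suc d)
  have ml: "m < l" "d = l - Suc m" using Suc(2) by auto
  note a = cylD[OF Suc(3)] and b = cylD[OF Suc(4)]
  define b1 a1 where d: "b1 = B m True" "a1 = A m False"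
  have ba: "bd l e b1 = b1" "bd l e a1 = a1" using cyl_cell[OF Suc(3) ml(1)] cyl_cell[OF Suc(4) ml(1)] d by auto
  have S: "b1 \<in> S" "a1 \<in> S" using a b d by auto
  have "eqv m (trunc l e (con m A B)) (con m (trunc l e A) (trunc l e B))"
  proof (rule con_eqvI)
    let ?A = "od m (tau b1) A" and ?B = "od m B (tau a1)"
    have h: "trunc l e B m True = b1" "trunc l e A m False = a1" using ml by (auto simp: trunc_lt d)
    have "con (Suc m) (od m (tau b1) (trunc l e A)) (od m (trunc l e B) (tau a1)) =
      con (Suc m) (trunc l e ?A) (trunc l e ?B)"
      using od_tau_trunc[of b1 "Suc m" l m e A] od_tau_trunc[of a1 "Suc m" l m e B] S ml ba by (auto intro: con_cong)
    moreover have "eqv (Suc m) (con (Suc m) (trunc l e ?A) (trunc l e ?B)) (trunc l e (con (Suc m) ?A ?B))"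
      using Suc(1)[OF ml(2) cyl_tail_left[OF Suc(3,4)] cyl_tail_right[OF Suc(3,4)]] ml(1) by (simp add: d)
    moreover have "eqv (Suc m) (trunc l e (con m A B)) (trunc l e (con (Suc m) ?A ?B))"
      by (rule eqv_trunc) (use con_tail_eqv[of m A B] ml d in auto)
    ultimately show "eqv (Suc m) (trunc l e (con m A B)) (con (Suc m) (od m (tau (trunc l e B m True)) (trunc l e A))
        (od m (trunc l e B) (tau (trunc l e A m False))))"
      unfolding h by (simp only:) (blast intro: eqv_sym eqv_trans)
  qed (use ml in \<open>simp add: trunc_lt\<close>)
  then show ?case by (rule eqv_sym)
qed

lemma cyl_trunc:
  assumes "cyl m x y A" "m \<le> k"
  shows "cyl m (bd k e x) (bd k e y) (trunc k e A)"
  using assms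
proof (induction "k - m" arbitrary: m x y)
  case 0
  then have [simp]: "m = k" by simp
  note a = cylD[OF 0(2)]
  let ?a = "A k e"
  have u: "cp k ?a (bd k e x) = ?a" "cp k (bd k e y) ?a = ?a"
    using a cp_unit_right[of ?a k] cp_unit_left[of ?a k] by auto
  have "cyl (Suc k) ?a ?a (trunc k e A)"
    by (rule cyl_cong[OF cyl_const[of _ _ False]]) (use a in \<open>auto simp: eqv_def trunc_ge\<close>)
  then show ?case
    by - (rule cylI; use a u in \<open>auto simp: trunc_ge bd_ge\<close>)
next
  case (Suc d)
  have ml: "m < k" "d = k - Suc m" using Suc(2) by auto
  note a = cylD[OF Suc(3)]
  have n: "cp m (A m True) (bd k e x) = bd k e (cp m (A m True) x)"
    "cp m (bd k e y) (A m False) = bd k e (cp m y (A m False))"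
    using a ml cyl_cell[OF Suc(3) ml(1)] by (auto simp: bd_cp)
  from Suc(1)[OF ml(2) a(7)] ml(1)
  have "cyl (Suc m) (bd k e (cp m (A m True) x)) (bd k e (cp m y (A m False))) (trunc k e A)" by simp
  then show ?case
    by - (rule cylI; use a n ml in \<open>auto simp: trunc_lt bd_lt\<close>)
qed

lemma comp_trunc:
  assumes "ccomp m k x y A x' y' B" "k < l"
  shows "eqv m (trunc l e (comp m k x' y A B)) (comp m k (bd l e x') (bd l e y) (trunc l e A) (trunc l e B))"
  using assms(1)
proof (rule ccomp_ind)
  fix x y x' y' assume c: "ccomp k k x y A x' y' B"
  note t = ccomp_tails[OF c] and f = ccompD[OF c]
  have kl: "Suc k \<le> l" using assms by simp
  let ?P = "od k A (tau x')" and ?Q = "od k (tau y) B"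
  have "con (Suc k) (od k (trunc l e A) (tau (bd l e x'))) (od k (tau (bd l e y)) (trunc l e B)) =
    con (Suc k) (trunc l e ?P) (trunc l e ?Q)"
    by (rule con_cong[OF od_tau_trunc(1)[OF f(10) kl] od_tau_trunc(2)[OF f(9) kl]])
  then have "eqv (Suc k) (con (Suc k) (od k (trunc l e A) (tau (bd l e x'))) (od k (tau (bd l e y)) (trunc l e B)))
     (trunc l e (con (Suc k) ?P ?Q))" using con_trunc[OF t kl] by simp
  moreover have "eqv (Suc k) (trunc l e (con (Suc k) ?P ?Q)) (trunc l e (gc k x' y A B))"
    by (rule eqv_trunc[OF eqv_sym[OF gc_tail] kl])
  ultimately have 1: "eqv (Suc k) (trunc l e (gc k x' y A B)) (gc k (bd l e x') (bd l e y) (trunc l e A) (trunc l e B))"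
    using gc_tail eqv_sym eqv_trans by blast
  show "eqv k (trunc l e (comp k k x' y A B)) (comp k k (bd l e x') (bd l e y) (trunc l e A) (trunc l e B))"
    unfolding eqv_def
  proof (intro allI impI)
    fix j e' assume "k \<le> j"
    then consider "j = k" | "Suc k \<le> j" by linarith
    then show "trunc l e (comp k k x' y A B) j e' = comp k k (bd l e x') (bd l e y) (trunc l e A) (trunc l e B) j e'"
      using 1 assms(2) unfolding comp_refl[symmetric] by cases (auto simp: trunc_lt comp_nth_eq eqv_def)
  qed
next
  fix m x y x' y' assume c: "ccomp m k x y A x' y' B" and m: "m < k"
   and IH: "eqv (Suc m) (trunc l e (comp (Suc m) k (cp m (B m True) x') (cp m y (A m False)) A B))
     (comp (Suc m) k (bd l e (cp m (B m True) x')) (bd l e (cp m y (A m False))) (trunc l e A) (trunc l e B))"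
  have ml: "m < l" using m assms(2) by simp
  note f = ccompD[OF c] and a = cylD[OF ccompD(1)[OF c]] and b = cylD[OF ccompD(2)[OF c]]
  have n: "cp m (B m True) (bd l e x') = bd l e (cp m (B m True) x')"
    "cp m (bd l e y) (A m False) = bd l e (cp m y (A m False))"
    using a b ml cyl_cell[OF f(1) ml] cyl_cell[OF f(2) ml] by (auto simp: bd_cp)
  have h: "trunc l e A m e' = A m e'" "trunc l e B m e' = B m e'" for e' using ml by (auto simp: trunc_lt)
  show "eqv m (trunc l e (comp m k x' y A B)) (comp m k (bd l e x') (bd l e y) (trunc l e A) (trunc l e B))"
    unfolding eqv_def
  proof (intro allI impI)
    fix j e' assume "m \<le> j"
    then consider "j = m" | "Suc m \<le> j" by linarith
    then show "trunc l e (comp m k x' y A B) j e' = comp m k (bd l e x') (bd l e y) (trunc l e A) (trunc l e B) j e'"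
    proof cases
      case 1
      then show ?thesis using ml m by (simp add: trunc_lt comp_nth_lt)
    next
      case 2
      then show ?thesis using IH by (simp add: comp_Suc[OF m] h n eqv_def)
    qed
  qed
qed

text \<open>Above \<open>k\<close>, whiskering \<open>A\<close> by a boundary of its own source
  changes nothing, and the whiskered unit cylinder is constant on the target of the tail of
  \<open>A\<close>. What remains is \<open>con_tau_right\<close>.\<close>

lemma comp_unit_right:
  assumes "cyl m x y A" "m \<le> k"
  shows "eqv m (comp m k (bd k False x) y A (trunc k False A)) A"
proof -
  let ?d = "k - m"
  define xk yk a where d: "xk = lx ?d m x A" "yk = ry ?d m y A" "a = A k False"
  have mk: "m + ?d = k" using assms by simp
  have c: "cyl k xk yk A" using cyl_lx[OF assms(1), of ?d] mk d by simp
  note f = cylD[OF c]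
  have e: "lx ?d m (bd k False x) (trunc k False A) = bd k False xk"
    using lx_trunc[OF assms(1), of ?d k] mk d by simp
  let ?m = "Suc k"
  have u1: "eqv ?m (od k A (tau (bd k False xk))) A"
  proof -
    have "cp k (A j e) (bd k False xk) = A j e" if "?m \<le> j" for j e
      using cyl_bd_below[OF f(7) _ that, of k False e] cp_unit_right[of "A j e" k] f
      by (simp add: bd_cp_False)
    then show ?thesis using f(1) by (auto simp: eqv_def od_nth tau_nth bd_ge)
  qed
  have "eqv ?m (od k (tau yk) (trunc k False A)) (od k (tau yk) (tau a))"
    by (rule eqv_od[OF eqv_refl]) (use f bd_cell[OF f(3,4)] in \<open>auto simp: eqv_def trunc_ge tau_nth d\<close>)
  moreover have "eqv ?m (od k (tau yk) (tau a)) (tau (cp k yk a))"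
    by (rule eqv_sym[OF tau_od]) (use f d in auto)
  ultimately have u2: "eqv ?m (od k (tau yk) (trunc k False A)) (tau (cp k yk a))" by (rule eqv_trans)
  have "con ?m (od k A (tau (bd k False xk))) (od k (tau yk) (trunc k False A)) = con ?m A (tau (cp k yk a))"
    by (rule con_cong[OF u1 u2])
  then have "eqv ?m (con ?m (od k A (tau (bd k False xk))) (od k (tau yk) (trunc k False A))) A"
    using con_tau_right[OF f(7)] d by simp
  then show ?thesis
    unfolding comp_def e d(2)[symmetric] by (auto simp: eqv_def gc_def trunc_ge)
qed

lemma comp_unit_left:
  assumes "cyl m x y A" "m \<le> k"
  shows "eqv m (comp m k x (bd k True y) (trunc k True A) A) A"
proof -
  let ?d = "k - m"
  define xk yk a where d: "xk = lx ?d m x A" "yk = ry ?d m y A" "a = A k True"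
  have mk: "m + ?d = k" using assms by simp
  have c: "cyl k xk yk A" using cyl_lx[OF assms(1), of ?d] mk d by simp
  note f = cylD[OF c]
  have e: "ry ?d m (bd k True y) (trunc k True A) = bd k True yk"
    using lx_trunc[OF assms(1), of ?d k] mk d by simp
  let ?m = "Suc k"
  have u1: "eqv ?m (od k (tau (bd k True yk)) A) A"
  proof -
    have "cp k (bd k True yk) (A j e) = A j e" if "?m \<le> j" for j e
      using cyl_bd_below[OF f(7) _ that, of k True e] cyl_par[OF f(7), of k True] cp_unit_left[of "A j e" k] f
      by (simp add: bd_cp_True)
    then show ?thesis using f(2) by (auto simp: eqv_def od_nth tau_nth bd_ge)
  qed
  have "eqv ?m (od k (trunc k True A) (tau xk)) (od k (tau a) (tau xk))"
    by (rule eqv_od[OF _ eqv_refl]) (use f bd_cell[OF f(3,4)] in \<open>auto simp: eqv_def trunc_ge tau_nth d\<close>)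
  moreover have "eqv ?m (od k (tau a) (tau xk)) (tau (cp k a xk))"
    by (rule eqv_sym[OF tau_od]) (use f d in auto)
  ultimately have u2: "eqv ?m (od k (trunc k True A) (tau xk)) (tau (cp k a xk))" by (rule eqv_trans)
  have "con ?m (od k (trunc k True A) (tau xk)) (od k (tau (bd k True yk)) A) = con ?m (tau (cp k a xk)) A"
    by (rule con_cong[OF u2 u1])
  then have "eqv ?m (con ?m (od k (trunc k True A) (tau xk)) (od k (tau (bd k True yk)) A)) A"
    using con_tau_left[OF f(7)] d by simp
  then show ?thesis
    unfolding comp_def e d(1)[symmetric] by (auto simp: eqv_def gc_def trunc_def)
qed

lemma eqv_split: "A m = B m \<Longrightarrow> eqv (Suc m) A B \<Longrightarrow> eqv m A B"
  unfolding eqv_def by (metis Suc_leI le_neq_implies_less)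

text \<open>Above \<open>k\<close> both sides are a concatenation of \<open>A\<close>,
  \<open>B\<close> and \<open>D\<close>, each whiskered by ends of the other two; associativity is
  that of \<open>con\<close>.\<close>

lemma comp_assoc_base:
  assumes "ccomp k k x y A x' y' B" "ccomp k k x' y' B x'' y'' D"
  shows "eqv k (comp k k x'' (cp k y y') (comp k k x' y A B) D)
      (comp k k (cp k x' x'') y A (comp k k x'' y' B D))"
proof (rule eqv_split)
  note a0 = ccompD[OF assms(1)] and b0 = ccompD[OF assms(2)]
  note a = cylD[OF a0(1)] and b = cylD[OF a0(2)] and c = cylD[OF b0(2)]
  let ?G1 = "comp k k x' y A B" and ?G2 = "comp k k x'' y' B D" and ?m = "Suc k"
  show "comp k k x'' (cp k y y') ?G1 D k = comp k k (cp k x' x'') y A ?G2 k"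
    by (auto simp: comp_nth_eq fun_eq_iff)
  let ?P1 = "od k (od k A (tau x')) (tau x'')" and ?P2 = "od k (od k (tau y) B) (tau x'')"
    and ?P3 = "od k (tau (cp k y y')) D"
  note t = ccomp_tails[OF assms(1)]
  note sm = bd_cp_True bd_cp_False cp_in cp_assoc
  note ss = a(1-3,5,6) b(1-3,5,6) c(1-3,5,6) a0(4,5,7) b0(4,5,7)
  have bk: "bd k False (B k False) = bd k False x'" "bd k False (B k False) = bd k True x''"
     "bd k True (B k False) = bd k False y'" "bd k False (A k False) = bd k False x"
     "bd k False (A k False) = bd k True x'" "bd k True (A k False) = bd k False y"
     "bd k True (A k False) = bd k True y'" "bd k False (A k True) = bd k True x"
     "bd k True (D k True) = bd k True y''" "bd k False (D k True) = bd k True x''"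
    using ss by metis+
  note sB = a(1-3) b(1-3) c(1-3) bk a0(4,5) b0(4,5)
  have c1: "cyl ?m (cp k (cp k (A k True) (cp k x x')) x'') (cp k (cp k (cp k y (A k False)) x') x'') ?P1"
    by (rule cyl_od[OF t(1) cyl_tau]) (use sB in \<open>auto simp: sm\<close>)
  have c2: "cyl ?m (cp k (cp k (cp k y (A k False)) x') x'') (cp k (cp k (cp k y y') (B k False)) x'') ?P2"
    by (rule cyl_od[OF t(2) cyl_tau]) (use sB in \<open>auto simp: sm\<close>)
  have c3: "cyl ?m (cp k (cp k (cp k y y') (B k False)) x'') (cp k (cp k y y') (cp k y'' (D k False))) ?P3"
  proof -
    have "cyl ?m (cp k (cp k y y') (cp k (D k True) x'')) (cp k (cp k y y') (cp k y'' (D k False))) ?P3"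
      by (rule cyl_od[OF cyl_tau c(7)]) (use sB in \<open>auto simp: sm\<close>)
    moreover have "cp k (cp k (cp k y y') (B k False)) x'' = cp k (cp k y y') (cp k (B k False) x'')"
      by (rule cp_assoc) (use sB in \<open>auto simp: sm\<close>)
    ultimately show ?thesis using b0(7) by simp
  qed
  have e1: "eqv ?m (od k ?G1 (tau x'')) (con ?m ?P1 ?P2)"
  proof -
    have "eqv ?m (con ?m ?P1 ?P2) (od k (con ?m (od k A (tau x')) (od k (tau y) B)) (con ?m (tau x'') (tau x'')))"
      by (rule con_od[OF t cyl_tau cyl_tau]) (use sB in \<open>auto simp: sm\<close>)
    moreover have "eqv ?m (od k (con ?m (od k A (tau x')) (od k (tau y) B)) (con ?m (tau x'') (tau x''))) (od k ?G1 (tau x''))"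
      unfolding comp_refl by (rule eqv_od[OF eqv_sym[OF gc_tail] con_tau_left[OF cyl_tau]]) (fact c)
    ultimately show ?thesis by (meson eqv_trans eqv_sym)
  qed
  let ?Q2 = "od k (tau y) (od k B (tau x''))" and ?Q3 = "od k (tau y) (od k (tau y') D)"
  note t' = ccomp_tails[OF assms(2)]
  have e2: "eqv ?m (od k (tau y) ?G2) (con ?m ?Q2 ?Q3)"
  proof -
    have "eqv ?m (con ?m ?Q2 ?Q3) (od k (con ?m (tau y) (tau y)) (con ?m (od k B (tau x'')) (od k (tau y') D)))"
      by (rule con_od[OF cyl_tau cyl_tau t']) (use sB b0(7) a0(7)[symmetric] in \<open>auto simp: sm\<close>)
    moreover have "eqv ?m (od k (con ?m (tau y) (tau y)) (con ?m (od k B (tau x'')) (od k (tau y') D))) (od k (tau y) ?G2)"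
      unfolding comp_refl by (rule eqv_od[OF con_tau_left[OF cyl_tau] eqv_sym[OF gc_tail]]) (fact a)
    ultimately show ?thesis by (meson eqv_trans eqv_sym)
  qed
  have r1: "eqv ?m ?P1 (od k A (tau (cp k x' x'')))"
  proof -
    have "eqv ?m ?P1 (od k A (od k (tau x') (tau x'')))"
      by (rule od_assoc_eqv[OF a(7) cyl_tau cyl_tau]) (use sB in \<open>auto simp: sm\<close>)
    moreover have "eqv ?m (od k A (tau (cp k x' x''))) (od k A (od k (tau x') (tau x'')))"
      by (rule eqv_od[OF eqv_refl tau_od]) (use sB in auto)
    ultimately show ?thesis by (meson eqv_trans eqv_sym)
  qed
  have r2: "eqv ?m ?P2 ?Q2"
    by (rule od_assoc_eqv[OF cyl_tau b(7) cyl_tau]) (use sB a0(7)[symmetric] in \<open>auto simp: sm\<close>)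
  have r3: "eqv ?m ?P3 ?Q3"
  proof -
    have "eqv ?m (od k (od k (tau y) (tau y')) D) ?Q3"
      by (rule od_assoc_eqv[OF cyl_tau cyl_tau c(7)]) (use sB b0(7)[symmetric] in \<open>auto simp: sm\<close>)
    moreover have "eqv ?m ?P3 (od k (od k (tau y) (tau y')) D)"
      by (rule eqv_od[OF tau_od eqv_refl]) (use sB in auto)
    ultimately show ?thesis by (meson eqv_trans)
  qed
  have g1: "eqv ?m (comp k k x'' (cp k y y') ?G1 D) (con ?m (od k ?G1 (tau x'')) ?P3)"
    unfolding comp_refl by (rule gc_tail)
  have g2: "con ?m (od k ?G1 (tau x'')) ?P3 = con ?m (con ?m ?P1 ?P2) ?P3"
    by (rule con_cong[OF e1 eqv_refl])
  have g3: "eqv ?m (con ?m (con ?m ?P1 ?P2) ?P3) (con ?m ?P1 (con ?m ?P2 ?P3))"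
    by (rule con_assoc[OF c1 c2 c3])
  have g4: "con ?m ?P1 (con ?m ?P2 ?P3) = con ?m (od k A (tau (cp k x' x''))) (od k (tau y) ?G2)"
    by (rule con_cong[OF r1]) (use e2 con_cong[OF r2 r3] in \<open>simp add: eqv_sym\<close>)
  have g5: "eqv ?m (comp k k (cp k x' x'') y A ?G2) (con ?m (od k A (tau (cp k x' x''))) (od k (tau y) ?G2))"
    unfolding comp_refl by (rule gc_tail)
  show "eqv ?m (comp k k x'' (cp k y y') ?G1 D) (comp k k (cp k x' x'') y A ?G2)"
    by (rule eqv_trans[OF g1[unfolded g2] eqv_trans[OF g3[unfolded g4] eqv_sym[OF g5]]])
qed

lemma comp_assoc:
  assumes "ccomp m k x y A x' y' B" "ccomp m k x' y' B x'' y'' D"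
  shows "eqv m (comp m k x'' (cp k y y') (comp m k x' y A B) D)
      (comp m k (cp k x' x'') y A (comp m k x'' y' B D))"
  using assms
proof (induction "k - m" arbitrary: m x y x' y' x'' y'')
  case 0
  then have "m = k" using ccompD(3)[OF 0(2)] by simp
  with comp_assoc_base 0(2,3) show ?case by blast
next
  case (Suc d)
  have m: "m < k" "d = k - Suc m" using Suc(2) by auto
  note a0 = ccompD[OF Suc(3)] and b0 = ccompD[OF Suc(4)]
  note a = cylD[OF a0(1)] and b = cylD[OF a0(2)] and c = cylD[OF b0(2)]
  have ab: "B m e = A m e" "D m e = A m e" for e using a0(6) b0(6) m by auto
  have h: "comp m k x' y A B m e = A m e" "comp m k x'' y' B D m e = A m e" for e
    using m by (simp_all add: comp_nth_lt ab)
  have n1: "cp m (cp k y y') (A m False) = cp k (cp m y (A m False)) (cp m y' (B m False))"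
    using cp_bd_comp(2)[OF a0(9,11,5) a(3,4) m(1)] a(6) ab by simp
  have n2: "cp m (A m True) (cp k x' x'') = cp k (cp m (B m True) x') (cp m (D m True) x'')"
    using cp_bd_comp(1)[OF a0(10) b0(10) b0(4) b(3,4) m(1)] b(5) ab by simp
  show ?case
  proof (rule eqv_split)
    show "eqv (Suc m) (comp m k x'' (cp k y y') (comp m k x' y A B) D)
      (comp m k (cp k x' x'') y A (comp m k x'' y' B D))"
    proof -
      have L: "comp m k x'' (cp k y y') (comp m k x' y A B) D = comp (Suc m) k (cp m (D m True) x'')
          (cp k (cp m y (A m False)) (cp m y' (B m False))) (comp m k x' y A B) D"
        by (subst comp_Suc[OF m(1)]) (simp only: h n1)
      have R: "comp m k (cp k x' x'') y A (comp m k x'' y' B D) = comp (Suc m) k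
          (cp k (cp m (B m True) x') (cp m (D m True) x'')) (cp m y (A m False)) A (comp m k x'' y' B D)"
        by (subst comp_Suc[OF m(1)]) (simp only: h n2)
      show ?thesis
        using Suc(1)[OF m(2) ccomp_Suc[OF Suc(3) m(1)] ccomp_Suc[OF Suc(4) m(1)]]
        unfolding L R unfolding comp_Suc[OF m(1), of x' y A B] comp_Suc[OF m(1), of x'' y' B D] .
    qed
  qed (auto simp: comp_nth_lt m)
qed

text \<open>Above \<open>k\<close> a composite along \<open>k\<close> is a concatenation of
  whiskered cylinders. Once the whiskers have been moved into the composites along \<open>l\<close>
  by \<open>od_comp\<close>, interchange becomes \<open>con_comp\<close>.\<close>

lemma comp_interchange_base:
  assumes "ccomp k l x y A x' y' A'" "ccomp k l w z B w' z' B'"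
    "ccomp k k x y A w z B" "ccomp k k x' y' A' w' z' B'" "k < l"
  shows "eqv k (comp k k (cp l w w') (cp l y y') (comp k l x' y A A') (comp k l w' z B B'))
      (comp k l (cp k x' w') (cp k y z) (comp k k w y A B) (comp k k w' y' A' B'))"
proof (rule eqv_split)
  note f1 = ccompD[OF assms(1)] and f2 = ccompD[OF assms(2)] and f3 = ccompD[OF assms(3)]
    and f4 = ccompD[OF assms(4)]
  note a = cylD[OF f1(1)] and a' = cylD[OF f1(2)] and b = cylD[OF f2(1)] and b' = cylD[OF f2(2)]
  let ?GA = "comp k l x' y A A'" and ?GB = "comp k l w' z B B'"
  let ?H = "comp k k w y A B" and ?H' = "comp k k w' y' A' B'" and ?m = "Suc k"
  have eq: "A' k e = A k e" "B' k e = B k e" for e using f1(6) f2(6) assms(5) by auto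
  show "comp k k (cp l w w') (cp l y y') ?GA ?GB k = comp k l (cp k x' w') (cp k y z) ?H ?H' k"
    by (auto simp: comp_nth_eq comp_nth_lt assms(5) fun_eq_iff)
  have ml: "?m \<le> l" using assms(5) by simp
  note S = f1(8-11) f2(8-11)
  have kk: "bd k False x = bd k True w" "bd k False x' = bd k True w'"
    "bd k False y = bd k True z" "bd k False y' = bd k True z'" using f3 f4 by auto
  have GA: "?GA = comp ?m l (cp k (A' k True) x') (cp k y (A k False)) A A'"
    and GB: "?GB = comp ?m l (cp k (B' k True) w') (cp k z (B k False)) B B'"
    by (rule comp_Suc[OF assms(5)])+
  note cA = ccomp_Suc[OF assms(1,5)] and cB = ccomp_Suc[OF assms(2,5)]
  have tw: "ccomp ?m l w w (tau w) w' w' (tau w')" by (rule ccomp_tau[OF S(5,7) f2(4) ml])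
  have ty: "ccomp ?m l y y (tau y) y' y' (tau y')" by (rule ccomp_tau[OF S(2,4) f1(5) ml])
  have k1: "bd k False (cp k (A k True) x) = bd k True w" using a kk by (simp add: bd_cp_False)
  have k2: "bd k False y = bd k True (cp k (B k True) w)" using b kk by (simp add: bd_cp_True)
  have e1: "eqv ?m (od k ?GA (tau (cp l w w')))
      (comp ?m l (cp k (cp k (A' k True) x') w') (cp k (cp k y (A k False)) w) (od k A (tau w)) (od k A' (tau w')))"
    unfolding GA
    by (rule eqv_trans[OF eqv_od[OF eqv_refl eqv_sym[OF comp_tau[OF S(5,7) f2(4) ml]]] od_comp[OF cA tw _ k1]]) simp
  have e2: "eqv ?m (od k (tau (cp l y y')) ?GB)
      (comp ?m l (cp k y' (cp k (B' k True) w')) (cp k y (cp k z (B k False))) (od k (tau y) B) (od k (tau y') B'))"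
    unfolding GB
    by (rule eqv_trans[OF eqv_od[OF eqv_sym[OF comp_tau[OF S(2,4) f1(5) ml]] eqv_refl] od_comp[OF ty cB _ k2]]) simp
  have c1: "ccomp ?m l (cp k (cp k (A k True) x) w) (cp k (cp k y (A k False)) w) (od k A (tau w))
      (cp k (cp k (A' k True) x') w') (cp k (cp k y' (A' k False)) w') (od k A' (tau w'))"
    by (rule ccomp_od[OF cA tw _ k1]) simp
  have c2: "ccomp ?m l (cp k y (cp k (B k True) w)) (cp k y (cp k z (B k False))) (od k (tau y) B)
      (cp k y' (cp k (B' k True) w')) (cp k y' (cp k z' (B' k False))) (od k (tau y') B')"
    by (rule ccomp_od[OF ty cB _ k2]) simp
  have g1: "cp k (cp k y (A k False)) w = cp k y (cp k (B k True) w)"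
    unfolding f3(7)[symmetric]
    by (rule cp_assoc) (use a b kk S f3(7) a(5)[of False] in auto)
  have g2: "cp k (cp k y' (A' k False)) w' = cp k y' (cp k (B' k True) w')"
    unfolding f4(7)[symmetric]
    by (rule cp_assoc) (use a' b' kk S f4(7) a'(5)[of False] in auto)
  note cc = con_comp[OF c1[unfolded g1 g2] c2]
  let ?PA = "od k A (tau w)" and ?QB = "od k (tau y) B" and ?PA' = "od k A' (tau w')" and ?QB' = "od k (tau y') B'"
  have "eqv ?m (comp k k (cp l w w') (cp l y y') ?GA ?GB) (con ?m (od k ?GA (tau (cp l w w'))) (od k (tau (cp l y y')) ?GB))"
    unfolding comp_refl by (rule gc_tail)
  also have "con ?m (od k ?GA (tau (cp l w w'))) (od k (tau (cp l y y')) ?GB) =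
      con ?m (comp ?m l (cp k (cp k (A' k True) x') w') (cp k y (cp k (B k True) w)) ?PA ?PA')
        (comp ?m l (cp k y' (cp k (B' k True) w')) (cp k y (cp k z (B k False))) ?QB ?QB')"
    by (rule con_cong[OF e1[unfolded g1] e2])
  finally have 1: "eqv ?m (comp k k (cp l w w') (cp l y y') ?GA ?GB)
    (comp ?m l (cp k (cp k (A' k True) x') w') (cp k y (cp k z (B k False))) (con ?m ?PA ?QB) (con ?m ?PA' ?QB'))"
    using cc eqv_trans by blast
  have "comp k l (cp k x' w') (cp k y z) ?H ?H' =
      comp ?m l (cp k (?H' k True) (cp k x' w')) (cp k (cp k y z) (?H k False)) ?H ?H'"
    by (rule comp_Suc[OF assms(5)])
  moreover have "cp k (?H' k True) (cp k x' w') = cp k (cp k (A' k True) x') w'"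
    using a' b' kk S by (simp add: comp_nth_eq cp_assoc)
  moreover have "cp k (cp k y z) (?H k False) = cp k y (cp k z (B k False))"
    using a b kk S by (simp add: comp_nth_eq cp_assoc)
  ultimately have 2: "comp k l (cp k x' w') (cp k y z) ?H ?H' =
      comp ?m l (cp k (cp k (A' k True) x') w') (cp k y (cp k z (B k False))) ?H ?H'" by simp
  have "eqv ?m (comp ?m l (cp k (cp k (A' k True) x') w') (cp k y (cp k z (B k False))) (con ?m ?PA ?QB) (con ?m ?PA' ?QB'))
     (comp ?m l (cp k (cp k (A' k True) x') w') (cp k y (cp k z (B k False))) ?H ?H')"
    unfolding comp_refl by (rule comp_cong[OF eqv_sym[OF gc_tail] eqv_sym[OF gc_tail] ml])
  then show "eqv ?m (comp k k (cp l w w') (cp l y y') ?GA ?GB) (comp k l (cp k x' w') (cp k y z) ?H ?H')"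
    unfolding 2 by (rule eqv_trans[OF 1])
qed

lemma comp_interchange:
  assumes "ccomp m l x y A x' y' A'" "ccomp m l w z B w' z' B'"
    "ccomp m k x y A w z B" "ccomp m k x' y' A' w' z' B'" "k < l"
  shows "eqv m (comp m k (cp l w w') (cp l y y') (comp m l x' y A A') (comp m l w' z B B'))
      (comp m l (cp k x' w') (cp k y z) (comp m k w y A B) (comp m k w' y' A' B'))"
  using assms(1-4)
proof (induction "k - m" arbitrary: m x y x' y' w z w' z')
  case 0
  then have "m = k" using ccompD(3)[OF 0(4)] by simp
  with comp_interchange_base 0 assms(5) show ?case by blast
next
  case (Suc d)
  have m: "m < k" "d = k - Suc m" "m < l" using Suc(2) assms(5) by auto
  note f1 = ccompD[OF Suc(3)] and f2 = ccompD[OF Suc(4)] and f3 = ccompD[OF Suc(5)]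
    and f4 = ccompD[OF Suc(6)]
  note a = cylD[OF f1(1)] and a' = cylD[OF f1(2)] and b = cylD[OF f2(1)] and b' = cylD[OF f2(2)]
  have eq: "A' m e = A m e" "B m e = A m e" "B' m e = A m e" for e
    using f1(6)[of m e] f2(6)[of m e] f3(6)[of m e] m by auto
  have h: "comp m l x' y A A' m e = A m e" "comp m l w' z B B' m e = A m e"
    "comp m k w y A B m e = A m e" "comp m k w' y' A' B' m e = A m e" for e
    using m by (simp_all add: comp_nth_lt eq)
  have n: "cp m (A m True) (cp l w w') = cp l (cp m (A m True) w) (cp m (A m True) w')"
     "cp m (A m True) (cp k x' w') = cp k (cp m (A m True) x') (cp m (A m True) w')"
     "cp m (cp l y y') (A m False) = cp l (cp m y (A m False)) (cp m y' (A m False))"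
     "cp m (cp k y z) (A m False) = cp k (cp m y (A m False)) (cp m z (A m False))"
    using cp_bd_comp(1)[OF f2(8,10,4) a(3,4) m(3)] cp_bd_comp(1)[OF f4(8,10,4) a(3,4) m(1)]
     cp_bd_comp(2)[OF f1(9,11,5) a(3,4) m(3)] cp_bd_comp(2)[OF f3(9,11,5) a(3,4) m(1)]
     a(6)[of False] b(5)[of True] a'(5)[of True] eq by simp_all
  show ?case
  proof (rule eqv_split)
    note IH = Suc(1)[OF m(2) ccomp_Suc[OF Suc(3) m(3)] ccomp_Suc[OF Suc(4) m(3)]
        ccomp_Suc[OF Suc(5) m(1)] ccomp_Suc[OF Suc(6) m(1)], unfolded eq]
    have "comp m k (cp l w w') (cp l y y') (comp m l x' y A A') (comp m l w' z B B') =
      comp (Suc m) k (cp l (cp m (A m True) w) (cp m (A m True) w')) (cp l (cp m y (A m False)) (cp m y' (A m False)))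
        (comp m l x' y A A') (comp m l w' z B B')"
      by (subst comp_Suc[OF m(1)]) (simp add: h n)
    moreover have "comp m l (cp k x' w') (cp k y z) (comp m k w y A B) (comp m k w' y' A' B') =
      comp (Suc m) l (cp k (cp m (A m True) x') (cp m (A m True) w')) (cp k (cp m y (A m False)) (cp m z (A m False)))
        (comp m k w y A B) (comp m k w' y' A' B')"
      by (subst comp_Suc[OF m(3)]) (simp add: h n)
    ultimately show "eqv (Suc m) (comp m k (cp l w w') (cp l y y') (comp m l x' y A A') (comp m l w' z B B'))
      (comp m l (cp k x' w') (cp k y z) (comp m k w y A B) (comp m k w' y' A' B'))"
      using IH by (simp add: comp_Suc[OF m(1)] comp_Suc[OF m(3)] eq)
  qed (auto simp: comp_nth_lt m h fun_eq_iff)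
qed

section \<open>The omega-category of cylinders\<close>

definition gS :: "('a \<times> 'a \<times> (nat \<Rightarrow> bool \<Rightarrow> 'a)) set" where
  "gS = {(x, y, A). cyl 0 x y A}"

definition gbd :: "nat \<Rightarrow> bool \<Rightarrow> 'a \<times> 'a \<times> (nat \<Rightarrow> bool \<Rightarrow> 'a) \<Rightarrow> 'a \<times> 'a \<times> (nat \<Rightarrow> bool \<Rightarrow> 'a)" where
  "gbd k e = (\<lambda>(x, y, A). (bd k e x, bd k e y, trunc k e A))"

definition gcp :: "nat \<Rightarrow> 'a \<times> 'a \<times> (nat \<Rightarrow> bool \<Rightarrow> 'a) \<Rightarrow> 'a \<times> 'a \<times> (nat \<Rightarrow> bool \<Rightarrow> 'a) \<Rightarrow>
    'a \<times> 'a \<times> (nat \<Rightarrow> bool \<Rightarrow> 'a)" where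
  "gcp k = (\<lambda>(x, y, A) (x', y', B). (cp k x x', cp k y y', comp 0 k x' y A B))"

lemma eqv_0: "eqv 0 A B \<longleftrightarrow> A = B"
  by (auto simp: eqv_def fun_eq_iff)

lemma trunc_eqD:
  assumes "trunc k d A = trunc k d' B"
  shows "j < k \<Longrightarrow> A j e = B j e" "A k d = B k d'"
  using fun_cong[OF fun_cong[OF assms, of j], of e] fun_cong[OF fun_cong[OF assms, of k], of e]
  by (auto simp: trunc_def)

lemma gbd_eqD:
  assumes "(x, y, A) \<in> gS" "(x', y', B) \<in> gS" "gbd k False (x, y, A) = gbd k True (x', y', B)"
  shows "ccomp 0 k x y A x' y' B"
  using assms trunc_eqD[of k False A True B] by (auto simp: gS_def gbd_def ccomp_def)

lemma trunc_trunc: "k < l \<Longrightarrow> trunc k e (trunc l e' A) = trunc k e A"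
    "l \<le> k \<Longrightarrow> trunc k e (trunc l e' A) = trunc l e' A"
  by (auto simp: trunc_def fun_eq_iff)

text \<open>At level 0 every entry of the sequence matters, so \<open>eqv 0\<close> is equality and
  the laws proved up to \<open>eqv\<close> become the axioms.\<close>

lemma oset_gam: "oset gS gbd gcp"
proof
  fix U k e assume "U \<in> gS"
  then show "gbd k e U \<in> gS" by (auto simp: gS_def gbd_def cyl_trunc split: prod.splits)
next
  fix U and k l :: nat and e e' assume "U \<in> gS" "k < l"
  then show "gbd k e (gbd l e' U) = gbd k e U"
    by (auto simp: gS_def gbd_def bd_lt trunc_trunc dest: cylD(1,2) split: prod.splits)
next
  fix U and k l :: nat and e e' assume "U \<in> gS" "l \<le> k"
  then show "gbd k e (gbd l e' U) = gbd l e' U"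
    by (auto simp: gS_def gbd_def bd_ge trunc_trunc dest: cylD(1,2) split: prod.splits)
next
  fix U V k assume U: "U \<in> gS" "V \<in> gS" "gbd k False U = gbd k True V"
  obtain x y A x' y' B where e: "U = (x, y, A)" "V = (x', y', B)" by (cases U, cases V) auto
  note c = gbd_eqD[OF U[unfolded e]]
  note f = ccompD[OF c]
  show "gcp k U V \<in> gS" using cyl_comp_closed[OF c] by (simp add: e gS_def gcp_def)
  have "trunc k False (comp 0 k x' y A B) = trunc k False B"
    using f(6) by (auto simp: trunc_def fun_eq_iff comp_nth_lt comp_nth_eq)
  then show "gbd k False (gcp k U V) = gbd k False V"
    using f by (simp add: e gcp_def gbd_def bd_cp_False)
  have "trunc k True (comp 0 k x' y A B) = trunc k True A"
    by (auto simp: trunc_def fun_eq_iff comp_nth_lt comp_nth_eq)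
  then show "gbd k True (gcp k U V) = gbd k True U"
    using f by (simp add: e gcp_def gbd_def bd_cp_True)
next
  fix U V and k l :: nat and b assume U: "U \<in> gS" "V \<in> gS" "gbd k False U = gbd k True V" and kl: "k < l"
  obtain x y A x' y' B where e: "U = (x, y, A)" "V = (x', y', B)" by (cases U, cases V) auto
  note c = gbd_eqD[OF U[unfolded e]]
  note f = ccompD[OF c]
  show "gbd l b (gcp k U V) = gcp k (gbd l b U) (gbd l b V)"
    using f kl comp_trunc[OF c kl, of b] by (simp add: e gcp_def gbd_def bd_cp eqv_0)
next
  fix U V W k assume U: "U \<in> gS" "V \<in> gS" "W \<in> gS" "gbd k False U = gbd k True V" "gbd k False V = gbd k True W"
  obtain x y A x' y' B x'' y'' D where e: "U = (x, y, A)" "V = (x', y', B)" "W = (x'', y'', D)"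
    by (cases U, cases V, cases W) auto
  note c = gbd_eqD[OF U(1,2,4)[unfolded e]] and d = gbd_eqD[OF U(2,3,5)[unfolded e]]
  note f = ccompD[OF c] ccompD[OF d]
  show "gcp k (gcp k U V) W = gcp k U (gcp k V W)"
    using f comp_assoc[OF c d] by (simp add: e gcp_def eqv_0 cp_assoc)
next
  fix U k assume U: "U \<in> gS"
  obtain x y A where e: "U = (x, y, A)" by (cases U) auto
  have c: "cyl 0 x y A" using U by (simp add: e gS_def)
  show "gcp k U (gbd k False U) = U"
    using comp_unit_right[OF c, of k] cylD(1,2)[OF c] by (simp add: e gcp_def gbd_def eqv_0 cp_unit_right)
  show "gcp k (gbd k True U) U = U"
    using comp_unit_left[OF c, of k] cylD(1,2)[OF c] by (simp add: e gcp_def gbd_def eqv_0 cp_unit_left)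
next
  fix k l :: nat and U U' V V' assume kl: "k < l" and S: "U \<in> gS" "U' \<in> gS" "V \<in> gS" "V' \<in> gS"
    and c: "gbd l False U = gbd l True U'" "gbd l False V = gbd l True V'" "gbd k False U = gbd k True V"
    "gbd k False U' = gbd k True V'"
  obtain x y A x' y' A' w z B w' z' B'
    where e: "U = (x, y, A)" "U' = (x', y', A')" "V = (w, z, B)" "V' = (w', z', B')"
    by (cases U, cases V, cases U', cases V') auto
  note d = gbd_eqD[OF S(1,2) [unfolded e] c(1)[unfolded e]] gbd_eqD[OF S(3,4) [unfolded e] c(2)[unfolded e]]
    gbd_eqD[OF S(1,3) [unfolded e] c(3)[unfolded e]] gbd_eqD[OF S(2,4) [unfolded e] c(4)[unfolded e]]
  note f1 = ccompD[OF d(1)] and f2 = ccompD[OF d(2)] and f3 = ccompD[OF d(3)] and f4 = ccompD[OF d(4)]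
  show "gcp k (gcp l U U') (gcp l V V') = gcp l (gcp k U V) (gcp k U' V')"
    using comp_interchange[OF d kl] interchange[OF kl f1(8,10) f2(8,10) f1(4) f2(4) f3(4) f4(4)]
      interchange[OF kl f1(9,11) f2(9,11) f1(5) f2(5) f3(5) f4(5)]
    by (simp add: e gcp_def eqv_0)
qed

end

text \<open>
  Families of cells of \<open>G\<close> over a cell \<open>x\<close> of \<open>S\<close>, indexed by the fibre \<open>F\<close> of a presheaf over the
  target \<open>0\<close>-cell of \<open>x\<close>, with prescribed \<open>0\<close>-dimensional boundaries \<open>zeta\<close>.  A functor from \<open>S\<close> to
  such families is a functor to \<open>G\<close> from the category of elements of the presheaf.
\<close>

locale oset_family = oset S bd cp + G: oset G gbd gcp
  for S :: "'a set" and bd cp and G :: "'g set" and gbd gcp +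
  fixes pi :: "'g \<Rightarrow> 'a" and F :: "'a \<Rightarrow> 'f set" and pull :: "'a \<Rightarrow> 'f \<Rightarrow> 'f" and zeta :: "'a \<Rightarrow> 'f \<Rightarrow> 'g"
  assumes pi_bd: "a \<in> G \<Longrightarrow> pi (gbd k e a) = bd k e (pi a)"
    and pi_cp: "a \<in> G \<Longrightarrow> b \<in> G \<Longrightarrow> gbd k False a = gbd k True b \<Longrightarrow> pi (gcp k a b) = cp k (pi a) (pi b)"
    and pull_in: "x \<in> S \<Longrightarrow> f \<in> F (bd 0 True x) \<Longrightarrow> pull x f \<in> F (bd 0 False x)"
    and pull_bd: "x \<in> S \<Longrightarrow> f \<in> F (bd 0 True x) \<Longrightarrow> 0 < k \<Longrightarrow> pull (bd k e x) f = pull x f"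
    and pull_bd0: "x \<in> S \<Longrightarrow> f \<in> F (bd 0 e x) \<Longrightarrow> pull (bd 0 e x) f = f"
    and pull_cp0: "x \<in> S \<Longrightarrow> y \<in> S \<Longrightarrow> bd 0 False x = bd 0 True y \<Longrightarrow> f \<in> F (bd 0 True x) \<Longrightarrow>
      pull (cp 0 x y) f = pull y (pull x f)"
    and pull_cp: "x \<in> S \<Longrightarrow> y \<in> S \<Longrightarrow> bd k False x = bd k True y \<Longrightarrow> f \<in> F (bd 0 True x) \<Longrightarrow> 0 < k \<Longrightarrow>
      pull (cp k x y) f = pull x f"
    and zeta_in: "x \<in> S \<Longrightarrow> f \<in> F (bd 0 e x) \<Longrightarrow> zeta (bd 0 e x) f \<in> G"
    and zeta_bd: "x \<in> S \<Longrightarrow> f \<in> F (bd 0 e x) \<Longrightarrow> gbd 0 e' (zeta (bd 0 e x) f) = zeta (bd 0 e x) f"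
    and pi_zeta: "x \<in> S \<Longrightarrow> f \<in> F (bd 0 e x) \<Longrightarrow> pi (zeta (bd 0 e x) f) = bd 0 e x"
begin

section \<open>The omega-category of indexed families\<close>

definition famS :: "('a \<times> ('f \<Rightarrow> 'g)) set" where
  "famS = {(x, p). x \<in> S \<and> p \<in> extensional (F (bd 0 True x)) \<and>
     (\<forall>f\<in>F (bd 0 True x). p f \<in> G \<and> pi (p f) = x \<and> gbd 0 True (p f) = zeta (bd 0 True x) f \<and>
       gbd 0 False (p f) = zeta (bd 0 False x) (pull x f))}"

text \<open>A 0-boundary is indexed by the fibre over that 0-cell, which may differ from the index
  set of \<open>p\<close>; this is why boundaries in dimension 0 are prescribed by
  \<open>zeta\<close>. For \<open>k > 0\<close> the target 0-cell, and with it the fibre, is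
  unchanged.\<close>

definition fambd :: "nat \<Rightarrow> bool \<Rightarrow> 'a \<times> ('f \<Rightarrow> 'g) \<Rightarrow> 'a \<times> ('f \<Rightarrow> 'g)" where
  "fambd k e = (\<lambda>(x, p). (bd k e x, if k = 0 then restrict (zeta (bd 0 e x)) (F (bd 0 e x))
     else restrict (\<lambda>f. gbd k e (p f)) (F (bd 0 True x))))"

text \<open>Along a 0-cell the second family lives over an earlier object and is read at the pulled
  back index; along higher cells both families share one fibre.\<close>

definition famcp :: "nat \<Rightarrow> 'a \<times> ('f \<Rightarrow> 'g) \<Rightarrow> 'a \<times> ('f \<Rightarrow> 'g) \<Rightarrow> 'a \<times> ('f \<Rightarrow> 'g)" where
  "famcp k = (\<lambda>(x, p) (y, q). (cp k x y,
     restrict (\<lambda>f. gcp k (p f) (q (if k = 0 then pull x f else f))) (F (bd 0 True x))))"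

lemma famD:
  assumes "(x, p) \<in> famS"
  shows "x \<in> S" "p \<in> extensional (F (bd 0 True x))" "f \<in> F (bd 0 True x) \<Longrightarrow> p f \<in> G"
    "f \<in> F (bd 0 True x) \<Longrightarrow> pi (p f) = x" "f \<in> F (bd 0 True x) \<Longrightarrow> gbd 0 True (p f) = zeta (bd 0 True x) f"
    "f \<in> F (bd 0 True x) \<Longrightarrow> gbd 0 False (p f) = zeta (bd 0 False x) (pull x f)"
  using assms by (auto simp: famS_def)

lemma restrict_eqD: "restrict f A = restrict g A \<Longrightarrow> a \<in> A \<Longrightarrow> f a = g a"
  by (metis restrict_apply')

lemma fam_composable:
  assumes U: "(x, p) \<in> famS" "(y, q) \<in> famS" "fambd k False (x, p) = fambd k True (y, q)"
    and f: "f \<in> F (bd 0 True x)"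
  defines "f' \<equiv> if k = 0 then pull x f else f"
  shows "bd k False x = bd k True y" "f' \<in> F (bd 0 True y)"
    "gbd k False (p f) = gbd k True (q f')" "0 < k \<Longrightarrow> bd 0 True x = bd 0 True y"
    "0 < k \<Longrightarrow> bd 0 False x = bd 0 False y" "0 < k \<Longrightarrow> pull x f = pull y f"
proof -
  note a = famD[OF U(1)] and b = famD[OF U(2)]
  show xy: "bd k False x = bd k True y" using U(3) by (simp add: fambd_def)
  show e: "bd 0 True x = bd 0 True y" "bd 0 False x = bd 0 False y" if "0 < k"
    using bd_below_eq[OF a(1) b(1) xy that] by auto
  show f': "f' \<in> F (bd 0 True y)"
    using f pull_in[OF a(1) f] xy e(1) by (auto simp: f'_def)
  show "gbd k False (p f) = gbd k True (q f')"
  proof (cases "k = 0")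
    case True
    then show ?thesis using a(6)[OF f] b(5)[OF f'] xy by (simp add: f'_def)
  next
    case False
    then have "restrict (\<lambda>f. gbd k False (p f)) (F (bd 0 True x)) = restrict (\<lambda>f. gbd k True (q f)) (F (bd 0 True y))"
      using U(3) by (simp add: fambd_def)
    moreover have "bd 0 True y = bd 0 True x" using e(1) False by simp
    ultimately show ?thesis using restrict_eqD[OF _ f, of "\<lambda>f. gbd k False (p f)" "\<lambda>f. gbd k True (q f)"] False
      by (simp add: f'_def)
  qed
  show "pull x f = pull y f" if "0 < k"
    using pull_bd[OF a(1) f that, of False] pull_bd[OF b(1) _ that, of f True] f e(1)[OF that] xy by simp
qed

text \<open>Each law is checked index by index in \<open>G\<close>. Work is needed only for
  \<open>k = 0\<close>, where the presheaf laws for \<open>pull\<close> and the prescribed values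
  \<open>zeta\<close> take over.\<close>

lemma oset_fam: "oset famS fambd famcp"
proof
  fix U k e assume "U \<in> famS"
  moreover obtain x p where e: "U = (x, p)" by (cases U)
  ultimately have U: "(x, p) \<in> famS" by simp
  note a = famD[OF U]
  show "fambd k e U \<in> famS"
  proof (cases "k = 0")
    case True
    then show ?thesis using a(1)
      by (auto simp: e fambd_def famS_def bd_ge zeta_in pi_zeta zeta_bd pull_bd0)
  next
    case False
    then show ?thesis using a G.bd_lt
      by (auto simp: e fambd_def famS_def bd_lt pi_bd pull_bd)
  qed
next
  fix U and k l :: nat and e e' assume "U \<in> famS" "k < l"
  moreover obtain x p where e: "U = (x, p)" by (cases U)
  ultimately have U: "(x, p) \<in> famS" and kl: "k < l" by simp_all
  note a = famD[OF U]
  show "fambd k e (fambd l e' U) = fambd k e U"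
    using a kl by (auto simp: e fambd_def bd_lt G.bd_lt fun_eq_iff)
next
  fix U and k l :: nat and e e' assume "U \<in> famS" "l \<le> k"
  moreover obtain x p where e: "U = (x, p)" by (cases U)
  ultimately have U: "(x, p) \<in> famS" and kl: "l \<le> k" by simp_all
  note a = famD[OF U]
  show "fambd k e (fambd l e' U) = fambd l e' U"
  proof (cases "l = 0")
    case True
    have "gbd k e (zeta (bd 0 e' x) f) = zeta (bd 0 e' x) f" if "f \<in> F (bd 0 e' x)" for f
      using zeta_bd[OF a(1) that] zeta_in[OF a(1) that] G.bd_ge[of _ 0 k] by (metis le0)
    then show ?thesis using a kl True by (auto simp: e fambd_def bd_ge fun_eq_iff)
  next
    case False
    then show ?thesis using a kl by (auto simp: e fambd_def bd_lt bd_ge G.bd_ge fun_eq_iff)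
  qed
next
  fix U V k assume UV: "U \<in> famS" "V \<in> famS" "fambd k False U = fambd k True V"
  obtain x p y q where e: "U = (x, p)" "V = (y, q)" by (cases U, cases V) auto
  note a = famD[OF UV(1)[unfolded e]] and b = famD[OF UV(2)[unfolded e]]
  note c = fam_composable[OF UV[unfolded e]]
  have xy: "bd k False x = bd k True y" using UV(3) by (simp add: e fambd_def)
  have t: "bd 0 True (cp k x y) = bd 0 True x" "0 < k \<Longrightarrow> bd 0 False (cp k x y) = bd 0 False x"
    "k = 0 \<Longrightarrow> bd 0 False (cp k x y) = bd 0 False y"
    using a(1) b(1) xy bd_cp_True[of x y 0] bd_cp_below_left[of x y k 0] bd_cp_False[of x y 0]
    by (cases "k = 0"; auto)+
  show "famcp k U V \<in> famS"
  proof (cases "k = 0")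
    case True
    show ?thesis using a b c xy t True
      by (auto simp: e famcp_def famS_def cp_in G.cp_in pi_cp G.bd_cp_True G.bd_cp_False pull_cp0)
  next
    case False
    then show ?thesis using a b c xy t False
      by (auto simp: e famcp_def famS_def cp_in G.cp_in pi_cp G.bd_cp_below_left pull_cp)
  qed
  show "fambd k True (famcp k U V) = fambd k True U"
  proof (cases "k = 0")
    case True
    then show ?thesis using a b xy by (simp add: e famcp_def fambd_def bd_cp_True)
  next
    case False
    then show ?thesis using a b c xy t
      by (auto simp: e famcp_def fambd_def bd_cp_True G.bd_cp_True fun_eq_iff)
  qed
  show "fambd k False (famcp k U V) = fambd k False V"
  proof (cases "k = 0")
    case True
    then show ?thesis using a b xy by (simp add: e famcp_def fambd_def bd_cp_False)
  next
    case False
    have "bd 0 True x = bd 0 True y" by (rule bd_below_eq[OF a(1) b(1) xy]) (use False in simp)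
    then have g: "gbd k False (gcp k (p f) (q f)) = gbd k False (q f)" if "f \<in> F (bd 0 True x)" for f
      using G.bd_cp_False[OF a(3)[OF that] b(3) c(3)[OF that]] c(2)[OF that] False by simp
    then show ?thesis using False t(1) bd_cp_False[OF a(1) b(1) xy] g \<open>bd 0 True x = bd 0 True y\<close>[symmetric]
      by (simp add: e famcp_def fambd_def restrict_def fun_eq_iff)
  qed
next
  fix U V and k l :: nat and d assume UV: "U \<in> famS" "V \<in> famS" "fambd k False U = fambd k True V" and kl: "k < l"
  obtain x p y q where e: "U = (x, p)" "V = (y, q)" by (cases U, cases V) auto
  note a = famD[OF UV(1)[unfolded e]] and b = famD[OF UV(2)[unfolded e]]
  note c = fam_composable[OF UV[unfolded e]]
  have xy: "bd k False x = bd k True y" using UV(3) by (simp add: e fambd_def)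
  have t: "bd 0 True (cp k x y) = bd 0 True x"
    using a(1) b(1) xy bd_cp_True[of x y 0] bd_cp_below_left[of x y k 0] by (cases "k = 0") auto
  show "fambd l d (famcp k U V) = famcp k (fambd l d U) (fambd l d V)"
    using a b c xy t kl by (auto simp: e famcp_def fambd_def bd_cp G.bd_cp bd_lt pull_bd fun_eq_iff)
next
  fix U V W k assume UV: "U \<in> famS" "V \<in> famS" "W \<in> famS" "fambd k False U = fambd k True V"
    "fambd k False V = fambd k True W"
  obtain x p y q z r where e: "U = (x, p)" "V = (y, q)" "W = (z, r)" by (cases U, cases V, cases W) auto
  note a = famD[OF UV(1)[unfolded e]] and b = famD[OF UV(2)[unfolded e]] and b' = famD[OF UV(3)[unfolded e]]
  note c = fam_composable[OF UV(1,2,4)[unfolded e]] and c' = fam_composable[OF UV(2,3,5)[unfolded e]]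
  have xy: "bd k False x = bd k True y" "bd k False y = bd k True z" using UV by (simp_all add: e fambd_def)
  have t: "bd 0 True (cp k x y) = bd 0 True x" "bd 0 True (cp k x (cp k y z)) = bd 0 True x"
    using a(1) b(1) b'(1) xy bd_cp_True[of x y 0] bd_cp_below_left[of x y k 0]
     bd_cp_True[of x "cp k y z" 0] bd_cp_below_left[of x "cp k y z" k 0] cp_in[of y z k] bd_cp_True[of y z k]
    by (cases "k = 0"; auto)+
  show "famcp k (famcp k U V) W = famcp k U (famcp k V W)"
  proof (cases "k = 0")
    case True
    then show ?thesis using a b b' c c' xy t
      by (auto simp: e famcp_def cp_assoc G.cp_assoc pull_cp0 fun_eq_iff)
  next
    case False
    then show ?thesis using a b b' c c' xy t
      by (auto simp: e famcp_def cp_assoc G.cp_assoc pull_cp fun_eq_iff)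
  qed
next
  fix U k assume U: "U \<in> famS"
  obtain x p where e: "U = (x, p)" by (cases U)
  note a = famD[OF U[unfolded e]]
  have px: "restrict p (F (bd 0 True x)) = p" using a(2) by (simp add: extensional_restrict)
  have u: "gcp k (p f) (gbd k False (p f)) = p f" "gcp k (gbd k True (p f)) (p f) = p f" if "f \<in> F (bd 0 True x)" for f
    using a(3)[OF that] by (simp_all add: G.cp_unit_right G.cp_unit_left)
  have r: "gcp 0 (p f) (restrict (zeta (bd 0 False x)) (F (bd 0 False x)) (pull x f)) = p f"
    "gcp 0 (zeta (bd 0 True x) f) (p (pull (bd 0 True x) f)) = p f"
    if "f \<in> F (bd 0 True x)" for f
    using G.cp_unit_right[OF a(3)[OF that], of 0] G.cp_unit_left[OF a(3)[OF that], of 0]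
      a(5,6)[OF that] pull_in[OF a(1) that] pull_bd0[OF a(1) that] that by simp_all
  have "famcp k U (fambd k False U) = (x, restrict p (F (bd 0 True x)))"
    using r(1) u(1) by (cases "k = 0")
      (simp_all add: e famcp_def fambd_def cp_unit_right[OF a(1)] fun_eq_iff del: restrict_apply add: restrict_def[of _ "F (bd 0 True x)"])
  then show "famcp k U (fambd k False U) = U" by (simp add: px e)
  have k0: "bd 0 True (bd k True x) = bd 0 True x"
    using a(1) bd_lt[of x 0 k] bd_ge[of x 0 0] by (cases "k = 0") auto
  have "famcp k (fambd k True U) U = (x, restrict p (F (bd 0 True x)))"
    using r(2) u(2) k0 by (cases "k = 0")
      (simp_all add: e famcp_def fambd_def cp_unit_left[OF a(1)] fun_eq_iff del: restrict_apply add: restrict_def[of _ "F (bd 0 True x)"])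
  then show "famcp k (fambd k True U) U = U" by (simp add: px e)
next
  fix k l :: nat and U U' V V' assume kl: "k < l" and S: "U \<in> famS" "U' \<in> famS" "V \<in> famS" "V' \<in> famS"
    and d: "fambd l False U = fambd l True U'" "fambd l False V = fambd l True V'" "fambd k False U = fambd k True V"
    "fambd k False U' = fambd k True V'"
  obtain x p x' p' y q y' q' where e: "U = (x, p)" "U' = (x', p')" "V = (y, q)" "V' = (y', q')"
    by (cases U, cases V, cases U', cases V') auto
  note a = famD[OF S(1)[unfolded e]] and a' = famD[OF S(2)[unfolded e]] and b = famD[OF S(3)[unfolded e]]
    and b' = famD[OF S(4)[unfolded e]]
  note c1 = fam_composable[OF S(1,2)[unfolded e] d(1)[unfolded e]]
    and c2 = fam_composable[OF S(3,4)[unfolded e] d(2)[unfolded e]]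
    and c3 = fam_composable[OF S(1,3)[unfolded e] d(3)[unfolded e]]
    and c4 = fam_composable[OF S(2,4)[unfolded e] d(4)[unfolded e]]
  have l0: "0 < l" using kl by simp
  have xy: "bd l False x = bd l True x'" "bd l False y = bd l True y'" "bd k False x = bd k True y" 
    "bd k False x' = bd k True y'" using d by (simp_all add: e fambd_def)
  have t: "bd 0 True (cp l x x') = bd 0 True x" "bd 0 True (cp k x y) = bd 0 True x" "bd 0 True x = bd 0 True x'"
    using a(1) b(1) a'(1) xy l0 bd_cp_True[of x y 0] bd_cp_below_left[of x y k 0] bd_cp_below_left[of x x' l 0]
      bd_below_eq[OF a(1) a'(1) xy(1) l0]
    by (cases "k = 0"; auto)+
  show "famcp k (famcp l U U') (famcp l V V') = famcp l (famcp k U V) (famcp k U' V')"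
  proof (rule prod_eqI)
    show "fst (famcp k (famcp l U U') (famcp l V V')) = fst (famcp l (famcp k U V) (famcp k U' V'))"
      using interchange[OF kl a(1) a'(1) b(1) b'(1) xy] by (simp add: e famcp_def)
    show "snd (famcp k (famcp l U U') (famcp l V V')) = snd (famcp l (famcp k U V) (famcp k U' V'))"
    proof
      fix f
      show "snd (famcp k (famcp l U U') (famcp l V V')) f = snd (famcp l (famcp k U V) (famcp k U' V')) f"
      proof (cases "f \<in> F (bd 0 True x)")
        case True
        then have f': "f \<in> F (bd 0 True x')" using t by simp
        define g where "g = (if k = 0 then pull x f else f)"
        have g': "g = (if k = 0 then pull x' f else f)" using c1(6)[OF True l0] by (simp add: g_def)
        have gy: "g \<in> F (bd 0 True y)" "g \<in> F (bd 0 True y')" using c3(2)[OF True] c4(2)[OF f'] g' by (simp_all add: g_def)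
        have pl: "pull (cp l x x') f = pull x f" using pull_cp[OF a(1) a'(1) xy(1) True l0] .
        have "gcp k (gcp l (p f) (p' f)) (gcp l (q g) (q' g)) = gcp l (gcp k (p f) (q g)) (gcp k (p' f) (q' g))"
          by (rule G.interchange[OF kl]) (use True f' gy a b a' b' c1 c2 c3 c4 l0 g' in \<open>auto simp: g_def\<close>)
        moreover have "snd (famcp k (famcp l U U') (famcp l V V')) f = gcp k (gcp l (p f) (p' f)) (gcp l (q g) (q' g))"
          using True gy t l0 pl by (auto simp: e famcp_def g_def)
        moreover have "snd (famcp l (famcp k U V) (famcp k U' V')) f = gcp l (gcp k (p f) (q g)) (gcp k (p' f) (q' g))"
          using True f' t l0 g' by (auto simp: e famcp_def g_def)
        ultimately show ?thesis by simp
      next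
        case False
        then show ?thesis using t by (simp add: e famcp_def)
      qed
    qed
  qed
qed

end

section \<open>From graded to one-sorted \<omega>-categories\<close>

text \<open>An \<open>n\<close>-cell is an element fixed by \<open>bd n False\<close>. Units become
  inclusions of fixed point sets, and elements of infinite dimension belong to no degree.\<close>

definition flat :: "'a set \<Rightarrow> (nat \<Rightarrow> bool \<Rightarrow> 'a \<Rightarrow> 'a) \<Rightarrow> (nat \<Rightarrow> 'a \<Rightarrow> 'a \<Rightarrow> 'a) \<Rightarrow> 'a ocat" where
  "flat S bd cp = \<lparr>cells = (\<lambda>n. {x \<in> S. bd n False x = x}), src = (\<lambda>n. bd n False),
     tgt = (\<lambda>n. bd n True), idn = (\<lambda>n x. x), cmp = (\<lambda>n k. cp k)\<rparr>"

lemma flat_simps [simp]: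
  "cells (flat S bd cp) n = {x \<in> S. bd n False x = x}" "src (flat S bd cp) n = bd n False"
  "tgt (flat S bd cp) n = bd n True" "idn (flat S bd cp) n x = x" "cmp (flat S bd cp) n k = cp k"
  by (simp_all add: flat_def)

lemma idn_at_flat [simp]: "idn_at (flat S bd cp) k n x = x"
  by (induction n) auto

context oset
begin

lemma src_at_flat: "x \<in> S \<Longrightarrow> bd n False x = x \<Longrightarrow> k \<le> n \<Longrightarrow> src_at (flat S bd cp) k n x = bd k False x"
proof (induction n arbitrary: x)
  case (Suc n)
  show ?case
  proof (cases "k = Suc n")
    case False
    then show ?thesis using Suc by (cases "k = n") (auto simp: bd_ge bd_lt)
  qed (use Suc in auto)
qed simp

lemma tgt_at_flat: "x \<in> S \<Longrightarrow> bd n False x = x \<Longrightarrow> k \<le> n \<Longrightarrow> tgt_at (flat S bd cp) k n x = bd k True x"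
proof (induction n arbitrary: x)
  case 0
  then show ?case using bd_cell[of x 0 False 0 True] by simp
next
  case (Suc n)
  show ?case
  proof (cases "k = Suc n")
    case True
    then show ?thesis using Suc.prems bd_cell[of x k False k True] by simp
  next
    case False
    then show ?thesis using Suc by (cases "k = n") (auto simp: bd_ge bd_lt)
  qed
qed

lemma composable_flat:
  "composable (flat S bd cp) n k x y \<longleftrightarrow> k < n \<and> x \<in> S \<and> y \<in> S \<and> bd n False x = x \<and> bd n False y = y \<and>
     bd k False x = bd k True y"
  by (auto simp: composable_def src_at_flat tgt_at_flat)

lemma omega_category_flat: "omega_category (flat S bd cp)"
proof
  fix n k x y assume "composable (flat S bd cp) n k x y"
  then have c: "k < n" "x \<in> S" "y \<in> S" "bd n False x = x" "bd n False y = y" "bd k False x = bd k True y"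
    by (simp_all add: composable_flat)
  then show "cmp (flat S bd cp) n k x y \<in> cells (flat S bd cp) n" by (simp add: cp_in bd_cp)
next
  fix n x assume "x \<in> cells (flat S bd cp) n"
  then show "tgt (flat S bd cp) n (idn (flat S bd cp) n x) = x" using bd_cell[of x n False n True] by simp
next
  fix n k x assume "x \<in> cells (flat S bd cp) n" "k < n"
  then show "cmp (flat S bd cp) n k x (idn_at (flat S bd cp) k n (src_at (flat S bd cp) k n x)) = x"
     "cmp (flat S bd cp) n k (idn_at (flat S bd cp) k n (tgt_at (flat S bd cp) k n x)) x = x"
    by (auto simp: src_at_flat tgt_at_flat cp_unit_right cp_unit_left)
next
  fix n k l x x' y y' assume "k < l" "composable (flat S bd cp) n l x x'" "composable (flat S bd cp) n l y y'"
    "composable (flat S bd cp) n k x y" "composable (flat S bd cp) n k x' y'"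
  then show "cmp (flat S bd cp) n k (cmp (flat S bd cp) n l x x') (cmp (flat S bd cp) n l y y') =
     cmp (flat S bd cp) n l (cmp (flat S bd cp) n k x y) (cmp (flat S bd cp) n k x' y')"
    by (auto simp: composable_flat intro: interchange)
qed (auto simp: composable_flat bd_ge bd_lt bd_cp bd_cp_True bd_cp_False cp_assoc intro: bd_cell)

end

context omega_category
begin

text \<open>A cell is stored as the sequence of its iterated sources, continued beyond its dimension
  by its units; this turns \<open>idn\<close> into an identity. Sequences that never become units
  are the cells of infinite dimension.\<close>

definition seqs :: "(nat \<Rightarrow> 'a) set" where
  "seqs = {\<xi>. \<forall>m. \<xi> m \<in> cells C m \<and> src C m (\<xi> (Suc m)) = \<xi> m}"

text \<open>Source and target agree below dimension \<open>k\<close> by globularity. The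
  \<open>k\<close>-target itself is not an entry of the sequence and is recovered from the entry in
  degree \<open>Suc k\<close>.\<close>

definition rbd :: "nat \<Rightarrow> bool \<Rightarrow> (nat \<Rightarrow> 'a) \<Rightarrow> nat \<Rightarrow> 'a" where
  "rbd k e \<xi> = (\<lambda>m. if m < k then \<xi> m else idn_at C k m (if e then tgt C k (\<xi> (Suc k)) else \<xi> k))"

text \<open>Entries are sources, and the source of a composite is that of its second factor; hence
  the entries up to \<open>k\<close> come from that factor.\<close>

definition rcp :: "nat \<Rightarrow> (nat \<Rightarrow> 'a) \<Rightarrow> (nat \<Rightarrow> 'a) \<Rightarrow> nat \<Rightarrow> 'a" where
  "rcp k \<xi> \<eta> = (\<lambda>m. if m \<le> k then \<eta> m else cmp C m k (\<xi> m) (\<eta> m))"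

definition iota :: "nat \<Rightarrow> 'a \<Rightarrow> nat \<Rightarrow> 'a" where
  "iota n x = (\<lambda>m. if m < n then src_at C m n x else idn_at C n m x)"

lemma src_at_self [simp]: "src_at C n n x = x"
  by (cases n) auto

lemma tgt_at_self [simp]: "tgt_at C n n x = x"
  by (cases n) auto

lemma idn_at_self [simp]: "idn_at C n n x = x"
  by (cases n) auto

lemma seqsD: "\<xi> \<in> seqs \<Longrightarrow> \<xi> m \<in> cells C m" "\<xi> \<in> seqs \<Longrightarrow> src C m (\<xi> (Suc m)) = \<xi> m"
  by (auto simp: seqs_def)

lemma src_at_seq: "\<xi> \<in> seqs \<Longrightarrow> k \<le> n \<Longrightarrow> src_at C k n (\<xi> n) = \<xi> k"
  by (induction n) (auto simp: seqsD le_Suc_eq)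

lemma tgt_at_seq: "\<xi> \<in> seqs \<Longrightarrow> k < n \<Longrightarrow> tgt_at C k n (\<xi> n) = tgt C k (\<xi> (Suc k))"
proof (induction n)
  case (Suc n)
  show ?case
  proof (cases "k = n")
    case False
    with Suc obtain n' where n: "n = Suc n'" "k \<le> n'" by (cases n) auto
    have "tgt C n' (tgt C n (\<xi> (Suc n))) = tgt C n' (\<xi> n)"
      using tgt_tgt[of "\<xi> (Suc n)" n'] Suc.prems n by (simp add: seqsD)
    then show ?thesis using Suc n False by simp
  qed simp
qed simp

lemma idn_at_closed: "y \<in> cells C k \<Longrightarrow> k \<le> n \<Longrightarrow> idn_at C k n y \<in> cells C n"
  by (induction n) (auto simp: idn_closed le_Suc_eq)

lemma idn_at_idn_at: "l \<le> k \<Longrightarrow> k \<le> m \<Longrightarrow> idn_at C k m (idn_at C l k w) = idn_at C l m w"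
  by (induction m) (auto simp: le_Suc_eq)

lemma src_at_idn_at: "a \<in> cells C l \<Longrightarrow> k \<le> l \<Longrightarrow> l \<le> m \<Longrightarrow> src_at C k m (idn_at C l m a) = src_at C k l a"
  by (induction m) (auto simp: le_Suc_eq src_idn idn_at_closed)

lemma tgt_at_idn_at: "a \<in> cells C l \<Longrightarrow> k \<le> l \<Longrightarrow> l \<le> m \<Longrightarrow> tgt_at C k m (idn_at C l m a) = tgt_at C k l a"
  by (induction m) (auto simp: le_Suc_eq tgt_idn idn_at_closed)

lemma composable_idn_at:
  "composable C l k a b \<Longrightarrow> l \<le> m \<Longrightarrow> composable C m k (idn_at C l m a) (idn_at C l m b)"
  by (auto simp: composable_def src_at_idn_at tgt_at_idn_at idn_at_closed)

lemma idn_at_cmp: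
  "composable C l k a b \<Longrightarrow> l \<le> m \<Longrightarrow> idn_at C l m (cmp C l k a b) = cmp C m k (idn_at C l m a) (idn_at C l m b)"
proof (induction m)
  case (Suc m)
  show ?case
  proof (cases "l = Suc m")
    case False
    with Suc show ?thesis using idn_cmp[OF composable_idn_at[OF Suc.prems(1), of m]] by simp
  qed simp
qed simp

lemma tgt_closed_seq: "\<xi> \<in> seqs \<Longrightarrow> tgt C k (\<xi> (Suc k)) \<in> cells C k"
  by (simp add: seqsD tgt_closed)

lemma rbd_in: "\<xi> \<in> seqs \<Longrightarrow> rbd k e \<xi> \<in> seqs"
  unfolding seqs_def
proof (intro CollectI allI)
  fix m assume "\<xi> \<in> {\<xi>. \<forall>m. \<xi> m \<in> cells C m \<and> src C m (\<xi> (Suc m)) = \<xi> m}"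
  then have x: "\<xi> \<in> seqs" by (simp add: seqs_def)
  have s: "k = Suc m \<Longrightarrow> src C m (tgt C k (\<xi> (Suc k))) = \<xi> m"
    using src_src[of "\<xi> (Suc k)" m] x by (simp add: seqsD)
  show "rbd k e \<xi> m \<in> cells C m \<and> src C m (rbd k e \<xi> (Suc m)) = rbd k e \<xi> m"
    using x s tgt_closed_seq[OF x]
    by (cases "Suc m = k") (auto simp: rbd_def seqsD idn_at_closed src_idn)
qed

lemma rbd_composable:
  assumes "\<xi> \<in> seqs" "\<eta> \<in> seqs" "rbd k False \<xi> = rbd k True \<eta>" "k < n"
  shows "composable C n k (\<xi> n) (\<eta> n)"
  using fun_cong[OF assms(3), of k] assms src_at_seq[of \<xi> k n] tgt_at_seq[of \<eta> k n]
  by (simp add: composable_def seqsD rbd_def)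

lemma oset_seqs: "oset seqs rbd rcp"
proof
  show "\<And>x k e. x \<in> seqs \<Longrightarrow> rbd k e x \<in> seqs" by (rule rbd_in)
next
  fix \<xi> and k l :: nat and e e' assume x: "\<xi> \<in> seqs" and kl: "k < l"
  have "l = Suc k \<Longrightarrow> tgt C k (tgt C l (\<xi> (Suc l))) = tgt C k (\<xi> l)"
    using tgt_tgt[of "\<xi> (Suc l)" k] x by (simp add: seqsD)
  then show "rbd k e (rbd l e' \<xi>) = rbd k e \<xi>"
    using kl by (cases "l = Suc k") (auto simp: rbd_def fun_eq_iff)
next
  fix \<xi> and k l :: nat and e e' assume x: "\<xi> \<in> seqs" and kl: "l \<le> k"
  let ?w = "if e' then tgt C l (\<xi> (Suc l)) else \<xi> l"
  have w: "?w \<in> cells C l" using x by (simp add: seqsD tgt_closed_seq)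
  show "rbd k e (rbd l e' \<xi>) = rbd l e' \<xi>"
  proof
    fix m
    have "idn_at C k m (if e then tgt C k (idn_at C l (Suc k) ?w) else idn_at C l k ?w) = idn_at C l m ?w" if "k \<le> m"
      using that kl w by (auto simp: tgt_idn idn_at_closed idn_at_idn_at)
    then show "rbd k e (rbd l e' \<xi>) m = rbd l e' \<xi> m"
      using kl by (auto simp: rbd_def)
  qed
next
  fix \<xi> \<eta> k assume x: "\<xi> \<in> seqs" and y: "\<eta> \<in> seqs" and c: "rbd k False \<xi> = rbd k True \<eta>"
  note cm = rbd_composable[OF x y c]
  have ck: "\<xi> k = tgt C k (\<eta> (Suc k))" using fun_cong[OF c, of k] by (simp add: rbd_def)
  show "rcp k \<xi> \<eta> \<in> seqs"
    unfolding seqs_def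
  proof (intro CollectI allI)
    fix m
    consider "m < k" | "m = k" | "k < m" by linarith
    then show "rcp k \<xi> \<eta> m \<in> cells C m \<and> src C m (rcp k \<xi> \<eta> (Suc m)) = rcp k \<xi> \<eta> m"
    proof cases
      case 2
      then show ?thesis using y src_cmp_top[OF cm[of "Suc k"]] cm[of "Suc k"] x
        by (auto simp: rcp_def seqsD cmp_closed)
    next
      case 3
      then show ?thesis using cm[of m] cm[of "Suc m"] src_cmp[OF cm[of "Suc m"]] x y
        by (auto simp: rcp_def seqsD cmp_closed)
    qed (use y in \<open>simp add: rcp_def seqsD\<close>)
  qed
  show "rbd k False (rcp k \<xi> \<eta>) = rbd k False \<eta>"
    by (auto simp: rbd_def rcp_def fun_eq_iff)
  have "\<And>m. m < k \<Longrightarrow> \<eta> m = \<xi> m" using fun_cong[OF c] by (metis rbd_def)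
  then show "rbd k True (rcp k \<xi> \<eta>) = rbd k True \<xi>"
    using tgt_cmp_top[OF cm[of "Suc k"]] by (auto simp: rbd_def rcp_def fun_eq_iff)
next
  fix \<xi> \<eta> and k l :: nat and e assume x: "\<xi> \<in> seqs" and y: "\<eta> \<in> seqs" and c: "rbd k False \<xi> = rbd k True \<eta>" and kl: "k < l"
  note cm = rbd_composable[OF x y c]
  have sl: "src C l (\<xi> (Suc l)) = \<xi> l" "src C l (\<eta> (Suc l)) = \<eta> l" using x y by (auto simp: seqsD)
  have ct: "composable C l k (tgt C l (\<xi> (Suc l))) (tgt C l (\<eta> (Suc l)))"
  proof -
    obtain l' where l: "l = Suc l'" "k \<le> l'" using kl by (cases l) auto
    have "src_at C k l (tgt C l (\<xi> (Suc l))) = \<xi> k"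
      using l src_src[of "\<xi> (Suc l)" l'] x src_at_seq[of \<xi> k l'] by (simp add: seqsD)
    moreover have "tgt_at C k l (tgt C l (\<eta> (Suc l))) = tgt C k (\<eta> (Suc k))"
      using tgt_at_seq[OF y, of k "Suc l"] kl by simp
    ultimately show ?thesis
      using fun_cong[OF c, of k] kl x y by (simp add: composable_def tgt_closed_seq rbd_def)
  qed
  show "rbd l e (rcp k \<xi> \<eta>) = rcp k (rbd l e \<xi>) (rbd l e \<eta>)"
  proof
    fix m
    show "rbd l e (rcp k \<xi> \<eta>) m = rcp k (rbd l e \<xi>) (rbd l e \<eta>) m"
      using kl idn_at_cmp[OF ct, of m] idn_at_cmp[OF cm[of l], of m] tgt_cmp[OF cm[of "Suc l"]]
      by (auto simp: rbd_def rcp_def)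
  qed
next
  fix \<xi> \<eta> \<zeta> k assume x: "\<xi> \<in> seqs" "\<eta> \<in> seqs" "\<zeta> \<in> seqs" and c: "rbd k False \<xi> = rbd k True \<eta>"
    "rbd k False \<eta> = rbd k True \<zeta>"
  show "rcp k (rcp k \<xi> \<eta>) \<zeta> = rcp k \<xi> (rcp k \<eta> \<zeta>)"
    using cmp_assoc[OF rbd_composable[OF x(1,2) c(1)] rbd_composable[OF x(2,3) c(2)]]
    by (auto simp: rcp_def fun_eq_iff)
next
  fix \<xi> k assume x: "\<xi> \<in> seqs"
  show "rcp k \<xi> (rbd k False \<xi>) = \<xi>"
  proof
    fix m show "rcp k \<xi> (rbd k False \<xi>) m = \<xi> m"
      using cmp_idn_right[of "\<xi> m" m k] x src_at_seq[OF x, of k m] by (auto simp: rcp_def rbd_def seqsD)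
  qed
  show "rcp k (rbd k True \<xi>) \<xi> = \<xi>"
  proof
    fix m show "rcp k (rbd k True \<xi>) \<xi> m = \<xi> m"
      using cmp_idn_left[of "\<xi> m" m k] x tgt_at_seq[OF x, of k m] by (auto simp: rcp_def rbd_def seqsD)
  qed
next
  fix k l :: nat and x x' y y' assume kl: "k < l" and S: "x \<in> seqs" "x' \<in> seqs" "y \<in> seqs" "y' \<in> seqs"
    and c: "rbd l False x = rbd l True x'" "rbd l False y = rbd l True y'" "rbd k False x = rbd k True y"
    "rbd k False x' = rbd k True y'"
  note i = interchange[OF kl rbd_composable[OF S(1,2) c(1)] rbd_composable[OF S(3,4) c(2)]
      rbd_composable[OF S(1,3) c(3)] rbd_composable[OF S(2,4) c(4)]]
  show "rcp k (rcp l x x') (rcp l y y') = rcp l (rcp k x y) (rcp k x' y')"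
    using kl i by (auto simp: rcp_def fun_eq_iff)
qed

lemma src_at_closed: "x \<in> cells C n \<Longrightarrow> k \<le> n \<Longrightarrow> src_at C k n x \<in> cells C k"
  and tgt_at_closed: "x \<in> cells C n \<Longrightarrow> k \<le> n \<Longrightarrow> tgt_at C k n x \<in> cells C k"
  by (induction n arbitrary: x) (auto simp: le_Suc_eq src_closed tgt_closed)

lemma src_src_at: "Suc m \<le> n \<Longrightarrow> src C m (src_at C (Suc m) n x) = src_at C m n x"
  by (induction n arbitrary: x) (auto simp: le_Suc_eq)

lemma iota_in: "x \<in> cells C n \<Longrightarrow> iota n x \<in> seqs"
  unfolding seqs_def
proof (intro CollectI allI)
  fix m assume x: "x \<in> cells C n"
  consider "Suc m < n" | "Suc m = n" | "n \<le> m" by linarith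
  then show "iota n x m \<in> cells C m \<and> src C m (iota n x (Suc m)) = iota n x m"
  proof cases
    case 2
    then show ?thesis using x src_src_at[of m n x] by (auto simp: iota_def src_at_closed)
  qed (use x in \<open>auto simp: iota_def src_at_closed src_src_at idn_at_closed src_idn\<close>)
qed

lemma iota_nth [simp]: "iota n x n = x"
  by (simp add: iota_def)

lemma iota_cell: "x \<in> cells C n \<Longrightarrow> rbd n e (iota n x) = iota n x"
  by (auto simp: rbd_def iota_def fun_eq_iff tgt_idn)

lemma iota_inv: "\<xi> \<in> seqs \<Longrightarrow> rbd n False \<xi> = \<xi> \<Longrightarrow> iota n (\<xi> n) = \<xi>"
proof
  fix m assume x: "\<xi> \<in> seqs" and c: "rbd n False \<xi> = \<xi>"
  show "iota n (\<xi> n) m = \<xi> m"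
    using src_at_seq[OF x, of m n] fun_cong[OF c, of m] by (auto simp: iota_def rbd_def)
qed

lemma cell_eqI: "\<xi> \<in> seqs \<Longrightarrow> \<eta> \<in> seqs \<Longrightarrow> rbd n False \<xi> = \<xi> \<Longrightarrow> rbd n False \<eta> = \<eta> \<Longrightarrow> \<xi> n = \<eta> n \<Longrightarrow> \<xi> = \<eta>"
  by (metis iota_inv)

lemma rbd_nth: "\<xi> \<in> seqs \<Longrightarrow> rbd n e \<xi> n = (if e then tgt C n (\<xi> (Suc n)) else src C n (\<xi> (Suc n)))"
  by (simp add: rbd_def seqsD)

lemma iota_src: "x \<in> cells C (Suc n) \<Longrightarrow> iota n (src C n x) = rbd n False (iota (Suc n) x)"
  by (rule cell_eqI[of _ _ n]) (auto simp: iota_in src_closed rbd_in iota_cell rbd_nth oset.bd_ge[OF oset_seqs])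

lemma iota_tgt: "x \<in> cells C (Suc n) \<Longrightarrow> iota n (tgt C n x) = rbd n True (iota (Suc n) x)"
  by (rule cell_eqI[of _ _ n]) (auto simp: iota_in tgt_closed rbd_in iota_cell rbd_nth oset.bd_ge[OF oset_seqs])

lemma iota_idn_at: "x \<in> cells C n \<Longrightarrow> n \<le> m \<Longrightarrow> iota m (idn_at C n m x) = iota n x"
proof (rule cell_eqI[of _ _ m])
  assume a: "x \<in> cells C n" "n \<le> m"
  show "rbd m False (iota n x) = iota n x"
    by (rule oset.bd_cell[OF oset_seqs iota_in iota_cell]) (use a in auto)
  show "iota m (idn_at C n m x) m = iota n x m" using a by (simp add: iota_def[of n])
qed (auto simp: iota_in idn_at_closed iota_cell)

lemma iota_src_at: "x \<in> cells C n \<Longrightarrow> k \<le> n \<Longrightarrow> iota k (src_at C k n x) = rbd k False (iota n x)"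
proof (rule cell_eqI[of _ _ k])
  assume a: "x \<in> cells C n" "k \<le> n"
  show "iota k (src_at C k n x) k = rbd k False (iota n x) k"
    using a by (cases "k = n") (auto simp: rbd_def iota_def)
qed (auto simp: iota_in src_at_closed rbd_in iota_cell oset.bd_ge[OF oset_seqs])

lemma iota_tgt_at: "x \<in> cells C n \<Longrightarrow> k \<le> n \<Longrightarrow> iota k (tgt_at C k n x) = rbd k True (iota n x)"
proof (rule cell_eqI[of _ _ k])
  assume a: "x \<in> cells C n" "k \<le> n"
  show "iota k (tgt_at C k n x) k = rbd k True (iota n x) k"
  proof (cases "k = n")
    case True
    then show ?thesis using a by (simp add: iota_cell)
  next
    case False
    then show ?thesis using tgt_at_seq[OF iota_in[OF a(1)], of k n] a by (simp add: rbd_def)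
  qed
qed (auto simp: iota_in tgt_at_closed rbd_in iota_cell oset.bd_ge[OF oset_seqs])

lemma composable_iota: "composable C n k x y \<Longrightarrow> rbd k False (iota n x) = rbd k True (iota n y)"
  using iota_src_at[of x n k] iota_tgt_at[of y n k] by (simp add: composable_def)

lemma iota_cmp: "composable C n k x y \<Longrightarrow> iota n (cmp C n k x y) = rcp k (iota n x) (iota n y)"
proof (rule cell_eqI[of _ _ n])
  assume c: "composable C n k x y"
  then have k: "k < n" and x: "x \<in> cells C n" "y \<in> cells C n" by (auto simp: composable_def)
  show "iota n (cmp C n k x y) \<in> seqs" "rbd n False (iota n (cmp C n k x y)) = iota n (cmp C n k x y)"
    using c by (auto simp: iota_in iota_cell cmp_closed)
  show "rcp k (iota n x) (iota n y) \<in> seqs"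
    using oset.cp_in[OF oset_seqs iota_in iota_in composable_iota[OF c]] x by simp
  show "rbd n False (rcp k (iota n x) (iota n y)) = rcp k (iota n x) (iota n y)"
    using oset.bd_cp[OF oset_seqs iota_in iota_in composable_iota[OF c] k] x by (simp add: iota_cell)
  show "iota n (cmp C n k x y) n = rcp k (iota n x) (iota n y) n" using k by (simp add: rcp_def)
qed

end

section \<open>The universal property of a free \<omega>-category\<close>

text \<open>The one-sorted form of a functor out of \<open>below C n\<close>: units need no mention,
  and the side conditions speak of dimension only.\<close>

definition functor_below where
  "functor_below n S bd cp T tb tc F \<longleftrightarrow>
     (\<forall>x\<in>S. (\<exists>m<n. bd m False x = x) \<longrightarrow> F x \<in> T \<and> (\<forall>k e. F (bd k e x) = tb k e (F x))) \<and>
     (\<forall>x\<in>S. \<forall>y\<in>S. \<forall>k. (\<exists>m<n. bd m False x = x \<and> bd m False y = y) \<and> bd k False x = bd k True y \<longrightarrow>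
       F (cp k x y) = tc k (F x) (F y))"

lemma functor_belowD:
  assumes "functor_below n S bd cp T tb tc F" "x \<in> S" "m < n" "bd m False x = x"
  shows "F x \<in> T" "F (bd k e x) = tb k e (F x)"
    "y \<in> S \<Longrightarrow> bd m False y = y \<Longrightarrow> bd k False x = bd k True y \<Longrightarrow> F (cp k x y) = tc k (F x) (F y)"
  using assms unfolding functor_below_def by blast+

lemma src_at_cells_upd [simp]: "src_at (C\<lparr>cells := X\<rparr>) k n x = src_at C k n x"
  by (induction n arbitrary: x) auto

lemma tgt_at_cells_upd [simp]: "tgt_at (C\<lparr>cells := X\<rparr>) k n x = tgt_at C k n x"
  by (induction n arbitrary: x) auto

lemma idn_at_cells_upd [simp]: "idn_at (C\<lparr>cells := X\<rparr>) k n x = idn_at C k n x"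
  by (induction n) auto

lemma below_simps [simp]:
  "src (below C n) = src C" "tgt (below C n) = tgt C" "idn (below C n) = idn C" "cmp (below C n) = cmp C"
  "src_at (below C n) = src_at C" "tgt_at (below C n) = tgt_at C" "idn_at (below C n) = idn_at C"
  by (auto simp: below_def fun_eq_iff)

lemma below_cells: "x \<in> cells (below C n) m \<longleftrightarrow> (\<exists>k\<le>m. k < n \<and> (\<exists>y\<in>cells C k. x = idn_at C k m y))"
  by (simp add: below_def)

context omega_functor
begin

lemma fun_src_at: "x \<in> cells C n \<Longrightarrow> k \<le> n \<Longrightarrow> f k (src_at C k n x) = src_at D k n (f n x)"
  by (induction n arbitrary: x) (auto simp: le_Suc_eq dom.src_closed fun_src)

lemma fun_tgt_at: "x \<in> cells C n \<Longrightarrow> k \<le> n \<Longrightarrow> f k (tgt_at C k n x) = tgt_at D k n (f n x)"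
  by (induction n arbitrary: x) (auto simp: le_Suc_eq dom.tgt_closed fun_tgt)

lemma fun_idn_at: "x \<in> cells C k \<Longrightarrow> k \<le> n \<Longrightarrow> f n (idn_at C k n x) = idn_at D k n (f k x)"
  by (induction n) (auto simp: le_Suc_eq dom.idn_at_closed fun_idn)

lemma fun_composable: "composable C n k x y \<Longrightarrow> composable D n k (f n x) (f n y)"
  by (auto simp: composable_def fun_closed simp flip: fun_src_at fun_tgt_at)

end

lemma omega_functor_comp:
  assumes "omega_functor A B f" "omega_functor B D g"
  shows "omega_functor A D (\<lambda>n. g n \<circ> f n)"
proof -
  interpret f: omega_functor A B f by fact
  interpret g: omega_functor B D g by fact
  show ?thesis
    by unfold_locales
      (auto simp: f.fun_closed g.fun_closed f.fun_src g.fun_src f.fun_tgt g.fun_tgt f.fun_idn g.fun_idn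
        f.fun_cmp g.fun_cmp f.fun_composable)
qed

context omega_category
begin

lemma below_sub: "x \<in> cells (below C n) m \<Longrightarrow> x \<in> cells C m"
  by (auto simp: below_cells idn_at_closed)

lemma below_iota:
  assumes "x \<in> cells (below C n) m"
  shows "iota m x \<in> seqs" "\<exists>k<n. rbd k False (iota m x) = iota m x"
proof -
  obtain k y where "k \<le> m" "k < n" "y \<in> cells C k" "x = idn_at C k m y"
    using assms by (auto simp: below_cells)
  then show "iota m x \<in> seqs" "\<exists>k<n. rbd k False (iota m x) = iota m x"
    by (auto simp: iota_idn_at iota_in iota_cell intro!: exI[of _ k])
qed

lemma below_cells_le: "m < n \<Longrightarrow> cells (below C n) m = cells C m"
proof (intro equalityI subsetI)
  fix x assume "m < n" "x \<in> cells C m"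
  then show "x \<in> cells (below C n) m"
    unfolding below_cells by (intro exI[of _ m] conjI bexI[of _ x]) auto
qed (rule below_sub)

lemma omega_functor_of_functor_below:
  assumes T: "oset T tb tc" and F: "functor_below n seqs rbd rcp T tb tc F" and b: "omega_category (below C n)"
  shows "omega_functor (below C n) (flat T tb tc) (\<lambda>m x. F (iota m x))"
proof -
  interpret T: oset T tb tc by fact
  interpret b: omega_category "below C n" by fact
  interpret fl: omega_category "flat T tb tc" by (rule T.omega_category_flat)
  have bd: "F (iota m x) \<in> T \<and> F (rbd k e (iota m x)) = tb k e (F (iota m x))" if "x \<in> cells (below C n) m" for m x k e
    using below_iota[OF that] functor_belowD[OF F] by blast
  show ?thesis
  proof
    fix m x assume x: "x \<in> cells (below C n) m"
    have "F (iota m x) = tb m False (F (iota m x))"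
      using bd[OF x, of m False] iota_cell[OF below_sub[OF x]] by simp
    then show "F (iota m x) \<in> cells (flat T tb tc) m" using bd[OF x] by simp
    show "F (iota (Suc m) (idn (below C n) m x)) = idn (flat T tb tc) m (F (iota m x))"
      using iota_idn_at[OF below_sub[OF x], of "Suc m"] by simp
  next
    fix m x assume x: "x \<in> cells (below C n) (Suc m)"
    show "F (iota m (src (below C n) m x)) = src (flat T tb tc) m (F (iota (Suc m) x))"
      "F (iota m (tgt (below C n) m x)) = tgt (flat T tb tc) m (F (iota (Suc m) x))"
      using bd[OF x] by (simp_all add: iota_src iota_tgt below_sub[OF x])
  next
    fix m k x y assume c: "composable (below C n) m k x y"
    then have x: "x \<in> cells (below C n) m" "y \<in> cells (below C n) m" by (auto simp: composable_def)
    have c': "composable C m k x y" using c x below_sub by (auto simp: composable_def)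
    obtain k1 k2 where k: "k1 < n" "rbd k1 False (iota m x) = iota m x" "k2 < n" "rbd k2 False (iota m y) = iota m y"
      using below_iota[OF x(1)] below_iota[OF x(2)] by blast
    \<comment> \<open>\<open>functor_below\<close> asks for one dimension that bounds both
      factors.\<close>
    let ?k = "max k1 k2"
    have k': "?k < n" "rbd ?k False (iota m x) = iota m x" "rbd ?k False (iota m y) = iota m y"
      using k oset.bd_cell[OF oset_seqs below_iota(1)[OF x(1)] k(2), of ?k]
       oset.bd_cell[OF oset_seqs below_iota(1)[OF x(2)] k(4), of ?k] by auto
    show "F (iota m (cmp (below C n) m k x y)) = cmp (flat T tb tc) m k (F (iota m x)) (F (iota m y))"
      using functor_belowD(3)[OF F below_iota(1)[OF x(1)] k'(1,2) below_iota(1)[OF x(2)] k'(3) composable_iota[OF c']]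
      by (simp add: iota_cmp[OF c'])
  qed
qed

text \<open>Every cell of dimension at most \<open>N\<close> is an \<open>N\<close>-cell up to
  units, so degree \<open>N\<close> of \<open>r\<close> contains all its values; the values in other
  degrees are the same because \<open>idn\<close> is trivial in \<open>flat\<close>.\<close>

lemma functor_below_of_omega_functor:
  assumes T: "oset T tb tc" and r: "omega_functor (below C (Suc N)) (flat T tb tc) r"
  shows "functor_below (Suc N) seqs rbd rcp T tb tc (\<lambda>\<xi>. r N (\<xi> N))"
    "x \<in> cells (below C (Suc N)) m \<Longrightarrow> r N (iota m x N) = r m x"
proof -
  interpret T: oset T tb tc by fact
  interpret r: omega_functor "below C (Suc N)" "flat T tb tc" r by fact
  interpret R: oset seqs rbd rcp by (rule oset_seqs)
  have cN: "cells (below C (Suc N)) m = cells C m" if "m \<le> N" for m using below_cells_le[of m "Suc N"] that by simp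
  have rt: "r N x \<in> T \<and> tb N False (r N x) = r N x" if "x \<in> cells C N" for x
    using r.fun_closed[of x N] that cN[of N] by simp
  have ri: "r m (idn_at C k m y) = r k y" if "y \<in> cells C k" "k \<le> N" "k \<le> m" for y k m
    using r.fun_idn_at[of y k m] that cN[of k] by simp
  have bdN: "r N (rbd k e \<xi> N) = tb k e (r N (\<xi> N))" if x: "\<xi> \<in> seqs" "rbd N False \<xi> = \<xi>" for \<xi> k e
  proof (cases "k < N")
    case True
    have t: "r N (\<xi> N) \<in> T" "tb N False (r N (\<xi> N)) = r N (\<xi> N)" using rt[of "\<xi> N"] seqsD(1)[OF x(1)] by auto
    have "r k (src_at C k N (\<xi> N)) = tb k False (r N (\<xi> N))" "r k (tgt_at C k N (\<xi> N)) = tb k True (r N (\<xi> N))"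
      using r.fun_src_at[of "\<xi> N" N k] r.fun_tgt_at[of "\<xi> N" N k] True cN[of N] seqsD(1)[OF x(1)]
        T.src_at_flat[OF t, of k] T.tgt_at_flat[OF t, of k] by auto
    then show ?thesis
      using True x ri[of _ k N] src_at_seq[OF x(1), of k N] tgt_at_seq[OF x(1) True]
      by (auto simp: rbd_def seqsD tgt_closed_seq)
  next
    case False
    then show ?thesis using R.bd_cell[OF x, of k] T.bd_cell[of "r N (\<xi> N)" N False k] rt[of "\<xi> N"] x
      by (auto simp: seqsD)
  qed
  have up: "rbd N False x = x" if "x \<in> seqs" "m < Suc N" "rbd m False x = x" for x m
    using R.bd_cell[OF that(1,3)] that(2) by simp
  show "functor_below (Suc N) seqs rbd rcp T tb tc (\<lambda>\<xi>. r N (\<xi> N))"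
    unfolding functor_below_def
  proof (intro conjI ballI allI impI)
    fix x assume x: "x \<in> seqs" "\<exists>m<Suc N. rbd m False x = x"
    then have xN: "rbd N False x = x" using up by blast
    show "r N (x N) \<in> T" using rt x by (simp add: seqsD)
    show "r N (rbd k e x N) = tb k e (r N (x N))" for k e by (rule bdN[OF x(1) xN])
  next
    fix x y k assume x: "x \<in> seqs" "y \<in> seqs" and h: "(\<exists>m<Suc N. rbd m False x = x \<and> rbd m False y = y) \<and> rbd k False x = rbd k True y"
    then have xN: "rbd N False x = x" "rbd N False y = y" using up by blast+
    show "r N (rcp k x y N) = tc k (r N (x N)) (r N (y N))"
    proof (cases "k < N")
      case True
      have "composable (below C (Suc N)) N k (x N) (y N)"
        using rbd_composable[OF x _ True] h cN[of N] by (simp add: composable_def)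
      from r.fun_cmp[OF this] show ?thesis using True by (simp add: rcp_def)
    next
      case False
      \<comment> \<open>For \<open>k\<close> at least the dimension the \<open>k\<close>-boundaries
        are the cells themselves, so composability is equality.\<close>
      then have e: "x = y" using h R.bd_cell[OF x(1) xN(1), of k False] R.bd_cell[OF x(2) xN(2), of k True] by simp
      have "rcp k x x = x" using R.cp_cell_self[OF x(1) xN(1)] False by simp
      moreover have "tc k (r N (y N)) (r N (y N)) = r N (y N)"
        using T.cp_cell_self[of "r N (y N)" N False k] rt[of "y N"] x False by (simp add: seqsD)
      ultimately show ?thesis using e by simp
    qed
  qed
  show "r N (iota m x N) = r m x" if x: "x \<in> cells (below C (Suc N)) m"
  proof (cases "m \<le> N")
    case True
    then show ?thesis using ri[of x m N] below_sub[OF x] by (cases "m = N") (auto simp: iota_def)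
  next
    case False
    then obtain k y where k: "k \<le> N" "k \<le> m" "y \<in> cells C k" "x = idn_at C k m y"
      using x by (auto simp: below_cells less_Suc_eq_le)
    have "iota m x N = idn_at C k N y" using k iota_idn_at[of y k m] by (auto simp: iota_def[of k])
    then show ?thesis using k ri[of y k N] ri[of y k m] by simp
  qed
qed

end

text \<open>
  A pair of functions \<open>a, b : nat \<Rightarrow> 'a \<Rightarrow> 't\<close> generates a sub-\<omega>-category of \<open>T\<close> whose cells are
  values of terms, and terms can be coded as lists; so \<open>T\<close> may be replaced by an isomorphic
  \<omega>-category with cells in \<open>'a test\<close>.
\<close>

datatype 'a tm = LA nat 'a | LB nat 'a | Bd nat bool "'a tm" | Cm nat "'a tm" "'a tm"

primrec enc :: "'a tm \<Rightarrow> ('a + nat) list" where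
  "enc (LA m z) = [Inr 0, Inr m, Inl z]"
| "enc (LB m z) = [Inr 1, Inr m, Inl z]"
| "enc (Bd k e t) = Inr 2 # Inr k # Inr (if e then 1 else 0) # enc t"
| "enc (Cm k t t') = Inr 3 # Inr k # enc t @ enc t'"

text \<open>The leading tag fixes how many parts follow, so the code is prefix-free; the arbitrary
  remainders make the induction work for the two arguments of \<open>Cm\<close>.\<close>

lemma enc_append_inj: "enc t @ r = enc t' @ r' \<Longrightarrow> t = t' \<and> r = r'"
proof (induction t arbitrary: t' r r')
  case (LA m z)
  then show ?case by (cases t') auto
next
  case (LB m z)
  then show ?case by (cases t') auto
next
  case (Bd k e t)
  from Bd.prems obtain t1 where t': "t' = Bd k e t1" "enc t @ r = enc t1 @ r'"
    by (cases t') (auto split: if_splits)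
  with Bd.IH[OF t'(2)] show ?case by simp
next
  case (Cm k t1 t2)
  from Cm.prems obtain t1' t2' where t': "t' = Cm k t1' t2'" "enc t1 @ (enc t2 @ r) = enc t1' @ (enc t2' @ r')"
    by (cases t') auto
  from Cm.IH(1)[OF t'(2)] have "t1 = t1'" "enc t2 @ r = enc t2' @ r'" by auto
  with Cm.IH(2) t' show ?case by blast
qed

lemma enc_inj: "enc t = enc t' \<Longrightarrow> t = t'"
  using enc_append_inj[of t "[]" t' "[]"] by simp

primrec ev :: "(nat \<Rightarrow> 'a \<Rightarrow> 't) \<Rightarrow> (nat \<Rightarrow> 'a \<Rightarrow> 't) \<Rightarrow> (nat \<Rightarrow> bool \<Rightarrow> 't \<Rightarrow> 't) \<Rightarrow> (nat \<Rightarrow> 't \<Rightarrow> 't \<Rightarrow> 't) \<Rightarrow> 'a tm \<Rightarrow> 't" where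
  "ev a b tb tc (LA m z) = a m z"
| "ev a b tb tc (LB m z) = b m z"
| "ev a b tb tc (Bd k e t) = tb k e (ev a b tb tc t)"
| "ev a b tb tc (Cm k t t') = tc k (ev a b tb tc t) (ev a b tb tc t')"

lemma oset_sub:
  assumes "oset T tb tc" "U \<subseteq> T" "\<And>x k e. x \<in> U \<Longrightarrow> tb k e x \<in> U"
    and "\<And>x y k. x \<in> U \<Longrightarrow> y \<in> U \<Longrightarrow> tb k False x = tb k True y \<Longrightarrow> tc k x y \<in> U"
  shows "oset U tb tc"
proof -
  interpret T: oset T tb tc by fact
  show ?thesis
    by unfold_locales
      (use assms(2-4) in \<open>auto simp: T.bd_lt T.bd_ge T.bd_cp_False T.bd_cp_True T.bd_cp T.cp_assoc
          T.cp_unit_right T.cp_unit_left subset_iff intro!: T.interchange\<close>)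
qed

lemma oset_transport:
  assumes "oset U tb tc" "inj_on c U"
  defines "d \<equiv> inv_into U c"
  shows "oset (c ` U) (\<lambda>k e w. c (tb k e (d w))) (\<lambda>k w w'. c (tc k (d w) (d w')))"
proof -
  interpret T: oset U tb tc by fact
  have d [simp]: "d (c x) = x" if "x \<in> U" for x using assms that by simp
  have c [simp]: "c x = c y \<longleftrightarrow> x = y" if "x \<in> U" "y \<in> U" for x y using assms(2) that by (auto dest: inj_onD)
  show ?thesis
    by unfold_locales
      (auto simp: T.bd_lt T.bd_ge T.bd_cp_False T.bd_cp_True T.bd_cp T.cp_assoc T.cp_in
          T.cp_unit_right T.cp_unit_left intro!: arg_cong[of _ _ c] T.interchange)
qed

lemma coded_sub:
  fixes a b :: "nat \<Rightarrow> 'a \<Rightarrow> 't"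
  assumes T: "oset T tb tc"
  obtains U and c :: "'t \<Rightarrow> 'a test" where "oset U tb tc" "U \<subseteq> T" "inj_on c U"
    "\<And>m z. a m z \<in> T \<Longrightarrow> a m z \<in> U" "\<And>m z. b m z \<in> T \<Longrightarrow> b m z \<in> U"
proof
  interpret T: oset T tb tc by fact
  let ?ev = "ev a b tb tc"
  let ?U = "{z \<in> T. \<exists>t. z = ?ev t}"
  show "oset ?U tb tc"
  proof (rule oset_sub[OF T])
    fix x k e assume "x \<in> ?U"
    then obtain t where "x \<in> T" "x = ?ev t" by blast
    then show "tb k e x \<in> ?U" by (auto intro!: exI[of _ "Bd k e t"])
  next
    fix x y k assume "x \<in> ?U" "y \<in> ?U" and k: "tb k False x = tb k True y"
    then obtain t t' where "x \<in> T" "x = ?ev t" "y \<in> T" "y = ?ev t'" by blast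
    then show "tc k x y \<in> ?U" using k by (auto intro!: exI[of _ "Cm k t t'"] T.cp_in)
  qed auto
  show "?U \<subseteq> T" by blast
  \<comment> \<open>A code is a singleton because elements of \<open>'a test\<close> are sets of
    lists; evaluating the chosen term gives the cell back.\<close>
  show "inj_on (\<lambda>z. {enc (SOME t. ?ev t = z)}) ?U"
  proof (rule inj_onI)
    fix x y assume xy: "x \<in> ?U" "y \<in> ?U" and e: "{enc (SOME t. ?ev t = x)} = {enc (SOME t. ?ev t = y)}"
    obtain t t' where t: "?ev t = x" "?ev t' = y" using xy by auto
    have "enc (SOME t. ?ev t = x) = enc (SOME t. ?ev t = y)" using e by simp
    then have s: "(SOME t. ?ev t = x) = (SOME t. ?ev t = y)" by (rule enc_inj)
    have "x = ?ev (SOME t. ?ev t = x)" by (rule someI[of "\<lambda>t. ?ev t = x", OF t(1), symmetric])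
    also have "\<dots> = ?ev (SOME t. ?ev t = y)" by (simp only: s)
    also have "\<dots> = y" by (rule someI[of "\<lambda>t. ?ev t = y", OF t(2)])
    finally show "x = y" .
  qed
  show "a m z \<in> ?U" if "a m z \<in> T" for m z using that by (auto intro!: exI[of _ "LA m z"])
  show "b m z \<in> ?U" if "b m z \<in> T" for m z using that by (auto intro!: exI[of _ "LB m z"])
qed

section \<open>Extension, uniqueness and induction over generators\<close>

locale basis = omega_category C for C :: "'a ocat" +
  fixes Sig :: "nat \<Rightarrow> 'a set"
  assumes Sig_sub: "Sig n \<subseteq> cells C n"
    and push: "pushout_square TYPE('a test)
          (coproduct (Sig n) (\<lambda>_. sphere n)) (coproduct (Sig n) (\<lambda>_. globe n))
          (below C n) (below C (Suc n)) (\<lambda>m z. z)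
          (\<lambda>m (x, z). pair_map C n (src C (n - 1) x) (tgt C (n - 1) x) m z)
          (\<lambda>m (x, z). cell_map C n x m z) (\<lambda>m z. z)"

lemma coproduct_globe_cells:
  "(x, j, b) \<in> cells (coproduct I (\<lambda>_. globe n)) m \<longleftrightarrow> x \<in> I \<and> j \<le> m \<and> (j < n \<or> j = n \<and> b)"
  by (auto simp: coproduct_def globe_def globular_def)

lemma coproduct_sphere_cells:
  "(x, j, b) \<in> cells (coproduct I (\<lambda>_. sphere n)) m \<longleftrightarrow> x \<in> I \<and> j \<le> m \<and> j < n"
  by (auto simp: coproduct_def sphere_def globular_def)

lemma coproduct_globe_src_at:
  "j \<le> m \<Longrightarrow> k \<le> m \<Longrightarrow> src_at (coproduct I (\<lambda>_. globe n)) k m (x, j, b) = (x, if k < j then (k, False) else (j, b))"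
proof (induction m arbitrary: j b)
  case (Suc m)
  then show ?case by (cases "k = Suc m"; cases "j = Suc m") (auto simp: coproduct_def globe_def globular_def)
qed simp

lemma coproduct_globe_tgt_at:
  "j \<le> m \<Longrightarrow> k \<le> m \<Longrightarrow> tgt_at (coproduct I (\<lambda>_. globe n)) k m (x, j, b) = (x, if k < j then (k, True) else (j, b))"
proof (induction m arbitrary: j b)
  case (Suc m)
  then show ?case by (cases "k = Suc m"; cases "j = Suc m") (auto simp: coproduct_def globe_def globular_def)
qed simp

text \<open>If two cells of a globe are \<open>k\<close>-composable, then one is a
  \<open>k\<close>-boundary of the other or they are equal; these are the three cases of the
  composition law.\<close>

lemma (in oset) classifying_functor:
  assumes B: "omega_category (coproduct I (\<lambda>_. globe n))"
    and y: "\<And>x. x \<in> I \<Longrightarrow> y x \<in> S \<and> bd n False (y x) = y x"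
  shows "omega_functor (coproduct I (\<lambda>_. globe n)) (flat S bd cp) (\<lambda>m (x, j, b). bd j b (y x))"
proof -
  interpret B: omega_category "coproduct I (\<lambda>_. globe n)" by fact
  interpret fl: omega_category "flat S bd cp" by (rule omega_category_flat)
  let ?B = "coproduct I (\<lambda>_. globe n)"
  show ?thesis
  proof
    fix m z assume "z \<in> cells ?B m"
    then obtain x j b where z: "z = (x, j, b)" "x \<in> I" "j \<le> m" by (cases z) (auto simp: coproduct_globe_cells)
    then show "(case z of (x, j, b) \<Rightarrow> bd j b (y x)) \<in> cells (flat S bd cp) m"
      using y[of x] by (simp add: bd_ge)
    show "(case idn ?B m z of (x, j, b) \<Rightarrow> bd j b (y x)) = idn (flat S bd cp) m (case z of (x, j, b) \<Rightarrow> bd j b (y x))"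
      by (simp add: z coproduct_def globe_def globular_def)
  next
    fix m z assume "z \<in> cells ?B (Suc m)"
    then obtain x j b where z: "z = (x, j, b)" "x \<in> I" "j \<le> Suc m" by (cases z) (auto simp: coproduct_globe_cells)
    show "(case src ?B m z of (x, j, b) \<Rightarrow> bd j b (y x)) = src (flat S bd cp) m (case z of (x, j, b) \<Rightarrow> bd j b (y x))"
      "(case tgt ?B m z of (x, j, b) \<Rightarrow> bd j b (y x)) = tgt (flat S bd cp) m (case z of (x, j, b) \<Rightarrow> bd j b (y x))"
      using z y[of x] by (auto simp: coproduct_def globe_def globular_def bd_lt bd_ge)
  next
    fix m k z w assume c: "composable ?B m k z w"
    obtain x j b x' j' b' where zw: "z = (x, j, b)" "w = (x', j', b')" by (cases z, cases w) auto
    have k: "k < m" and zz: "x \<in> I" "j \<le> m" "x' \<in> I" "j' \<le> m"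
      using c by (auto simp: composable_def zw coproduct_globe_cells)
    have e: "x' = x" "(if k < j then (k, False) else (j, b)) = (if k < j' then (k, True) else (j', b'))"
      using c k zz coproduct_globe_src_at[of j m k I n x b] coproduct_globe_tgt_at[of j' m k I n x' b']
      by (auto simp: composable_def zw)
    have yx: "y x \<in> S" using y zz by blast
    have "cp k (bd j b (y x)) (bd j' b' (y x)) = (if j \<le> k then bd j' b' (y x) else bd j b (y x))"
    proof (cases "k < j")
      case True
      then have "j' = k" "b' = False" using e(2) by (auto split: if_splits)
      then show ?thesis using True cp_unit_right[of "bd j b (y x)" k] yx by (simp add: bd_lt)
    next
      case False
      show ?thesis
      proof (cases "k < j'")
        case True
        then have "j = k" "b = True" using e(2) False by (auto split: if_splits)
        then show ?thesis using True cp_unit_left[of "bd j' b' (y x)" k] yx by (simp add: bd_lt)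
      next
        case nk: False
        then have "j = j'" "b = b'" using e(2) False by auto
        then show ?thesis using False cp_cell_self[of "bd j b (y x)" j b k] yx by (simp add: bd_ge)
      qed
    qed
    then show "(case cmp ?B m k z w of (x, j, b) \<Rightarrow> bd j b (y x)) =
       cmp (flat S bd cp) m k (case z of (x, j, b) \<Rightarrow> bd j b (y x)) (case w of (x, j, b) \<Rightarrow> bd j b (y x))"
      by (simp add: zw e(1) coproduct_def globe_def globular_def)
  qed
qed

lemma functor_below_comp:
  assumes "functor_below n S bd cp U tb tc F" "\<And>x. x \<in> U \<Longrightarrow> c x \<in> V" "\<And>x k e. x \<in> U \<Longrightarrow> c (tb k e x) = vb k e (c x)"
    and "\<And>x y k. x \<in> U \<Longrightarrow> y \<in> U \<Longrightarrow> tb k False x = tb k True y \<Longrightarrow> c (tc k x y) = vc k (c x) (c y)"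
  shows "functor_below n S bd cp V vb vc (\<lambda>x. c (F x))"
  unfolding functor_below_def
proof (intro conjI ballI allI impI)
  fix x assume x: "x \<in> S" "\<exists>m<n. bd m False x = x"
  then have f: "F x \<in> U" "\<And>k e. F (bd k e x) = tb k e (F x)" using functor_belowD[OF assms(1)] by blast+
  show "c (F x) \<in> V" using assms(2) f by blast
  show "c (F (bd k e x)) = vb k e (c (F x))" for k e using assms(3) f by simp
next
  fix x y k assume x: "x \<in> S" "y \<in> S" and h: "(\<exists>m<n. bd m False x = x \<and> bd m False y = y) \<and> bd k False x = bd k True y"
  then obtain m where m: "m < n" "bd m False x = x" "bd m False y = y" by blast
  note fx = functor_belowD[OF assms(1) x(1) m(1,2)] and fy = functor_belowD[OF assms(1) x(2) m(1,3)]
  have "F (cp k x y) = tc k (F x) (F y)" using fx(3)[OF x(2) m(3)] h by blast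
  moreover have "tb k False (F x) = tb k True (F y)" using h fx(2)[of k False] fy(2)[of k True] by simp
  ultimately show "c (F (cp k x y)) = vc k (c (F x)) (c (F y))" using assms(4)[OF fx(1) fy(1)] by simp
qed

lemma functor_below_cong_target:
  assumes "functor_below n S bd cp T tb tc F" "U \<subseteq> T" "\<And>x m. x \<in> S \<Longrightarrow> m < n \<Longrightarrow> bd m False x = x \<Longrightarrow> F x \<in> U"
  shows "functor_below n S bd cp U tb tc F"
  using assms unfolding functor_below_def by blast

context basis
begin

lemma push_functors:
  "omega_functor (coproduct (Sig n) (\<lambda>_. globe n)) (below C (Suc n)) (\<lambda>m (x, z). cell_map C n x m z)"
  "omega_functor (below C n) (below C (Suc n)) (\<lambda>m z. z)"
  "fun_agree (coproduct (Sig n) (\<lambda>_. sphere n)) (\<lambda>m. (\<lambda>(x, z). cell_map C n x m z) \<circ> (\<lambda>z. z))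
     (\<lambda>m. (\<lambda>z. z) \<circ> (\<lambda>(x, z). pair_map C n (src C (n - 1) x) (tgt C (n - 1) x) m z))"
  using push[of n] unfolding pushout_square_def by blast+

lemma push_universal:
  fixes E :: "'a test ocat"
  assumes "omega_functor (coproduct (Sig n) (\<lambda>_. globe n)) E p" "omega_functor (below C n) E q"
    "fun_agree (coproduct (Sig n) (\<lambda>_. sphere n)) (\<lambda>m. p m \<circ> (\<lambda>z. z))
       (\<lambda>m. q m \<circ> (\<lambda>(x, z). pair_map C n (src C (n - 1) x) (tgt C (n - 1) x) m z))"
  shows "\<exists>r. omega_functor (below C (Suc n)) E r \<and>
     fun_agree (coproduct (Sig n) (\<lambda>_. globe n)) (\<lambda>m. r m \<circ> (\<lambda>(x, z). cell_map C n x m z)) p \<and>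
     fun_agree (below C n) (\<lambda>m. r m \<circ> (\<lambda>z. z)) q \<and>
     (\<forall>r'. omega_functor (below C (Suc n)) E r' \<and>
        fun_agree (coproduct (Sig n) (\<lambda>_. globe n)) (\<lambda>m. r' m \<circ> (\<lambda>(x, z). cell_map C n x m z)) p \<and>
        fun_agree (below C n) (\<lambda>m. r' m \<circ> (\<lambda>z. z)) q \<longrightarrow> fun_agree (below C (Suc n)) r' r)"
  using push[of n] assms unfolding pushout_square_def by blast

lemma below_category: "omega_category (below C n)"
  using push_functors(2)[of n] by (auto simp: omega_functor_def)

lemma globes_category: "omega_category (coproduct (Sig n) (\<lambda>_. globe n))"
  using push_functors(1)[of n] by (auto simp: omega_functor_def)

text \<open>In sequence form both classifying maps give boundaries of the generator, so that
  compatibility of a cocone becomes a condition on \<open>rbd\<close>.\<close>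

lemma iota_pair_map:
  assumes "x \<in> Sig n" "j \<le> m" "j < n"
  shows "iota m (pair_map C n (src C (n - 1) x) (tgt C (n - 1) x) m (j, b)) = rbd j b (iota n x)"
    "iota m (cell_map C n x m (j, b)) = rbd j b (iota n x)"
proof -
  obtain n' where n: "n = Suc n'" "j \<le> n'" using assms(3) by (cases n) auto
  have x: "x \<in> cells C n" using assms Sig_sub by blast
  have e: "pair_map C n (src C (n - 1) x) (tgt C (n - 1) x) m (j, b) =
     idn_at C j m (if b then tgt_at C j n x else src_at C j n x)"
    using n by (simp add: pair_map_def)
  have "iota m (idn_at C j m (if b then tgt_at C j n x else src_at C j n x)) = rbd j b (iota n x)"
    using iota_src_at[OF x, of j] iota_tgt_at[OF x, of j] assms iota_idn_at[OF src_at_closed[OF x, of j] assms(2)]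
      iota_idn_at[OF tgt_at_closed[OF x, of j] assms(2)] by simp
  then show "iota m (pair_map C n (src C (n - 1) x) (tgt C (n - 1) x) m (j, b)) = rbd j b (iota n x)"
    "iota m (cell_map C n x m (j, b)) = rbd j b (iota n x)"
    by (simp_all only: e cell_map_def prod.case)
qed

lemma below_cells_bd:
  "\<xi> \<in> seqs \<Longrightarrow> rbd m False \<xi> = \<xi> \<Longrightarrow> m < n \<Longrightarrow> \<xi> m \<in> cells (below C n) m \<and> iota m (\<xi> m) = \<xi>"
  by (simp add: below_cells_le seqsD iota_inv)

text \<open>The pushout is tested only against cells in \<open>'a test\<close>, while
  \<open>T\<close> is arbitrary. So the part of \<open>T\<close> generated by the given values is
  replaced by a coded copy, the cocone is formed there, and the induced functor is decoded.\<close>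

theorem extend_functor:
  fixes T :: "'t set"
  assumes T: "oset T tb tc" and F: "functor_below n seqs rbd rcp T tb tc F"
    and y: "\<And>x. x \<in> Sig n \<Longrightarrow> y x \<in> T" "\<And>x. x \<in> Sig n \<Longrightarrow> tb n False (y x) = y x"
    and ybd: "\<And>x k e. x \<in> Sig n \<Longrightarrow> k < n \<Longrightarrow> tb k e (y x) = F (rbd k e (iota n x))"
  shows "\<exists>F'. functor_below (Suc n) seqs rbd rcp T tb tc F' \<and>
    (\<forall>\<xi> m. \<xi> \<in> seqs \<longrightarrow> m < n \<longrightarrow> rbd m False \<xi> = \<xi> \<longrightarrow> F' \<xi> = F \<xi>) \<and> (\<forall>x\<in>Sig n. F' (iota n x) = y x)"
proof -
  interpret T: oset T tb tc by fact
  obtain U and c :: "'t \<Rightarrow> 'a test" where U: "oset U tb tc" "U \<subseteq> T" "inj_on c U"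
    and aU: "\<And>m z. F (iota m z) \<in> T \<Longrightarrow> F (iota m z) \<in> U" and bU: "\<And>m::nat. \<And>z. y z \<in> T \<Longrightarrow> y z \<in> U"
    using coded_sub[OF T, of "\<lambda>m z. F (iota m z)" "\<lambda>m. y"] by metis
  interpret U: oset U tb tc by fact
  define d where "d = inv_into U c"
  define vb vc where v: "vb = (\<lambda>k e w. c (tb k e (d w)))" "vc = (\<lambda>k w w'. c (tc k (d w) (d w')))"
  have d [simp]: "d (c x) = x" if "x \<in> U" for x using U(3) that by (simp add: d_def)
  have V: "oset (c ` U) vb vc" unfolding v d_def by (rule oset_transport[OF U(1,3)])
  interpret V: oset "c ` U" vb vc by fact
  have FU: "F \<xi> \<in> U" if "\<xi> \<in> seqs" "m < n" "rbd m False \<xi> = \<xi>" for \<xi> m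
    using aU[of m "\<xi> m"] functor_belowD(1)[OF F that] iota_inv[OF that(1,3)] by simp
  have FU': "functor_below n seqs rbd rcp U tb tc F" by (rule functor_below_cong_target[OF F U(2) FU])
  have FV: "functor_below n seqs rbd rcp (c ` U) vb vc (\<lambda>x. c (F x))"
    by (rule functor_below_comp[OF FU']) (auto simp: v)
  let ?E = "flat (c ` U) vb vc"
  let ?p = "\<lambda>m::nat. \<lambda>(x, j, b). vb j b (c (y x))" and ?q = "\<lambda>m x. c (F (iota m x))"
  have yU: "y x \<in> U" "tb n False (y x) = y x" if "x \<in> Sig n" for x using bU y that by auto
  have p: "omega_functor (coproduct (Sig n) (\<lambda>_. globe n)) ?E ?p"
    by (rule V.classifying_functor[OF globes_category]) (use yU in \<open>auto simp: v\<close>)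
  have q: "omega_functor (below C n) ?E ?q"
    by (rule omega_functor_of_functor_below[OF V FV below_category])
  have "?p m (x, j, b) = ?q m (pair_map C n (src C (n - 1) x) (tgt C (n - 1) x) m (j, b))"
    if "x \<in> Sig n" "j \<le> m" "j < n" for m x j b
    using iota_pair_map[OF that] ybd[OF that(1,3)] yU[OF that(1)] by (simp add: v)
  then have "fun_agree (coproduct (Sig n) (\<lambda>_. sphere n)) (\<lambda>m. ?p m \<circ> (\<lambda>z. z))
       (\<lambda>m. ?q m \<circ> (\<lambda>(x, z). pair_map C n (src C (n - 1) x) (tgt C (n - 1) x) m z))"
    unfolding fun_agree_def by (auto simp: coproduct_sphere_cells)
  from push_universal[OF p q this] obtain r where r: "omega_functor (below C (Suc n)) ?E r"
     "fun_agree (coproduct (Sig n) (\<lambda>_. globe n)) (\<lambda>m. r m \<circ> (\<lambda>(x, z). cell_map C n x m z)) ?p"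
     "fun_agree (below C n) (\<lambda>m. r m \<circ> (\<lambda>z. z)) ?q" by blast
  note G = functor_below_of_omega_functor[OF V r(1)]
  define F' where "F' = (\<lambda>\<xi>. d (r n (\<xi> n)))"
  have "functor_below (Suc n) seqs rbd rcp U tb tc F'"
    unfolding F'_def by (rule functor_below_comp[OF G(1)]) (auto simp: v U.cp_in inj_on_eq_iff[OF U(3)])
  then have "functor_below (Suc n) seqs rbd rcp T tb tc F'"
    by (rule functor_below_comp[where c = "\<lambda>x. x"]) (use U(2) in auto)
  moreover have "F' \<xi> = F \<xi>" if h: "\<xi> \<in> seqs" "m < n" "rbd m False \<xi> = \<xi>" for \<xi> m
  proof -
    have b: "\<xi> m \<in> cells (below C n) m" "iota m (\<xi> m) = \<xi>" using below_cells_bd h by auto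
    then have b': "\<xi> m \<in> cells (below C (Suc n)) m" using h(2) by (simp add: below_cells_le)
    have "r n (\<xi> n) = r m (\<xi> m)" using G(2)[OF b'] b(2) by simp
    also have "\<dots> = c (F \<xi>)" using r(3) b unfolding fun_agree_def by (metis comp_apply)
    finally show ?thesis using FU[OF h] by (simp add: F'_def)
  qed
  moreover have "F' (iota n x) = y x" if x: "x \<in> Sig n" for x
  proof -
    have "(x, n, True) \<in> cells (coproduct (Sig n) (\<lambda>_. globe n)) n" using x by (simp add: coproduct_globe_cells)
    from r(2)[unfolded fun_agree_def, rule_format, OF this]
    have "r n x = vb n True (c (y x))" by (simp add: cell_map_def)
    also have "\<dots> = c (y x)" using yU[OF x] U.bd_cell[of "y x" n False n True] by (simp add: v)
    finally show ?thesis using yU[OF x] by (simp add: F'_def)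
  qed
  ultimately show ?thesis by blast
qed

text \<open>Both functors take values in one coded copy, generated by the values of the two
  together, and induce the same cocone on it.\<close>

theorem functor_unique:
  fixes T :: "'t set"
  assumes T: "oset T tb tc" and F: "functor_below (Suc n) seqs rbd rcp T tb tc F" "functor_below (Suc n) seqs rbd rcp T tb tc F'"
    and agree: "\<And>\<xi> m. \<xi> \<in> seqs \<Longrightarrow> m < n \<Longrightarrow> rbd m False \<xi> = \<xi> \<Longrightarrow> F' \<xi> = F \<xi>"
      "\<And>x. x \<in> Sig n \<Longrightarrow> F' (iota n x) = F (iota n x)"
    and x: "\<xi> \<in> seqs" "rbd n False \<xi> = \<xi>"
  shows "F' \<xi> = F \<xi>"
proof -
  interpret T: oset T tb tc by fact
  obtain U and c :: "'t \<Rightarrow> 'a test" where U: "oset U tb tc" "U \<subseteq> T" "inj_on c U"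
    and aU: "\<And>m z. F (iota m z) \<in> T \<Longrightarrow> F (iota m z) \<in> U" and bU: "\<And>m z. F' (iota m z) \<in> T \<Longrightarrow> F' (iota m z) \<in> U"
    using coded_sub[OF T, of "\<lambda>m z. F (iota m z)" "\<lambda>m z. F' (iota m z)"] by metis
  define d where "d = inv_into U c"
  define vb vc where v: "vb = (\<lambda>k e w. c (tb k e (d w)))" "vc = (\<lambda>k w w'. c (tc k (d w) (d w')))"
  have d [simp]: "d (c x) = x" if "x \<in> U" for x using U(3) that by (simp add: d_def)
  have V: "oset (c ` U) vb vc" unfolding v d_def by (rule oset_transport[OF U(1,3)])
  have FU: "F \<xi> \<in> U" "F' \<xi> \<in> U" if "\<xi> \<in> seqs" "m < Suc n" "rbd m False \<xi> = \<xi>" for \<xi> m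
    using aU[of m "\<xi> m"] bU[of m "\<xi> m"] functor_belowD(1)[OF F(1) that] functor_belowD(1)[OF F(2) that] iota_inv[OF that(1,3)] by simp_all
  have FV: "functor_below (Suc n) seqs rbd rcp (c ` U) vb vc (\<lambda>x. c (F x))" "functor_below (Suc n) seqs rbd rcp (c ` U) vb vc (\<lambda>x. c (F' x))"
    by (rule functor_below_comp[OF functor_below_cong_target[OF F(1) U(2) FU(1)]], auto simp: v)
      (rule functor_below_comp[OF functor_below_cong_target[OF F(2) U(2) FU(2)]], auto simp: v)
  let ?E = "flat (c ` U) vb vc"
  let ?r = "\<lambda>m x. c (F (iota m x))" and ?r' = "\<lambda>m x. c (F' (iota m x))"
  have r: "omega_functor (below C (Suc n)) ?E ?r" and r': "omega_functor (below C (Suc n)) ?E ?r'"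
    by (rule omega_functor_of_functor_below[OF V FV(1) below_category], rule omega_functor_of_functor_below[OF V FV(2) below_category])
  let ?h = "\<lambda>m (x, z). cell_map C n x m z"
  have p: "omega_functor (coproduct (Sig n) (\<lambda>_. globe n)) ?E (\<lambda>m. ?r m \<circ> ?h m)"
    by (rule omega_functor_comp[OF push_functors(1) r])
  have q: "omega_functor (below C n) ?E (\<lambda>m. ?r m \<circ> (\<lambda>z. z))"
    by (rule omega_functor_comp[OF push_functors(2) r])
  have "fun_agree (coproduct (Sig n) (\<lambda>_. sphere n)) (\<lambda>m. (?r m \<circ> ?h m) \<circ> (\<lambda>z. z))
       (\<lambda>m. (?r m \<circ> (\<lambda>z. z)) \<circ> (\<lambda>(x, z). pair_map C n (src C (n - 1) x) (tgt C (n - 1) x) m z))"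
    using push_functors(3)[of n] unfolding fun_agree_def by (auto simp: o_def)
  from push_universal[OF p q this] obtain r0 where
    r0: "\<And>r'. omega_functor (below C (Suc n)) ?E r' \<Longrightarrow>
        fun_agree (coproduct (Sig n) (\<lambda>_. globe n)) (\<lambda>m. r' m \<circ> ?h m) (\<lambda>m. ?r m \<circ> ?h m) \<Longrightarrow>
        fun_agree (below C n) (\<lambda>m. r' m \<circ> (\<lambda>z. z)) (\<lambda>m. ?r m \<circ> (\<lambda>z. z)) \<Longrightarrow> fun_agree (below C (Suc n)) r' r0"
    by blast
  have "F' (iota m (cell_map C n x m (j, b))) = F (iota m (cell_map C n x m (j, b)))"
    if h: "x \<in> Sig n" "j \<le> m" "j < n \<or> j = n \<and> b" for m x j b
  proof (cases "j < n")
    case True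
    have "rbd j b (iota n x) \<in> seqs" "rbd j False (rbd j b (iota n x)) = rbd j b (iota n x)"
      using h Sig_sub[of n] iota_in[of x n] oset.bd_ge[OF oset_seqs] by (auto simp: rbd_in)
    then show ?thesis using iota_pair_map(2)[OF h(1,2) True, of b] agree(1) True by simp
  next
    case False
    then have "cell_map C n x m (j, b) = idn_at C n m x" "n \<le> m" using h by (auto simp: cell_map_def)
    then show ?thesis using agree(2)[OF h(1)] iota_idn_at[of x n m] h(1) Sig_sub[of n] by auto
  qed
  then have h1: "fun_agree (coproduct (Sig n) (\<lambda>_. globe n)) (\<lambda>m. ?r' m \<circ> ?h m) (\<lambda>m. ?r m \<circ> ?h m)"
    unfolding fun_agree_def by (auto simp: coproduct_globe_cells)
  have h2: "fun_agree (below C n) (\<lambda>m. ?r' m \<circ> (\<lambda>z. z)) (\<lambda>m. ?r m \<circ> (\<lambda>z. z))"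
    unfolding fun_agree_def using below_iota agree(1) by (metis comp_apply)
  have "fun_agree (below C (Suc n)) ?r r0" "fun_agree (below C (Suc n)) ?r' r0"
    using r0[OF r] r0[OF r' h1 h2] by (auto simp: fun_agree_def)
  then have "c (F' (iota n (\<xi> n))) = c (F (iota n (\<xi> n)))"
    using x by (simp add: fun_agree_def below_cells_le seqsD)
  then show ?thesis using iota_inv[OF x] FU[OF x(1) _ x(2)] inj_onD[OF U(3)] by simp
qed

text \<open>The cells with property \<open>Q\<close> form an omega-category \<open>?T\<close>
  containing the lower cells and the generators. Extending the inclusion of lower cells to a functor
  into \<open>?T\<close>, uniqueness shows that this functor is the identity, so every cell lies in
  \<open>?T\<close>.\<close>

theorem cell_induct:
  assumes x: "\<xi> \<in> seqs" "rbd n False \<xi> = \<xi>"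
    and low: "\<And>\<xi> m. \<xi> \<in> seqs \<Longrightarrow> m < n \<Longrightarrow> rbd m False \<xi> = \<xi> \<Longrightarrow> Q \<xi>"
    and gen: "\<And>x. x \<in> Sig n \<Longrightarrow> Q (iota n x)"
    and cmp: "\<And>x y k. x \<in> seqs \<Longrightarrow> y \<in> seqs \<Longrightarrow> rbd n False x = x \<Longrightarrow> rbd n False y = y \<Longrightarrow> k < n \<Longrightarrow>
      rbd k False x = rbd k True y \<Longrightarrow> Q x \<Longrightarrow> Q y \<Longrightarrow> Q (rcp k x y)"
  shows "Q \<xi>"
proof -
  interpret R: oset seqs rbd rcp by (rule oset_seqs)
  let ?T = "{x \<in> seqs. rbd n False x = x \<and> Q x}"
  have T: "oset ?T rbd rcp"
  proof (rule oset_sub[OF oset_seqs])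
    fix x k e assume "x \<in> ?T"
    then have xx: "x \<in> seqs" "rbd n False x = x" "Q x" by auto
    show "rbd k e x \<in> ?T"
    proof (cases "k < n")
      case True
      then show ?thesis using xx low[of "rbd k e x" k] by (auto simp: R.bd_ge)
    next
      case False
      then show ?thesis using xx R.bd_cell[OF xx(1,2), of k e] by simp
    qed
  next
    fix x y k assume "x \<in> ?T" "y \<in> ?T" and h: "rbd k False x = rbd k True y"
    then have xx: "x \<in> seqs" "rbd n False x = x" "Q x" "y \<in> seqs" "rbd n False y = y" "Q y" by auto
    show "rcp k x y \<in> ?T"
    proof (cases "k < n")
      case True
      then show ?thesis using xx cmp[OF xx(1,4,2,5) True h] h by (auto simp: R.cp_in R.bd_cp)
    next
      case False
      then have "x = y" using R.bd_cell[OF xx(1,2), of k False] R.bd_cell[OF xx(4,5), of k True] h by simp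
      then show ?thesis using xx R.cp_cell_self[OF xx(1,2), of k] False by simp
    qed
  qed auto
  have id: "functor_below m seqs rbd rcp seqs rbd rcp (\<lambda>x. x)" for m by (auto simp: functor_below_def)
  have "functor_below n seqs rbd rcp ?T rbd rcp (\<lambda>x. x)"
  proof (rule functor_below_cong_target[OF id])
    fix x m assume m: "x \<in> seqs" "m < n" "rbd m False x = x"
    have "rbd n False x = x" by (rule R.bd_cell[OF m(1,3)]) (use m(2) in simp)
    then show "x \<in> ?T" using m low by blast
  qed auto
  then have "\<exists>F'. functor_below (Suc n) seqs rbd rcp ?T rbd rcp F' \<and>
    (\<forall>\<xi> m. \<xi> \<in> seqs \<longrightarrow> m < n \<longrightarrow> rbd m False \<xi> = \<xi> \<longrightarrow> F' \<xi> = \<xi>) \<and> (\<forall>x\<in>Sig n. F' (iota n x) = iota n x)"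
    by (rule extend_functor[OF T]) (use gen subsetD[OF Sig_sub] in \<open>auto simp: iota_in iota_cell\<close>)
  then obtain F' where
    F': "functor_below (Suc n) seqs rbd rcp ?T rbd rcp F'"
    "\<And>\<xi> m. \<xi> \<in> seqs \<Longrightarrow> m < n \<Longrightarrow> rbd m False \<xi> = \<xi> \<Longrightarrow> F' \<xi> = \<xi>"
    "\<And>x. x \<in> Sig n \<Longrightarrow> F' (iota n x) = iota n x"
    by blast
  have F2: "functor_below (Suc n) seqs rbd rcp seqs rbd rcp F'"
    by (rule functor_below_comp[OF F'(1), where c = "\<lambda>x. x"]) auto
  have "F' \<xi> = \<xi>"
    by (rule functor_unique[OF oset_seqs id F2 F'(2,3) x])
  then show ?thesis using functor_belowD(1)[OF F'(1) x(1) _ x(2)] by simp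
qed

end

section \<open>Free resolutions of the constant functor\<close>

text \<open>The conditions involve a map in degree \<open>k\<close> alone; the last two say that it
  is onto and one-to-one on cycles modulo boundaries.\<close>

lemma homology_isoI:
  fixes G :: "nat \<Rightarrow> 'a monoid" and G' :: "nat \<Rightarrow> 'b monoid"
  assumes G: "\<And>n. comm_group (G n)" "\<And>n. comm_group (G' n)"
    and d: "\<And>n. d n \<in> hom (G (Suc n)) (G n)" "\<And>n. d' n \<in> hom (G' (Suc n)) (G' n)"
    and dd: "\<And>n x. x \<in> carrier (G (Suc (Suc n))) \<Longrightarrow> d n (d (Suc n) x) = \<one>\<^bsub>G n\<^esub>"
      "\<And>n x. x \<in> carrier (G' (Suc (Suc n))) \<Longrightarrow> d' n (d' (Suc n) x) = \<one>\<^bsub>G' n\<^esub>"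
    and h: "h \<in> hom (G k) (G' k)"
    and cyc: "\<And>z. z \<in> cycles G d k \<Longrightarrow> h z \<in> cycles G' d' k"
    and bnd: "\<And>x. x \<in> carrier (G (Suc k)) \<Longrightarrow> h (d k x) \<in> d' k ` carrier (G' (Suc k))"
    and surj: "\<And>z'. z' \<in> cycles G' d' k \<Longrightarrow> \<exists>z\<in>cycles G d k. \<exists>b\<in>d' k ` carrier (G' (Suc k)). z' = b \<otimes>\<^bsub>G' k\<^esub> h z"
    and inj: "\<And>z. z \<in> cycles G d k \<Longrightarrow> h z \<in> d' k ` carrier (G' (Suc k)) \<Longrightarrow> z \<in> d k ` carrier (G (Suc k))"
  shows "chain_homology G d k \<cong> chain_homology G' d' k"
proof -
  have grp: "group (G n)" "group (G' n)" for n using G by (auto simp: comm_group_def)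
  have gh: "group_hom (G (Suc n)) (G n) (d n)" "group_hom (G' (Suc n)) (G' n) (d' n)" for n
    using grp d by (auto simp: group_hom_def group_hom_axioms_def)
  have Z: "subgroup (cycles G d k) (G k)" "subgroup (cycles G' d' k) (G' k)"
    using group_hom.subgroup_kernel[OF gh(1)] group_hom.subgroup_kernel[OF gh(2)] group.subgroup_self[OF grp(1)] group.subgroup_self[OF grp(2)]
    by (auto simp: cycles_def split: nat.split)
  let ?B = "d k ` carrier (G (Suc k))" and ?B' = "d' k ` carrier (G' (Suc k))"
  have B: "subgroup ?B (G k)" "subgroup ?B' (G' k)"
    using group_hom.img_is_subgroup[OF gh(1)] group_hom.img_is_subgroup[OF gh(2)] by auto
  have BZ: "?B \<subseteq> cycles G d k" "?B' \<subseteq> cycles G' d' k"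
    using dd hom_in_carrier[OF d(1)] hom_in_carrier[OF d(2)] by (auto simp: cycles_def kernel_def split: nat.split)
  let ?H = "subgroup_generated (G k) (cycles G d k)" and ?H' = "subgroup_generated (G' k) (cycles G' d' k)"
  have cH: "carrier ?H = cycles G d k" "carrier ?H' = cycles G' d' k"
    using subgroup.carrier_subgroup_generated_subgroup[OF Z(1)] subgroup.carrier_subgroup_generated_subgroup[OF Z(2)]
    by auto
  have gH: "group ?H" "comm_group ?H'"
    using group.group_subgroup_generated[OF grp(1)] group.abelian_subgroup_generated[OF grp(2) G(2)] by auto
  interpret H': comm_group ?H' by fact
  have B': "subgroup ?B' ?H'"
    using B(2) BZ(2) group.subgroup_subgroup_generated_iff[OF grp(2)] Z(2) cH(2) by simp
  interpret N: normal ?B' ?H' by (rule H'.subgroup_imp_normal[OF B'])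
  have hZ: "h \<in> hom ?H ?H'"
    using h cyc Z[THEN subgroup.subset] by (auto simp: hom_def cH subset_iff)
  let ?f = "\<lambda>z. ?B' #>\<^bsub>?H'\<^esub> h z"
  have f: "?f \<in> hom ?H (?H' Mod ?B')"
    using hom_compose[OF hZ N.r_coset_hom_Mod] by (simp add: o_def)
  interpret F: group_hom ?H "?H' Mod ?B'" ?f
    by (simp add: group_hom_def group_hom_axioms_def gH f N.factorgroup_is_group)
  have "?f ` carrier ?H = carrier (?H' Mod ?B')"
  proof
    show "?f ` carrier ?H \<subseteq> carrier (?H' Mod ?B')" using F.hom_closed by blast
    show "carrier (?H' Mod ?B') \<subseteq> ?f ` carrier ?H"
    proof
      fix X assume "X \<in> carrier (?H' Mod ?B')"
      then obtain z' where z': "z' \<in> cycles G' d' k" "X = ?B' #>\<^bsub>?H'\<^esub> z'"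
        by (auto simp: FactGroup_def RCOSETS_def cH)
      then obtain z b where zb: "z \<in> cycles G d k" "b \<in> ?B'" "z' = b \<otimes>\<^bsub>G' k\<^esub> h z" using surj by blast
      have "h z \<in> carrier ?H'" using cyc zb by (simp add: cH)
      moreover have "z' \<in> ?B' #>\<^bsub>?H'\<^esub> h z" using zb by (auto simp: r_coset_def)
      ultimately have "?B' #>\<^bsub>?H'\<^esub> h z = ?B' #>\<^bsub>?H'\<^esub> z'"
        using H'.repr_independence[OF _ _ B'] by blast
      then show "X \<in> ?f ` carrier ?H" using z' zb cH by auto
    qed
  qed
  note iso = F.FactGroup_iso[OF this]
  have "kernel ?H (?H' Mod ?B') ?f = ?B"
  proof -
    have "?f z = ?B' \<longleftrightarrow> h z \<in> ?B'" if "z \<in> cycles G d k" for z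
      using H'.coset_join1[OF _ _ B'] H'.coset_join2[OF _ B'] cyc[OF that] N.subset by (auto simp: cH)
    then have "kernel ?H (?H' Mod ?B') ?f = {z \<in> cycles G d k. h z \<in> ?B'}"
      unfolding kernel_def cH by (auto simp only: one_FactGroup)
    also have "\<dots> = ?B" using BZ bnd inj by blast
    finally show ?thesis .
  qed
  with iso show ?thesis by (simp add: chain_homology_def)
qed

lemma frag_add_eq: "frag_extend (\<lambda>i. a i + b i) m = frag_extend a m + frag_extend b m"
  by (simp add: frag_extend_def frag_cmul_distrib2 sum.distrib)

lemma frag_diff_eq: "frag_extend (\<lambda>i. a i - b i) m = frag_extend a m - frag_extend b m"
proof -
  have "frag_extend (\<lambda>i. a i - b i) m + frag_extend b m = frag_extend a m"
    by (simp add: frag_add_eq[symmetric])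
  then show ?thesis by (simp add: eq_diff_eq)
qed

lemma frag_extend_frag_extend: "frag_extend f (frag_extend g m) = frag_extend (\<lambda>i. frag_extend f (g i)) m"
  by (rule frag_induction[of m UNIV]) (auto simp: frag_extend_diff)

lemma frag_extend_zero: "frag_extend (\<lambda>i. 0) m = 0"
  by (rule frag_extend_eq_0) simp

lemma frag_extend_in:
  assumes "Poly_Mapping.keys m \<subseteq> A" "\<And>i. i \<in> A \<Longrightarrow> Poly_Mapping.keys (f i) \<subseteq> B"
  shows "Poly_Mapping.keys (frag_extend f m) \<subseteq> B"
  using keys_frag_extend[of f m] assms by blast

context omega_category
begin

text \<open>
  The free left module on generators \<open>i\<close> located at objects \<open>loc i\<close>: its value at \<open>c\<close> has the
  basis of all \<open>(i, f)\<close> with \<open>f : loc i \<rightarrow> c\<close>, and \<open>act g\<close> is the action of an arrow \<open>g\<close>.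
\<close>

definition Fr :: "'i set \<Rightarrow> ('i \<Rightarrow> 'a) \<Rightarrow> 'a \<Rightarrow> ('i \<times> 'a \<Rightarrow>\<^sub>0 int) set" where
  "Fr I loc c = {m. Poly_Mapping.keys m \<subseteq> {(i, f). i \<in> I \<and> f \<in> cells C 1 \<and> src C 0 f = loc i \<and> tgt C 0 f = c}}"

definition act :: "'a \<Rightarrow> ('i \<times> 'a \<Rightarrow>\<^sub>0 int) \<Rightarrow> ('i \<times> 'a \<Rightarrow>\<^sub>0 int)" where
  "act g = frag_extend (\<lambda>(i, f). frag_of (i, cmp C 1 0 g f))"

text \<open>The module map with prescribed values on generators, as given by the Yoneda lemma:
  \<open>(i, f)\<close> is the arrow \<open>f\<close> acting on the basis element
  \<open>i\<close>.\<close>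

definition nex :: "('i \<Rightarrow> ('j \<times> 'a \<Rightarrow>\<^sub>0 int)) \<Rightarrow> ('i \<times> 'a \<Rightarrow>\<^sub>0 int) \<Rightarrow> ('j \<times> 'a \<Rightarrow>\<^sub>0 int)" where
  "nex t = frag_extend (\<lambda>(i, f). act f (t i))"

text \<open>The map to the colimit over \<open>C\<close>, where all translates of a generator are
  identified.\<close>

definition forg :: "('i \<times> 'a \<Rightarrow>\<^sub>0 int) \<Rightarrow> ('i \<Rightarrow>\<^sub>0 int)" where
  "forg = frag_extend (\<lambda>(i, f). frag_of i)"

text \<open>The augmentation to the constant functor; the integers appear as the free group on one
  point so that the calculus of \<open>frag_extend\<close> applies.\<close>

definition aug :: "('i \<times> 'a \<Rightarrow>\<^sub>0 int) \<Rightarrow> (unit \<Rightarrow>\<^sub>0 int)" where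
  "aug = frag_extend (\<lambda>_. frag_of ())"

lemma lin_simps [simp]:
  "act g 0 = 0" "nex t 0 = 0" "forg 0 = 0" "aug 0 = 0"
  "act g (a - b) = act g a - act g b" "nex t (a - b) = nex t a - nex t b" "forg (a - b) = forg a - forg b"
  "aug (a - b) = aug a - aug b"
  "act g (a + b) = act g a + act g b" "nex t (a + b) = nex t a + nex t b"
  "forg (a + b) = forg a + forg b" "aug (a + b) = aug a + aug b"
  "act g (- a) = - act g a" "nex t (- a) = - nex t a" "forg (- a) = - forg a" "aug (- a) = - aug a"
  "act g (frag_cmul r a) = frag_cmul r (act g a)" "nex t (frag_cmul r a) = frag_cmul r (nex t a)"
  "forg (frag_cmul r a) = frag_cmul r (forg a)" "aug (frag_cmul r a) = frag_cmul r (aug a)"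
  "act g (frag_of (i, f)) = frag_of (i, cmp C 1 0 g f)" "nex t (frag_of (i, f)) = act f (t i)"
  "forg (frag_of (i, f)) = frag_of i" "aug (frag_of x) = frag_of ()"
  by (simp_all add: act_def nex_def forg_def aug_def frag_extend_diff frag_extend_add frag_extend_minus frag_extend_cmul)

lemma arrow_composable: "composable C 1 0 g f \<longleftrightarrow> g \<in> cells C 1 \<and> f \<in> cells C 1 \<and> src C 0 g = tgt C 0 f"
  by (auto simp: composable_def)

lemma arrow_simps:
  assumes "g \<in> cells C 1" "f \<in> cells C 1" "src C 0 g = tgt C 0 f"
  shows "cmp C 1 0 g f \<in> cells C 1" "src C 0 (cmp C 1 0 g f) = src C 0 f" "tgt C 0 (cmp C 1 0 g f) = tgt C 0 g"
  using cmp_closed[of 1 0 g f] src_cmp_top[of 0 g f] tgt_cmp_top[of 0 g f] assms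
  by (auto simp: composable_def)

lemma arrow_src_tgt: "f \<in> cells C 1 \<Longrightarrow> src C 0 f \<in> cells C 0" "f \<in> cells C 1 \<Longrightarrow> tgt C 0 f \<in> cells C 0"
  by (simp_all add: src_closed tgt_closed)

lemma arrow_assoc:
  assumes "h \<in> cells C 1" "g \<in> cells C 1" "f \<in> cells C 1" "src C 0 h = tgt C 0 g" "src C 0 g = tgt C 0 f"
  shows "cmp C 1 0 (cmp C 1 0 h g) f = cmp C 1 0 h (cmp C 1 0 g f)"
  by (rule cmp_assoc) (use assms in \<open>auto simp: composable_def\<close>)

lemma arrow_id:
  assumes "f \<in> cells C 1"
  shows "cmp C 1 0 f (idn C 0 (src C 0 f)) = f" "cmp C 1 0 (idn C 0 (tgt C 0 f)) f = f"
  using cmp_idn_right[of f 1 0] cmp_idn_left[of f 1 0] assms by auto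

lemma ident_arrow: "c \<in> cells C 0 \<Longrightarrow> idn C 0 c \<in> cells C 1" "c \<in> cells C 0 \<Longrightarrow> src C 0 (idn C 0 c) = c"
  "c \<in> cells C 0 \<Longrightarrow> tgt C 0 (idn C 0 c) = c"
  using idn_closed[of c 0] by (simp_all add: src_idn tgt_idn)

lemma Fr_simps [simp]:
  "0 \<in> Fr I loc c" "a \<in> Fr I loc c \<Longrightarrow> b \<in> Fr I loc c \<Longrightarrow> a - b \<in> Fr I loc c"
  "a \<in> Fr I loc c \<Longrightarrow> b \<in> Fr I loc c \<Longrightarrow> a + b \<in> Fr I loc c" "a \<in> Fr I loc c \<Longrightarrow> - a \<in> Fr I loc c"
  "a \<in> Fr I loc c \<Longrightarrow> frag_cmul r a \<in> Fr I loc c"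
  "frag_of (i, f) \<in> Fr I loc c \<longleftrightarrow> i \<in> I \<and> f \<in> cells C 1 \<and> src C 0 f = loc i \<and> tgt C 0 f = c"
  using keys_diff[of a b] keys_add[of a b] keys_cmul[of r a] by (auto simp: Fr_def)

lemma Fr_induct [consumes 1, case_names zero gen diff]:
  assumes "m \<in> Fr I loc c" "P 0"
    "\<And>i f. i \<in> I \<Longrightarrow> f \<in> cells C 1 \<Longrightarrow> src C 0 f = loc i \<Longrightarrow> tgt C 0 f = c \<Longrightarrow> P (frag_of (i, f))"
    "\<And>a b. a \<in> Fr I loc c \<Longrightarrow> b \<in> Fr I loc c \<Longrightarrow> P a \<Longrightarrow> P b \<Longrightarrow> P (a - b)"
  shows "P m"
proof -
  have "Poly_Mapping.keys m \<subseteq> {(i, f). i \<in> I \<and> f \<in> cells C 1 \<and> src C 0 f = loc i \<and> tgt C 0 f = c}"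
    using assms(1) by (simp add: Fr_def)
  then have "m \<in> Fr I loc c \<and> P m"
    by (induction rule: frag_induction) (use assms(2-4) in auto)
  then show ?thesis ..
qed

lemma act_Fr: "m \<in> Fr I loc c \<Longrightarrow> g \<in> cells C 1 \<Longrightarrow> src C 0 g = c \<Longrightarrow> act g m \<in> Fr I loc (tgt C 0 g)"
  by (induction rule: Fr_induct) (auto simp: arrow_simps[simplified])

lemma act_act:
  "m \<in> Fr I loc c \<Longrightarrow> f \<in> cells C 1 \<Longrightarrow> src C 0 f = c \<Longrightarrow> g \<in> cells C 1 \<Longrightarrow> src C 0 g = tgt C 0 f \<Longrightarrow>
    act g (act f m) = act (cmp C 1 0 g f) m"
  by (induction rule: Fr_induct) (auto simp: arrow_assoc[simplified])

lemma act_id: "m \<in> Fr I loc c \<Longrightarrow> act (idn C 0 c) m = m"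
  by (induction rule: Fr_induct) (auto simp: arrow_id[simplified])

lemma nex_Fr:
  assumes "m \<in> Fr I loc c" "\<And>i. i \<in> I \<Longrightarrow> t i \<in> Fr J loc' (loc i)"
  shows "nex t m \<in> Fr J loc' c"
  using assms(1)
proof (induction rule: Fr_induct)
  case (gen i f)
  then show ?case using act_Fr[OF assms(2)[of i], of f] by auto
qed auto

lemma nex_act:
  assumes "m \<in> Fr I loc c" "\<And>i. i \<in> I \<Longrightarrow> t i \<in> Fr J loc' (loc i)" "g \<in> cells C 1" "src C 0 g = c"
  shows "nex t (act g m) = act g (nex t m)"
  using assms(1)
proof (induction rule: Fr_induct)
  case (gen i f)
  then show ?case using act_act[OF assms(2)[of i], of f g] assms(3,4) by auto
qed auto

lemma nex_nex:
  assumes "m \<in> Fr I loc c" "\<And>i. i \<in> I \<Longrightarrow> t i \<in> Fr J loc' (loc i)" "\<And>j. j \<in> J \<Longrightarrow> t' j \<in> Fr K loc'' (loc' j)"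
  shows "nex t' (nex t m) = nex (\<lambda>i. nex t' (t i)) m"
  using assms(1)
proof (induction rule: Fr_induct)
  case (gen i f)
  then show ?case using nex_act[OF assms(2)[of i] assms(3), of f] by auto
qed auto

lemma nex_cong: "m \<in> Fr I loc c \<Longrightarrow> (\<And>i. i \<in> I \<Longrightarrow> t i = t' i) \<Longrightarrow> nex t m = nex t' m"
  by (induction rule: Fr_induct) auto

lemma nex_diff: "nex (\<lambda>i. t i - t' i) m = nex t m - nex t' m"
  by (auto simp: nex_def frag_diff_eq[symmetric] intro!: frag_extend_eq)

lemma nex_ident: "m \<in> Fr I loc c \<Longrightarrow> nex (\<lambda>i. frag_of (i, idn C 0 (loc i))) m = m"
proof (induction rule: Fr_induct)
  case (gen i f)
  then show ?case using arrow_id(1)[of f] by simp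
qed auto

lemma forg_act [simp]: "forg (act g m) = forg m"
  by (simp add: forg_def act_def frag_extend_frag_extend split_def)

lemma forg_nex: "forg (nex t m) = frag_extend (\<lambda>i. forg (t i)) (forg m)"
  by (rule frag_induction[of m UNIV]) (auto simp: frag_extend_diff)

lemma aug_act [simp]: "aug (act g m) = aug m"
  by (simp add: aug_def act_def frag_extend_frag_extend split_def)

lemma aug_nex: "m \<in> Fr I loc c \<Longrightarrow> (\<And>i. i \<in> I \<Longrightarrow> aug (t i) = frag_of ()) \<Longrightarrow> aug (nex t m) = aug m"
  by (induction rule: Fr_induct) auto

lemma aug_nex_0: "m \<in> Fr I loc c \<Longrightarrow> (\<And>i. i \<in> I \<Longrightarrow> aug (t i) = 0) \<Longrightarrow> aug (nex t m) = 0"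
  by (induction rule: Fr_induct) auto

section \<open>Resolutions and the comparison theorem\<close>

definition cyc :: "(nat \<Rightarrow> 'i \<Rightarrow> ('i \<times> 'a \<Rightarrow>\<^sub>0 int)) \<Rightarrow> nat \<Rightarrow> ('i \<times> 'a \<Rightarrow>\<^sub>0 int) \<Rightarrow> bool" where
  "cyc D n z = (case n of 0 \<Rightarrow> aug z = 0 | Suc m \<Rightarrow> nex (D m) z = 0)"

text \<open>A free resolution of the constant functor: \<open>D\<close> gives the differentials on
  generators, exactness is required at each object separately, and an element of augmentation one
  makes the augmentation onto.\<close>

definition resolution where
  "resolution I loc D \<longleftrightarrow> (\<forall>n. \<forall>i\<in>I n. loc n i \<in> cells C 0) \<and>
     (\<forall>n. \<forall>i\<in>I (Suc n). D n i \<in> Fr (I n) (loc n) (loc (Suc n) i) \<and> cyc D n (D n i)) \<and>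
     (\<forall>n. \<forall>c\<in>cells C 0. \<forall>z\<in>Fr (I n) (loc n) c. cyc D n z \<longrightarrow>
        (\<exists>w\<in>Fr (I (Suc n)) (loc (Suc n)) c. nex (D n) w = z)) \<and>
     (\<forall>c\<in>cells C 0. \<exists>z\<in>Fr (I 0) (loc 0) c. aug z = frag_of ())"

lemma resolutionD:
  assumes "resolution I loc D"
  shows "i \<in> I n \<Longrightarrow> loc n i \<in> cells C 0"
    "i \<in> I (Suc n) \<Longrightarrow> D n i \<in> Fr (I n) (loc n) (loc (Suc n) i)"
    "i \<in> I (Suc n) \<Longrightarrow> cyc D n (D n i)"
    "c \<in> cells C 0 \<Longrightarrow> z \<in> Fr (I n) (loc n) c \<Longrightarrow> cyc D n z \<Longrightarrow>
       \<exists>w\<in>Fr (I (Suc n)) (loc (Suc n)) c. nex (D n) w = z"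
    "c \<in> cells C 0 \<Longrightarrow> \<exists>z\<in>Fr (I 0) (loc 0) c. aug z = frag_of ()"
  using assms unfolding resolution_def by blast+

definition chain_map where
  "chain_map I loc D J loc' D' p \<longleftrightarrow> (\<forall>n. \<forall>i\<in>I n. p n i \<in> Fr (J n) (loc' n) (loc n i)) \<and>
     (\<forall>i\<in>I 0. aug (p 0 i) = frag_of ()) \<and>
     (\<forall>n. \<forall>i\<in>I (Suc n). nex (D' n) (p (Suc n) i) = nex (p n) (D n i))"

lemma chain_mapD:
  assumes "chain_map I loc D J loc' D' p"
  shows "i \<in> I n \<Longrightarrow> p n i \<in> Fr (J n) (loc' n) (loc n i)" "i \<in> I 0 \<Longrightarrow> aug (p 0 i) = frag_of ()"
    "i \<in> I (Suc n) \<Longrightarrow> nex (D' n) (p (Suc n) i) = nex (p n) (D n i)"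
  using assms unfolding chain_map_def by blast+

text \<open>Values on generators are lifted by exactness of the second resolution. The invariant of
  the recursion is that boundaries of the next generators are sent to cycles, which is what the next
  lift requires.\<close>

lemma chain_map_exists:
  assumes I: "resolution I loc D" and J: "resolution J loc' D'"
  obtains p where "chain_map I loc D J loc' D' p"
proof -
  let ?P = "\<lambda>n p. (\<forall>i\<in>I n. p i \<in> Fr (J n) (loc' n) (loc n i)) \<and> (n = 0 \<longrightarrow> (\<forall>i\<in>I 0. aug (p i) = frag_of ())) \<and>
    (\<forall>i\<in>I (Suc n). cyc D' n (nex p (D n i)))"
  let ?Q = "\<lambda>n p p'. \<forall>i\<in>I (Suc n). nex (D' n) (p' i) = nex p (D n i)"
  have "\<exists>p. ?P 0 p"
  proof -
    have "\<forall>i\<in>I 0. \<exists>z. z \<in> Fr (J 0) (loc' 0) (loc 0 i) \<and> aug z = frag_of ()"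
      using resolutionD(5)[OF J] resolutionD(1)[OF I] by blast
    then obtain p where p: "\<forall>i\<in>I 0. p i \<in> Fr (J 0) (loc' 0) (loc 0 i) \<and> aug (p i) = frag_of ()"
      by metis
    then have "\<forall>i\<in>I (Suc 0). cyc D' 0 (nex p (D 0 i))"
      using aug_nex[OF resolutionD(2)[OF I, of _ 0], of _ p] resolutionD(3)[OF I, of _ 0] by (simp add: cyc_def)
    with p show ?thesis by blast
  qed
  moreover have "\<exists>p'. ?P (Suc n) p' \<and> ?Q n p p'" if p: "?P n p" for n p
  proof -
    have pm: "nex p (D n i) \<in> Fr (J n) (loc' n) (loc (Suc n) i)" if "i \<in> I (Suc n)" for i
      by (rule nex_Fr[OF resolutionD(2)[OF I that]]) (use p in blast)
    have "\<forall>i\<in>I (Suc n). \<exists>w. w \<in> Fr (J (Suc n)) (loc' (Suc n)) (loc (Suc n) i) \<and> nex (D' n) w = nex p (D n i)"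
      using resolutionD(4)[OF J resolutionD(1)[OF I] pm] p by blast
    then obtain p' where p': "\<forall>i\<in>I (Suc n). p' i \<in> Fr (J (Suc n)) (loc' (Suc n)) (loc (Suc n) i) \<and>
        nex (D' n) (p' i) = nex p (D n i)" by metis
    have "cyc D' (Suc n) (nex p' (D (Suc n) i))" if i: "i \<in> I (Suc (Suc n))" for i
    proof -
      note Di = resolutionD(2)[OF I i]
      have "nex (D' n) (nex p' (D (Suc n) i)) = nex (\<lambda>j. nex (D' n) (p' j)) (D (Suc n) i)"
        by (rule nex_nex[OF Di]) (use p' resolutionD(2)[OF J] in auto)
      also have "\<dots> = nex (\<lambda>j. nex p (D n j)) (D (Suc n) i)"
        by (rule nex_cong[OF Di]) (use p' in auto)
      also have "\<dots> = nex p (nex (D n) (D (Suc n) i))"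
        by (rule nex_nex[OF Di, symmetric]) (use p resolutionD(2)[OF I] in auto)
      also have "nex (D n) (D (Suc n) i) = 0" using resolutionD(3)[OF I i] by (simp add: cyc_def)
      finally show ?thesis by (simp add: cyc_def)
    qed
    with p' show ?thesis by (intro exI[of _ p']) auto
  qed
  ultimately obtain p where "\<forall>n. ?P n (p n) \<and> ?Q n (p n) (p (Suc n))"
    using dependent_nat_choice[of ?P ?Q] by blast
  then have "chain_map I loc D J loc' D' p" unfolding chain_map_def by blast
  then show ?thesis using that by blast
qed

text \<open>The same recursion, applied to the defect \<open>?e\<close> of the homotopy equation;
  the invariant is that this defect is a cycle.\<close>

lemma homotopy_exists:
  assumes I: "resolution I loc D" and J: "resolution J loc' D'"
    and p: "chain_map I loc D J loc' D' p" and p': "chain_map I loc D J loc' D' p'"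
  obtains h where "\<And>n i. i \<in> I n \<Longrightarrow> h n i \<in> Fr (J (Suc n)) (loc' (Suc n)) (loc n i)"
    "\<And>i. i \<in> I 0 \<Longrightarrow> nex (D' 0) (h 0 i) = p 0 i - p' 0 i"
    "\<And>n i. i \<in> I (Suc n) \<Longrightarrow> nex (D' (Suc n)) (h (Suc n) i) = p (Suc n) i - p' (Suc n) i - nex (h n) (D n i)"
proof -
  let ?e = "\<lambda>n h i. p (Suc n) i - p' (Suc n) i - nex h (D n i)"
  let ?P = "\<lambda>n h. (\<forall>i\<in>I n. h i \<in> Fr (J (Suc n)) (loc' (Suc n)) (loc n i)) \<and>
    (n = 0 \<longrightarrow> (\<forall>i\<in>I 0. nex (D' 0) (h i) = p 0 i - p' 0 i)) \<and> (\<forall>i\<in>I (Suc n). cyc D' (Suc n) (?e n h i))"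
  let ?Q = "\<lambda>n h h'. \<forall>i\<in>I (Suc n). nex (D' (Suc n)) (h' i) = ?e n h i"
  note pm = chain_mapD(1)[OF p] chain_mapD(1)[OF p']
  have "\<exists>h. ?P 0 h"
  proof -
    have "\<exists>w\<in>Fr (J (Suc 0)) (loc' (Suc 0)) (loc 0 i). nex (D' 0) w = p 0 i - p' 0 i" if i: "i \<in> I 0" for i
      by (rule resolutionD(4)[OF J resolutionD(1)[OF I i]])
        (use pm[OF i] chain_mapD(2)[OF p i] chain_mapD(2)[OF p' i] in \<open>auto simp: cyc_def\<close>)
    then have "\<forall>i\<in>I 0. \<exists>w. w \<in> Fr (J (Suc 0)) (loc' (Suc 0)) (loc 0 i) \<and> nex (D' 0) w = p 0 i - p' 0 i" by blast
    then obtain h where h: "\<forall>i\<in>I 0. h i \<in> Fr (J (Suc 0)) (loc' (Suc 0)) (loc 0 i) \<and> nex (D' 0) (h i) = p 0 i - p' 0 i"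
      by metis
    have "cyc D' (Suc 0) (?e 0 h i)" if i: "i \<in> I (Suc 0)" for i
    proof -
      note Di = resolutionD(2)[OF I i]
      have "nex (D' 0) (nex h (D 0 i)) = nex (\<lambda>j. nex (D' 0) (h j)) (D 0 i)"
        by (rule nex_nex[OF Di]) (use h resolutionD(2)[OF J] in auto)
      also have "\<dots> = nex (\<lambda>j. p 0 j - p' 0 j) (D 0 i)"
        by (rule nex_cong[OF Di]) (use h in auto)
      finally show ?thesis
        using chain_mapD(3)[OF p i] chain_mapD(3)[OF p' i] by (simp add: cyc_def nex_diff)
    qed
    with h show ?thesis by blast
  qed
  moreover have "\<exists>h'. ?P (Suc n) h' \<and> ?Q n h h'" if h: "?P n h" for n h
  proof -
    have em: "?e n h i \<in> Fr (J (Suc n)) (loc' (Suc n)) (loc (Suc n) i)" if "i \<in> I (Suc n)" for i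
      using pm[OF that] nex_Fr[OF resolutionD(2)[OF I that], of h] h by simp
    have "\<forall>i\<in>I (Suc n). \<exists>w. w \<in> Fr (J (Suc (Suc n))) (loc' (Suc (Suc n))) (loc (Suc n) i) \<and> nex (D' (Suc n)) w = ?e n h i"
      using resolutionD(4)[OF J resolutionD(1)[OF I] em] h by blast
    then obtain h' where h': "\<forall>i\<in>I (Suc n). h' i \<in> Fr (J (Suc (Suc n))) (loc' (Suc (Suc n))) (loc (Suc n) i) \<and>
       nex (D' (Suc n)) (h' i) = ?e n h i" by metis
    have "cyc D' (Suc (Suc n)) (?e (Suc n) h' i)" if i: "i \<in> I (Suc (Suc n))" for i
    proof -
      note Di = resolutionD(2)[OF I i]
      have "nex (D' (Suc n)) (nex h' (D (Suc n) i)) = nex (\<lambda>j. nex (D' (Suc n)) (h' j)) (D (Suc n) i)"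
        by (rule nex_nex[OF Di]) (use h' resolutionD(2)[OF J] in auto)
      also have "\<dots> = nex (\<lambda>j. ?e n h j) (D (Suc n) i)"
        by (rule nex_cong[OF Di]) (use h' in auto)
      also have "\<dots> = nex (p (Suc n)) (D (Suc n) i) - nex (p' (Suc n)) (D (Suc n) i) - nex (\<lambda>j. nex h (D n j)) (D (Suc n) i)"
        by (simp add: nex_diff)
      also have "nex (\<lambda>j. nex h (D n j)) (D (Suc n) i) = nex h (nex (D n) (D (Suc n) i))"
        by (rule nex_nex[OF Di, symmetric]) (use h resolutionD(2)[OF I] in auto)
      also have "nex (D n) (D (Suc n) i) = 0" using resolutionD(3)[OF I i] by (simp add: cyc_def)
      finally show ?thesis
        using chain_mapD(3)[OF p i] chain_mapD(3)[OF p' i] by (simp add: cyc_def)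
    qed
    with h' show ?thesis by (intro exI[of _ h']) auto
  qed
  ultimately obtain h where h: "\<forall>n. ?P n (h n) \<and> ?Q n (h n) (h (Suc n))"
    using dependent_nat_choice[of ?P ?Q] by blast
  show ?thesis by (rule that[of h]) (use h in blast)+
qed

lemma chain_map_id:
  assumes "resolution I loc D"
  shows "chain_map I loc D I loc D (\<lambda>n i. frag_of (i, idn C 0 (loc n i)))"
  unfolding chain_map_def
proof (intro conjI allI ballI)
  fix n i assume i: "i \<in> I (Suc n)"
  show "nex (D n) (frag_of (i, idn C 0 (loc (Suc n) i))) = nex (\<lambda>i. frag_of (i, idn C 0 (loc n i))) (D n i)"
    using resolutionD(2)[OF assms i] by (simp add: nex_ident act_id)
qed (use resolutionD(1)[OF assms] in \<open>auto simp: ident_arrow[simplified]\<close>)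

lemma chain_map_comp:
  assumes I: "resolution I loc D" and J: "resolution J loc' D'" and K: "resolution K loc'' D''"
    and p: "chain_map I loc D J loc' D' p" and q: "chain_map J loc' D' K loc'' D'' q"
  shows "chain_map I loc D K loc'' D'' (\<lambda>n i. nex (q n) (p n i))"
  unfolding chain_map_def
proof (intro conjI allI ballI)
  note pm = chain_mapD(1)[OF p] and qm = chain_mapD(1)[OF q]
  show "nex (q n) (p n i) \<in> Fr (K n) (loc'' n) (loc n i)" if "i \<in> I n" for n i
    by (rule nex_Fr[OF pm[OF that] qm])
  show "aug (nex (q 0) (p 0 i)) = frag_of ()" if "i \<in> I 0" for i
    using aug_nex[OF pm[OF that] chain_mapD(2)[OF q]] chain_mapD(2)[OF p that] by simp
  fix n i assume i: "i \<in> I (Suc n)"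
  have "nex (D'' n) (nex (q (Suc n)) (p (Suc n) i)) = nex (\<lambda>j. nex (D'' n) (q (Suc n) j)) (p (Suc n) i)"
    by (rule nex_nex[OF pm[OF i] qm]) (use resolutionD(2)[OF K] in auto)
  also have "\<dots> = nex (\<lambda>j. nex (q n) (D' n j)) (p (Suc n) i)"
    by (rule nex_cong[OF pm[OF i]]) (use chain_mapD(3)[OF q] in auto)
  also have "\<dots> = nex (q n) (nex (D' n) (p (Suc n) i))"
    by (rule nex_nex[OF pm[OF i], symmetric]) (use resolutionD(2)[OF J] qm in auto)
  also have "\<dots> = nex (q n) (nex (p n) (D n i))" using chain_mapD(3)[OF p i] by simp
  also have "\<dots> = nex (\<lambda>j. nex (q n) (p n j)) (D n i)"
    by (rule nex_nex[OF resolutionD(2)[OF I i]]) (use pm qm in auto)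
  finally show "nex (D'' n) (nex (q (Suc n)) (p (Suc n) i)) = nex (\<lambda>i. nex (q n) (p n i)) (D n i)" .
qed

section \<open>Homology of the colimit\<close>

definition colim :: "(nat \<Rightarrow> 'i \<Rightarrow> ('i \<times> 'a \<Rightarrow>\<^sub>0 int)) \<Rightarrow> nat \<Rightarrow> ('i \<Rightarrow>\<^sub>0 int) \<Rightarrow> ('i \<Rightarrow>\<^sub>0 int)" where
  "colim D n = frag_extend (\<lambda>i. forg (D n i))"

lemma keys_forg: "m \<in> Fr I loc c \<Longrightarrow> Poly_Mapping.keys (forg m) \<subseteq> I"
  unfolding forg_def by (rule frag_extend_in[of m "{(i, f). i \<in> I}"]) (auto simp: Fr_def)

lemma colim_nex:
  assumes "\<And>i. i \<in> A \<Longrightarrow> nex t (s i) = w i" "Poly_Mapping.keys x \<subseteq> A"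
  shows "frag_extend (\<lambda>i. forg (t i)) (frag_extend (\<lambda>i. forg (s i)) x) = frag_extend (\<lambda>i. forg (w i)) x"
  unfolding frag_extend_frag_extend
proof (rule frag_extend_eq)
  fix i assume "i \<in> Poly_Mapping.keys x"
  then have "nex t (s i) = w i" using assms by blast
  then show "frag_extend (\<lambda>i. forg (t i)) (forg (s i)) = forg (w i)" by (simp add: forg_nex[symmetric])
qed

lemma colim_colim:
  assumes "resolution I loc D" "Poly_Mapping.keys x \<subseteq> I (Suc (Suc n))"
  shows "colim D n (colim D (Suc n) x) = 0"
proof -
  have "colim D n (colim D (Suc n) x) = frag_extend (\<lambda>i. forg 0) x"
    unfolding colim_def
    by (rule colim_nex[OF _ assms(2)]) (use resolutionD(3)[OF assms(1), of _ "Suc n"] in \<open>auto simp: cyc_def\<close>)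
  then show ?thesis by (simp add: frag_extend_zero)
qed

lemma colim_in:
  assumes "resolution I loc D" "Poly_Mapping.keys x \<subseteq> I (Suc n)"
  shows "Poly_Mapping.keys (colim D n x) \<subseteq> I n"
  unfolding colim_def
  by (rule frag_extend_in[OF assms(2)]) (use keys_forg resolutionD(2)[OF assms(1)] in blast)

text \<open>The witness is the image of \<open>x\<close> under the homotopy from \<open>p\<close> to
  the identity. In positive degrees the term that passes through the boundary of \<open>x\<close>
  vanishes, because \<open>x\<close> is a cycle.\<close>

lemma homotopic_to_id:
  assumes I: "resolution I loc D" and p: "chain_map I loc D I loc D p"
    and x: "Poly_Mapping.keys x \<subseteq> I k" "\<And>m. k = Suc m \<Longrightarrow> colim D m x = 0"
  obtains y where "Poly_Mapping.keys y \<subseteq> I (Suc k)" "frag_extend (\<lambda>i. forg (p k i)) x = x + colim D k y"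
proof -
  obtain h where h: "\<And>n i. i \<in> I n \<Longrightarrow> h n i \<in> Fr (I (Suc n)) (loc (Suc n)) (loc n i)"
    "\<And>i. i \<in> I 0 \<Longrightarrow> nex (D 0) (h 0 i) = p 0 i - frag_of (i, idn C 0 (loc 0 i))"
    "\<And>n i. i \<in> I (Suc n) \<Longrightarrow> nex (D (Suc n)) (h (Suc n) i) =
       p (Suc n) i - frag_of (i, idn C 0 (loc (Suc n) i)) - nex (h n) (D n i)"
    using homotopy_exists[OF I I p chain_map_id[OF I]] by blast
  let ?b = "\<lambda>t. frag_extend (\<lambda>i. forg (t i))"
  let ?y = "?b (h k) x"
  have y: "Poly_Mapping.keys ?y \<subseteq> I (Suc k)"
    by (rule frag_extend_in[OF x(1)]) (use keys_forg h(1) in blast)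
  have "colim D k ?y = ?b (p k) x - x"
  proof (cases k)
    case 0
    have "colim D k ?y = ?b (\<lambda>i. p 0 i - frag_of (i, idn C 0 (loc 0 i))) x"
      unfolding colim_def 0 by (rule colim_nex[OF h(2)]) (use x 0 in auto)
    then show ?thesis by (simp add: frag_diff_eq 0 frag_expansion[symmetric])
  next
    case (Suc m)
    have "colim D k ?y = ?b (\<lambda>i. p k i - frag_of (i, idn C 0 (loc k i)) - nex (h m) (D m i)) x"
      unfolding colim_def Suc by (rule colim_nex[OF h(3)]) (use x Suc in auto)
    also have "\<dots> = ?b (p k) x - x - ?b (\<lambda>i. nex (h m) (D m i)) x"
      by (simp add: frag_diff_eq frag_expansion[symmetric])
    also have "?b (\<lambda>i. nex (h m) (D m i)) x = ?b (h m) (colim D m x)"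
      unfolding colim_def by (rule colim_nex[symmetric, of UNIV]) auto
    finally show ?thesis using x(2)[OF Suc] by simp
  qed
  with y that show ?thesis by simp
qed

theorem resolutions_same_homology:
  assumes I: "resolution I loc D" and J: "resolution J loc' D'"
  shows "chain_homology (\<lambda>n. free_Abelian_group (I n)) (colim D) k \<cong>
    chain_homology (\<lambda>n. free_Abelian_group (J n)) (colim D') k"
proof -
  obtain p where p: "chain_map I loc D J loc' D' p" using chain_map_exists[OF I J] .
  obtain q where q: "chain_map J loc' D' I loc D q" using chain_map_exists[OF J I] .
  note qp = chain_map_comp[OF I J I p q] and pq = chain_map_comp[OF J I J q p]
  let ?b = "\<lambda>t. frag_extend (\<lambda>i. forg (t i))"
  have cmI: "colim D' n (?b (p (Suc n)) x) = ?b (p n) (colim D n x)" if "Poly_Mapping.keys x \<subseteq> I (Suc n)" for n x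
  proof -
    have "colim D' n (?b (p (Suc n)) x) = ?b (\<lambda>i. nex (p n) (D n i)) x"
      unfolding colim_def by (rule colim_nex[OF _ that]) (use chain_mapD(3)[OF p] in auto)
    also have "\<dots> = ?b (p n) (colim D n x)"
      unfolding colim_def by (rule colim_nex[symmetric, of UNIV]) auto
    finally show ?thesis .
  qed
  have cmJ: "colim D n (?b (q (Suc n)) x) = ?b (q n) (colim D' n x)" if "Poly_Mapping.keys x \<subseteq> J (Suc n)" for n x
  proof -
    have "colim D n (?b (q (Suc n)) x) = ?b (\<lambda>i. nex (q n) (D' n i)) x"
      unfolding colim_def by (rule colim_nex[OF _ that]) (use chain_mapD(3)[OF q] in auto)
    also have "\<dots> = ?b (q n) (colim D' n x)"
      unfolding colim_def by (rule colim_nex[symmetric, of UNIV]) auto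
    finally show ?thesis .
  qed
  have inp: "Poly_Mapping.keys (?b (p n) x) \<subseteq> J n" if "Poly_Mapping.keys x \<subseteq> I n" for n x
    by (rule frag_extend_in[OF that]) (use keys_forg chain_mapD(1)[OF p] in blast)
  have inq: "Poly_Mapping.keys (?b (q n) x) \<subseteq> I n" if "Poly_Mapping.keys x \<subseteq> J n" for n x
    by (rule frag_extend_in[OF that]) (use keys_forg chain_mapD(1)[OF q] in blast)
  have cI: "z \<in> cycles (\<lambda>n. free_Abelian_group (I n)) (colim D) k \<longleftrightarrow>
     Poly_Mapping.keys z \<subseteq> I k \<and> (\<forall>m. k = Suc m \<longrightarrow> colim D m z = 0)" for z
    by (cases k) (auto simp: cycles_def kernel_def)
  have cJ: "z \<in> cycles (\<lambda>n. free_Abelian_group (J n)) (colim D') k \<longleftrightarrow>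
     Poly_Mapping.keys z \<subseteq> J k \<and> (\<forall>m. k = Suc m \<longrightarrow> colim D' m z = 0)" for z
    by (cases k) (auto simp: cycles_def kernel_def)
  have bqp: "?b (q k) (?b (p k) z) = ?b (\<lambda>i. nex (q k) (p k i)) z" for z
    by (rule colim_nex[of UNIV]) auto
  have bpq: "?b (p k) (?b (q k) z) = ?b (\<lambda>i. nex (p k) (q k i)) z" for z
    by (rule colim_nex[of UNIV]) auto
  show ?thesis
  proof (rule homology_isoI[where h = "?b (p k)"])
    show "colim D n \<in> hom (free_Abelian_group (I (Suc n))) (free_Abelian_group (I n))" for n
      using colim_in[OF I] by (auto simp: hom_def colim_def frag_extend_add)
    show "colim D' n \<in> hom (free_Abelian_group (J (Suc n))) (free_Abelian_group (J n))" for n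
      using colim_in[OF J] by (auto simp: hom_def colim_def frag_extend_add)
    show "?b (p k) \<in> hom (free_Abelian_group (I k)) (free_Abelian_group (J k))"
      using inp by (auto simp: hom_def frag_extend_add)
  next
    fix z assume "z \<in> cycles (\<lambda>n. free_Abelian_group (I n)) (colim D) k"
    then have z: "Poly_Mapping.keys z \<subseteq> I k" "\<And>m. k = Suc m \<Longrightarrow> colim D m z = 0" using cI by blast+
    then show "?b (p k) z \<in> cycles (\<lambda>n. free_Abelian_group (J n)) (colim D') k"
      using inp cmI by (auto simp: cJ)
    assume "?b (p k) z \<in> colim D' k ` carrier (free_Abelian_group (J (Suc k)))"
    then obtain w where w: "Poly_Mapping.keys w \<subseteq> J (Suc k)" "?b (p k) z = colim D' k w" by auto
    obtain y where y: "Poly_Mapping.keys y \<subseteq> I (Suc k)" "?b (\<lambda>i. nex (q k) (p k i)) z = z + colim D k y"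
      using homotopic_to_id[OF I qp z] by blast
    have "z = colim D k (?b (q (Suc k)) w - y)"
      using y(2) unfolding bqp[symmetric] w(2) cmJ[OF w(1), symmetric]
      by (simp add: colim_def frag_extend_diff algebra_simps)
    moreover have "Poly_Mapping.keys (?b (q (Suc k)) w - y) \<subseteq> I (Suc k)"
      by (intro order_trans[OF keys_diff] Un_least inq[OF w(1)] y(1))
    ultimately show "z \<in> colim D k ` carrier (free_Abelian_group (I (Suc k)))" by auto
  next
    fix z assume "z \<in> cycles (\<lambda>n. free_Abelian_group (J n)) (colim D') k"
    then have z: "Poly_Mapping.keys z \<subseteq> J k" "\<And>m. k = Suc m \<Longrightarrow> colim D' m z = 0" using cJ by blast+
    obtain y where y: "Poly_Mapping.keys y \<subseteq> J (Suc k)" "?b (\<lambda>i. nex (p k) (q k i)) z = z + colim D' k y"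
      using homotopic_to_id[OF J pq z] by blast
    have m1: "?b (q k) z \<in> cycles (\<lambda>n. free_Abelian_group (I n)) (colim D) k"
      using z inq cmJ by (auto simp: cI)
    have m2: "colim D' k (- y) + ?b (p k) (?b (q k) z) = z"
      unfolding bpq y(2) by (simp add: colim_def frag_extend_minus)
    have m3: "colim D' k (- y) \<in> colim D' k ` carrier (free_Abelian_group (J (Suc k)))"
      using y(1) by auto
    show "\<exists>w\<in>cycles (\<lambda>n. free_Abelian_group (I n)) (colim D) k.
       \<exists>b\<in>colim D' k ` carrier (free_Abelian_group (J (Suc k))). z = b \<otimes>\<^bsub>free_Abelian_group (J k)\<^esub> ?b (p k) w"
      by (intro bexI[OF _ m1] bexI[OF _ m3]) (simp only: mult_free_Abelian_group m2)
  next
    fix x assume "x \<in> carrier (free_Abelian_group (I (Suc k)))"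
    then have x: "Poly_Mapping.keys x \<subseteq> I (Suc k)" by simp
    then show "?b (p k) (colim D k x) \<in> colim D' k ` carrier (free_Abelian_group (J (Suc k)))"
      using cmI[OF x, symmetric] inp[OF x] by auto
  qed (auto simp: abelian_free_Abelian_group colim_colim[OF I] colim_colim[OF J])
qed

end

section \<open>The complex of a polygraphic resolution\<close>

locale category_resolution = basis P Sig + C: omega_category C
  for P :: "'p ocat" and Sig and C :: "'c ocat" +
  fixes u :: "nat \<Rightarrow> 'p \<Rightarrow> 'c"
  assumes nC: "n_category 1 C" and u: "omega_functor P C u" and u_surj: "u 0 ` cells P 0 = cells C 0"
    and lift: "parallel P n x y \<Longrightarrow> b \<in> cells C (Suc n) \<Longrightarrow> src C n b = u n x \<Longrightarrow> tgt C n b = u n y \<Longrightarrow>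
      \<exists>a\<in>cells P (Suc n). src P n a = x \<and> tgt P n a = y \<and> u (Suc n) a = b"
begin

sublocale u: omega_functor P C u by (rule u)
sublocale R: oset seqs rbd rcp by (rule oset_seqs)

lemma C_unit:
  assumes "x \<in> cells C (Suc (Suc m))"
  shows "src C (Suc m) x = tgt C (Suc m) x" "x = idn C (Suc m) (src C (Suc m) x)"
proof -
  obtain y where y: "y \<in> cells C 1" "x = idn_at C 1 (Suc (Suc m)) y"
    using nC assms unfolding n_category_def by (metis One_nat_def Suc_less_eq zero_less_Suc)
  then have x: "x = idn C (Suc m) (idn_at C 1 (Suc m) y)" "idn_at C 1 (Suc m) y \<in> cells C (Suc m)"
    using C.idn_at_closed[of y 1 "Suc m"] by auto
  show "src C (Suc m) x = tgt C (Suc m) x" "x = idn C (Suc m) (src C (Suc m) x)"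
    using x C.src_idn C.tgt_idn by auto
qed

text \<open>The arrow of \<open>C\<close> below a cell of any dimension. It is unchanged by
  boundaries of positive dimension and is an identity for a 0-cell.\<close>

definition ua :: "(nat \<Rightarrow> 'p) \<Rightarrow> 'c" where
  "ua x = u 1 (x 1)"

abbreviation "sob x \<equiv> src C 0 (ua x)"
abbreviation "tob x \<equiv> tgt C 0 (ua x)"
abbreviation "cell n x \<equiv> x \<in> seqs \<and> rbd n False x = x"

lemma ua_in: "x \<in> seqs \<Longrightarrow> ua x \<in> cells C 1"
  by (simp add: ua_def seqsD u.fun_closed del: One_nat_def)

lemma ob_in: "x \<in> seqs \<Longrightarrow> sob x \<in> cells C 0" "x \<in> seqs \<Longrightarrow> tob x \<in> cells C 0"
  using C.arrow_src_tgt[OF ua_in] by auto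

text \<open>The case with content is the 1-target: it may differ from the 1-source in
  \<open>P\<close>, but a 2-cell of \<open>C\<close> is a unit, so the images agree.\<close>

lemma ua_bd:
  assumes "x \<in> seqs" "0 < k"
  shows "ua (rbd k e x) = ua x"
proof (cases "k = 1")
  case True
  have "u 1 (tgt P 1 (x 2)) = u 1 (src P 1 (x 2))"
    using C_unit(1)[of "u 2 (x 2)" 0] u.fun_src[of "x 2" 1] u.fun_tgt[of "x 2" 1] u.fun_closed[of "x 2" 2]
      seqsD(1)[OF assms(1), of 2] by (simp add: numeral_2_eq_2)
  then show ?thesis using True assms seqsD(2)[OF assms(1), of 1] by (auto simp: ua_def rbd_def numeral_2_eq_2)
next
  case False
  then show ?thesis using assms by (simp add: ua_def rbd_def)
qed

lemma ua_bd0: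
  assumes "x \<in> seqs"
  shows "ua (rbd 0 e x) = idn C 0 (if e then tob x else sob x)"
proof -
  have "u 1 (idn P 0 y) = idn C 0 (u 0 y)" if "y \<in> cells P 0" for y using u.fun_idn[OF that] by simp
  moreover have "u 0 (tgt P 0 (x 1)) = tob x" "u 0 (src P 0 (x 1)) = sob x"
    using u.fun_src[of "x 1" 0] u.fun_tgt[of "x 1" 0] seqsD(1)[OF assms, of 1] by (auto simp: ua_def)
  moreover have "src P 0 (x 1) = x 0" using seqsD(2)[OF assms, of 0] by simp
  ultimately show ?thesis
    using tgt_closed_seq[OF assms, of 0] seqsD(1)[OF assms, of 0] by (auto simp: ua_def rbd_def)
qed

lemma tob_bd:
  assumes "x \<in> seqs"
  shows "tob (rbd k e x) = (if k = 0 \<and> \<not> e then sob x else tob x)"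
    "sob (rbd k e x) = (if k = 0 \<and> e then tob x else sob x)"
proof -
  have "k = 0 \<or> 0 < k" by auto
  then show "tob (rbd k e x) = (if k = 0 \<and> \<not> e then sob x else tob x)"
    "sob (rbd k e x) = (if k = 0 \<and> e then tob x else sob x)"
    using ua_bd0[OF assms, of e] ua_bd[OF assms, of k e] ob_in[OF assms] C.ident_arrow by (auto simp del: One_nat_def)
qed

lemma composable_ua:
  assumes "x \<in> seqs" "y \<in> seqs" "rbd k False x = rbd k True y"
  shows "k = 0 \<Longrightarrow> sob x = tob y" "0 < k \<Longrightarrow> ua x = ua y"
proof -
  show "k = 0 \<Longrightarrow> sob x = tob y" using tob_bd(1)[OF assms(1), of 0 False] tob_bd(1)[OF assms(2), of 0 True] assms(3) by simp
  show "0 < k \<Longrightarrow> ua x = ua y" using ua_bd[OF assms(1)] ua_bd[OF assms(2)] assms(3) by metis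
qed

lemma ua_cp:
  assumes "x \<in> seqs" "y \<in> seqs" "rbd k False x = rbd k True y"
  shows "ua (rcp k x y) = (if k = 0 then cmp C 1 0 (ua x) (ua y) else ua x)"
proof (cases "k = 0")
  case True
  have "composable P 1 0 (x 1) (y 1)" using rbd_composable[OF assms, of 1] True by simp
  from u.fun_cmp[OF this] show ?thesis using True by (simp add: ua_def rcp_def)
next
  case False
  then have "ua (rcp k x y) = ua y" by (simp add: ua_def rcp_def)
  then show ?thesis using False composable_ua(2)[OF assms] by simp
qed

lemma tob_cp:
  assumes "x \<in> seqs" "y \<in> seqs" "rbd k False x = rbd k True y"
  shows "tob (rcp k x y) = tob x"
  using ua_cp[OF assms] C.arrow_simps(3)[OF ua_in[OF assms(1)] ua_in[OF assms(2)]] composable_ua(1)[OF assms] by simp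

lemma iota_Sig: "i \<in> Sig n \<Longrightarrow> cell n (iota n i)"
  using subsetD[OF Sig_sub] by (simp add: iota_in iota_cell)

section \<open>Linearization of cells over C\<close>

definition loc :: "nat \<Rightarrow> 'p \<Rightarrow> 'c" where
  "loc n i = tob (iota n i)"

abbreviation "Mo n \<equiv> C.Fr (Sig n) (loc n)"

text \<open>The universal derivation; it turns a pasting of generators into its linearization over \<open>C\<close>.\<close>

definition derivation where
  "derivation n d \<longleftrightarrow> (\<forall>x. cell n x \<longrightarrow> d x \<in> Mo n (tob x)) \<and>
    (\<forall>x m. m < n \<longrightarrow> cell m x \<longrightarrow> d x = 0) \<and> (\<forall>i\<in>Sig n. d (iota n i) = frag_of (i, idn C 0 (loc n i))) \<and>
    (\<forall>x y k. k < n \<longrightarrow> cell n x \<longrightarrow> cell n y \<longrightarrow> rbd k False x = rbd k True y \<longrightarrow>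
       d (rcp k x y) = d x + (if k = 0 then C.act (ua x) (d y) else d y))"

lemma act_in:
  assumes "x \<in> seqs" "m \<in> Mo n (sob x)"
  shows "C.act (ua x) m \<in> Mo n (tob x)"
  using C.act_Fr[OF assms(2) ua_in[OF assms(1)] refl] .

text \<open>Derivations are sections of a square-zero extension: \<open>?T\<close> consists of cells
  with a module element that all boundaries of dimension below \<open>n\<close> forget. The zero
  section below dimension \<open>n\<close> is extended by the basis elements on the
  generators.\<close>

lemma derivation_exists: "\<exists>d. derivation n d"
proof -
  let ?T = "{(x, m). cell n x \<and> m \<in> Mo n (tob x)}"
  define tb where "tb = (\<lambda>k e (x, m). if k < n then (rbd k e x, 0 :: 'p \<times> 'c \<Rightarrow>\<^sub>0 int) else (x, m))"
  define tc where "tc = (\<lambda>k (x, m) (y, m'). if k < n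
      then (rcp k x y, m + (if k = 0 then C.act (ua x) m' else m')) else (x, m :: 'p \<times> 'c \<Rightarrow>\<^sub>0 int))"
  have T: "oset ?T tb tc"
  proof
    fix X k e assume "X \<in> ?T"
    then show "tb k e X \<in> ?T" by (auto simp: tb_def R.bd_ge split: if_splits)
  next
    fix X and k l :: nat and e e' assume "X \<in> ?T" "k < l"
    then show "tb k e (tb l e' X) = tb k e X" by (auto simp: tb_def R.bd_lt)
  next
    fix X and k l :: nat and e e' assume "X \<in> ?T" "l \<le> k"
    then show "tb k e (tb l e' X) = tb l e' X" by (auto simp: tb_def R.bd_ge)
  next
    fix X Y k assume XY: "X \<in> ?T" "Y \<in> ?T" "tb k False X = tb k True Y"
    obtain x m y m' where e: "X = (x, m)" "Y = (y, m')" by (cases X, cases Y) auto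
    have x: "cell n x" "cell n y" "m \<in> Mo n (tob x)" "m' \<in> Mo n (tob y)" using XY by (auto simp: e)
    have c: "rbd k False x = rbd k True y" if "k < n" using XY(3) that by (simp add: e tb_def)
    have q: "\<not> k < n \<Longrightarrow> x = y" "\<not> k < n \<Longrightarrow> m = m'" using XY(3) by (auto simp: e tb_def)
    show "tc k X Y \<in> ?T"
      using x c act_in[of x m' n] composable_ua[of x y k]
      by (auto simp: e tc_def R.cp_in R.bd_cp tob_cp simp del: One_nat_def)
    show "tb k False (tc k X Y) = tb k False Y" "tb k True (tc k X Y) = tb k True X"
      using x c q by (auto simp: e tc_def tb_def R.bd_cp_False R.bd_cp_True)
  next
    fix X Y and k l :: nat and e assume XY: "X \<in> ?T" "Y \<in> ?T" "tb k False X = tb k True Y" and kl: "k < l"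
    then show "tb l e (tc k X Y) = tc k (tb l e X) (tb l e Y)"
      by (auto simp: tc_def tb_def R.bd_cp)
  next
    fix X Y Z k assume XY: "X \<in> ?T" "Y \<in> ?T" "Z \<in> ?T" "tb k False X = tb k True Y" "tb k False Y = tb k True Z"
    obtain x m y m' z m'' where e: "X = (x, m)" "Y = (y, m')" "Z = (z, m'')" by (cases X, cases Y, cases Z) auto
    have x: "cell n x" "cell n y" "cell n z" "m' \<in> Mo n (tob y)" "m'' \<in> Mo n (tob z)" using XY by (auto simp: e)
    have c: "rbd k False x = rbd k True y" "rbd k False y = rbd k True z" if "k < n" using XY(4,5) that by (simp_all add: e tb_def)
    show "tc k (tc k X Y) Z = tc k X (tc k Y Z)"
    proof (cases "k < n")
      case True
      have "C.act (ua x) (C.act (ua y) m'') = C.act (cmp C 1 0 (ua x) (ua y)) m''" if "k = 0"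
        by (rule C.act_act) (use x c[OF True] ua_in that composable_ua(1)[of x y k] composable_ua(1)[of y z k] in \<open>auto simp del: One_nat_def\<close>)
      then show ?thesis using True x c[OF True] by (auto simp: e tc_def R.cp_assoc ua_cp simp del: One_nat_def)
    qed (simp add: e tc_def)
  next
    fix X k assume "X \<in> ?T"
    then show "tc k X (tb k False X) = X" "tc k (tb k True X) X = X"
      using ua_bd0 C.act_id by (auto simp: tc_def tb_def R.cp_unit_right R.cp_unit_left)
  next
    fix k l :: nat and X X' Y Y' assume kl: "k < l" and XX: "X \<in> ?T" "X' \<in> ?T" "Y \<in> ?T" "Y' \<in> ?T"
      and c: "tb l False X = tb l True X'" "tb l False Y = tb l True Y'" "tb k False X = tb k True Y" "tb k False X' = tb k True Y'"
    obtain x m y m' z w where e: "X = (x, m)" "Y = (y, m')" "X' = (z, w)" by (cases X, cases Y, cases X') auto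
    obtain z' w' where e': "Y' = (z', w')" by (cases Y')
    have x: "cell n x" "cell n y" "cell n z" "cell n z'" using XX by (auto simp: e e')
    show "tc k (tc l X X') (tc l Y Y') = tc l (tc k X Y) (tc k X' Y')"
    proof (cases "l < n")
      case True
      then have cc: "rbd l False x = rbd l True z" "rbd l False y = rbd l True z'" "rbd k False x = rbd k True y"
        "rbd k False z = rbd k True z'" using c kl by (simp_all add: e e' tb_def)
      have "rcp k (rcp l x z) (rcp l y z') = rcp l (rcp k x y) (rcp k z z')"
        by (rule R.interchange[OF kl]) (use x cc in auto)
      \<comment> \<open>As \<open>l\<close> is positive, composition along \<open>l\<close> does not
        change the arrow by which the second row is twisted.\<close>
      moreover have "ua x = ua z" "ua (rcp l x z) = ua x" using composable_ua(2)[of x z l] ua_cp[of x z l] x cc kl by auto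
      ultimately show ?thesis using True kl by (auto simp: e e' tc_def)
    next
      case False
      then have "X = X'" "Y = Y'" using c by (auto simp: e e' tb_def)
      then show ?thesis using False kl by (auto simp: e e' tc_def)
    qed
  qed
  have F0: "functor_below n seqs rbd rcp ?T tb tc (\<lambda>x. (x, 0))"
    unfolding functor_below_def
  proof (intro conjI ballI allI impI)
    fix x assume x: "x \<in> seqs" "\<exists>m<n. rbd m False x = x"
    then obtain m where m: "m < n" "rbd m False x = x" by blast
    then have xn: "rbd n False x = x" using R.bd_cell[OF x(1) m(2), of n] by simp
    then show "(x, 0) \<in> ?T" using x by simp
    show "(rbd k e x, 0) = tb k e (x, 0)" for k e
      using R.bd_cell[OF x(1) xn, of k] by (auto simp: tb_def)
  next
    fix x y k assume x: "x \<in> seqs" "y \<in> seqs" and h: "(\<exists>m<n. rbd m False x = x \<and> rbd m False y = y) \<and> rbd k False x = rbd k True y"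
    then obtain m where m: "m < n" "rbd m False x = x" "rbd m False y = y" by blast
    have "rcp k x y = x" if "\<not> k < n"
      using R.bd_cell[OF x(1) m(2), of k False] R.bd_cell[OF x(2) m(3), of k True] m(1) that h
        R.cp_cell_self[OF x(1) m(2), of k] by simp
    then show "(rcp k x y, 0) = tc k (x, 0) (y, 0)" by (auto simp: tc_def)
  qed
  define y where "y = (\<lambda>i. (iota n i, frag_of (i, idn C 0 (loc n i))))"
  have yT: "y i \<in> ?T" if "i \<in> Sig n" for i
    using iota_Sig[OF that] that ob_in(2) C.ident_arrow by (auto simp: y_def loc_def simp del: One_nat_def)
  have "\<exists>F. functor_below (Suc n) seqs rbd rcp ?T tb tc F \<and>
    (\<forall>x m. x \<in> seqs \<longrightarrow> m < n \<longrightarrow> rbd m False x = x \<longrightarrow> F x = (x, 0)) \<and> (\<forall>i\<in>Sig n. F (iota n i) = y i)"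
  proof (rule extend_functor[OF T F0])
    show "y i \<in> ?T" if "i \<in> Sig n" for i by (rule yT[OF that])
    show "tb n False (y i) = y i" if "i \<in> Sig n" for i by (simp add: tb_def y_def)
    show "tb k e (y i) = (rbd k e (iota n i), 0)" if "i \<in> Sig n" "k < n" for i k e
      using that by (simp add: tb_def y_def)
  qed
  then obtain F where F: "functor_below (Suc n) seqs rbd rcp ?T tb tc F"
    "\<And>x m. x \<in> seqs \<Longrightarrow> m < n \<Longrightarrow> rbd m False x = x \<Longrightarrow> F x = (x, 0)" "\<And>i. i \<in> Sig n \<Longrightarrow> F (iota n i) = y i"
    by blast
  \<comment> \<open>The first component is a functor that fixes lower cells and generators, so it is
    the identity by uniqueness; this makes the second component a derivation.\<close>
  have Fx: "fst (F x) = x" if "cell n x" for x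
  proof (rule functor_unique[OF oset_seqs])
    show "functor_below (Suc n) seqs rbd rcp seqs rbd rcp (\<lambda>x. fst (F x))"
    proof (rule functor_below_comp[OF F(1)])
      fix X k e assume "X \<in> ?T"
      then show "fst (tb k e X) = rbd k e (fst X)"
        using R.bd_cell[of "fst X" n False k e] by (cases X) (auto simp: tb_def)
    next
      fix X Y k assume XY: "X \<in> ?T" "Y \<in> ?T" "tb k False X = tb k True Y"
      have "X = Y \<and> rcp k (fst X) (fst X) = fst X" if "\<not> k < n"
        using XY that R.cp_cell_self[of "fst X" n False k] by (cases X; cases Y) (auto simp: tb_def)
      then show "fst (tc k X Y) = rcp k (fst X) (fst Y)" by (cases X; cases Y) (auto simp: tc_def)
    qed auto
    show "functor_below (Suc n) seqs rbd rcp seqs rbd rcp (\<lambda>x. x)" by (auto simp: functor_below_def)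
  qed (use that F in \<open>auto simp: y_def\<close>)
  have "derivation n (\<lambda>x. snd (F x))"
    unfolding derivation_def
  proof (intro conjI allI impI ballI)
    fix x assume x: "cell n x"
    then have "F x \<in> ?T" using functor_belowD(1)[OF F(1), of x n] by simp
    then show "snd (F x) \<in> Mo n (tob x)" using Fx[OF x] by (cases "F x") auto
  next
    show "m < n \<Longrightarrow> cell m x \<Longrightarrow> snd (F x) = 0" for x m using F(2) by simp
    show "i \<in> Sig n \<Longrightarrow> snd (F (iota n i)) = frag_of (i, idn C 0 (loc n i))" for i using F(3) by (simp add: y_def)
  next
    fix x y k assume h: "k < n" "cell n x" "cell n y" "rbd k False x = rbd k True y"
    have "F (rcp k x y) = tc k (F x) (F y)" using functor_belowD(3)[OF F(1), of x n y k] h by simp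
    then show "snd (F (rcp k x y)) = snd (F x) + (if k = 0 then C.act (ua x) (snd (F y)) else snd (F y))"
      using Fx[OF h(2)] h(1) by (cases "F x"; cases "F y") (auto simp: tc_def)
  qed
  then show ?thesis by blast
qed

definition der :: "nat \<Rightarrow> (nat \<Rightarrow> 'p) \<Rightarrow> ('p \<times> 'c \<Rightarrow>\<^sub>0 int)" where
  "der n = (SOME d. derivation n d)"

lemma derivation_der: "derivation n (der n)"
  unfolding der_def by (rule someI_ex[OF derivation_exists])

lemma der_in: "cell n x \<Longrightarrow> der n x \<in> Mo n (tob x)"
  and der_low: "m < n \<Longrightarrow> cell m x \<Longrightarrow> der n x = 0"
  and der_gen: "i \<in> Sig n \<Longrightarrow> der n (iota n i) = frag_of (i, idn C 0 (loc n i))"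
  and der_cp: "k < n \<Longrightarrow> cell n x \<Longrightarrow> cell n y \<Longrightarrow> rbd k False x = rbd k True y \<Longrightarrow>
       der n (rcp k x y) = der n x + (if k = 0 then C.act (ua x) (der n y) else der n y)"
  using derivation_der[of n] unfolding derivation_def by blast+

text \<open>The linearized boundary. For \<open>n = 0\<close> source and target may lie over
  different objects, and the arrow below \<open>x\<close> brings the class of the source to the
  target object.\<close>

definition der_bd :: "nat \<Rightarrow> (nat \<Rightarrow> 'p) \<Rightarrow> ('p \<times> 'c \<Rightarrow>\<^sub>0 int)" where
  "der_bd n x = der n (rbd n True x) -
    (if n = 0 then C.act (ua x) (der n (rbd n False x)) else der n (rbd n False x))"

definition Di :: "nat \<Rightarrow> 'p \<Rightarrow> ('p \<times> 'c \<Rightarrow>\<^sub>0 int)" where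
  "Di n i = der_bd n (iota (Suc n) i)"

lemma der_bd_in:
  assumes "x \<in> seqs"
  shows "der_bd n x \<in> Mo n (tob x)"
proof -
  have "der n (rbd n e x) \<in> Mo n (tob (rbd n e x))" for e by (rule der_in) (simp add: assms R.bd_ge)
  from this[of True] this[of False] show ?thesis
    using act_in[OF assms, of _ n] by (auto simp: der_bd_def tob_bd[OF assms])
qed

lemma Di_in: "i \<in> Sig (Suc n) \<Longrightarrow> Di n i \<in> Mo n (loc (Suc n) i)"
  using der_bd_in[of "iota (Suc n) i" n] iota_Sig by (simp add: Di_def loc_def)

text \<open>Both sides obey the derivation rule: along \<open>n\<close> the common boundary cancels,
  and along \<open>k < n\<close> the boundaries are themselves composites. Both vanish on lower
  cells, and on generators the claim is the definition of \<open>Di\<close>.\<close>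

lemma nex_der:
  assumes "cell (Suc n) x"
  shows "C.nex (Di n) (der (Suc n) x) = der_bd n x"
proof -
  let ?Q = "\<lambda>x. C.nex (Di n) (der (Suc n) x) = der_bd n x"
  show ?thesis
  proof (rule cell_induct[where Q = ?Q and n = "Suc n"])
    fix x m assume x: "x \<in> seqs" "m < Suc n" "rbd m False x = x"
    have e: "rbd n e x = x" for e using R.bd_cell[OF x(1,3)] x(2) by simp
    have "C.act (ua x) (der 0 x) = der 0 x" if "n = 0"
      using C.act_id[OF der_in[of x 0]] ua_bd0[OF x(1), of True] e that x(1) by simp
    then show "?Q x" using x e der_low[of m "Suc n" x] by (auto simp: der_bd_def)
  next
    fix i assume i: "i \<in> Sig (Suc n)"
    show "?Q (iota (Suc n) i)" using C.act_id[OF Di_in[OF i]] by (simp add: der_gen[OF i]) (simp add: Di_def)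
  next
    fix x y k assume x: "x \<in> seqs" "y \<in> seqs" "rbd (Suc n) False x = x" "rbd (Suc n) False y = y" and k: "k < Suc n"
      and c: "rbd k False x = rbd k True y" and Q: "?Q x" "?Q y"
    have na: "C.nex (Di n) (C.act (ua x) (der (Suc n) y)) = C.act (ua x) (C.nex (Di n) (der (Suc n) y))" if "k = 0"
      by (rule C.nex_act[OF der_in Di_in]) (use x that c composable_ua(1)[of x y k] ua_in in auto)
    have L: "C.nex (Di n) (der (Suc n) (rcp k x y)) = der_bd n x + (if k = 0 then C.act (ua x) (der_bd n y) else der_bd n y)"
      using der_cp[of k "Suc n" x y] x k c Q na by auto
    show "?Q (rcp k x y)"
    proof (cases "k = n")
      case True
      have b: "rbd n True (rcp k x y) = rbd n True x" "rbd n False (rcp k x y) = rbd n False y"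
        using x c True by (auto simp: R.bd_cp_True R.bd_cp_False)
      show ?thesis
      proof (cases "n = 0")
        case 0: True
        have dy: "der 0 (rbd 0 False y) \<in> Mo 0 (sob y)"
          using der_in[of "rbd 0 False y" 0] x tob_bd(1)[OF x(2), of 0 False] by (simp add: R.bd_ge)
        have "C.act (ua x) (C.act (ua y) (der 0 (rbd 0 False y))) = C.act (cmp C 1 0 (ua x) (ua y)) (der 0 (rbd 0 False y))"
          by (rule C.act_act[OF dy ua_in _ ua_in]) (use x c True 0 composable_ua(1)[of x y k] in auto)
        then show ?thesis
          unfolding L using 0 True b c x by (simp add: der_bd_def ua_cp del: One_nat_def)
      next
        case False
        then show ?thesis unfolding L using True b c by (simp add: der_bd_def)
      qed
    next
      case False
      then have kn: "k < n" using k by simp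
      have b: "rbd n e (rcp k x y) = rcp k (rbd n e x) (rbd n e y)" for e using x c kn by (simp add: R.bd_cp)
      have "der n (rcp k (rbd n e x) (rbd n e y)) = der n (rbd n e x) +
         (if k = 0 then C.act (ua x) (der n (rbd n e y)) else der n (rbd n e y))" for e
        using der_cp[OF kn, of "rbd n e x" "rbd n e y"] x c kn ua_bd[of x n e] by (simp add: R.bd_ge R.bd_lt)
      then show ?thesis unfolding L using kn by (auto simp: der_bd_def b)
    qed
  qed (use assms in auto)
qed

lemma aug_der0: "cell 0 x \<Longrightarrow> C.aug (der 0 x) = frag_of ()"
  using cell_induct[of x 0 "\<lambda>x. C.aug (der 0 x) = frag_of ()"] der_gen by auto

text \<open>In degree 0 source and target have augmentation one; in higher degrees the source and
  the target of the generator are parallel, so \<open>der_bd\<close> is the same for both.\<close>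

lemma cyc_Di:
  assumes "i \<in> Sig (Suc n)"
  shows "C.cyc Di n (Di n i)"
proof -
  note x = iota_Sig[OF assms]
  show ?thesis
  proof (cases n)
    case 0
    then show ?thesis using aug_der0[of "rbd 0 True (iota 1 i)"] aug_der0[of "rbd 0 False (iota 1 i)"] x
      by (simp add: C.cyc_def Di_def der_bd_def R.bd_ge)
  next
    case (Suc m)
    let ?x = "iota (Suc n) i"
    have "C.nex (Di m) (der n (rbd n e ?x)) = der_bd m (rbd n e ?x)" for e
      using nex_der[of "rbd n e ?x" m] x Suc by (simp add: R.bd_ge)
    moreover have "der_bd m (rbd n e ?x) = der_bd m ?x" for e
    proof -
      have "ua (rbd n e ?x) = ua ?x" "rbd m d (rbd n e ?x) = rbd m d ?x" for d
        using x Suc ua_bd[of ?x n e] by (auto simp: R.bd_lt)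
      then show ?thesis by (simp only: der_bd_def)
    qed
    ultimately show ?thesis using Suc by (simp add: C.cyc_def Di_def der_bd_def[of "Suc m"])
  qed
qed

end

section \<open>Filling cylinders by means of the lifting property\<close>

context oset
begin

text \<open>
  Filling: over an \<open>(N+1)\<close>-cell, a cylinder is given by cylinders over its source and target, which
  agree in dimensions \<open>< N\<close>, and by one \<open>(N+2)\<close>-cell \<open>w\<close> between parallel cells.
\<close>

definition fillc :: "nat \<Rightarrow> (nat \<Rightarrow> bool \<Rightarrow> 'a) \<Rightarrow> (nat \<Rightarrow> bool \<Rightarrow> 'a) \<Rightarrow> 'a \<Rightarrow> nat \<Rightarrow> bool \<Rightarrow> 'a" where
  "fillc N As At w = (\<lambda>j e. if j < N then At j e else if j = N then (if e then At N True else As N False) else w)"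

lemma glue:
  assumes "cyl m (bd N False x) (bd N False y) As" "cyl m (bd N True x) (bd N True y) At" "m \<le> N"
    and "x \<in> S" "y \<in> S" "bd (Suc N) False x = x" "bd (Suc N) False y = y"
    and "\<And>j e. j < N \<Longrightarrow> As j e = At j e"
  shows "\<exists>X Y. X \<in> S \<and> Y \<in> S \<and> bd (Suc N) False X = X \<and> bd (Suc N) False Y = Y \<and> (\<forall>e. bd N e X = bd N e Y) \<and>
    (m = N \<longrightarrow> X = cp N (At N True) x \<and> Y = cp N y (As N False)) \<and>
    (\<forall>w. w \<in> S \<longrightarrow> bd (Suc (Suc N)) False w = w \<longrightarrow> bd (Suc N) False w = X \<longrightarrow> bd (Suc N) True w = Y \<longrightarrow>
      cyl m x y (fillc N As At w))"
  using assms
proof (induction "N - m" arbitrary: m x y)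
  case 0
  then have [simp]: "m = N" by simp
  note s = cylD[OF 0(2)] and t = cylD[OF 0(3)]
  have tm: "At N e \<in> S" "bd (Suc N) e' (At N e) = At N e" "bd N False (At N e) = bd N True x" "bd N True (At N e) = bd N True y"
    and sm: "As N e \<in> S" "bd (Suc N) e' (As N e) = As N e" "bd N False (As N e) = bd N False x" "bd N True (As N e) = bd N False y" for e e'
    using s t 0 by (auto simp: bd_ge)
  let ?X = "cp N (At N True) x" and ?Y = "cp N y (As N False)"
  have S: "?X \<in> S" "?Y \<in> S" using tm sm 0 by (auto intro!: cp_in)
  have c: "bd (Suc N) False ?X = ?X" "bd (Suc N) False ?Y = ?Y" using tm sm 0 by (auto simp: bd_cp)
  have p: "bd N e ?X = bd N e ?Y" for e
    using tm sm 0 by (cases e) (auto simp: bd_cp_True bd_cp_False)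
  have "cyl N x y (fillc N As At w)" if w: "w \<in> S" "bd (Suc (Suc N)) False w = w" "bd (Suc N) False w = ?X" "bd (Suc N) True w = ?Y" for w
  proof -
    have "cp (Suc N) w ?X = w" "cp (Suc N) ?Y w = w"
      using cp_unit_right[OF w(1), of "Suc N"] cp_unit_left[OF w(1), of "Suc N"] w by auto
    moreover have "cyl (Suc (Suc N)) w w (fillc N As At w)"
      by (rule cyl_cong[OF cyl_const[OF w(1,2)]]) (auto simp: eqv_def fillc_def)
    moreover have "bd (Suc N) e ?X = ?X" "bd (Suc N) e ?Y = ?Y" for e
      using bd_cell[OF S(1) c(1)] bd_cell[OF S(2) c(2)] by auto
    ultimately have "cyl (Suc N) ?X ?Y (fillc N As At w)"
      by - (rule cylI; use w S in \<open>auto simp: fillc_def\<close>)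
    then show ?thesis
      by - (rule cylI; use tm sm 0 in \<open>auto simp: fillc_def\<close>)
  qed
  then show ?case using S c p by (intro exI[of _ ?X] exI[of _ ?Y]) auto
next
  case (Suc d)
  have mN: "m < N" "d = N - Suc m" using Suc(2) by auto
  note s = cylD[OF Suc(3)] and t = cylD[OF Suc(4)]
  note xy = Suc(6-9)
  have eq: "As m e = At m e" for e using Suc(10) mN by simp
  have tm: "At m e \<in> S" "bd (Suc m) e' (At m e) = At m e" "bd m False (At m e) = bd m e x" "bd m True (At m e) = bd m e y" for e e'
    using t xy mN by (auto simp: bd_lt)
  have atN: "bd N e' (At m e) = At m e" for e e' using bd_cell[OF tm(1,2)] mN by simp
  let ?x = "cp m (At m True) x" and ?y = "cp m y (At m False)"
  have S: "?x \<in> S" "?y \<in> S" using tm xy by (auto intro!: cp_in)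
  have atN': "bd (Suc N) e' (At m e) = At m e" for e e' using bd_cell[OF tm(1,2)] mN by simp
  have c: "bd (Suc N) False ?x = ?x" "bd (Suc N) False ?y = ?y" using tm xy mN atN' by (auto simp: bd_cp)
  have b: "cp m (At m True) (bd N e x) = bd N e ?x" "cp m (bd N e y) (At m False) = bd N e ?y" for e
    using tm xy mN atN by (auto simp: bd_cp)
  have "\<exists>X Y. X \<in> S \<and> Y \<in> S \<and> bd (Suc N) False X = X \<and> bd (Suc N) False Y = Y \<and> (\<forall>e. bd N e X = bd N e Y) \<and>
    (Suc m = N \<longrightarrow> X = cp N (At N True) ?x \<and> Y = cp N ?y (As N False)) \<and>
    (\<forall>w. w \<in> S \<longrightarrow> bd (Suc (Suc N)) False w = w \<longrightarrow> bd (Suc N) False w = X \<longrightarrow> bd (Suc N) True w = Y \<longrightarrow>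
      cyl (Suc m) ?x ?y (fillc N As At w))"
    by (rule Suc(1)[OF mN(2)]) (use s(7) t(7) b eq S c mN Suc(10) in auto)
  then obtain X Y where XY: "X \<in> S" "Y \<in> S" "bd (Suc N) False X = X" "bd (Suc N) False Y = Y" "\<forall>e. bd N e X = bd N e Y"
    "\<forall>w. w \<in> S \<longrightarrow> bd (Suc (Suc N)) False w = w \<longrightarrow> bd (Suc N) False w = X \<longrightarrow> bd (Suc N) True w = Y \<longrightarrow>
      cyl (Suc m) ?x ?y (fillc N As At w)" by blast
  have "cyl m x y (fillc N As At w)" if w: "w \<in> S" "bd (Suc (Suc N)) False w = w" "bd (Suc N) False w = X" "bd (Suc N) True w = Y" for w
  proof -
    have "cyl (Suc m) ?x ?y (fillc N As At w)" using XY(6) w by blast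
    then show ?thesis
      by - (rule cylI; use tm xy mN in \<open>auto simp: fillc_def\<close>)
  qed
  then show ?case using XY mN by (intro exI[of _ X] exI[of _ Y]) auto
qed

lemma ccomp_lx:
  assumes "ccomp m k x y A x' y' B"
  shows "ccomp k k (lx (k - m) m x A) (ry (k - m) m y A) A (lx (k - m) m x' B) (ry (k - m) m y' B) B"
  by (rule ccomp_ind[OF assms]) (auto simp: Suc_diff_Suc[symmetric] simp del: Suc_diff_Suc)

lemma trunc_fillc:
  assumes "\<And>j e. j < N \<Longrightarrow> As j e = At j e"
  shows "trunc N False (fillc N As At w) = trunc N False As" "trunc N True (fillc N As At w) = trunc N True At"
  using assms by (auto simp: trunc_def fillc_def fun_eq_iff)

end

context category_resolution
begin

text \<open>The filler is a lift of the unit on the common image. For \<open>N > 0\<close> the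
  images agree since they are units of \<open>C\<close> on the same cell; for \<open>N = 0\<close>
  this is the hypothesis on \<open>ua\<close>.\<close>

lemma parallel_lift:
  assumes X: "cell (Suc N) X" and Y: "cell (Suc N) Y" and par: "\<And>e. rbd N e X = rbd N e Y"
    and N0: "N = 0 \<Longrightarrow> ua X = ua Y"
  obtains w where "cell (Suc (Suc N)) w" "rbd (Suc N) False w = X" "rbd (Suc N) True w = Y"
proof -
  let ?n = "Suc N"
  have st: "src P N (X ?n) = src P N (Y ?n)" "tgt P N (X ?n) = tgt P N (Y ?n)"
    using fun_cong[OF par[of False], of N] fun_cong[OF par[of True], of N] X Y by (simp_all add: rbd_nth)
  have p: "parallel P ?n (X ?n) (Y ?n)" using X Y st by (simp add: parallel_def seqsD)
  have uX: "u ?n (X ?n) \<in> cells C ?n" "u ?n (Y ?n) \<in> cells C ?n" using X Y by (simp_all add: seqsD u.fun_closed)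
  have "u ?n (X ?n) = u ?n (Y ?n)"
  proof (cases N)
    case 0
    then show ?thesis using N0 by (simp add: ua_def)
  next
    case (Suc M)
    have "src C N (u ?n (X ?n)) = src C N (u ?n (Y ?n))"
      using u.fun_src[of "X ?n" N] u.fun_src[of "Y ?n" N] X Y st by (simp add: seqsD)
    then show ?thesis using C_unit(2)[of "u ?n (X ?n)" M] C_unit(2)[of "u ?n (Y ?n)" M] uX Suc by metis
  qed
  then have "\<exists>a\<in>cells P (Suc ?n). src P ?n a = X ?n \<and> tgt P ?n a = Y ?n \<and> u (Suc ?n) a = idn C ?n (u ?n (X ?n))"
    by (intro lift[OF p]) (use uX in \<open>auto simp: C.idn_closed C.src_idn C.tgt_idn\<close>)
  then obtain a where a: "a \<in> cells P (Suc ?n)" "src P ?n a = X ?n" "tgt P ?n a = Y ?n" by blast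
  show ?thesis
  proof (rule that)
    show "cell (Suc ?n) (iota (Suc ?n) a)" using a by (simp add: iota_in iota_cell)
    show "rbd ?n False (iota (Suc ?n) a) = X" "rbd ?n True (iota (Suc ?n) a) = Y"
      using iota_src[OF a(1)] iota_tgt[OF a(1)] a iota_inv X Y by auto
  qed
qed

end

section \<open>Cones: cylinders ending in a fixed 0-cell\<close>

locale cone_resolution = category_resolution P Sig C u
  for P :: "'p ocat" and Sig and C :: "'c ocat" and u +
  fixes o\<^sub>0 :: 'p
  assumes o0: "o\<^sub>0 \<in> cells P 0"
begin

definition oc :: "nat \<Rightarrow> 'p" where
  "oc = iota 0 o\<^sub>0"

definition cc0 :: 'c where
  "cc0 = u 0 o\<^sub>0"

lemma oc_cell: "oc \<in> seqs" "rbd k e oc = oc"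
  using o0 R.bd_cell[OF iota_in iota_cell, OF o0 o0, of k] by (auto simp: oc_def iota_in)

text \<open>The presheaf represented by \<open>cc0\<close>, pulled back along the resolution; its
  category of elements is the slice of \<open>P\<close> over that object.\<close>

definition Fib :: "(nat \<Rightarrow> 'p) \<Rightarrow> 'c set" where
  "Fib b = {f \<in> cells C 1. src C 0 f = tob b \<and> tgt C 0 f = cc0}"

definition pull :: "(nat \<Rightarrow> 'p) \<Rightarrow> 'c \<Rightarrow> 'c" where
  "pull x f = cmp C 1 0 f (ua x)"

text \<open>A chosen edge of \<open>P\<close> over \<open>f\<close> from \<open>b\<close> to the
  apex. It is the cone over the 0-cell \<open>b\<close> at the index \<open>f\<close>.\<close>

definition lf :: "(nat \<Rightarrow> 'p) \<Rightarrow> 'c \<Rightarrow> nat \<Rightarrow> 'p" where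
  "lf b f = iota 1 (SOME a. a \<in> cells P 1 \<and> src P 0 a = b 0 \<and> tgt P 0 a = o\<^sub>0 \<and> u 1 a = f)"

definition zeta :: "(nat \<Rightarrow> 'p) \<Rightarrow> 'c \<Rightarrow> (nat \<Rightarrow> 'p) \<times> (nat \<Rightarrow> 'p) \<times> (nat \<Rightarrow> bool \<Rightarrow> nat \<Rightarrow> 'p)" where
  "zeta b f = (b, oc, \<lambda>j e. lf b f)"

definition Cn where
  "Cn = {U \<in> R.gS. fst (snd U) = oc}"

lemma tob_cell0: "cell 0 b \<Longrightarrow> tob b = u 0 (b 0) \<and> sob b = tob b"
proof -
  assume b: "cell 0 b"
  have t: "tob b = u 0 (tgt P 0 (b 1))" using u.fun_tgt[of "b 1" 0] b by (simp add: ua_def seqsD)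
  have s: "sob b = u 0 (src P 0 (b 1))" using u.fun_src[of "b 1" 0] b by (simp add: ua_def seqsD)
  have "rbd 0 True b = b" using R.bd_cell[of b 0 False 0 True] b by simp
  then have "tgt P 0 (b 1) = b 0" using rbd_nth[of b 0 True] b by simp
  then show ?thesis using t s b seqsD(2)[of b 0] by simp
qed

lemma lf_props:
  assumes b: "cell 0 b" and f: "f \<in> Fib b"
  shows "cell 1 (lf b f)" "rbd 0 False (lf b f) = b" "rbd 0 True (lf b f) = oc" "ua (lf b f) = f"
proof -
  have f': "f \<in> cells C 1" "src C 0 f = u 0 (b 0)" "tgt C 0 f = cc0" using f tob_cell0[OF b] by (auto simp: Fib_def)
  have "\<exists>a\<in>cells P 1. src P 0 a = b 0 \<and> tgt P 0 a = o\<^sub>0 \<and> u 1 a = f"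
    using lift[of 0 "b 0" "o\<^sub>0" f] f' b o0 by (simp add: parallel_def seqsD cc0_def)
  then have "\<exists>a. a \<in> cells P 1 \<and> src P 0 a = b 0 \<and> tgt P 0 a = o\<^sub>0 \<and> u 1 a = f" by blast
  from someI_ex[OF this] obtain a where a: "lf b f = iota 1 a" "a \<in> cells P 1" "src P 0 a = b 0" "tgt P 0 a = o\<^sub>0" "u 1 a = f"
    unfolding lf_def by blast
  show "cell 1 (lf b f)" using a by (simp add: iota_in iota_cell del: One_nat_def)
  show "rbd 0 False (lf b f) = b" "rbd 0 True (lf b f) = oc"
    using iota_src[of a 0] iota_tgt[of a 0] a iota_inv[of b 0] b by (auto simp: oc_def)
  show "ua (lf b f) = f" using a by (simp add: ua_def)
qed

lemma Cn_oset: "oset Cn R.gbd R.gcp"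
proof (rule oset_sub[OF R.oset_gam])
  interpret Gm: oset R.gS R.gbd R.gcp by (rule R.oset_gam)
  show "Cn \<subseteq> R.gS" by (auto simp: Cn_def)
  show "R.gbd k e U \<in> Cn" if "U \<in> Cn" for U k e
    using that Gm.bd_in[of U k e] oc_cell by (auto simp: Cn_def R.gbd_def split: prod.splits)
  show "R.gcp k U V \<in> Cn" if "U \<in> Cn" "V \<in> Cn" "R.gbd k False U = R.gbd k True V" for U V k
    using that Gm.cp_in[of U V k] R.cp_self[of oc k False] oc_cell by (auto simp: Cn_def R.gcp_def split: prod.splits)
qed

lemma zeta_in:
  assumes b: "cell 0 b" and f: "f \<in> Fib b"
  shows "zeta b f \<in> Cn"
proof -
  note l = lf_props[OF assms]
  have "rcp 0 (lf b f) b = lf b f" "rcp 0 oc (lf b f) = lf b f"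
    using R.cp_unit_right[of "lf b f" 0] R.cp_unit_left[of "lf b f" 0] l by auto
  moreover have "R.cyl 1 (lf b f) (lf b f) (\<lambda>j e. lf b f)" by (rule R.cyl_const[of _ _ False]) (use l in auto)
  ultimately have "R.cyl 0 b oc (\<lambda>j e. lf b f)"
    by - (rule R.cylI; use l b oc_cell R.bd_cell[of b 0 False 0] in auto)
  then show ?thesis by (simp add: Cn_def zeta_def R.gS_def)
qed

text \<open>A functor from \<open>P\<close> to these families that is the identity on first
  components selects a cone over every cell of the slice at once, by freeness of \<open>P\<close>
  alone.\<close>

sublocale fam: oset_family seqs rbd rcp Cn R.gbd R.gcp fst Fib pull zeta
proof -
  interpret G: oset Cn R.gbd R.gcp by (rule Cn_oset)
  have b0: "cell 0 (rbd 0 e x)" if "x \<in> seqs" for x e using that by (simp add: R.bd_ge)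
  have fb: "f \<in> Fib (rbd 0 e x) \<longleftrightarrow> f \<in> cells C 1 \<and> src C 0 f = (if e then tob x else sob x) \<and> tgt C 0 f = cc0"
    if "x \<in> seqs" for f e x
    using tob_bd[OF that, of 0 e] by (auto simp: Fib_def simp del: One_nat_def)
  show "oset_family seqs rbd rcp Cn R.gbd R.gcp fst Fib pull zeta"
  proof
    show "fst (R.gbd k e a) = rbd k e (fst a)" for a k e by (simp add: R.gbd_def split: prod.splits)
    show "fst (R.gcp k a b) = rcp k (fst a) (fst b)" for a b k by (simp add: R.gcp_def split: prod.splits)
    fix x f assume x: "x \<in> seqs"
    { assume f: "f \<in> Fib (rbd 0 True x)"
      show "pull x f \<in> Fib (rbd 0 False x)"
        using f fb[OF x] C.arrow_simps[OF _ ua_in[OF x], of f] by (auto simp: pull_def)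
      show "pull (rbd k e x) f = pull x f" if "0 < k" for k e using ua_bd[OF x that] by (simp add: pull_def)
      fix y assume y: "y \<in> seqs"
      show "pull (rcp 0 x y) f = pull y (pull x f)" if c: "rbd 0 False x = rbd 0 True y"
        using C.arrow_assoc[OF _ ua_in[OF x] ua_in[OF y], of f] f fb[OF x] composable_ua(1)[OF x y c] ua_cp[OF x y c]
        by (simp add: pull_def)
      show "pull (rcp k x y) f = pull x f" if c: "rbd k False x = rbd k True y" "0 < k" for k
        using ua_cp[OF x y c(1)] c(2) by (simp add: pull_def)
    }
    { fix e assume f: "f \<in> Fib (rbd 0 e x)"
      show "pull (rbd 0 e x) f = f"
        using f fb[OF x] ua_bd0[OF x, of e] C.arrow_id(1)[of f] by (auto simp: pull_def)
      show "zeta (rbd 0 e x) f \<in> Cn" by (rule zeta_in[OF b0[OF x] f])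
      show "R.gbd 0 e' (zeta (rbd 0 e x) f) = zeta (rbd 0 e x) f" for e'
        using x oc_cell by (simp add: zeta_def R.gbd_def R.bd_ge R.trunc_def)
      show "fst (zeta (rbd 0 e x) f) = rbd 0 e x" by (simp add: zeta_def)
    }
  qed
qed

lemma fam_cone:
  assumes "(x, p) \<in> fam.famS" "f \<in> Fib (rbd 0 True x)"
  shows "\<exists>A. p f = (x, oc, A) \<and> R.cyl 0 x oc A"
  using fam.famD(3,4)[OF assms(1) assms(2)] by (cases "p f") (auto simp: Cn_def R.gS_def)

text \<open>The values of \<open>g\<close> on the two \<open>N\<close>-dimensional boundaries of
  \<open>x\<close> supply, at each index, cones over source and target. Functoriality makes them
  agree in lower dimensions, so one filler completes the cone over \<open>x\<close>.\<close>

lemma section_step: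
  assumes g: "functor_below (Suc N) seqs rbd rcp fam.famS fam.fambd fam.famcp g"
    and g1: "\<And>z m. m \<le> N \<Longrightarrow> cell m z \<Longrightarrow> fst (g z) = z" and x: "cell (Suc N) x"
  shows "\<exists>y\<in>fam.famS. fst y = x \<and> fam.fambd (Suc N) False y = y \<and> (\<forall>k<Suc N. \<forall>e. fam.fambd k e y = g (rbd k e x))"
proof -
  interpret T: oset fam.famS fam.fambd fam.famcp by (rule fam.oset_fam)
  define q where "q = (\<lambda>e. snd (g (rbd N e x)))"
  have cN: "cell N (rbd N e x)" for e using x by (simp add: R.bd_ge)
  have gq: "g (rbd N e x) = (rbd N e x, q e)" for e using g1[OF order_refl cN, of e] by (metis q_def prod.collapse)
  have gS: "(rbd N e x, q e) \<in> fam.famS" "fam.fambd N e' (rbd N e x, q e) = (rbd N e x, q e)" for e e'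
  proof -
    have c: "rbd N e x \<in> seqs" "N < Suc N" "rbd N False (rbd N e x) = rbd N e x" using cN by auto
    show "(rbd N e x, q e) \<in> fam.famS" using functor_belowD(1)[OF g c] by (simp add: gq)
    have "rbd N e' (rbd N e x) = rbd N e x" by (rule R.bd_cell[OF c(1,3)]) simp
    then show "fam.fambd N e' (rbd N e x, q e) = (rbd N e x, q e)"
      using functor_belowD(2)[OF g c, of N e'] by (simp only: gq)
  qed
  \<comment> \<open>The index at which a boundary family is read: for \<open>N = 0\<close> the
    source lies over another object, so the index is pulled back there.\<close>
  define ff where "ff = (\<lambda>e f. if N = 0 \<and> \<not> e then pull x f else f)"
  have xs: "x \<in> seqs" using x by simp
  have fF: "ff e f \<in> Fib (rbd 0 True (rbd N e x))" if "f \<in> Fib (rbd 0 True x)" for e f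
    using that fam.pull_in[OF xs that] xs by (cases "N = 0"; cases e) (auto simp: ff_def R.bd_ge R.bd_lt)
  have "\<exists>A. (x, oc, A) \<in> Cn \<and> (\<forall>e. R.gbd N e (x, oc, A) = q e (ff e f)) \<and> R.gbd (Suc N) False (x, oc, A) = (x, oc, A)"
    if f: "f \<in> Fib (rbd 0 True x)" for f
  proof -
    obtain As where As: "q False (ff False f) = (rbd N False x, oc, As)" "R.cyl 0 (rbd N False x) oc As"
      using fam_cone[OF gS(1) fF[OF f]] by blast
    obtain At where At: "q True (ff True f) = (rbd N True x, oc, At)" "R.cyl 0 (rbd N True x) oc At"
      using fam_cone[OF gS(1) fF[OF f]] by blast
    have tr: "R.gbd N e' (q e (ff e f)) = q e (ff e f)" for e e'
    proof (cases "N = 0")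
      case True
      have z: "q e (ff e f) = zeta (rbd 0 e x) (ff e f)"
        using fam.famD(5,6)[OF gS(1) fF[OF f], of e] True fam.oset_fam gS(2)[of e e] f
        by (auto simp: fam.fambd_def fun_eq_iff) (metis fF[OF f] R.bd_ge True order_refl restrict_apply' xs)
      show ?thesis using z True fam.zeta_bd[OF xs, of "ff e f" e e'] fF[OF f, of e] xs by (simp add: R.bd_ge)
    next
      case False
      then have "restrict (\<lambda>f. R.gbd N e' (q e f)) (Fib (rbd 0 True (rbd N e x))) = q e"
        using gS(2)[of e' e] by (simp add: fam.fambd_def)
      from fun_cong[OF this, of "ff e f"] show ?thesis using fF[OF f, of e] by simp
    qed
    have trA: "R.trunc N e' As = As" "R.trunc N e' At = At" for e'
      using tr[of e' False] tr[of e' True] As At by (auto simp: R.gbd_def)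
    \<comment> \<open>Both entries belong to the cone that \<open>g\<close> assigns to the common
      lower boundary of \<open>x\<close>.\<close>
    have agree: "As j e = At j e" if j: "j < N" for j e
    proof -
      have "fam.fambd j e (rbd N d x, q d) = g (rbd j e x)" for d
      proof -
        have c: "rbd N d x \<in> seqs" "N < Suc N" "rbd N False (rbd N d x) = rbd N d x" using cN by auto
        show ?thesis using functor_belowD(2)[OF g c, of j e] by (simp only: gq R.bd_lt[OF xs j])
      qed
      then have e: "fam.fambd j e (rbd N False x, q False) = fam.fambd j e (rbd N True x, q True)" by simp
      have N0: "N \<noteq> 0" "0 < N" using j by auto
      have b: "rbd 0 True (rbd N e' x) = rbd 0 True x" for e' using R.bd_lt[OF xs N0(2)] .
      have ffe: "ff e' f = f" for e' using N0 by (simp add: ff_def)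
      have "R.gbd j e (q False f) = R.gbd j e (q True f)"
      proof (cases "j = 0")
        case True
        have "R.gbd 0 e (q e' f) = zeta (rbd 0 e x) (if e then f else pull x f)" for e'
          using fam.famD(5,6)[OF gS(1), of f e'] f b fam.pull_bd[OF xs f N0(2), of e'] R.bd_lt[OF xs N0(2)] by (cases e) auto
        then show ?thesis using True by simp
      next
        case False
        then have "restrict (\<lambda>f. R.gbd j e (q False f)) (Fib (rbd 0 True x)) = restrict (\<lambda>f. R.gbd j e (q True f)) (Fib (rbd 0 True x))"
          using e by (simp add: fam.fambd_def b)
        from fam.restrict_eqD[OF this f] show ?thesis .
      qed
      then have "R.trunc j e As = R.trunc j e At" using As At by (simp add: ffe R.gbd_def)
      then show ?thesis using R.trunc_eqD(2) by blast
    qed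
    have ocN: "rbd N e oc = oc" "rbd (Suc N) False oc = oc" for e by (simp_all add: oc_cell)
    obtain X Y where XY: "cell (Suc N) X" "cell (Suc N) Y" "\<forall>e. rbd N e X = rbd N e Y"
      "N = 0 \<Longrightarrow> X = rcp 0 (At 0 True) x \<and> Y = rcp 0 oc (As 0 False)"
      "\<And>w. cell (Suc (Suc N)) w \<Longrightarrow> rbd (Suc N) False w = X \<Longrightarrow> rbd (Suc N) True w = Y \<Longrightarrow> R.cyl 0 x oc (R.fillc N As At w)"
      using R.glue[of 0 N x oc As At] As(2) At(2) x oc_cell agree by (simp add: ocN) blast
    \<comment> \<open>In dimension 1 one end lies over the composite of \<open>f\<close> with the
      arrow below \<open>x\<close>, the other over \<open>pull x f\<close>. These are equal because
      the cone over the source was read at the pulled back index.\<close>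
    have "ua X = ua Y" if N: "N = 0"
    proof -
      have "At = (\<lambda>j e. lf (rbd 0 True x) f)" "As = (\<lambda>j e. lf (rbd 0 False x) (pull x f))"
        using fam.famD(5)[OF gS(1) fF[OF f], of True] fam.famD(5)[OF gS(1) fF[OF f], of False] tr[of True True] tr[of True False] N As At xs
        by (auto simp: ff_def zeta_def R.bd_ge)
      moreover note lt = lf_props[of "rbd 0 True x" f] lf_props[of "rbd 0 False x" "pull x f"]
      moreover have "cell 0 (rbd 0 e x)" for e using xs by (simp add: R.bd_ge)
      moreover note fam.pull_in[OF xs f]
      ultimately have A: "At 0 True \<in> seqs" "rbd 0 False (At 0 True) = rbd 0 True x" "ua (At 0 True) = f"
        "As 0 False \<in> seqs" "rbd 0 True (As 0 False) = oc" "ua (As 0 False) = pull x f" using f by auto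
      have "ua X = cmp C 1 0 f (ua x)" using XY(4)[OF N] ua_cp[OF A(1) xs A(2)] A(3) by simp
      moreover have "Y = As 0 False" using XY(4)[OF N] R.cp_unit_left[OF A(4), of 0] A(5) by simp
      ultimately show ?thesis using A(6) by (simp add: pull_def)
    qed
    then obtain w where w: "cell (Suc (Suc N)) w" "rbd (Suc N) False w = X" "rbd (Suc N) True w = Y"
      using parallel_lift[OF XY(1,2)] XY(3) by blast
    let ?A = "R.fillc N As At w"
    have c: "R.cyl 0 x oc ?A" by (rule XY(5)[OF w])
    moreover have "R.gbd N e (x, oc, ?A) = q e (ff e f)" for e
      using As At trA R.trunc_fillc[of N As At w] agree by (cases e) (simp_all add: R.gbd_def ocN)
    moreover have "R.gbd (Suc N) False (x, oc, ?A) = (x, oc, ?A)"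
      using x by (auto simp: R.gbd_def ocN R.trunc_def R.fillc_def fun_eq_iff)
    ultimately show ?thesis by (intro exI[of _ ?A]) (auto simp: Cn_def R.gS_def)
  qed
  then have "\<exists>A. \<forall>f\<in>Fib (rbd 0 True x). (x, oc, A f) \<in> Cn \<and> (\<forall>e. R.gbd N e (x, oc, A f) = q e (ff e f)) \<and>
      R.gbd (Suc N) False (x, oc, A f) = (x, oc, A f)"
    by (intro bchoice) blast
  then obtain A where A: "\<And>f. f \<in> Fib (rbd 0 True x) \<Longrightarrow> (x, oc, A f) \<in> Cn"
    "\<And>f e. f \<in> Fib (rbd 0 True x) \<Longrightarrow> R.gbd N e (x, oc, A f) = q e (ff e f)"
    "\<And>f. f \<in> Fib (rbd 0 True x) \<Longrightarrow> R.gbd (Suc N) False (x, oc, A f) = (x, oc, A f)" by blast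
  let ?p = "restrict (\<lambda>f. (x, oc, A f)) (Fib (rbd 0 True x))"
  have z: "R.gbd 0 True (x, oc, A f) = zeta (rbd 0 True x) f \<and> R.gbd 0 False (x, oc, A f) = zeta (rbd 0 False x) (pull x f)"
    if f: "f \<in> Fib (rbd 0 True x)" for f
  proof (cases "N = 0")
    case True
    have "R.gbd 0 e (x, oc, A f) = zeta (rbd 0 e x) (ff e f)" for e
    proof -
      have "R.gbd 0 True (q e (ff e f)) = zeta (rbd 0 e x) (ff e f)"
        using fam.famD(5)[OF gS(1) fF[OF f], of e] True xs by (simp add: R.bd_ge)
      moreover have "R.gbd 0 True (R.gbd 0 e (x, oc, A f)) = R.gbd 0 e (x, oc, A f)"
        by (rule fam.G.bd_ge[OF A(1)[OF f]]) simp
      ultimately show ?thesis using A(2)[OF f, of e] True by simp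
    qed
    from this[of True] this[of False] show ?thesis using True by (simp add: ff_def)
  next
    case False
    then have N0: "0 < N" and ffe: "ff e f = f" for e by (auto simp: ff_def)
    have b: "rbd 0 e' (rbd N e x) = rbd 0 e' x" for e e' using R.bd_lt[OF xs N0] .
    have "R.gbd 0 e (x, oc, A f) = R.gbd 0 e (q True f)" for e
      using fam.G.bd_lt[OF A(1)[OF f] N0, of e True] A(2)[OF f, of True] ffe by simp
    then show ?thesis
      using fam.famD(5,6)[OF gS(1), of f True] f b fam.pull_bd[OF xs f N0, of True] by simp
  qed
  have yS: "(x, ?p) \<in> fam.famS" using xs A(1) z by (auto simp: fam.famS_def)
  have yN: "fam.fambd N e (x, ?p) = g (rbd N e x)" for e
  proof (cases "N = 0")
    case True
    have "q e = restrict (zeta (rbd 0 e x)) (Fib (rbd 0 e x))"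
      using gS(2)[of e e] True xs by (auto simp: fam.fambd_def R.bd_ge)
    then show ?thesis using gq[of e] True by (simp add: fam.fambd_def)
  next
    case False
    then have N0: "0 < N" and ffe: "ff e f = f" for e f by (auto simp: ff_def)
    have "q e = restrict (\<lambda>f. R.gbd N e (q e f)) (Fib (rbd 0 True x))"
      using gS(2)[of e e] False R.bd_lt[OF xs N0] by (auto simp: fam.fambd_def)
    moreover have "R.gbd N e (q e f) = R.gbd N e (x, oc, A f)" if "f \<in> Fib (rbd 0 True x)" for f
      using A(2)[OF that, of e] fam.G.bd_ge[OF A(1)[OF that], of N N e e] ffe by simp
    ultimately have "q e = restrict (\<lambda>f. R.gbd N e (x, oc, A f)) (Fib (rbd 0 True x))"
      by (metis (no_types, lifting) restrict_ext)
    then show ?thesis using gq[of e] False by (simp add: fam.fambd_def restrict_def fun_eq_iff)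
  qed
  have "fam.fambd k e (x, ?p) = g (rbd k e x)" if k: "k < Suc N" for k e
  proof (cases "k = N")
    case False
    then have kN: "k < N" using k by simp
    have "fam.fambd k e (x, ?p) = fam.fambd k e (fam.fambd N True (x, ?p))" using T.bd_lt[OF yS kN] by simp
    also have "\<dots> = g (rbd k e (rbd N True x))"
      unfolding yN using functor_belowD(2)[OF g, of "rbd N True x" N k e] cN[of True] by simp
    finally show ?thesis using R.bd_lt[OF xs kN] by simp
  qed (simp add: yN)
  moreover have "fam.fambd (Suc N) False (x, ?p) = (x, ?p)"
    using x A(3) by (auto simp: fam.fambd_def fun_eq_iff)
  ultimately show ?thesis using yS by (intro bexI[of _ "(x, ?p)"]) auto
qed

end

section \<open>Linearization of the entries of a cylinder\<close>

context category_resolution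
begin

lemma cyl_nth_cell: "R.cyl m x y A \<Longrightarrow> m \<le> j \<Longrightarrow> cell (Suc j) (A j e)"
  using R.cyl_cells by blast

text \<open>Of the cells attached to \<open>x\<close> on the way from level \<open>m\<close> to
  level \<open>n\<close>, only the last has dimension \<open>n\<close>; the derivation kills the
  others. The assumption \<open>0 < m\<close> excludes the twisted composition along
  0-cells.\<close>

lemma der_lx:
  assumes "R.cyl m x y A" "cell n x" "0 < m" "m + d = n"
  shows "der n (R.lx d m x A) = der n x + (if d = 0 then 0 else der n (A (n - 1) True)) \<and> cell n (R.lx d m x A)"
  using assms
proof (induction d arbitrary: m x y)
  case (Suc d)
  note a = R.cylD[OF Suc(2)]
  have mn: "m < n" using Suc(5) by simp
  have ca: "cell (Suc m) (A m True)" "cell n (A m True)" using a(3,4) R.cyl_cell[OF Suc(2) mn] by auto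
  have c: "rbd m False (A m True) = rbd m True x" using a by simp
  have cx: "cell n (rcp m (A m True) x)" using ca Suc(3) c mn by (simp add: R.cp_in R.bd_cp)
  have dx: "der n (rcp m (A m True) x) = der n (A m True) + der n x"
    using der_cp[OF mn ca(2) Suc(3) c] Suc(4) by simp
  have IH: "der n (R.lx d (Suc m) (rcp m (A m True) x) A) = der n (rcp m (A m True) x) +
     (if d = 0 then 0 else der n (A (n - 1) True)) \<and> cell n (R.lx d (Suc m) (rcp m (A m True) x) A)"
    by (rule Suc.IH[OF a(7) cx]) (use Suc(5) in auto)
  show ?case
  proof (cases "d = 0")
    case True
    then show ?thesis using IH dx Suc(5) by (auto simp: add.commute)
  next
    case False
    then have "der n (A m True) = 0" using der_low[of "Suc m" n] ca Suc(5) by simp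
    then show ?thesis using IH dx False by simp
  qed
qed simp

text \<open>The whiskers that enter a concatenation have lower dimension than its entries and vanish
  under the derivation.\<close>

lemma der_con:
  assumes "R.cyl m x y A" "R.cyl m y z B" "0 < m"
  shows "der (Suc (m + d)) (R.cc d m A B e) = der (Suc (m + d)) (A (m + d) e) + der (Suc (m + d)) (B (m + d) e)"
  using assms
proof (induction d arbitrary: m x y z A B)
  case 0
  note a = R.cylD[OF 0(1)] and b = R.cylD[OF 0(2)]
  have "der (Suc m) (rcp m (B m e) (A m e)) = der (Suc m) (B m e) + der (Suc m) (A m e)"
    using der_cp[of m "Suc m" "B m e" "A m e"] a b 0(3) by simp
  then show ?case by (simp add: add.commute)
next
  case (Suc d)
  note a = R.cylD[OF Suc(2)] and b = R.cylD[OF Suc(3)]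
  let ?j = "Suc m + d" let ?b = "B m True" and ?a = "A m False"
  have mj: "m < Suc ?j" "Suc m \<le> ?j" "m < Suc m" by auto
  have ca: "cell (Suc ?j) (A ?j e)" and cb: "cell (Suc ?j) (B ?j e)"
    by (rule cyl_nth_cell[OF Suc(2)], simp, rule cyl_nth_cell[OF Suc(3)], simp)
  have bb: "rbd ?j e' ?b = ?b" "cell (Suc ?j) ?b" "cell (Suc m) ?b" "rbd ?j e' ?a = ?a" "cell (Suc ?j) ?a" "cell (Suc m) ?a" for e'
    using R.bd_cell[of ?b "Suc m" False] R.bd_cell[of ?a "Suc m" False] a(3,4) b(3,4) by auto
  have zero: "der (Suc ?j) ?b = 0" "der (Suc ?j) ?a = 0" using der_low[of "Suc m" "Suc ?j"] bb by auto
  have c1: "rbd m False ?b = rbd m True (A ?j e)"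
  proof -
    have "rbd m True (A ?j e) = rbd m True (rcp m y ?a)"
      using R.cyl_bd_below[OF a(7) mj(3,2)] R.cyl_par[OF a(7) mj(3)] by simp
    then show ?thesis using a b by (simp add: R.bd_cp_True)
  qed
  have c2: "rbd m False (B ?j e) = rbd m True ?a"
  proof -
    have "rbd m False (B ?j e) = rbd m False (rcp m ?b y)"
      using R.cyl_bd_below[OF b(7) mj(3,2)] by simp
    then show ?thesis using a b by (simp add: R.bd_cp_False)
  qed
  have d1: "der (Suc ?j) (R.od m (R.tau ?b) A ?j e) = der (Suc ?j) (A ?j e)"
    using der_cp[OF mj(1) bb(2) ca c1] zero Suc(4) bb(1) by (simp add: R.od_nth R.tau_nth del: add_Suc)
  have d2: "der (Suc ?j) (R.od m B (R.tau ?a) ?j e) = der (Suc ?j) (B ?j e)"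
    using der_cp[OF mj(1) cb bb(5) c2] zero Suc(4) bb(4) by (simp add: R.od_nth R.tau_nth del: add_Suc)
  have "der (Suc ?j) (R.cc d (Suc m) (R.od m (R.tau ?b) A) (R.od m B (R.tau ?a)) e) =
     der (Suc ?j) (R.od m (R.tau ?b) A ?j e) + der (Suc ?j) (R.od m B (R.tau ?a) ?j e)"
    by (rule Suc.IH[OF R.cyl_tail_left[OF Suc(2,3)] R.cyl_tail_right[OF Suc(2,3)]]) simp
  then show ?case using d1 d2 by simp
qed

text \<open>The first step attaches \<open>A 0 True\<close> along a 0-cell and so contributes the
  action of the arrow below it; the remaining steps are those of \<open>der_lx\<close>.\<close>

lemma der_lx0:
  assumes "R.cyl 0 x y A" "cell n x" "0 < n"
  shows "der n (R.lx n 0 x A) = C.act (ua (A 0 True)) (der n x) + der n (A (n - 1) True)"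
proof -
  obtain N where n: "n = Suc N" using assms(3) by (cases n) auto
  note a = R.cylD[OF assms(1)]
  have ca: "cell 1 (A 0 True)" "cell n (A 0 True)" using a(3,4) R.cyl_cell[OF assms(1) assms(3)] by auto
  have c: "rbd 0 False (A 0 True) = rbd 0 True x" using a by simp
  have cx: "cell n (rcp 0 (A 0 True) x)" using ca assms c by (simp add: R.cp_in R.bd_cp)
  have dx: "der n (rcp 0 (A 0 True) x) = der n (A 0 True) + C.act (ua (A 0 True)) (der n x)"
    using der_cp[OF assms(3) ca(2) assms(2) c] by simp
  have "der n (R.lx N 1 (rcp 0 (A 0 True) x) A) = der n (rcp 0 (A 0 True) x) + (if N = 0 then 0 else der n (A (n - 1) True))"
    using der_lx[of 1 "rcp 0 (A 0 True) x" "rcp 0 y (A 0 False)" A n N] a(7) cx n by simp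
  then show ?thesis using der_low[of 1 n "A 0 True"] ca dx n by (cases "N = 0") auto
qed

end

section \<open>A functorial choice of cones\<close>

context cone_resolution
begin

lemma oc_act: "m \<in> C.Fr I lc cc0 \<Longrightarrow> C.act (ua oc) m = m"
proof -
  assume m: "m \<in> C.Fr I lc cc0"
  have "ua oc = idn C 0 cc0"
    using ua_bd0[OF oc_cell(1), of True] oc_cell tob_cell0[of oc] by (simp add: oc_def cc0_def)
  then show ?thesis using C.act_id[OF m] by simp
qed

text \<open>The target is a unit for every composition that occurs, so each attached cell absorbs
  what was there before and the last one remains.\<close>

lemma ry_oc:
  assumes "R.cyl m x y A" "\<And>e. rbd m e y = y" "0 < d"
  shows "R.ry d m y A = A (m + d - 1) False"
  using assms
proof (induction d arbitrary: m x y)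
  case (Suc d)
  note a = R.cylD[OF Suc(2)]
  have e: "rcp m y (A m False) = A m False"
    using R.cp_unit_left[of "A m False" m] a Suc(3) by simp
  show ?case
  proof (cases "d = 0")
    case True
    then show ?thesis using e by simp
  next
    case False
    have "R.ry d (Suc m) (rcp m y (A m False)) A = A (Suc m + d - 1) False"
      by (rule Suc.IH[OF a(7)]) (use e a(4)[of _ False] False in auto)
    then show ?thesis by simp
  qed
qed simp

text \<open>Partial sections are extended one dimension at a time by freeness, with
  \<open>zeta\<close> on generators of dimension 0 and \<open>section_step\<close> above. A coherent
  sequence is kept because each functor covers only cells of bounded dimension.\<close>

lemma section_exists:
  "\<exists>G. \<forall>n. (functor_below n seqs rbd rcp fam.famS fam.fambd fam.famcp (G n) \<and> (\<forall>m z. m < n \<longrightarrow> cell m z \<longrightarrow> fst (G n z) = z)) \<and>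
     (\<forall>m z. m < n \<longrightarrow> cell m z \<longrightarrow> G (Suc n) z = G n z)"
proof (rule dependent_nat_choice)
  show "\<exists>g. functor_below 0 seqs rbd rcp fam.famS fam.fambd fam.famcp g \<and> (\<forall>m z. m < 0 \<longrightarrow> cell m z \<longrightarrow> fst (g z) = z)"
    by (simp add: functor_below_def)
next
  fix g :: "(nat \<Rightarrow> 'p) \<Rightarrow> (nat \<Rightarrow> 'p) \<times> ('c \<Rightarrow> (nat \<Rightarrow> 'p) \<times> (nat \<Rightarrow> 'p) \<times> (nat \<Rightarrow> bool \<Rightarrow> nat \<Rightarrow> 'p))" and n
  assume "functor_below n seqs rbd rcp fam.famS fam.fambd fam.famcp g \<and> (\<forall>m z. m < n \<longrightarrow> cell m z \<longrightarrow> fst (g z) = z)"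
  then have g: "functor_below n seqs rbd rcp fam.famS fam.fambd fam.famcp g" and g1: "\<And>m z. m < n \<Longrightarrow> cell m z \<Longrightarrow> fst (g z) = z"
    by auto
  have "\<exists>y\<in>fam.famS. fst y = iota n i \<and> fam.fambd n False y = y \<and> (\<forall>k<n. \<forall>e. fam.fambd k e y = g (rbd k e (iota n i)))"
    if i: "i \<in> Sig n" for i
  proof (cases n)
    case 0
    let ?x = "iota 0 i"
    have x: "cell 0 ?x" "rbd 0 True ?x = ?x" using iota_Sig[OF i] 0 R.bd_cell[of ?x 0 False 0 True] by auto
    have "fam.fambd 0 True (?x, \<lambda>_. undefined) = (?x, restrict (zeta ?x) (Fib ?x))" using x by (simp add: fam.fambd_def)
    moreover have "(?x, restrict (zeta ?x) (Fib ?x)) \<in> fam.famS"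
      using x fam.zeta_in[of ?x _ True] fam.zeta_bd[of ?x _ True] fam.pi_zeta[of ?x _ True] fam.pull_bd0[of ?x _ True]
      by (auto simp: fam.famS_def)
    moreover have "fam.fambd 0 False (?x, restrict (zeta ?x) (Fib ?x)) = (?x, restrict (zeta ?x) (Fib ?x))"
      using x by (simp add: fam.fambd_def)
    ultimately show ?thesis using 0 by (intro bexI[of _ "(?x, restrict (zeta ?x) (Fib ?x))"]) auto
  next
    case (Suc N)
    show ?thesis using section_step[of N g "iota n i"] g g1 Suc iota_Sig[OF i] by (simp add: less_Suc_eq_le)
  qed
  then obtain y where y: "\<And>i. i \<in> Sig n \<Longrightarrow> y i \<in> fam.famS" "\<And>i. i \<in> Sig n \<Longrightarrow> fst (y i) = iota n i"
    "\<And>i. i \<in> Sig n \<Longrightarrow> fam.fambd n False (y i) = y i"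
    "\<And>i k e. i \<in> Sig n \<Longrightarrow> k < n \<Longrightarrow> fam.fambd k e (y i) = g (rbd k e (iota n i))" by metis
  from extend_functor[OF fam.oset_fam g y(1,3,4)] obtain g' where g':
    "functor_below (Suc n) seqs rbd rcp fam.famS fam.fambd fam.famcp g'"
    "\<forall>z m. z \<in> seqs \<longrightarrow> m < n \<longrightarrow> rbd m False z = z \<longrightarrow> g' z = g z" "\<forall>i\<in>Sig n. g' (iota n i) = y i"
    by blast
  have f1: "functor_below (Suc n) seqs rbd rcp seqs rbd rcp (\<lambda>z. fst (g' z))"
    by (rule functor_below_comp[OF g'(1)]) (auto simp: fam.famS_def fam.fambd_def fam.famcp_def)
  have f2: "functor_below (Suc n) seqs rbd rcp seqs rbd rcp (\<lambda>z. z)" by (auto simp: functor_below_def)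
  have top: "fst (g' z) = z" if "cell n z" for z
    by (rule functor_unique[OF oset_seqs f2 f1]) (use that g' g1 y in auto)
  have "fst (g' z) = z" if "m < Suc n" "cell m z" for m z
  proof -
    have "cell n z" using R.bd_cell[of z m False n False] that by simp
    then show ?thesis by (rule top)
  qed
  then show "\<exists>g'. (functor_below (Suc n) seqs rbd rcp fam.famS fam.fambd fam.famcp g' \<and> (\<forall>m z. m < Suc n \<longrightarrow> cell m z \<longrightarrow> fst (g' z) = z)) \<and>
     (\<forall>m z. m < n \<longrightarrow> cell m z \<longrightarrow> g' z = g z)"
    using g' by (intro exI[of _ g']) auto
qed

definition sec where
  "sec = (SOME G. \<forall>n. (functor_below n seqs rbd rcp fam.famS fam.fambd fam.famcp (G n) \<and> (\<forall>m z. m < n \<longrightarrow> cell m z \<longrightarrow> fst (G n z) = z)) \<and>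
     (\<forall>m z. m < n \<longrightarrow> cell m z \<longrightarrow> G (Suc n) z = G n z))"

lemma sec_all: "\<forall>n. (functor_below n seqs rbd rcp fam.famS fam.fambd fam.famcp (sec n) \<and> (\<forall>m z. m < n \<longrightarrow> cell m z \<longrightarrow> fst (sec n z) = z)) \<and>
     (\<forall>m z. m < n \<longrightarrow> cell m z \<longrightarrow> sec (Suc n) z = sec n z)"
  unfolding sec_def by (rule someI_ex[OF section_exists])

lemma sec_functor_below: "functor_below n seqs rbd rcp fam.famS fam.fambd fam.famcp (sec n)"
  and sec_fst: "m < n \<Longrightarrow> cell m z \<Longrightarrow> fst (sec n z) = z"
  and sec_Suc: "m < n \<Longrightarrow> cell m z \<Longrightarrow> sec (Suc n) z = sec n z"
  using sec_all by blast+

lemma sec_stable: "m < n \<Longrightarrow> cell m z \<Longrightarrow> sec n z = sec (Suc m) z"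
  by (induction n) (auto simp: sec_Suc less_Suc_eq)

text \<open>\<open>al n x f\<close> is the sequence of cells of the cone over the \<open>n\<close>-cell \<open>x\<close> selected by \<open>f\<close>.\<close>

definition al :: "nat \<Rightarrow> (nat \<Rightarrow> 'p) \<Rightarrow> 'c \<Rightarrow> nat \<Rightarrow> bool \<Rightarrow> nat \<Rightarrow> 'p" where
  "al n x f = snd (snd (snd (sec (Suc n) x) f))"

lemma sec_eq: "cell n x \<Longrightarrow> sec (Suc n) x = (x, snd (sec (Suc n) x)) \<and> (x, snd (sec (Suc n) x)) \<in> fam.famS"
proof -
  assume x: "cell n x"
  then have "fst (sec (Suc n) x) = x" using sec_fst[of n "Suc n" x] by simp
  then have e: "sec (Suc n) x = (x, snd (sec (Suc n) x))" by (cases "sec (Suc n) x") simp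
  have "sec (Suc n) x \<in> fam.famS" using functor_belowD(1)[OF sec_functor_below[where n = "Suc n"], where x = x and m = n] x by simp
  then show ?thesis using e by simp
qed

lemma al_cyl:
  assumes "cell n x" "f \<in> Fib (rbd 0 True x)"
  shows "snd (sec (Suc n) x) f = (x, oc, al n x f)" "R.cyl 0 x oc (al n x f)"
  using fam_cone[of x "snd (sec (Suc n) x)" f] sec_eq[OF assms(1)] assms(2) by (auto simp: al_def)

lemma sec_bd: "cell n x \<Longrightarrow> fam.fambd k e (x, snd (sec (Suc n) x)) = sec (Suc n) (rbd k e x)"
  using sec_eq[of x n] functor_belowD(2)[OF sec_functor_below[where n = "Suc n"], where x = x and m = n and k = k and e = e] by simp

lemma al_0:
  assumes "cell 0 x" "f \<in> Fib x"
  shows "al 0 x f = (\<lambda>j e. lf x f)"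
proof -
  have x: "rbd 0 e x = x" for e using R.bd_cell[of x 0 False 0 e] assms by simp
  have "(x, restrict (zeta x) (Fib x)) = sec 1 x" using sec_bd[OF assms(1), of 0 True] x by (simp add: fam.fambd_def)
  then have "snd (sec 1 x) f = zeta x f" using assms(2) by (metis restrict_apply' snd_conv)
  then show ?thesis by (simp add: al_def zeta_def)
qed

text \<open>For \<open>n > 0\<close> an \<open>n\<close>-cell is its own \<open>n\<close>-boundary,
  hence so is its cone, and truncation repeats one cell from \<open>n\<close> on.\<close>

lemma al_const:
  assumes x: "cell n x" and f: "f \<in> Fib (rbd 0 True x)" and j: "n \<le> j"
  shows "al n x f j e = al n x f n e'"
proof (cases "n = 0")
  case True
  then have "rbd 0 True x = x" using R.bd_cell[of x 0 False 0 True] x by simp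
  then show ?thesis using al_0 x f True by simp
next
  case False
  have "sec (Suc n) (rbd n False x) = (x, snd (sec (Suc n) x))" using x sec_eq[OF x] by simp
  then have "restrict (\<lambda>f. R.gbd n False (snd (sec (Suc n) x) f)) (Fib (rbd 0 True x)) = snd (sec (Suc n) x)"
    using sec_bd[OF x, of n False] False by (simp add: fam.fambd_def)
  from fun_cong[OF this, of f] have "R.gbd n False (x, oc, al n x f) = (x, oc, al n x f)"
    using f al_cyl(1)[OF x f] by simp
  then have t: "R.trunc n False (al n x f) = al n x f" by (simp add: R.gbd_def)
  show ?thesis
    using fun_cong[OF fun_cong[OF t, of j], of e] fun_cong[OF fun_cong[OF t, of n], of e'] j by (simp add: R.trunc_def)
qed

lemma al_ua:
  assumes x: "cell n x" and f: "f \<in> Fib (rbd 0 True x)"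
  shows "ua (al n x f 0 True) = f" "al n x f 0 True = lf (rbd 0 True x) f" "al n x f 0 False = lf (rbd 0 False x) (pull x f)"
proof -
  have xs: "x \<in> seqs" using x by simp
  note S = sec_eq[OF x, THEN conjunct2]
  have z: "R.gbd 0 True (x, oc, al n x f) = zeta (rbd 0 True x) f" "R.gbd 0 False (x, oc, al n x f) = zeta (rbd 0 False x) (pull x f)"
    using fam.famD(5,6)[OF S f] al_cyl(1)[OF x f] by auto
  show a: "al n x f 0 True = lf (rbd 0 True x) f"
    using fun_cong[OF fun_cong[OF arg_cong[OF z(1), of "\<lambda>u. snd (snd u)"], of 0], of True] by (simp add: R.gbd_def zeta_def R.trunc_def)
  show "al n x f 0 False = lf (rbd 0 False x) (pull x f)"
    using fun_cong[OF fun_cong[OF arg_cong[OF z(2), of "\<lambda>u. snd (snd u)"], of 0], of True] by (simp add: R.gbd_def zeta_def R.trunc_def)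
  show "ua (al n x f 0 True) = f" unfolding a by (rule lf_props(4)[OF _ f]) (simp add: xs R.bd_ge)
qed

text \<open>The boundary of the cone over \<open>x\<close> is the cone over the boundary, by
  functoriality; only the 0-dimensional source needs a change of index.\<close>

lemma al_bd:
  assumes x: "cell (Suc N) x" and f: "f \<in> Fib (rbd 0 True x)"
  shows "al (Suc N) x f N True = al N (rbd N True x) f N False"
    "al (Suc N) x f N False = al N (rbd N False x) (if N = 0 then pull x f else f) N False"
proof -
  have xs: "x \<in> seqs" using x by simp
  have "al (Suc N) x f N e = al N (rbd N e x) (if N = 0 \<and> \<not> e then pull x f else f) N False" for e
  proof (cases "N = 0")
    case True
    have c: "cell 0 (rbd 0 e x)" for e using xs by (simp add: R.bd_ge)
    show ?thesis using al_ua(2,3)[OF x f] al_0[OF c[of True] f] al_0[OF c[of False] fam.pull_in[OF xs f]] True by (cases e) auto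
  next
    case False
    have cN: "cell N (rbd N e x)" using xs by (simp add: R.bd_ge)
    have b: "rbd 0 True (rbd N e x) = rbd 0 True x" using R.bd_lt[OF xs, of 0 N] False by simp
    have "sec (Suc (Suc N)) (rbd N e x) = sec (Suc N) (rbd N e x)" using sec_Suc[of N "Suc N"] cN by simp
    then have "restrict (\<lambda>f. R.gbd N e (snd (sec (Suc (Suc N)) x) f)) (Fib (rbd 0 True x)) = snd (sec (Suc N) (rbd N e x))"
      using arg_cong[OF sec_bd[OF x, of N e], of snd] False by (simp add: fam.fambd_def)
    from fun_cong[OF this, of f] have "R.gbd N e (x, oc, al (Suc N) x f) = (rbd N e x, oc, al N (rbd N e x) f)"
      using f al_cyl(1)[OF x f] al_cyl(1)[OF cN, of f] b by simp
    then have "R.trunc N e (al (Suc N) x f) = al N (rbd N e x) f" by (simp add: R.gbd_def)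
    from fun_cong[OF fun_cong[OF this, of N], of False] show ?thesis using False by (simp add: R.trunc_def)
  qed
  from this[of True] this[of False] show "al (Suc N) x f N True = al N (rbd N True x) f N False"
    "al (Suc N) x f N False = al N (rbd N False x) (if N = 0 then pull x f else f) N False" by simp_all
qed

section \<open>Top cells of cones and the contracting homotopy\<close>

definition top :: "nat \<Rightarrow> (nat \<Rightarrow> 'p) \<Rightarrow> 'c \<Rightarrow> nat \<Rightarrow> 'p" where
  "top n x f = al n x f n False"

lemma top_cell: "cell n x \<Longrightarrow> f \<in> Fib (rbd 0 True x) \<Longrightarrow> cell (Suc n) (top n x f)"
  unfolding top_def by (rule cyl_nth_cell[OF al_cyl(2)]) auto

lemma top_tob:
  assumes "cell n x" "f \<in> Fib (rbd 0 True x)"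
  shows "tob (top n x f) = cc0"
proof -
  note c = al_cyl(2)[OF assms]
  note t = top_cell[OF assms]
  have "rbd 0 True (top n x f) = oc"
  proof (cases n)
    case 0
    then show ?thesis using R.cylD(6)[OF c, of False] oc_cell by (simp add: top_def)
  next
    case (Suc N)
    have "rbd 0 True (top n x f) = rbd 0 True (rcp 0 oc (al n x f 0 False))"
      unfolding top_def using R.cyl_bd_below[OF R.cylD(7)[OF c], of 0 n] R.cyl_par[OF R.cylD(7)[OF c], of 0] Suc by simp
    also have "\<dots> = oc" using R.cylD(3,6)[OF c] oc_cell by (simp add: R.bd_cp_True)
    finally show ?thesis .
  qed
  then show ?thesis using tob_bd(1)[of "top n x f" 0 True] t tob_cell0[of oc] oc_cell by (simp add: oc_def cc0_def)
qed

text \<open>By functoriality the cone over a composite is a composite of cones, whose top cell is a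
  concatenation of whiskered top cells. \<open>der_con\<close> splits it, and the whiskers
  contribute nothing.\<close>

lemma top_comp:
  assumes x: "cell n x" and y: "cell n y" and k: "k < n" and c: "rbd k False x = rbd k True y"
    and f: "f \<in> Fib (rbd 0 True x)"
  defines "f' \<equiv> if k = 0 then pull x f else f"
  shows "f' \<in> Fib (rbd 0 True y)"
    "der (Suc n) (top n (rcp k x y) f) = der (Suc n) (top n x f) + der (Suc n) (top n y f')"
proof -
  let ?px = "snd (sec (Suc n) x)" and ?py = "snd (sec (Suc n) y)"
  have sx: "sec (Suc n) x = (x, ?px)" "(x, ?px) \<in> fam.famS" and sy: "sec (Suc n) y = (y, ?py)" "(y, ?py) \<in> fam.famS"
    using sec_eq[OF x] sec_eq[OF y] by auto
  have "fam.fambd k False (x, ?px) = fam.fambd k True (y, ?py)" using sec_bd[OF x] sec_bd[OF y] c by simp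
  note fc = fam.fam_composable[OF sx(2) sy(2) this f, folded f'_def]
  show f': "f' \<in> Fib (rbd 0 True y)" by (rule fc(2))
  let ?A = "al n x f" and ?B = "al n y f'"
  note A = al_cyl[OF x f] and B = al_cyl[OF y f']
  have g: "(x, oc, ?A) \<in> R.gS" "(y, oc, ?B) \<in> R.gS" using A B by (simp_all add: R.gS_def)
  note cc = R.gbd_eqD[OF g fc(3)[unfolded A(1) B(1)]]
  have xy: "cell n (rcp k x y)" using x y c k by (simp add: R.cp_in R.bd_cp)
  have "sec (Suc n) (rcp k x y) = fam.famcp k (x, ?px) (y, ?py)"
    using functor_belowD(3)[OF sec_functor_below[where n = "Suc n"], where x = x and m = n and y = y and k = k] x y c sx(1) sy(1) by simp
  then have "snd (sec (Suc n) (rcp k x y)) f = R.gcp k (?px f) (?py f')"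
    using f by (auto simp: fam.famcp_def f'_def)
  then have al: "al n (rcp k x y) f = R.comp 0 k y oc ?A ?B"
    unfolding A(1) B(1) by (simp add: al_def R.gcp_def)
  define xk yk where xy': "xk = R.lx k 0 y ?B" "yk = R.ry k 0 oc ?A"
  note ck = R.ccomp_lx[OF cc, simplified, folded xy']
  note tl = R.ccomp_tails[OF ck] and fk = R.ccompD[OF ck]
  note sA = R.cylD[OF fk(1)] and sB = R.cylD[OF fk(2)]
  have kn: "Suc k \<le> n" "k < Suc k" using k by auto
  obtain d where d: "n = Suc k + d" using kn(1) le_Suc_ex by blast
  have An: "cell (Suc n) (?A n False)" "cell (Suc n) (?B n False)" using cyl_nth_cell[OF A(2)] cyl_nth_cell[OF B(2)] by auto
  have zero: "der (Suc n) (rbd n False z) = 0" "cell (Suc n) (rbd n False z)" if "z \<in> seqs" for z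
    using that der_low[of n "Suc n" "rbd n False z"] R.bd_cell[of "rbd n False z" n False "Suc n" False] by (auto simp: R.bd_ge)
  have c1: "rbd k False (?A n False) = rbd k True (rbd n False xk)"
    using R.cyl_bd_below[OF sA(7) kn(2,1), of False False] sA fk(4,10) k by (simp add: R.bd_cp_False R.bd_lt)
  have c2: "rbd k False (rbd n False yk) = rbd k True (?B n False)"
    using R.cyl_bd_below[OF sB(7) kn(2,1), of True False] R.cyl_par[OF sB(7) kn(2), of True] sB fk(5,9) k by (simp add: R.bd_cp_True R.bd_lt)
  have k': "k < Suc n" using k by simp
  have d1: "der (Suc n) (R.od k ?A (R.tau xk) n False) = der (Suc n) (?A n False)"
    using der_cp[OF k' An(1) zero(2)[OF fk(10)] c1] zero(1)[OF fk(10)] by (simp add: R.od_nth R.tau_nth)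
  \<comment> \<open>For \<open>k = 0\<close> the derivation twists by the arrow below the left
    whisker. That whisker is the common apex, whose arrow is an identity.\<close>
  have d2: "der (Suc n) (R.od k (R.tau yk) ?B n False) = der (Suc n) (?B n False)"
  proof (cases "k = 0")
    case True
    then have yk: "yk = oc" by (simp add: xy')
    have "der (Suc n) (?B n False) \<in> Mo (Suc n) cc0"
      using der_in[OF An(2)] top_tob[OF y f'] by (simp add: top_def)
    then show ?thesis
      using der_cp[OF k' zero(2)[OF fk(9)] An(2) c2] zero(1)[OF fk(9)] True oc_cell oc_act
      by (simp add: R.od_nth R.tau_nth yk)
  next
    case False
    then show ?thesis
      using der_cp[OF k' zero(2)[OF fk(9)] An(2) c2] zero(1)[OF fk(9)] by (simp add: R.od_nth R.tau_nth)
  qed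
  have "top n (rcp k x y) f = R.con (Suc k) (R.od k ?A (R.tau xk)) (R.od k (R.tau yk) ?B) n False"
    using k by (simp add: top_def al R.comp_def R.gc_def xy')
  also have "\<dots> = R.cc d (Suc k) (R.od k ?A (R.tau xk)) (R.od k (R.tau yk) ?B) False" by (simp add: R.con_def d)
  finally show "der (Suc n) (top n (rcp k x y) f) = der (Suc n) (top n x f) + der (Suc n) (top n y f')"
    using der_con[OF tl, of d False] d1 d2 by (simp add: d top_def)
qed

text \<open>The sign reflects that the cell to be recovered sits in the source of the top cell, and
  sources enter the differential negatively.\<close>

definition hh :: "nat \<Rightarrow> ('p \<times> 'c \<Rightarrow>\<^sub>0 int) \<Rightarrow> ('p \<times> 'c \<Rightarrow>\<^sub>0 int)" where
  "hh n = frag_extend (\<lambda>(i, f). - der (Suc n) (top n (iota n i) f))"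

lemma hh_simps [simp]:
  "hh n 0 = 0" "hh n (a - b) = hh n a - hh n b" "hh n (a + b) = hh n a + hh n b" "hh n (- a) = - hh n a"
  "hh n (frag_of (i, f)) = - der (Suc n) (top n (iota n i) f)"
  by (simp_all add: hh_def frag_extend_diff frag_extend_add frag_extend_minus)

lemma Fib_iff: "x \<in> seqs \<Longrightarrow> f \<in> Fib (rbd 0 True x) \<longleftrightarrow> f \<in> cells C 1 \<and> src C 0 f = tob x \<and> tgt C 0 f = cc0"
  using tob_bd(1)[of x 0 True] by (simp add: Fib_def)

text \<open>The homotopy is specified on basis elements only. Additivity of top cells, a consequence
  of the functorial choice of cones, extends the formula to all cells; this evaluates
  \<open>hh\<close> on boundaries.\<close>

lemma hh_der:
  assumes "cell n x" "f \<in> Fib (rbd 0 True x)"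
  shows "hh n (C.act f (der n x)) = - der (Suc n) (top n x f)"
proof -
  let ?Q = "\<lambda>x. \<forall>f\<in>Fib (rbd 0 True x). hh n (C.act f (der n x)) = - der (Suc n) (top n x f)"
  have "?Q x"
  proof (rule cell_induct[where Q = ?Q and n = n])
    fix x m assume x: "x \<in> seqs" "m < n" "rbd m False x = x"
    show "?Q x"
    proof
      fix f assume f: "f \<in> Fib (rbd 0 True x)"
      have cm: "cell m x" and cn: "cell n x" using x R.bd_cell[of x m False n False] by auto
      have "sec (Suc n) x = sec (Suc m) x" using sec_stable[of m "Suc n" x] cm x(2) by simp
      then have "al n x f = al m x f" by (simp add: al_def)
      then have "top n x f = top m x f" using al_const[OF cm f, of n False False] x(2) by (simp add: top_def)
      then have "der (Suc n) (top n x f) = 0" using der_low[of "Suc m" "Suc n"] top_cell[OF cm f] x(2) by simp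
      then show "hh n (C.act f (der n x)) = - der (Suc n) (top n x f)" using der_low[OF x(2) cm] by simp
    qed
  next
    fix i assume i: "i \<in> Sig n"
    have xs: "iota n i \<in> seqs" using iota_Sig[OF i] by simp
    show "?Q (iota n i)"
    proof
      fix f assume "f \<in> Fib (rbd 0 True (iota n i))"
      then have "f \<in> cells C 1" "src C 0 f = loc n i" using Fib_iff[OF xs] by (auto simp: loc_def)
      then have "cmp C 1 0 f (idn C 0 (loc n i)) = f" using C.arrow_id(1)[of f] by simp
      then show "hh n (C.act f (der n (iota n i))) = - der (Suc n) (top n (iota n i) f)" by (simp add: der_gen[OF i])
    qed
  next
    fix x y k assume x: "x \<in> seqs" "y \<in> seqs" "rbd n False x = x" "rbd n False y = y" and k: "k < n"
      and c: "rbd k False x = rbd k True y" and Q: "?Q x" "?Q y"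
    have b: "rbd 0 True (rcp k x y) = rbd 0 True x"
      using R.bd_cp_True[OF x(1,2), of 0] R.bd_cp_below_left[OF x(1,2) c, of 0] c by (cases "k = 0") auto
    show "?Q (rcp k x y)"
      unfolding b
    proof
      fix f assume f: "f \<in> Fib (rbd 0 True x)"
      have cx: "cell n x" "cell n y" using x by auto
      note t = top_comp[OF cx k c f]
      have ff: "f \<in> cells C 1" "src C 0 f = tob x" using f Fib_iff[OF x(1)] by auto
      have dy: "der n y \<in> Mo n (tob y)" using der_in[OF cx(2)] .
      have "C.act f (C.act (ua x) (der n y)) = C.act (pull x f) (der n y)" if "k = 0"
        using C.act_act[OF dy ua_in[OF x(1)] _ ff(1)] composable_ua(1)[OF x(1,2) c that] ff(2) by (simp add: pull_def)
      then show "hh n (C.act f (der n (rcp k x y))) = - der (Suc n) (top n (rcp k x y) f)"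
        using t Q f der_cp[OF k cx c] by (cases "k = 0") simp_all
    qed
  qed (use assms in auto)
  then show ?thesis using assms(2) by blast
qed

lemma Mo_gen: "frag_of (i, f) \<in> Mo n cc0 \<Longrightarrow> i \<in> Sig n \<and> cell n (iota n i) \<and> f \<in> Fib (rbd 0 True (iota n i))"
  using iota_Sig[of i n] Fib_iff[of "iota n i" f] by (auto simp: loc_def simp del: One_nat_def)

lemma hh_in: "m \<in> Mo n cc0 \<Longrightarrow> hh n m \<in> Mo (Suc n) cc0"
proof (induction rule: C.Fr_induct)
  case (gen i f)
  then have "frag_of (i, f) \<in> Mo n cc0" by simp
  from Mo_gen[OF this] show ?case using der_in[OF top_cell] top_tob by simp
qed auto

lemma nex_hh_0:
  assumes "m \<in> Mo 0 cc0"
  shows "C.nex (Di 0) (hh 0 m) = m - frag_extend (\<lambda>_. der 0 oc) (C.aug m)"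
  using assms
proof (induction rule: C.Fr_induct)
  case (gen i f)
  then have "frag_of (i, f) \<in> Mo 0 cc0" by simp
  note i = Mo_gen[OF this]
  let ?x = "iota 0 i"
  have x: "cell 0 ?x" and f: "f \<in> Fib (rbd 0 True ?x)" using i by auto
  have xx: "rbd 0 True ?x = ?x" using R.bd_cell[of ?x 0 False 0 True] x by simp
  have t: "top 0 ?x f = lf ?x f" using al_0[OF x] f xx by (simp add: top_def)
  note l = lf_props[OF x f[unfolded xx]]
  have "cmp C 1 0 f (idn C 0 (loc 0 i)) = f" using C.arrow_id(1)[of f] gen by simp
  then have "C.act f (der 0 ?x) = frag_of (i, f)" using der_gen[of i 0] i by simp
  then have "der_bd 0 (top 0 ?x f) = der 0 oc - frag_of (i, f)"
    using l t by (simp add: der_bd_def)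
  then show ?case using nex_der[of "top 0 ?x f" 0] top_cell[OF x f] by simp
qed (auto simp: frag_extend_diff)

text \<open>The source of the top cell contributes the basis element and the top cell over the
  target of the generator, and its target contributes the top cell over the source of the generator.
  By \<open>hh_der\<close> the two top cells account for \<open>hh\<close> of the boundary.\<close>

lemma nex_hh_Suc:
  assumes "m \<in> Mo (Suc N) cc0"
  shows "C.nex (Di (Suc N)) (hh (Suc N) m) = m - hh N (C.nex (Di N) m)"
  using assms
proof (induction rule: C.Fr_induct)
  case (gen i f)
  then have "frag_of (i, f) \<in> Mo (Suc N) cc0" by simp
  note i = Mo_gen[OF this]
  let ?n = "Suc N" let ?x = "iota ?n i" let ?A = "al ?n ?x f"
  have x: "cell ?n ?x" and xs: "?x \<in> seqs" and f: "f \<in> Fib (rbd 0 True ?x)" using i by auto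
  note c = al_cyl(2)[OF x f]
  have cl: "R.cyl ?n (R.lx ?n 0 ?x ?A) (R.ry ?n 0 oc ?A) ?A" using R.cyl_lx[OF c, of ?n] by (simp only: add_0)
  have ff: "f \<in> cells C 1" "src C 0 f = tob ?x" using f Fib_iff[OF xs] by auto
  have lxc: "cell ?n (R.lx ?n 0 ?x ?A)"
  proof -
    have c0: "R.cyl 1 (rcp 0 (?A 0 True) ?x) (rcp 0 oc (?A 0 False)) ?A" using R.cylD(7)[OF c] by simp
    have "cell ?n (rcp 0 (?A 0 True) ?x)"
      using R.cylD(1,3,5)[OF c] x R.cyl_cell[OF c, of ?n False True] by (simp add: R.cp_in R.bd_cp)
    from der_lx[OF c0 this, of N] show ?thesis by simp
  qed
  \<comment> \<open>The source of the top entry is the end of the cone carried up to level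
    \<open>?n\<close>, by definition of a cylinder.\<close>
  have src: "rbd ?n False (top ?n ?x f) = R.lx ?n 0 ?x ?A"
    using R.cylD(5)[OF cl, of False] lxc by (simp add: top_def)
  \<comment> \<open>The other end is built from the apex, so only the last entry below the top
    survives.\<close>
  have tgt: "rbd ?n True (top ?n ?x f) = ?A N False"
  proof -
    have "R.ry ?n 0 oc ?A = ?A N False" using ry_oc[OF c, of ?n] oc_cell by simp
    then show ?thesis using R.cylD(6)[OF cl, of False] cyl_nth_cell[OF c, of N False] by (simp add: top_def)
  qed
  let ?f' = "if N = 0 then pull ?x f else f"
  have cN: "cell N (rbd N e ?x)" for e using xs by (simp add: R.bd_ge)
  have fT: "f \<in> Fib (rbd 0 True (rbd N True ?x))" "?f' \<in> Fib (rbd 0 True (rbd N False ?x))"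
    using f fam.pull_in[OF xs f] xs by (cases "N = 0"; simp add: R.bd_ge R.bd_lt)+
  have aT: "?A N True = top N (rbd N True ?x) f" and aF: "?A N False = top N (rbd N False ?x) ?f'"
    using al_bd[OF x f] by (simp_all add: top_def)
  have "der ?n (R.lx ?n 0 ?x ?A) = C.act f (der ?n ?x) + der ?n (?A N True)"
    using der_lx0[OF c x] al_ua(1)[OF x f] by simp
  moreover have "C.act f (der ?n ?x) = frag_of (i, f)"
    using der_gen[of i ?n] i C.arrow_id(1)[of f] ff by (simp add: loc_def)
  moreover have "der ?n (?A N True) = - hh N (C.act f (der N (rbd N True ?x)))"
    using hh_der[OF cN fT(1)] by (simp add: aT)
  moreover have "der ?n (?A N False) = - hh N (C.act ?f' (der N (rbd N False ?x)))"
    using hh_der[OF cN fT(2)] by (simp add: aF)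
  \<comment> \<open>For \<open>N = 0\<close> the twist in \<open>der_bd\<close> by the arrow below
    the generator is exactly the change of index from \<open>f\<close> to
    \<open>pull ?x f\<close>.\<close>
  moreover have "C.act f (der_bd N ?x) = C.act f (der N (rbd N True ?x)) - C.act ?f' (der N (rbd N False ?x))"
  proof (cases "N = 0")
    case True
    have "der 0 (rbd 0 False ?x) \<in> Mo 0 (sob ?x)"
      using der_in[of "rbd 0 False ?x" 0] xs tob_bd(1)[OF xs, of 0 False] by (simp add: R.bd_ge)
    from C.act_act[OF this ua_in[OF xs] _ ff(1)] show ?thesis using True ff(2) by (simp add: der_bd_def pull_def)
  qed (simp add: der_bd_def)
  moreover have "C.nex (Di N) (frag_of (i, f)) = C.act f (der_bd N ?x)" by (simp add: Di_def)
  moreover have "C.nex (Di ?n) (hh ?n (frag_of (i, f))) = - (der ?n (?A N False) - der ?n (R.lx ?n 0 ?x ?A))"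
    using nex_der[of "top ?n ?x f" ?n] top_cell[OF x f] by (simp add: der_bd_def src tgt)
  ultimately show ?case by simp
qed auto

lemma exact_cone:
  assumes "z \<in> Mo n cc0" "C.cyc Di n z"
  shows "\<exists>w\<in>Mo (Suc n) cc0. C.nex (Di n) w = z"
proof
  show "C.nex (Di n) (hh n z) = z"
    using nex_hh_0[of z] nex_hh_Suc[of z] assms by (cases n) (auto simp: C.cyc_def)
qed (rule hh_in[OF assms(1)])

lemma aug_cone: "\<exists>z\<in>Mo 0 cc0. C.aug z = frag_of ()"
proof
  have oc: "cell 0 oc" "tob oc = cc0" using oc_cell tob_cell0[of oc] by (auto simp: oc_def cc0_def)
  show "der 0 oc \<in> Mo 0 cc0" using der_in[of oc 0] oc by simp
  show "C.aug (der 0 oc) = frag_of ()" using aug_der0[of oc] oc by simp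
qed

end

context category_resolution
begin

lemma cone_at:
  assumes "c \<in> cells C 0"
  obtains o0 where "cone_resolution P Sig C u o0" "cone_resolution.cc0 u o0 = c"
proof -
  have "c \<in> u 0 ` cells P 0" using assms u_surj by simp
  then obtain o0 where o: "o0 \<in> cells P 0" "u 0 o0 = c" by auto
  have r: "cone_resolution P Sig C u o0"
    by (rule cone_resolution.intro[OF category_resolution_axioms cone_resolution_axioms.intro[OF o(1)]])
  show thesis by (rule that[OF r]) (simp add: cone_resolution.cc0_def[OF r] o)
qed

theorem resolution_Sig: "C.resolution Sig loc Di"
  unfolding C.resolution_def
proof (intro conjI allI ballI impI)
  show "loc n i \<in> cells C 0" if "i \<in> Sig n" for n i using ob_in(2) iota_Sig[OF that] by (simp add: loc_def)
  show "Di n i \<in> Mo n (loc (Suc n) i)" if "i \<in> Sig (Suc n)" for n i by (rule Di_in[OF that])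
  show "C.cyc Di n (Di n i)" if "i \<in> Sig (Suc n)" for n i by (rule cyc_Di[OF that])
  show "\<exists>w\<in>Mo (Suc n) c. C.nex (Di n) w = z" if c: "c \<in> cells C 0" and z: "z \<in> Mo n c" "C.cyc Di n z" for n c z
  proof -
    obtain o0 where r: "cone_resolution P Sig C u o0" "cone_resolution.cc0 u o0 = c" using cone_at[OF c] .
    show ?thesis using cone_resolution.exact_cone[OF r(1), unfolded r(2), OF z] .
  qed
  show "\<exists>z\<in>Mo 0 c. C.aug z = frag_of ()" if c: "c \<in> cells C 0" for c
  proof -
    obtain o0 where r: "cone_resolution P Sig C u o0" "cone_resolution.cc0 u o0 = c" using cone_at[OF c] .
    show ?thesis using cone_resolution.aug_cone[OF r(1), unfolded r(2)] .
  qed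
qed

end

section \<open>The abelianization of a free \<open>\<omega>\<close>-category\<close>

context omega_category
begin

definition cls :: "nat \<Rightarrow> ('a \<Rightarrow>\<^sub>0 int) \<Rightarrow> ('a \<Rightarrow>\<^sub>0 int) set" where
  "cls n c = abel_rel C n #>\<^bsub>free_Abelian_group (cells C n)\<^esub> c"

lemma cls_alt: "cls n c = (\<lambda>r. r + c) ` abel_rel C n"
  by (auto simp: cls_def r_coset_def)

lemma abel_rel_subgroup: "subgroup (abel_rel C n) (free_Abelian_group (cells C n))"
  unfolding abel_rel_def
proof (rule group.generate_is_subgroup[OF group_free_Abelian_group], intro subsetI)
  fix z assume "z \<in> {frag_of (cmp C n k x y) - (frag_of x + frag_of y) | k x y. composable C n k x y}"
  then obtain k x y where z: "z = frag_of (cmp C n k x y) - (frag_of x + frag_of y)" "composable C n k x y" by blast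
  have "x \<in> cells C n" "y \<in> cells C n" "cmp C n k x y \<in> cells C n"
    using z(2) cmp_closed by (auto simp: composable_def)
  then have "Poly_Mapping.keys z \<subseteq> cells C n"
    unfolding z(1) by (intro order_trans[OF keys_diff] Un_least order_trans[OF Poly_Mapping.keys_add]) auto
  then show "z \<in> carrier (free_Abelian_group (cells C n))" by simp
qed

lemma abel_rel_keys: "r \<in> abel_rel C n \<Longrightarrow> Poly_Mapping.keys r \<subseteq> cells C n"
  using subgroup.subset[OF abel_rel_subgroup] by (auto simp: subset_iff)

lemma abel_rel_zero: "0 \<in> abel_rel C n"
  using subgroup.one_closed[OF abel_rel_subgroup, of n] by simp

lemma abel_rel_add: "a \<in> abel_rel C n \<Longrightarrow> b \<in> abel_rel C n \<Longrightarrow> a + b \<in> abel_rel C n"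
  using subgroup.m_closed[OF abel_rel_subgroup, of a n b] by simp

lemma abel_rel_minus: "a \<in> abel_rel C n \<Longrightarrow> - a \<in> abel_rel C n"
  using subgroup.m_inv_closed[OF abel_rel_subgroup, of a n] abel_rel_keys[of a n] by simp

lemma abel_rel_diff: "a \<in> abel_rel C n \<Longrightarrow> b \<in> abel_rel C n \<Longrightarrow> a - b \<in> abel_rel C n"
  using abel_rel_add[of a n "- b"] abel_rel_minus[of b n] by simp

lemma abel_rel_gen: "composable C n k x y \<Longrightarrow> frag_of (cmp C n k x y) - (frag_of x + frag_of y) \<in> abel_rel C n"
  unfolding abel_rel_def by (rule generate.incl) blast

lemma abel_rel_extend:
  assumes r: "r \<in> abel_rel C n" and zero: "0 \<in> T"
    and add: "\<And>a b. a \<in> T \<Longrightarrow> b \<in> T \<Longrightarrow> a + b \<in> T" and minus: "\<And>a. a \<in> T \<Longrightarrow> - a \<in> T"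
    and gen: "\<And>k x y. composable C n k x y \<Longrightarrow> f (cmp C n k x y) - (f x + f y) \<in> T"
  shows "frag_extend f r \<in> T"
  using r unfolding abel_rel_def
proof (induction rule: generate.induct)
  case (incl h)
  then show ?case using gen by (auto simp: frag_extend_diff frag_extend_add)
next
  case (inv h)
  then have "h \<in> abel_rel C n" unfolding abel_rel_def by (rule generate.incl)
  from abel_rel_keys[OF this] show ?case
    using inv gen by (auto simp: frag_extend_minus frag_extend_diff frag_extend_add intro!: minus[of "f _ - _", simplified])
qed (simp_all add: zero add frag_extend_add)

lemma cls_eq: "cls n a = cls n b \<longleftrightarrow> a - b \<in> abel_rel C n"
proof
  assume "cls n a = cls n b"
  moreover have "a \<in> cls n a" unfolding cls_alt using image_eqI[OF _ abel_rel_zero, of a "\<lambda>r. r + a" n] by simp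
  ultimately obtain r where "a = r + b" "r \<in> abel_rel C n" unfolding cls_alt by blast
  then show "a - b \<in> abel_rel C n" by simp
next
  have sub: "cls n a \<subseteq> cls n b" if "a - b \<in> abel_rel C n" for a b
  proof
    fix z assume "z \<in> cls n a"
    then obtain r where r: "z = r + a" "r \<in> abel_rel C n" unfolding cls_alt by blast
    have "z = (r + (a - b)) + b" using r by simp
    then show "z \<in> cls n b" unfolding cls_alt by (rule image_eqI) (rule abel_rel_add[OF r(2) that])
  qed
  assume a: "a - b \<in> abel_rel C n"
  have b: "b - a \<in> abel_rel C n" using abel_rel_minus[OF a] by simp
  show "cls n a = cls n b" using sub[OF a] sub[OF b] by blast
qed

lemma cls_zero: "cls n 0 = abel_rel C n"
  by (simp add: cls_alt)

lemma carrier_abel: "carrier (abel C n) = cls n ` {c. Poly_Mapping.keys c \<subseteq> cells C n}"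
  unfolding abel_def carrier_FactGroup by (auto simp: cls_def)

lemma one_abel: "\<one>\<^bsub>abel C n\<^esub> = cls n 0"
  by (simp add: abel_def cls_zero)

lemma comm_group_abel: "comm_group (abel C n)"
  unfolding abel_def by (rule comm_group.abelian_FactGroup[OF abelian_free_Abelian_group abel_rel_subgroup])

lemma cls_hom: "cls n \<in> hom (free_Abelian_group (cells C n)) (abel C n)"
proof -
  interpret comm_group "free_Abelian_group (cells C n)" by (rule abelian_free_Abelian_group)
  interpret N: normal "abel_rel C n" "free_Abelian_group (cells C n)"
    by (rule subgroup_imp_normal[OF abel_rel_subgroup])
  show ?thesis using N.r_coset_hom_Mod by (simp add: abel_def cls_def[abs_def])
qed

lemma cls_add: "Poly_Mapping.keys a \<subseteq> cells C n \<Longrightarrow> Poly_Mapping.keys b \<subseteq> cells C n \<Longrightarrow>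
    cls n a \<otimes>\<^bsub>abel C n\<^esub> cls n b = cls n (a + b)"
  using hom_mult[OF cls_hom, of a n b] by simp

lemma composable_face:
  assumes c: "composable C (Suc n) k x y" and k: "k < n"
  shows "composable C n k (src C n x) (src C n y)" "composable C n k (tgt C n x) (tgt C n y)"
proof -
  interpret R: oset seqs rbd rcp by (rule oset_seqs)
  have x: "iota (Suc n) x \<in> seqs" "iota (Suc n) y \<in> seqs" using c by (auto simp: composable_def iota_in)
  have b: "rbd k False (rbd n e (iota (Suc n) x)) = rbd k True (rbd n e (iota (Suc n) y))" for e
    using composable_iota[OF c] x k by (simp add: R.bd_lt)
  have nth: "rbd n e (iota (Suc n) z) n = (if e then tgt C n z else src C n z)" for e z
    by (simp add: rbd_def iota_def)
  have "composable C n k (rbd n e (iota (Suc n) x) n) (rbd n e (iota (Suc n) y) n)" for e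
    by (rule rbd_composable[OF rbd_in[OF x(1)] rbd_in[OF x(2)] b k])
  from this[of True] this[of False] show "composable C n k (src C n x) (src C n y)"
    "composable C n k (tgt C n x) (tgt C n y)" by (simp_all add: nth)
qed

abbreviation fdiff :: "nat \<Rightarrow> ('a \<Rightarrow>\<^sub>0 int) \<Rightarrow> ('a \<Rightarrow>\<^sub>0 int)" where
  "fdiff n \<equiv> frag_extend (\<lambda>x. frag_of (tgt C n x) - frag_of (src C n x))"

lemma fdiff_keys: "Poly_Mapping.keys c \<subseteq> cells C (Suc n) \<Longrightarrow> Poly_Mapping.keys (fdiff n c) \<subseteq> cells C n"
  by (erule frag_extend_in, intro order_trans[OF keys_diff] Un_least) (auto simp: src_closed tgt_closed)

text \<open>For \<open>k = n\<close> the cell shared by the two boundaries cancels and the relation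
  is sent to zero; for \<open>k < n\<close> the image is the relation between the targets minus that
  between the sources.\<close>

lemma fdiff_rel:
  assumes "r \<in> abel_rel C (Suc n)"
  shows "fdiff n r \<in> abel_rel C n"
proof (rule abel_rel_extend[OF assms abel_rel_zero abel_rel_add abel_rel_minus])
  fix k x y assume c: "composable C (Suc n) k x y"
  then have "k \<le> n" by (simp add: composable_def)
  show "frag_of (tgt C n (cmp C (Suc n) k x y)) - frag_of (src C n (cmp C (Suc n) k x y)) -
      (frag_of (tgt C n x) - frag_of (src C n x) + (frag_of (tgt C n y) - frag_of (src C n y))) \<in> abel_rel C n"
  proof (cases "k = n")
    case True
    then have "src C n x = tgt C n y" using c by (simp add: composable_def)
    then show ?thesis using c True by (simp add: src_cmp_top tgt_cmp_top abel_rel_zero)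
  next
    case False
    then have k: "k < n" using \<open>k \<le> n\<close> by simp
    note f = composable_face[OF c k]
    from abel_rel_diff[OF abel_rel_gen[OF f(2)] abel_rel_gen[OF f(1)]] show ?thesis
      using src_cmp[OF c k] tgt_cmp[OF c k] by (simp add: algebra_simps)
  qed
qed

text \<open>Since relations go to relations, all representatives of a class have images in one
  class, and the set from which the definition takes its element is a singleton.\<close>

lemma abel_diff_cls: "abel_diff C n (cls (Suc n) c) = cls n (fdiff n c)"
proof -
  have e: "cls n (fdiff n (r + c)) = cls n (fdiff n c)" if "r \<in> abel_rel C (Suc n)" for r
    unfolding cls_eq using fdiff_rel[OF that] by (simp add: frag_extend_add)
  have "(\<lambda>c. cls n (fdiff n c)) ` cls (Suc n) c = {cls n (fdiff n c)}"
    unfolding cls_alt[of "Suc n"] using e abel_rel_zero[of "Suc n"] by (force simp: image_image)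
  then show ?thesis by (simp add: abel_diff_def cls_def)
qed

lemma abel_diff_hom: "abel_diff C n \<in> hom (abel C (Suc n)) (abel C n)"
proof (rule homI)
  fix X assume "X \<in> carrier (abel C (Suc n))"
  then obtain a where a: "X = cls (Suc n) a" "Poly_Mapping.keys a \<subseteq> cells C (Suc n)" by (auto simp: carrier_abel)
  show "abel_diff C n X \<in> carrier (abel C n)"
    using fdiff_keys[OF a(2)] by (auto simp: a carrier_abel abel_diff_cls)
  fix Y assume "Y \<in> carrier (abel C (Suc n))"
  then obtain b where b: "Y = cls (Suc n) b" "Poly_Mapping.keys b \<subseteq> cells C (Suc n)" by (auto simp: carrier_abel)
  show "abel_diff C n (X \<otimes>\<^bsub>abel C (Suc n)\<^esub> Y) = abel_diff C n X \<otimes>\<^bsub>abel C n\<^esub> abel_diff C n Y"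
    using a b by (simp add: cls_add abel_diff_cls fdiff_keys frag_extend_add)
qed

lemma fdiff_fdiff:
  assumes "Poly_Mapping.keys c \<subseteq> cells C (Suc (Suc n))"
  shows "fdiff n (fdiff (Suc n) c) = 0"
  unfolding frag_extend_frag_extend
  by (rule frag_extend_eq_0) (use assms in \<open>auto simp: frag_extend_diff src_src tgt_tgt\<close>)

lemma abel_diff_diff: "X \<in> carrier (abel C (Suc (Suc n))) \<Longrightarrow> abel_diff C n (abel_diff C (Suc n) X) = \<one>\<^bsub>abel C n\<^esub>"
  by (auto simp: carrier_abel abel_diff_cls one_abel fdiff_fdiff)

end

section \<open>The abelianization is free on the generators\<close>

context category_resolution
begin

text \<open>Counts the generators occurring in a cell: the linearization with the arrows of
  \<open>C\<close> forgotten. It respects the relations and inverts the map from chains on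
  generators to the abelianization.\<close>

definition q :: "nat \<Rightarrow> 'p \<Rightarrow> ('p \<Rightarrow>\<^sub>0 int)" where
  "q n x = C.forg (der n (iota n x))"

lemma cell_iota: "x \<in> cells P n \<Longrightarrow> cell n (iota n x)"
  by (simp add: iota_in iota_cell)

lemma q_cmp:
  assumes c: "composable P n k x y"
  shows "q n (cmp P n k x y) = q n x + q n y"
proof -
  have k: "k < n" "x \<in> cells P n" "y \<in> cells P n" using c by (auto simp: composable_def)
  show ?thesis
    using der_cp[OF k(1) cell_iota[OF k(2)] cell_iota[OF k(3)] composable_iota[OF c]]
    by (simp add: q_def iota_cmp[OF c])
qed

lemma q_gen: "i \<in> Sig n \<Longrightarrow> q n i = frag_of i"
  by (simp add: q_def der_gen)

lemma q_keys: "x \<in> cells P n \<Longrightarrow> Poly_Mapping.keys (q n x) \<subseteq> Sig n"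
  unfolding q_def by (rule C.keys_forg[OF der_in[OF cell_iota]])

lemma q_bd:
  assumes "x \<in> cells P (Suc n)"
  shows "C.colim Di n (q (Suc n) x) = q n (tgt P n x) - q n (src P n x)"
proof -
  have "C.colim Di n (q (Suc n) x) = C.forg (C.nex (Di n) (der (Suc n) (iota (Suc n) x)))"
    by (simp add: C.forg_nex C.colim_def q_def)
  also have "\<dots> = C.forg (der_bd n (iota (Suc n) x))"
    using nex_der[OF cell_iota[OF assms]] by simp
  also have "\<dots> = q n (tgt P n x) - q n (src P n x)"
    by (simp add: der_bd_def q_def iota_src[OF assms] iota_tgt[OF assms])
  finally show ?thesis .
qed

text \<open>Modulo the relations every cell is the sum of its generators, by induction over its
  construction.\<close>

lemma cell_congruent:
  assumes "cell n \<xi>"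
  shows "frag_of (\<xi> n) - C.forg (der n \<xi>) \<in> abel_rel P n"
proof (rule cell_induct[where Q = "\<lambda>\<xi>. frag_of (\<xi> n) - C.forg (der n \<xi>) \<in> abel_rel P n" and n = n])
  fix \<xi> m assume x: "\<xi> \<in> seqs" "m < n" "rbd m False \<xi> = \<xi>"
  \<comment> \<open>A cell of lower dimension is composable with itself, and the composite is the
    cell again. The relation then identifies it with twice itself, hence with zero.\<close>
  have t: "rbd m True \<xi> = \<xi>" using R.bd_cell[OF x(1,3)] by simp
  have c: "composable P n m (\<xi> n) (\<xi> n)" by (rule rbd_composable[OF x(1,1) _ x(2)]) (simp add: t x(3))
  have "rcp m \<xi> \<xi> = \<xi>" using R.cp_unit_left[OF x(1), of m] t by simp
  from fun_cong[OF this, of n] have "cmp P n m (\<xi> n) (\<xi> n) = \<xi> n" using x(2) by (simp add: rcp_def)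
  then show "frag_of (\<xi> n) - C.forg (der n \<xi>) \<in> abel_rel P n"
    using abel_rel_minus[OF abel_rel_gen[OF c]] der_low[OF x(2), of \<xi>] x by simp
next
  fix i assume "i \<in> Sig n"
  then show "frag_of (iota n i n) - C.forg (der n (iota n i)) \<in> abel_rel P n"
    by (simp add: der_gen abel_rel_zero)
next
  fix x y k assume x: "x \<in> seqs" "y \<in> seqs" "rbd n False x = x" "rbd n False y = y" and k: "k < n"
    and c: "rbd k False x = rbd k True y"
    and Q: "frag_of (x n) - C.forg (der n x) \<in> abel_rel P n" "frag_of (y n) - C.forg (der n y) \<in> abel_rel P n"
  have d: "C.forg (der n (rcp k x y)) = C.forg (der n x) + C.forg (der n y)"
    using der_cp[OF k, of x y] x c by simp
  have "rcp k x y n = cmp P n k (x n) (y n)" using k by (simp add: rcp_def)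
  then show "frag_of (rcp k x y n) - C.forg (der n (rcp k x y)) \<in> abel_rel P n"
    using abel_rel_add[OF abel_rel_gen[OF rbd_composable[OF x(1,2) c k]] abel_rel_add[OF Q]]
    by (simp add: d algebra_simps)
qed (use assms in auto)

lemma q_congruent:
  assumes "Poly_Mapping.keys c \<subseteq> cells P n"
  shows "c - frag_extend (q n) c \<in> abel_rel P n"
  using assms
proof (induction rule: frag_induction)
  case (one x)
  then show ?case using cell_congruent[OF cell_iota[OF one]] by (simp add: q_def)
next
  case (diff a b)
  then show ?case using abel_rel_diff by (fastforce simp: frag_extend_diff algebra_simps)
qed (simp add: abel_rel_zero)

lemma q_rel: "r \<in> abel_rel P n \<Longrightarrow> frag_extend (q n) r = 0"
  using abel_rel_extend[where T = "{0}" and f = "q n"] q_cmp by simp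

lemma q_section: "Poly_Mapping.keys c \<subseteq> Sig n \<Longrightarrow> frag_extend (q n) c = c"
  by (induction rule: frag_induction) (auto simp: q_gen frag_extend_diff)

lemma cells_of_Sig: "Poly_Mapping.keys c \<subseteq> Sig n \<Longrightarrow> Poly_Mapping.keys c \<subseteq> cells P n"
  using Sig_sub by blast

lemma carrier_abel_Sig: "carrier (abel P n) = cls n ` {c. Poly_Mapping.keys c \<subseteq> Sig n}"
proof
  show "carrier (abel P n) \<subseteq> cls n ` {c. Poly_Mapping.keys c \<subseteq> Sig n}"
  proof
    fix X assume "X \<in> carrier (abel P n)"
    then obtain c where c: "X = cls n c" "Poly_Mapping.keys c \<subseteq> cells P n" by (auto simp: carrier_abel)
    have "X = cls n (frag_extend (q n) c)" using q_congruent[OF c(2)] c(1) cls_eq by simp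
    moreover have "Poly_Mapping.keys (frag_extend (q n) c) \<subseteq> Sig n" by (rule frag_extend_in[OF c(2) q_keys])
    ultimately show "X \<in> cls n ` {c. Poly_Mapping.keys c \<subseteq> Sig n}" by blast
  qed
qed (use cells_of_Sig in \<open>auto simp: carrier_abel\<close>)

lemma cls_inj:
  assumes "Poly_Mapping.keys a \<subseteq> Sig n" "Poly_Mapping.keys b \<subseteq> Sig n" "cls n a = cls n b"
  shows "a = b"
  using q_rel[of "a - b" n] assms cls_eq by (simp add: frag_extend_diff q_section)

lemma abel_diff_Sig:
  assumes "Poly_Mapping.keys c \<subseteq> Sig (Suc n)"
  shows "abel_diff P n (cls (Suc n) c) = cls n (C.colim Di n c)"
proof -
  have c: "Poly_Mapping.keys c \<subseteq> cells P (Suc n)" by (rule cells_of_Sig[OF assms])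
  have "C.colim Di n c = C.colim Di n (frag_extend (q (Suc n)) c)" by (simp add: q_section[OF assms])
  also have "\<dots> = frag_extend (\<lambda>x. C.colim Di n (q (Suc n) x)) c"
    by (simp add: C.colim_def frag_extend_frag_extend)
  also have "\<dots> = frag_extend (\<lambda>x. q n (tgt P n x) - q n (src P n x)) c"
    by (rule frag_extend_eq) (use c q_bd in auto)
  also have "\<dots> = frag_extend (q n) (fdiff n c)"
    by (simp add: frag_extend_frag_extend frag_extend_diff)
  finally show ?thesis using q_congruent[OF fdiff_keys[OF c]] by (simp add: abel_diff_cls cls_eq)
qed

theorem colim_abel:
  "chain_homology (\<lambda>n. free_Abelian_group (Sig n)) (C.colim Di) k \<cong> abel_homology P k"
  unfolding abel_homology_def
proof (rule homology_isoI[where h = "cls k"])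
  note res = resolution_Sig
  let ?d = "C.colim Di"
  have cS: "z \<in> cycles (\<lambda>n. free_Abelian_group (Sig n)) ?d k \<longleftrightarrow>
     Poly_Mapping.keys z \<subseteq> Sig k \<and> (\<forall>m. k = Suc m \<longrightarrow> ?d m z = 0)" for z
    by (cases k) (auto simp: cycles_def kernel_def)
  have cA: "Z \<in> cycles (abel P) (abel_diff P) k \<longleftrightarrow>
     Z \<in> carrier (abel P k) \<and> (\<forall>m. k = Suc m \<longrightarrow> abel_diff P m Z = cls m 0)" for Z
    by (cases k) (auto simp: cycles_def kernel_def one_abel)
  have cyc: "cls k z \<in> cycles (abel P) (abel_diff P) k \<longleftrightarrow> z \<in> cycles (\<lambda>n. free_Abelian_group (Sig n)) ?d k"
    if "Poly_Mapping.keys z \<subseteq> Sig k" for z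
  proof -
    have "cls m (?d m z) = cls m 0 \<longleftrightarrow> ?d m z = 0" if "k = Suc m" for m
      using cls_inj[of "?d m z" m 0] C.colim_in[OF res, of z m] \<open>Poly_Mapping.keys z \<subseteq> Sig k\<close> that by auto
    then show ?thesis using that by (auto simp: cS cA carrier_abel_Sig abel_diff_Sig)
  qed
  show "comm_group (free_Abelian_group (Sig n))" for n by (rule abelian_free_Abelian_group)
  show "comm_group (abel P n)" for n by (rule comm_group_abel)
  show "?d n \<in> hom (free_Abelian_group (Sig (Suc n))) (free_Abelian_group (Sig n))" for n
    using C.colim_in[OF res] by (auto simp: hom_def C.colim_def frag_extend_add)
  show "abel_diff P n \<in> hom (abel P (Suc n)) (abel P n)" for n by (rule abel_diff_hom)
  show "?d n (?d (Suc n) x) = \<one>\<^bsub>free_Abelian_group (Sig n)\<^esub>"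
    if "x \<in> carrier (free_Abelian_group (Sig (Suc (Suc n))))" for n x
    using C.colim_colim[OF res] that by simp
  show "abel_diff P n (abel_diff P (Suc n) X) = \<one>\<^bsub>abel P n\<^esub>" if "X \<in> carrier (abel P (Suc (Suc n)))" for n X
    by (rule abel_diff_diff[OF that])
  show "cls k \<in> hom (free_Abelian_group (Sig k)) (abel P k)"
    by (rule homI) (auto simp: carrier_abel_Sig cls_add cells_of_Sig)
  show "cls k z \<in> cycles (abel P) (abel_diff P) k" if "z \<in> cycles (\<lambda>n. free_Abelian_group (Sig n)) ?d k" for z
    using cyc that cS by blast
  show "cls k (?d k x) \<in> abel_diff P k ` carrier (abel P (Suc k))"
    if "x \<in> carrier (free_Abelian_group (Sig (Suc k)))" for x
    using that abel_diff_Sig[of x k, symmetric] by (auto simp: carrier_abel_Sig)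
  show "\<exists>z\<in>cycles (\<lambda>n. free_Abelian_group (Sig n)) ?d k. \<exists>b\<in>abel_diff P k ` carrier (abel P (Suc k)).
      Z = b \<otimes>\<^bsub>abel P k\<^esub> cls k z" if Z: "Z \<in> cycles (abel P) (abel_diff P) k" for Z
  proof -
    obtain z where z: "Z = cls k z" "Poly_Mapping.keys z \<subseteq> Sig k" using Z by (auto simp: cA carrier_abel_Sig)
    have m1: "z \<in> cycles (\<lambda>n. free_Abelian_group (Sig n)) ?d k" using cyc[OF z(2)] Z z(1) by simp
    have "abel_diff P k (cls (Suc k) 0) = cls k 0" by (simp add: abel_diff_cls)
    moreover have "cls (Suc k) 0 \<in> carrier (abel P (Suc k))" unfolding carrier_abel by (rule imageI) simp
    ultimately have m2: "cls k 0 \<in> abel_diff P k ` carrier (abel P (Suc k))" by (metis imageI)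
    show ?thesis
      by (intro bexI[OF _ m1] bexI[OF _ m2]) (use z cells_of_Sig[OF z(2)] in \<open>simp add: cls_add\<close>)
  qed
  show "z \<in> ?d k ` carrier (free_Abelian_group (Sig (Suc k)))"
    if z: "z \<in> cycles (\<lambda>n. free_Abelian_group (Sig n)) ?d k" and b: "cls k z \<in> abel_diff P k ` carrier (abel P (Suc k))" for z
  proof -
    obtain c where c: "cls k z = abel_diff P k (cls (Suc k) c)" "Poly_Mapping.keys c \<subseteq> Sig (Suc k)"
      using b by (auto simp: carrier_abel_Sig)
    have "z = ?d k c"
      by (rule cls_inj[of _ k]) (use z c cS C.colim_in[OF res] in \<open>auto simp: abel_diff_Sig\<close>)
    then show ?thesis using c(2) by simp
  qed
qed

end

section \<open>The bar resolution\<close>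

lemma simplex_simps [simp]:
  "(i, j) \<in> cells (simplex n) m \<longleftrightarrow> i \<le> j \<and> j \<le> n \<and> (m = 0 \<longrightarrow> i = j)"
  "src (simplex n) 0 x = (fst x, fst x)" "tgt (simplex n) 0 x = (snd x, snd x)"
  "src (simplex n) (Suc m) x = x" "tgt (simplex n) (Suc m) x = x"
  "idn (simplex n) m x = x" "cmp (simplex n) m 0 x y = (fst y, snd x)" "cmp (simplex n) m (Suc k) x y = x"
  by (auto simp: simplex_def split_def)

lemma oset_simplex:
  "oset {(i, j). i \<le> j \<and> j \<le> (n::nat)} (\<lambda>k e x. if k = 0 then (if e then (snd x, snd x) else (fst x, fst x)) else x)
     (\<lambda>k x y. if k = 0 then (fst y, snd x) else x)"
  by unfold_locales (auto split: if_splits)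

text \<open>In \<open>simplex n\<close> arrows already stand for their units, so the encoding is
  one-sorted and the axioms can be checked in that form.\<close>

lemma simplex_flat:
  "simplex n = flat {(i, j). i \<le> j \<and> j \<le> n}
     (\<lambda>k e x. if k = 0 then (if e then (snd x, snd x) else (fst x, fst x)) else x)
     (\<lambda>k x y. if k = 0 then (fst y, snd x) else x)"
  by (auto simp: simplex_def flat_def fun_eq_iff)

lemma omega_category_simplex: "omega_category (simplex n)"
  unfolding simplex_flat by (rule oset.omega_category_flat[OF oset_simplex])

lemma src_at_simplex: "k \<le> m \<Longrightarrow> (i, j) \<in> cells (simplex n) m \<Longrightarrow> src_at (simplex n) k m (i, j) = (if k = 0 then (i, i) else (i, j))"
  and tgt_at_simplex: "k \<le> m \<Longrightarrow> (i, j) \<in> cells (simplex n) m \<Longrightarrow> tgt_at (simplex n) k m (i, j) = (if k = 0 then (j, j) else (i, j))"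
  using oset.src_at_flat[OF oset_simplex, of "(i, j)" n m k] oset.tgt_at_flat[OF oset_simplex, of "(i, j)" n m k]
  unfolding simplex_flat by auto

context omega_category
begin

lemma act_sum: "act g (sum b I) = (\<Sum>i\<in>I. act g (b i))"
  by (induction I rule: infinite_finite_induct) auto

lemma forg_sum: "forg (sum b I) = (\<Sum>i\<in>I. forg (b i))"
  by (induction I rule: infinite_finite_induct) auto

lemma Fr_sum: "(\<And>i. i \<in> I \<Longrightarrow> b i \<in> Fr J loc c) \<Longrightarrow> sum b I \<in> Fr J loc c"
  by (induction I rule: infinite_finite_induct) auto

text \<open>The composite from the \<open>i\<close>-th to the \<open>j\<close>-th object of a chain is \<open>a i j\<close>.\<close>

definition arrow_chain :: "nat \<Rightarrow> (nat \<Rightarrow> nat \<Rightarrow> 'a) \<Rightarrow> bool" where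
  "arrow_chain n a \<longleftrightarrow> (\<forall>i j. i \<le> j \<longrightarrow> j \<le> n \<longrightarrow>
      a i j \<in> cells C 1 \<and> src C 0 (a i j) = src C 0 (a i i) \<and> tgt C 0 (a i j) = src C 0 (a j j)) \<and>
     (\<forall>i\<le>n. a i i = idn C 0 (src C 0 (a i i))) \<and>
     (\<forall>i j k. i \<le> j \<longrightarrow> j \<le> k \<longrightarrow> k \<le> n \<longrightarrow> cmp C 1 0 (a j k) (a i j) = a i k)"

lemma diagD:
  assumes "arrow_chain n a"
  shows "i \<le> j \<Longrightarrow> j \<le> n \<Longrightarrow> a i j \<in> cells C 1"
    "i \<le> j \<Longrightarrow> j \<le> n \<Longrightarrow> src C 0 (a i j) = src C 0 (a i i)"
    "i \<le> j \<Longrightarrow> j \<le> n \<Longrightarrow> tgt C 0 (a i j) = src C 0 (a j j)"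
    "i \<le> n \<Longrightarrow> a i i = idn C 0 (src C 0 (a i i))"
    "i \<le> j \<Longrightarrow> j \<le> k \<Longrightarrow> k \<le> n \<Longrightarrow> cmp C 1 0 (a j k) (a i j) = a i k"
  using assms unfolding arrow_chain_def by blast+

text \<open>Inverse to reading a simplex in degree 1 (see \<open>nerve_of_self\<close>): a functor
  from a poset to \<open>C\<close> is determined by its values on arrows.\<close>

definition nerve_of :: "nat \<Rightarrow> (nat \<Rightarrow> nat \<Rightarrow> 'a) \<Rightarrow> nat \<Rightarrow> nat \<times> nat \<Rightarrow> 'a" where
  "nerve_of n a = (\<lambda>m. restrict (\<lambda>(i, j). if m = 0 then src C 0 (a i i) else idn_at C 1 m (a i j)) (cells (simplex n) m))"

lemma nerve_of_1: "i \<le> j \<Longrightarrow> j \<le> n \<Longrightarrow> nerve_of n a 1 (i, j) = a i j"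
  by (simp add: nerve_of_def)

lemma nerve_of_cong: "(\<And>i j. i \<le> j \<Longrightarrow> j \<le> n \<Longrightarrow> a i j = b i j) \<Longrightarrow> nerve_of n a = nerve_of n b"
  by (auto simp: nerve_of_def fun_eq_iff)

lemma nerve_of_nerve:
  assumes a: "arrow_chain n a"
  shows "nerve_of n a \<in> nerve C n"
proof -
  interpret s: omega_category "simplex n" by (rule omega_category_simplex)
  have "omega_functor (simplex n) C (nerve_of n a)"
  proof
    fix x m assume x: "x \<in> cells (simplex n) m"
    obtain i j where ij: "x = (i, j)" by (cases x)
    have aij: "a i j \<in> cells C 1" "a i i \<in> cells C 1" using diagD(1)[OF a] x ij by auto
    show "nerve_of n a m x \<in> cells C m"
      using x ij arrow_src_tgt(1)[OF aij(2)] idn_at_closed[OF aij(1), of m] by (cases "m = 0") (auto simp: nerve_of_def)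
    show "nerve_of n a (Suc m) (idn (simplex n) m x) = idn C m (nerve_of n a m x)"
      using x ij diagD(4)[OF a, of i] by (cases m) (auto simp: nerve_of_def)
  next
    fix x m assume x: "x \<in> cells (simplex n) (Suc m)"
    obtain i j where ij: "x = (i, j)" by (cases x)
    have aij: "a i j \<in> cells C 1" using diagD(1)[OF a] x ij by auto
    show "nerve_of n a m (src (simplex n) m x) = src C m (nerve_of n a (Suc m) x)"
      using x ij diagD(2)[OF a, of i j] src_idn[OF idn_at_closed[OF aij, of m]] by (cases m) (auto simp: nerve_of_def)
    show "nerve_of n a m (tgt (simplex n) m x) = tgt C m (nerve_of n a (Suc m) x)"
      using x ij diagD(3)[OF a, of i j] tgt_idn[OF idn_at_closed[OF aij, of m]] by (cases m) (auto simp: nerve_of_def)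
  next
    fix m k x y assume c: "composable (simplex n) m k x y"
    obtain i j i' j' where ij: "x = (i, j)" "y = (i', j')" by (cases x, cases y)
    have k: "k < m" and xy: "i \<le> j" "j \<le> n" "i' \<le> j'" "j' \<le> n"
      and e: "(if k = 0 then (i, i) else (i, j)) = (if k = 0 then (j', j') else (i', j'))"
      using c src_at_simplex[of k m i j n] tgt_at_simplex[of k m i' j' n] by (auto simp: composable_def ij)
    have aij: "a i j \<in> cells C 1" "a i' j' \<in> cells C 1" using diagD(1)[OF a] xy by auto
    show "nerve_of n a m (cmp (simplex n) m k x y) = cmp C m k (nerve_of n a m x) (nerve_of n a m y)"
    proof (cases "k = 0")
      case True
      then have j': "j' = i" using e by simp
      have "composable C 1 0 (a i j) (a i' j')"
        using aij diagD(2)[OF a xy(1,2)] diagD(3)[OF a xy(3,4)] by (simp add: arrow_composable j' del: One_nat_def)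
      from idn_at_cmp[OF this, of m] have "idn_at C 1 m (cmp C 1 0 (a i j) (a i' j')) = cmp C m 0 (idn_at C 1 m (a i j)) (idn_at C 1 m (a i' j'))"
        using k by simp
      moreover have "cmp C 1 0 (a i j) (a i' j') = a i' j" using diagD(5)[OF a, of i' i j] xy j' by simp
      ultimately show ?thesis using True k xy j' by (simp add: ij nerve_of_def)
    next
      case False
      let ?b = "idn_at C 1 m (a i j)"
      have b: "?b \<in> cells C m" using idn_at_closed[OF aij(1), of m] k by simp
      have "src_at C k m ?b = idn_at C 1 k (a i j)"
        using src_at_idn_at[of "idn_at C 1 k (a i j)" k k m] idn_at_closed[OF aij(1), of k] idn_at_idn_at[of 1 k m "a i j"] False k by simp
      then have "cmp C m k ?b ?b = ?b"
        using cmp_idn_right[OF b k] idn_at_idn_at[of 1 k m "a i j"] False k by simp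
      then show ?thesis using False e k xy by (cases k) (auto simp: ij nerve_of_def)
    qed
  qed
  then show ?thesis by (simp add: nerve_def nerve_of_def)
qed

lemma nerve_values:
  assumes s: "s \<in> nerve C n" and ij: "i \<le> j" "j \<le> n"
  shows "s 1 (i, j) \<in> cells C 1" "src C 0 (s 1 (i, j)) = s 0 (i, i)" "tgt C 0 (s 1 (i, j)) = s 0 (j, j)"
    "s 1 (i, i) = idn C 0 (s 0 (i, i))" "s (Suc m) (i, j) = idn_at C 1 (Suc m) (s 1 (i, j))"
    "j \<le> k \<Longrightarrow> k \<le> n \<Longrightarrow> cmp C 1 0 (s 1 (j, k)) (s 1 (i, j)) = s 1 (i, k)"
proof -
  interpret F: omega_functor "simplex n" C s using s by (simp add: nerve_def)
  show "s 1 (i, j) \<in> cells C 1" using F.fun_closed[of "(i, j)" 1] ij by simp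
  show "src C 0 (s 1 (i, j)) = s 0 (i, i)" using F.fun_src[of "(i, j)" 0] ij by simp
  show "tgt C 0 (s 1 (i, j)) = s 0 (j, j)" using F.fun_tgt[of "(i, j)" 0] ij by simp
  show "s 1 (i, i) = idn C 0 (s 0 (i, i))" using F.fun_idn[of "(i, i)" 0] ij by simp
  show "s (Suc m) (i, j) = idn_at C 1 (Suc m) (s 1 (i, j))"
  proof (induction m)
    case (Suc m)
    then show ?case using F.fun_idn[of "(i, j)" "Suc m"] ij by simp
  qed simp
  show "cmp C 1 0 (s 1 (j, k)) (s 1 (i, j)) = s 1 (i, k)" if "j \<le> k" "k \<le> n"
    using F.fun_cmp[of 1 0 "(j, k)" "(i, j)"] ij that by (simp add: composable_def)
qed

lemma nerve_arrow_chain: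
  assumes s: "s \<in> nerve C n"
  shows "arrow_chain n (\<lambda>i j. s 1 (i, j))"
  unfolding arrow_chain_def
proof (intro conjI allI impI)
  have o: "src C 0 (s 1 (i, i)) = s 0 (i, i)" if "i \<le> n" for i using nerve_values(2)[OF s, of i i] that by simp
  fix i j assume ij: "i \<le> j" "j \<le> n"
  note v = nerve_values(1-3)[OF s ij]
  show "s 1 (i, j) \<in> cells C 1" by (rule v(1))
  show "src C 0 (s 1 (i, j)) = src C 0 (s 1 (i, i))" "tgt C 0 (s 1 (i, j)) = src C 0 (s 1 (j, j))"
    unfolding v using o ij by simp_all
next
  fix i j k assume "i \<le> j" "j \<le> k" "k \<le> n"
  then show "cmp C 1 0 (s 1 (j, k)) (s 1 (i, j)) = s 1 (i, k)" using nerve_values(6)[OF s, of i j k] by simp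
next
  fix i assume "i \<le> n"
  then show "s 1 (i, i) = idn C 0 (src C 0 (s 1 (i, i)))"
    using nerve_values(2)[OF s, of i i] nerve_values(4)[OF s, of i i] by simp
qed

lemma nerve_at:
  assumes s: "s \<in> nerve C n" and ij: "(i, j) \<in> cells (simplex n) m"
  shows "s m (i, j) = (if m = 0 then src C 0 (s 1 (i, i)) else idn_at C 1 m (s 1 (i, j)))"
proof (cases m)
  case 0
  then show ?thesis using nerve_values(2)[OF s, of i j] ij by simp
next
  case (Suc k)
  have "s (Suc k) (i, j) = idn_at C 1 (Suc k) (s 1 (i, j))" using nerve_values(5)[OF s, of i j k] ij by simp
  then show ?thesis using Suc by simp
qed

lemma nerve_of_self: "s \<in> nerve C n \<Longrightarrow> nerve_of n (\<lambda>i j. s 1 (i, j)) = s"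
proof (intro ext)
  fix m and x :: "nat \<times> nat" assume s: "s \<in> nerve C n"
  obtain i j where x: "x = (i, j)" by (cases x)
  show "nerve_of n (\<lambda>i j. s 1 (i, j)) m x = s m x"
  proof (cases "x \<in> cells (simplex n) m")
    case True
    then show ?thesis using nerve_at[OF s, of i j m] by (simp add: nerve_of_def x)
  next
    case False
    have "s m \<in> extensional (cells (simplex n) m)" using s by (simp add: nerve_def)
    from extensional_arb[OF this False] show ?thesis using False by (simp add: nerve_of_def)
  qed
qed

lemma nerve_map_nerve_of:
  assumes s: "s \<in> nerve C n" and p: "\<And>i j. i \<le> j \<Longrightarrow> j \<le> m \<Longrightarrow> p i \<le> p j \<and> p j \<le> n"
  shows "nerve_map m p s = nerve_of m (\<lambda>i j. s 1 (p i, p j))"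
proof (intro ext)
  fix k and x :: "nat \<times> nat"
  obtain i j where x: "x = (i, j)" by (cases x)
  show "nerve_map m p s k x = nerve_of m (\<lambda>i j. s 1 (p i, p j)) k x"
  proof (cases "x \<in> cells (simplex m) k")
    case True
    then have "(p i, p j) \<in> cells (simplex n) k" using p[of i j] x by auto
    from nerve_at[OF s this] show ?thesis using True by (simp add: nerve_of_def nerve_map_def x)
  qed (simp add: nerve_of_def nerve_map_def)
qed

lemma arrow_chain_map:
  assumes a: "arrow_chain n a" and p: "\<And>i j. i \<le> j \<Longrightarrow> j \<le> m \<Longrightarrow> p i \<le> p j \<and> p j \<le> n"
  shows "arrow_chain m (\<lambda>i j. a (p i) (p j))"
  unfolding arrow_chain_def
proof (intro conjI allI impI)
  fix i j assume ij: "i \<le> j" "j \<le> m"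
  note d = diagD(1-3)[OF a, of "p i" "p j"] and q = p[OF ij]
  show "a (p i) (p j) \<in> cells C 1" "src C 0 (a (p i) (p j)) = src C 0 (a (p i) (p i))"
    "tgt C 0 (a (p i) (p j)) = src C 0 (a (p j) (p j))" using d q by simp_all
next
  fix i j k assume "i \<le> j" "j \<le> k" "k \<le> m"
  then show "cmp C 1 0 (a (p j) (p k)) (a (p i) (p j)) = a (p i) (p k)"
    using diagD(5)[OF a, of "p i" "p j" "p k"] p[of j k] p[of i j] by simp
qed (use diagD(4)[OF a] p in blast)

section \<open>Faces of a simplex and appending an arrow\<close>

abbreviation face :: "nat \<Rightarrow> nat \<Rightarrow> (nat \<Rightarrow> nat \<times> nat \<Rightarrow> 'a) \<Rightarrow> (nat \<Rightarrow> nat \<times> nat \<Rightarrow> 'a)" where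
  "face n i \<equiv> nerve_map n (coface i)"

lemma coface_mono: "i \<le> j \<Longrightarrow> j \<le> n \<Longrightarrow> coface l i \<le> coface l j \<and> coface l j \<le> Suc n"
  by (auto simp: coface_def)

lemma face_nerve_of: "s \<in> nerve C (Suc n) \<Longrightarrow> face n l s = nerve_of n (\<lambda>i j. s 1 (coface l i, coface l j))"
  by (rule nerve_map_nerve_of) (auto simp: coface_mono)

lemma face_nerve:
  assumes s: "s \<in> nerve C (Suc n)"
  shows "face n l s \<in> nerve C n"
  unfolding face_nerve_of[OF s]
  by (rule nerve_of_nerve, rule arrow_chain_map[OF nerve_arrow_chain[OF s]]) (rule coface_mono)

lemma face_1: "s \<in> nerve C (Suc n) \<Longrightarrow> i \<le> j \<Longrightarrow> j \<le> n \<Longrightarrow> face n l s 1 (i, j) = s 1 (coface l i, coface l j)"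
  using nerve_of_1 by (simp add: face_nerve_of del: One_nat_def)

definition chain_snoc :: "nat \<Rightarrow> (nat \<Rightarrow> nat \<Rightarrow> 'a) \<Rightarrow> 'a \<Rightarrow> nat \<Rightarrow> nat \<Rightarrow> 'a" where
  "chain_snoc n a g i j = (if j \<le> n then a i j else if i \<le> n then cmp C 1 0 g (a i n) else idn C 0 (tgt C 0 g))"

lemma arrow_chain_chain_snoc:
  assumes a: "arrow_chain n a" and g: "g \<in> cells C 1" "src C 0 g = src C 0 (a n n)"
  shows "arrow_chain (Suc n) (chain_snoc n a g)"
proof -
  have t: "tgt C 0 g \<in> cells C 0" by (rule arrow_src_tgt(2)[OF g(1)])
  have gi: "cmp C 1 0 g (a i n) \<in> cells C 1" "src C 0 (cmp C 1 0 g (a i n)) = src C 0 (a i i)"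
    "tgt C 0 (cmp C 1 0 g (a i n)) = tgt C 0 g" if "i \<le> n" for i
    using arrow_simps[OF g(1) diagD(1)[OF a that]] g(2) diagD(2,3)[OF a that] by simp_all
  note [simp] = gi ident_arrow[OF t]
  have ii: "chain_snoc n a g i i = (if i \<le> n then a i i else idn C 0 (tgt C 0 g))" for i by (simp add: chain_snoc_def)
  show ?thesis
    unfolding arrow_chain_def
  proof (intro conjI allI impI)
    fix i j assume ij: "i \<le> j" "j \<le> Suc n"
    show "chain_snoc n a g i j \<in> cells C 1" "src C 0 (chain_snoc n a g i j) = src C 0 (chain_snoc n a g i i)"
      "tgt C 0 (chain_snoc n a g i j) = src C 0 (chain_snoc n a g j j)"
      unfolding ii using ij diagD(1-3)[OF a, of i j] by (auto simp: chain_snoc_def simp del: One_nat_def)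
  next
    fix i j k assume ij: "i \<le> j" and jk: "j \<le> k" "k \<le> Suc n"
    consider "k \<le> n" | "j \<le> n" "k = Suc n" | "i \<le> n" "j = Suc n" "k = Suc n" | "i = Suc n" "j = Suc n" "k = Suc n"
      using ij jk by linarith
    then show "cmp C 1 0 (chain_snoc n a g j k) (chain_snoc n a g i j) = chain_snoc n a g i k"
    proof cases
      case 1
      then show ?thesis using ij jk diagD(5)[OF a, of i j k] by (simp add: chain_snoc_def)
    next
      case 2
      have "cmp C 1 0 (cmp C 1 0 g (a j n)) (a i j) = cmp C 1 0 g (cmp C 1 0 (a j n) (a i j))"
        by (rule arrow_assoc) (use 2 ij g diagD(1,3)[OF a, of j n] diagD(1,3)[OF a, of i j] diagD(2)[OF a, of j n] in auto)
      then show ?thesis using 2 ij diagD(5)[OF a, of i j n] by (simp add: chain_snoc_def)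
    next
      case 3
      then show ?thesis using arrow_id(2)[OF gi(1)[OF 3(1)], unfolded gi(3)[OF 3(1)]] by (simp add: chain_snoc_def)
    next
      case 4
      then show ?thesis using arrow_id(2)[OF ident_arrow(1)[OF t]] by (simp add: chain_snoc_def)
    qed
  next
    fix i assume "i \<le> Suc n"
    then show "chain_snoc n a g i i = idn C 0 (src C 0 (chain_snoc n a g i i))"
      unfolding ii using diagD(4)[OF a, of i] by auto
  qed
qed

definition nerve_snoc :: "nat \<Rightarrow> (nat \<Rightarrow> nat \<times> nat \<Rightarrow> 'a) \<Rightarrow> 'a \<Rightarrow> nat \<Rightarrow> nat \<times> nat \<Rightarrow> 'a" where
  "nerve_snoc n s g = nerve_of (Suc n) (chain_snoc n (\<lambda>i j. s 1 (i, j)) g)"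

definition last_vertex :: "nat \<Rightarrow> (nat \<Rightarrow> nat \<times> nat \<Rightarrow> 'a) \<Rightarrow> 'a" where
  "last_vertex n s = src C 0 (s 1 (n, n))"

lemma nerve_snoc_1: "i \<le> j \<Longrightarrow> j \<le> Suc n \<Longrightarrow> nerve_snoc n s g 1 (i, j) = chain_snoc n (\<lambda>i j. s 1 (i, j)) g i j"
  unfolding nerve_snoc_def by (rule nerve_of_1)

lemma nerve_snoc_nerve: "s \<in> nerve C n \<Longrightarrow> g \<in> cells C 1 \<Longrightarrow> src C 0 g = last_vertex n s \<Longrightarrow> nerve_snoc n s g \<in> nerve C (Suc n)"
  unfolding nerve_snoc_def last_vertex_def by (rule nerve_of_nerve[OF arrow_chain_chain_snoc[OF nerve_arrow_chain]])

lemma last_vertex_nerve_snoc: "g \<in> cells C 1 \<Longrightarrow> last_vertex (Suc n) (nerve_snoc n s g) = tgt C 0 g"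
  using ident_arrow(2)[OF arrow_src_tgt(2)] nerve_snoc_1[of "Suc n" "Suc n" n s g] by (simp add: last_vertex_def chain_snoc_def)

lemma face_last_nerve_snoc:
  assumes "s \<in> nerve C n" "g \<in> cells C 1" "src C 0 g = last_vertex n s"
  shows "face n (Suc n) (nerve_snoc n s g) = s"
proof -
  have "face n (Suc n) (nerve_snoc n s g) = nerve_of n (\<lambda>i j. s 1 (i, j))"
    unfolding face_nerve_of[OF nerve_snoc_nerve[OF assms]] by (rule nerve_of_cong) (simp add: nerve_snoc_1 coface_def chain_snoc_def del: One_nat_def)
  then show ?thesis by (simp only: nerve_of_self[OF assms(1)])
qed

lemma last_arrow:
  assumes s: "s \<in> nerve C (Suc n)" and i: "i \<le> Suc n"
  defines "w \<equiv> s 1 (coface i n, Suc n)"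
  shows "w \<in> cells C 1" "src C 0 w = last_vertex n (face n i s)" "tgt C 0 w = last_vertex (Suc n) s"
  using nerve_values(1-3)[OF s, of "coface i n" "Suc n"] nerve_values(2)[OF s, of "coface i n" "coface i n"]
    nerve_values(2)[OF s, of "Suc n" "Suc n"] coface_mono[of n n n i] face_1[OF s, of n n i]
  by (simp_all add: w_def last_vertex_def del: One_nat_def)

text \<open>One formula covers all \<open>i\<close>. For \<open>i \<le> n\<close> the extra factor
  is the identity at the last vertex of \<open>s\<close>; for \<open>i = Suc n\<close> it is the
  last arrow of \<open>s\<close>, which merges with \<open>g\<close> when the vertex between them is
  removed.\<close>

lemma face_nerve_snoc:
  assumes s: "s \<in> nerve C (Suc n)" and g: "g \<in> cells C 1" "src C 0 g = last_vertex (Suc n) s" and i: "i \<le> Suc n"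
  shows "face (Suc n) i (nerve_snoc (Suc n) s g) = nerve_snoc n (face n i s) (cmp C 1 0 g (s 1 (coface i n, Suc n)))"
  unfolding face_nerve_of[OF nerve_snoc_nerve[OF s g]] nerve_snoc_def[of n]
proof (rule nerve_of_cong)
  note w = last_arrow[OF s i]
  fix p r assume pr: "p \<le> r" "r \<le> Suc n"
  have "nerve_snoc (Suc n) s g 1 (coface i p, coface i r) = chain_snoc (Suc n) (\<lambda>i j. s 1 (i, j)) g (coface i p) (coface i r)"
    using coface_mono[OF pr, of i] by (simp add: nerve_snoc_1 del: One_nat_def)
  also have "\<dots> = chain_snoc n (\<lambda>p r. face n i s 1 (p, r)) (cmp C 1 0 g (s 1 (coface i n, Suc n))) p r"
  proof (cases "r \<le> n")
    case True
    then have "coface i r \<le> Suc n" by (simp add: coface_def)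
    then show ?thesis using True pr face_1[OF s, of p r i] by (simp add: chain_snoc_def del: One_nat_def)
  next
    case False
    then have r: "r = Suc n" "coface i r = Suc (Suc n)" using pr i by (auto simp: coface_def)
    show ?thesis
    proof (cases "p \<le> n")
      case True
      have cp: "coface i p \<le> coface i n" "coface i n \<le> Suc n" using coface_mono[of p n n i] True by auto
      have "cmp C 1 0 (cmp C 1 0 g (s 1 (coface i n, Suc n))) (s 1 (coface i p, coface i n)) =
          cmp C 1 0 g (cmp C 1 0 (s 1 (coface i n, Suc n)) (s 1 (coface i p, coface i n)))"
        by (rule arrow_assoc) (use w g nerve_values(1-3)[OF s, of "coface i p" "coface i n"]
            nerve_values(2)[OF s, of "coface i n" "Suc n"] cp in \<open>simp_all del: One_nat_def\<close>)
      also have "\<dots> = cmp C 1 0 g (s 1 (coface i p, Suc n))"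
        using nerve_values(6)[OF s cp, of "Suc n"] cp by (simp del: One_nat_def)
      finally show ?thesis using True r cp face_1[OF s, of p n i] by (simp add: chain_snoc_def del: One_nat_def)
    next
      case False
      then have "p = Suc n" using pr by simp
      then show ?thesis using r arrow_simps(3)[OF g(1) w(1)] w(3) g(2) by (simp add: chain_snoc_def)
    qed
  qed
  finally show "nerve_snoc (Suc n) s g 1 (coface i p, coface i r) =
      chain_snoc n (\<lambda>p r. face n i s 1 (p, r)) (cmp C 1 0 g (s 1 (coface i n, Suc n))) p r" .
qed

lemma nerve_snoc_face_last:
  assumes s: "s \<in> nerve C (Suc n)"
  shows "s = nerve_snoc n (face n (Suc n) s) (s 1 (n, Suc n))"
proof -
  have "nerve_snoc n (face n (Suc n) s) (s 1 (n, Suc n)) = nerve_of (Suc n) (\<lambda>i j. s 1 (i, j))"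
    unfolding nerve_snoc_def
  proof (rule nerve_of_cong)
    fix i j assume ij: "i \<le> j" "j \<le> Suc n"
    show "chain_snoc n (\<lambda>i j. face n (Suc n) s 1 (i, j)) (s 1 (n, Suc n)) i j = s 1 (i, j)"
      using ij face_1[OF s, of i j "Suc n"] face_1[OF s, of i n "Suc n"] nerve_values(6)[OF s, of i n "Suc n"]
        nerve_values(3)[OF s, of n "Suc n"] nerve_values(4)[OF s, of "Suc n" "Suc n"]
      by (auto simp: chain_snoc_def coface_def le_Suc_eq simp del: One_nat_def)
  qed
  then show ?thesis by (simp only: nerve_of_self[OF s])
qed

section \<open>The bar complex and its contraction\<close>

definition vertex :: "'a \<Rightarrow> nat \<Rightarrow> nat \<times> nat \<Rightarrow> 'a" where
  "vertex c = nerve_of 0 (\<lambda>i j. idn C 0 c)"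

lemma vertex_nerve: "c \<in> cells C 0 \<Longrightarrow> vertex c \<in> nerve C 0"
  unfolding vertex_def using ident_arrow[of c] arrow_id(1)[of "idn C 0 c"]
  by (intro nerve_of_nerve) (simp add: arrow_chain_def)

lemma last_vertex_vertex: "c \<in> cells C 0 \<Longrightarrow> last_vertex 0 (vertex c) = c"
  using ident_arrow[of c] nerve_of_1[of 0 0 0] by (simp add: last_vertex_def vertex_def)

lemma face_0_nerve_snoc:
  assumes "s \<in> nerve C 0" "g \<in> cells C 1" "src C 0 g = last_vertex 0 s"
  shows "face 0 0 (nerve_snoc 0 s g) = vertex (tgt C 0 g)"
  unfolding face_nerve_of[OF nerve_snoc_nerve[OF assms]] vertex_def
  by (rule nerve_of_cong) (simp add: nerve_snoc_1 coface_def chain_snoc_def del: One_nat_def)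

text \<open>The bar differential over \<open>C\<close>, with a simplex located at its last vertex.
  The arrow attached to a face is an identity unless the last vertex is dropped; then it is the last
  arrow of \<open>s\<close>, which would otherwise be lost.\<close>

definition bar :: "nat \<Rightarrow> (nat \<Rightarrow> nat \<times> nat \<Rightarrow> 'a) \<Rightarrow> ((nat \<Rightarrow> nat \<times> nat \<Rightarrow> 'a) \<times> 'a \<Rightarrow>\<^sub>0 int)" where
  "bar n s = (\<Sum>i\<le>Suc n. frag_cmul ((-1) ^ i) (frag_of (face n i s, s 1 (coface i n, Suc n))))"

lemma colim_bar: "colim bar = nerve_diff"
  by (intro ext) (simp add: colim_def nerve_diff_def bar_def forg_sum del: sum.atMost_Suc)

lemma bar_in:
  assumes s: "s \<in> nerve C (Suc n)"
  shows "bar n s \<in> Fr (nerve C n) (last_vertex n) (last_vertex (Suc n) s)"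
  unfolding bar_def
proof (rule Fr_sum)
  fix i assume "i \<in> {..Suc n}"
  then have i: "i \<le> Suc n" by simp
  show "frag_cmul ((-1) ^ i) (frag_of (face n i s, s 1 (coface i n, Suc n))) \<in> Fr (nerve C n) (last_vertex n) (last_vertex (Suc n) s)"
    using last_arrow[OF s i] face_nerve[OF s, of i] by (intro Fr_simps(5)) (simp del: One_nat_def)
qed

text \<open>Dropping the last vertex of the appended simplex returns \<open>(s, f)\<close>. That
  face has index \<open>Suc n\<close>, and the sign compensates the sign it carries in
  \<open>bar\<close>.\<close>

definition bar_htpy :: "nat \<Rightarrow> ((nat \<Rightarrow> nat \<times> nat \<Rightarrow> 'a) \<times> 'a \<Rightarrow>\<^sub>0 int) \<Rightarrow> ((nat \<Rightarrow> nat \<times> nat \<Rightarrow> 'a) \<times> 'a \<Rightarrow>\<^sub>0 int)" where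
  "bar_htpy n = frag_extend (\<lambda>(s, f). frag_cmul ((-1) ^ Suc n) (frag_of (nerve_snoc n s f, idn C 0 (tgt C 0 f))))"

lemma bar_htpy_simps [simp]:
  "bar_htpy n 0 = 0" "bar_htpy n (a - b) = bar_htpy n a - bar_htpy n b" "bar_htpy n (a + b) = bar_htpy n a + bar_htpy n b"
  "bar_htpy n (frag_cmul r a) = frag_cmul r (bar_htpy n a)"
  "bar_htpy n (frag_of (s, f)) = frag_cmul ((-1) ^ Suc n) (frag_of (nerve_snoc n s f, idn C 0 (tgt C 0 f)))"
  by (simp_all add: bar_htpy_def frag_extend_diff frag_extend_add frag_extend_cmul del: power_Suc)

lemma bar_htpy_sum: "bar_htpy n (sum b I) = (\<Sum>i\<in>I. bar_htpy n (b i))"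
  by (induction I rule: infinite_finite_induct) auto

lemma bar_htpy_in: "m \<in> Fr (nerve C n) (last_vertex n) c \<Longrightarrow> bar_htpy n m \<in> Fr (nerve C (Suc n)) (last_vertex (Suc n)) c"
proof (induction rule: Fr_induct)
  case (gen s f)
  then show ?case
    using nerve_snoc_nerve[OF gen(1-3)] last_vertex_nerve_snoc[OF gen(2)] ident_arrow[OF arrow_src_tgt(2)[OF gen(2)]]
    by (simp del: power_Suc)
qed auto

lemma bar_nerve_snoc:
  assumes s: "s \<in> nerve C n" and f: "f \<in> cells C 1" "src C 0 f = last_vertex n s"
  shows "bar n (nerve_snoc n s f) = (\<Sum>i\<le>n. frag_cmul ((-1) ^ i) (frag_of (face n i (nerve_snoc n s f), idn C 0 (tgt C 0 f)))) +
     frag_cmul ((-1) ^ Suc n) (frag_of (s, f))"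
proof -
  have "nerve_snoc n s f 1 (coface i n, Suc n) = idn C 0 (tgt C 0 f)" if "i \<le> n" for i
    using that by (simp add: nerve_snoc_1 coface_def chain_snoc_def del: One_nat_def)
  moreover have "nerve_snoc n s f 1 (coface (Suc n) n, Suc n) = f"
  proof -
    have "cmp C 1 0 f (s 1 (n, n)) = f"
      using nerve_values(2,4)[OF s, of n n] arrow_id(1)[OF f(1)] f(2) by (simp add: last_vertex_def)
    then show ?thesis by (simp add: nerve_snoc_1 coface_def chain_snoc_def del: One_nat_def)
  qed
  ultimately show ?thesis by (simp add: bar_def face_last_nerve_snoc[OF assms] del: power_Suc One_nat_def)
qed

lemma nex_bar_htpy:
  assumes s: "s \<in> nerve C n" and f: "f \<in> cells C 1" "src C 0 f = last_vertex n s"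
  shows "nex (bar n) (bar_htpy n (frag_of (s, f))) = frag_of (s, f) +
     frag_cmul ((-1) ^ Suc n) (\<Sum>i\<le>n. frag_cmul ((-1) ^ i) (frag_of (face n i (nerve_snoc n s f), idn C 0 (tgt C 0 f))))"
proof -
  have "bar n (nerve_snoc n s f) \<in> Fr (nerve C n) (last_vertex n) (tgt C 0 f)"
    using bar_in[OF nerve_snoc_nerve[OF assms]] last_vertex_nerve_snoc[OF f(1)] by simp
  from act_id[OF this] have "nex (bar n) (bar_htpy n (frag_of (s, f))) = frag_cmul ((-1) ^ Suc n) (bar n (nerve_snoc n s f))"
    by (simp del: power_Suc)
  also have "\<dots> = frag_of (s, f) +
     frag_cmul ((-1) ^ Suc n) (\<Sum>i\<le>n. frag_cmul ((-1) ^ i) (frag_of (face n i (nerve_snoc n s f), idn C 0 (tgt C 0 f))))"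
    unfolding bar_nerve_snoc[OF assms] by (simp add: frag_cmul_distrib2 power_mult_distrib[symmetric] del: power_Suc)
  finally show ?thesis .
qed

lemma nex_bar_htpy_0:
  "m \<in> Fr (nerve C 0) (last_vertex 0) c \<Longrightarrow>
    nex (bar 0) (bar_htpy 0 m) = m - frag_extend (\<lambda>_. frag_of (vertex c, idn C 0 c)) (aug m)"
proof (induction rule: Fr_induct)
  case (gen s f)
  then show ?case using nex_bar_htpy[OF gen(1-3)] face_0_nerve_snoc[OF gen(1-3)] by (simp del: bar_htpy_simps(5))
qed (auto simp: frag_extend_diff)

text \<open>All faces except the last occur both in the differential of the appended simplex and in
  the appended faces; the sign of the homotopy changes with the degree, so they cancel.\<close>

lemma nex_bar_htpy_Suc:
  "m \<in> Fr (nerve C (Suc n)) (last_vertex (Suc n)) c \<Longrightarrow> nex (bar (Suc n)) (bar_htpy (Suc n) m) = m - bar_htpy n (nex (bar n) m)"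
proof (induction rule: Fr_induct)
  case (gen s f)
  let ?t = "\<lambda>i. frag_of (face (Suc n) i (nerve_snoc (Suc n) s f), idn C 0 (tgt C 0 f))"
  have t: "bar_htpy n (act f (frag_of (face n i s, s 1 (coface i n, Suc n)))) = frag_cmul ((-1) ^ Suc n) (?t i)" if "i \<le> Suc n" for i
    using face_nerve_snoc[OF gen(1-3) that] arrow_simps(3)[OF gen(2) last_arrow(1)[OF gen(1) that]] last_arrow(3)[OF gen(1) that] gen(3)
    by (simp del: power_Suc One_nat_def)
  have "bar_htpy n (nex (bar n) (frag_of (s, f))) =
      (\<Sum>i\<le>Suc n. frag_cmul ((-1) ^ i) (bar_htpy n (act f (frag_of (face n i s, s 1 (coface i n, Suc n))))))"
    by (simp only: lin_simps bar_def act_sum bar_htpy_sum bar_htpy_simps)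
  also have "\<dots> = frag_cmul ((-1) ^ Suc n) (\<Sum>i\<le>Suc n. frag_cmul ((-1) ^ i) (?t i))"
    unfolding frag_cmul_sum by (rule sum.cong) (simp_all add: t mult.commute del: power_Suc lin_simps One_nat_def)
  finally have "bar_htpy n (nex (bar n) (frag_of (s, f))) = frag_cmul ((-1) ^ Suc n) (\<Sum>i\<le>Suc n. frag_cmul ((-1) ^ i) (?t i))" .
  moreover have "frag_cmul ((-1) ^ Suc (Suc n)) x = - frag_cmul ((-1) ^ Suc n) x" for x :: "(nat \<Rightarrow> nat \<times> nat \<Rightarrow> 'a) \<times> 'a \<Rightarrow>\<^sub>0 int"
    by simp
  ultimately show ?case using nex_bar_htpy[OF gen(1-3)] by (simp only: diff_conv_add_uminus)
qed auto

text \<open>Simplicial identities are replaced by the contraction. Up to sign, the boundary of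
  \<open>s\<close> is the boundary of the contraction applied to its last face and last arrow, so
  the contraction identity reduces the claim to lower degree.\<close>

lemma cyc_bar: "s \<in> nerve C (Suc n) \<Longrightarrow> cyc bar n (bar n s)"
proof (induction n arbitrary: s)
  case 0
  then show ?case by (simp add: cyc_def bar_def)
next
  case (Suc n)
  let ?s = "face (Suc n) (Suc (Suc n)) s" and ?f = "s 1 (Suc n, Suc (Suc n))"
  let ?m = "frag_of (?s, ?f)"
  have s': "?s \<in> nerve C (Suc n)" by (rule face_nerve[OF Suc.prems])
  have co: "coface (Suc (Suc n)) (Suc n) = Suc n" by (simp add: coface_def)
  have f: "?f \<in> cells C 1" "src C 0 ?f = last_vertex (Suc n) ?s" "tgt C 0 ?f = last_vertex (Suc (Suc n)) s"
    using last_arrow[OF Suc.prems, of "Suc (Suc n)"] unfolding co by simp_all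
  have m: "?m \<in> Fr (nerve C (Suc n)) (last_vertex (Suc n)) (tgt C 0 ?f)" using s' f by (simp del: One_nat_def)
  have D: "nex (bar n) ?m \<in> Fr (nerve C n) (last_vertex n) (tgt C 0 ?f)" by (rule nex_Fr[OF m bar_in])
  have IH: "cyc bar n (nex (bar n) ?m)"
  proof (cases n)
    case 0
    then show ?thesis using aug_nex_0[OF m, of "bar n"] Suc.IH by (simp add: cyc_def)
  next
    case (Suc k)
    have b: "bar (Suc k) i \<in> Fr (nerve C (Suc k)) (last_vertex (Suc k)) (last_vertex (Suc (Suc k)) i)"
      "nex (bar k) (bar (Suc k) i) = 0" if "i \<in> nerve C (Suc (Suc k))" for i
      using bar_in[OF that] Suc.IH[of i] that Suc by (simp_all add: cyc_def)
    have m': "?m \<in> Fr (nerve C (Suc (Suc k))) (last_vertex (Suc (Suc k))) (tgt C 0 ?f)" using m unfolding Suc .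
    have "nex (bar k) (nex (bar (Suc k)) ?m) = nex (\<lambda>i. nex (bar k) (bar (Suc k) i)) ?m"
      by (rule nex_nex[OF m' b(1) bar_in])
    also have "\<dots> = nex (\<lambda>i. 0) ?m" by (rule nex_cong[OF m' b(2)])
    finally show ?thesis using Suc by (simp add: cyc_def)
  qed
  \<comment> \<open>The boundary of \<open>?m\<close> is a cycle by the induction hypothesis, and
    the contraction exhibits every cycle as the boundary of its image.\<close>
  have Dh: "nex (bar n) (bar_htpy n (nex (bar n) ?m)) = nex (bar n) ?m"
    using nex_bar_htpy_0[of "nex (bar n) ?m"] nex_bar_htpy_Suc[of "nex (bar n) ?m"] D IH by (cases n) (auto simp: cyc_def)
  have "nex (bar n) (nex (bar (Suc n)) (bar_htpy (Suc n) ?m)) = 0"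
    using nex_bar_htpy_Suc[OF m] Dh by (simp del: lin_simps(22) bar_htpy_simps(5))
  moreover have "nex (bar (Suc n)) (bar_htpy (Suc n) ?m) = frag_cmul ((-1) ^ Suc (Suc n)) (bar (Suc n) s)"
  proof -
    have "nex (bar (Suc n)) (frag_of (s, idn C 0 (tgt C 0 ?f))) = bar (Suc n) s"
      using act_id[OF bar_in[OF Suc.prems]] f(3) by simp
    then show ?thesis using nerve_snoc_face_last[OF Suc.prems, symmetric] by (simp del: power_Suc)
  qed
  ultimately have "frag_cmul ((-1) ^ Suc (Suc n)) (nex (bar n) (bar (Suc n) s)) = 0" by (simp only: lin_simps(18))
  then show ?case by (simp add: cyc_def)
qed

theorem resolution_bar: "resolution (nerve C) last_vertex bar"
  unfolding resolution_def
proof (intro conjI allI ballI impI)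
  show "last_vertex n s \<in> cells C 0" if "s \<in> nerve C n" for n s
    unfolding last_vertex_def by (rule arrow_src_tgt(1)[OF nerve_values(1)[OF that]]) simp_all
  show "bar n s \<in> Fr (nerve C n) (last_vertex n) (last_vertex (Suc n) s)" if "s \<in> nerve C (Suc n)" for n s by (rule bar_in[OF that])
  show "cyc bar n (bar n s)" if "s \<in> nerve C (Suc n)" for n s by (rule cyc_bar[OF that])
  show "\<exists>w\<in>Fr (nerve C (Suc n)) (last_vertex (Suc n)) c. nex (bar n) w = z"
    if z: "z \<in> Fr (nerve C n) (last_vertex n) c" "cyc bar n z" for n c z
  proof
    show "nex (bar n) (bar_htpy n z) = z" using nex_bar_htpy_0[of z c] nex_bar_htpy_Suc[of z _ c] z by (cases n) (auto simp: cyc_def)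
  qed (rule bar_htpy_in[OF z(1)])
  show "\<exists>z\<in>Fr (nerve C 0) (last_vertex 0) c. aug z = frag_of ()" if c: "c \<in> cells C 0" for c
    using vertex_nerve[OF c] last_vertex_vertex[OF c] ident_arrow[OF c] by (intro bexI[of _ "frag_of (vertex c, idn C 0 c)"]) simp_all
qed

end

theorem theorem1:
  fixes C :: "'c ocat" and P :: "'p ocat" and u :: "nat \<Rightarrow> 'p \<Rightarrow> 'c" and k :: nat
  assumes "n_category 1 C"
    and "polygraphic_resolution P C u"
  shows "nerve_homology C k \<cong> abel_homology P k"
proof -
  have C: "omega_category C" using assms(1) by (simp add: n_category_def)
  have pr: "free_omega_category P" "omega_functor P C u" "u 0 ` cells P 0 = cells C 0"
    "\<And>n x y \<beta>. \<beta> \<in> cells C (Suc n) \<Longrightarrow> parallel P n x y \<Longrightarrow> src C n \<beta> = u n x \<Longrightarrow> tgt C n \<beta> = u n y \<Longrightarrow>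
      \<exists>\<alpha>\<in>cells P (Suc n). src P n \<alpha> = x \<and> tgt P n \<alpha> = y \<and> u (Suc n) \<alpha> = \<beta>"
    using assms(2) unfolding polygraphic_resolution_def by blast+
  obtain Sig where "omega_category P" "\<And>n. Sig n \<subseteq> cells P n"
    "\<And>n. pushout_square TYPE('p test)
          (coproduct (Sig n) (\<lambda>_. sphere n)) (coproduct (Sig n) (\<lambda>_. globe n))
          (below P n) (below P (Suc n)) (\<lambda>m z. z)
          (\<lambda>m (x, z). pair_map P n (src P (n - 1) x) (tgt P (n - 1) x) m z)
          (\<lambda>m (x, z). cell_map P n x m z) (\<lambda>m z. z)"
    using pr(1) unfolding free_omega_category_def by blast
  then have "basis P Sig" by (intro basis.intro basis_axioms.intro)
  then have r: "category_resolution P Sig C u"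
    by (intro category_resolution.intro category_resolution_axioms.intro C assms(1) pr)
  \<comment> \<open>Forgetting arrows turns the bar differential into the differential of the nerve.
    Both sides are then homologies of colimits of free resolutions of one and the same
    functor.\<close>
  have "nerve_homology C k \<cong> chain_homology (\<lambda>n. free_Abelian_group (Sig n)) (omega_category.colim (category_resolution.Di P Sig C u)) k"
    unfolding nerve_homology_def omega_category.colim_bar[OF C, symmetric]
    by (rule omega_category.resolutions_same_homology[OF C omega_category.resolution_bar[OF C] category_resolution.resolution_Sig[OF r]])
  from iso_trans[OF this category_resolution.colim_abel[OF r]] show ?thesis .
qed

end
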